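(* Let $\Delta\subset\mathfrak d^*$ be an $n$-dimensional convex polytope with chosen inward-pointing normals $X_1,\dots,X_d$ and quasilattice $Q$ containing them, let $M=\Psi^{-1}(0)/N$ be the associated space with projection $p\colon\Psi^{-1}(0)\to M$, decomposed into the singular pieces $\mathcal T_F$ ($F$ a singular face of $\Delta$) and the regular piece $\mathcal T_\Delta$, with the quasifold structures described in the context. Then each piece $\mathcal T_F$ (respectively $\mathcal T_\Delta$) of the decomposition of $M$ has a natural symplectic structure induced by the quotient procedure, that is, a symplectic form on the quasifold $\mathcal T_F$ (respectively $\mathcal T_\Delta$) whose pull-back via $p$ coincides with the restriction of the standard symplectic form of $\mathbb C^d$ to the manifold $\Psi^{-1}(0)\cap(\mathbb C^* )^{F^c}$ (respectively $\Psi^{-1}(0)_\Delta$).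
   Context: **The space $M$.** Let $\mathfrak d$ be a real vector space of dimension $n$ and $\Delta\subset\mathfrak d^*$ an $n$-dimensional convex polytope, $\Delta=\bigcap_{j=1}^d\{\mu\in\mathfrak d^*\mid\langle\mu,X_j\rangle\ge\lambda_j\}$, where $X_1,\dots,X_d\in\mathfrak d$ are inward-pointing normals, one for each codimension-$1$ face, and $\lambda_j\in\mathbb R$. A quasilattice in $\mathfrak d$ is the $\mathbb Z$-span of a finite set of $\mathbb R$-spanning vectors; $Q$ is a quasilattice containing all $X_j$. Let $\pi\colon\mathbb R^d\to\mathfrak d$ be linear with $\pi(e_j)=X_j$. Let $T^d=\mathbb R^d/\mathbb Z^d$ act on $\mathbb C^d$ by $\exp(x)\cdot\underline z=(e^{2\pi i x_j}z_j)_j$, where $\exp\colon\mathbb R^d\to T^d$ is the quotient map. Let $N$ be the kernel of the homomorphism $T^d\to\mathfrak d/Q$ induced by $\pi$; its Lie algebra is $\mathfrak n=\ker\pi$, with inclusion $\iota\colon\mathfrak n\to\mathbb R^d$. Let $\Upsilon(\underline z)=\sum_j(|z_j|^2+\lambda_j)e_j^*$, $\Psi=\iota^*\circ\Upsilon\colon\mathbb C^d\to\mathfrak n^*$, and $M=\Psi^{-1}(0)/N$ with the quotient topology and projection $p$. The map $\Phi\colon M\to\mathfrak d^*$ is defined by $\pi^*(\Phi([\underline z]))=\Upsilon(\underline z)$. The standard symplectic form of $\mathbb C^d$ is normalized so that $\Upsilon$ is a moment mapping for the $T^d$-action (e.g. $\frac{1}{2\pi i}\sum_j dz_j\wedge d\bar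 z_j$ with the convention $\iota(X)\omega=d\langle\Upsilon,X\rangle$). **Faces and pieces.** An open face is $F=\{\mu\in\Delta\mid\langle\mu,X_j\rangle=\lambda_j\text{ iff }j\in I_F\}$, $I_F\subset\{1,\dots,d\}$, $r_F=\mathrm{card}(I_F)$; a $p$-dimensional face is singular if $r_F>n-p$ and nonsingular if $r_F=n-p$ (the interior of $\Delta$ is nonsingular). For $J\subset\{1,\dots,d\}$ and $\mathbb K\subset\mathbb C$, $\mathbb K^J=\{\underline z\in\mathbb C^d\mid z_j\in\mathbb K\text{ if }j\in J,\ z_j=0\text{ if }j\notin J\}$; $T^J$ is the subtorus $\{a\in T^d\mid a_j=1\text{ if }j\notin J\}$; $J^c$ is the complement; $F^c$ stands for $I_F^c$. The pieces are $\mathcal T_F=\Phi^{-1}(F)=(\Psi^{-1}(0)\cap(\mathbb C^* )^{F^c})/N$ for $F$ singular and $\mathcal T_\Delta=\Psi^{-1}(0)_\Delta/N$, with $\Psi^{-1}(0)_\Delta=\bigcup_{F\text{ nonsing.}}(\Psi^{-1}(0)\cap(\mathbb C^* )^{F^c})$. **Quasifolds.** A model of dimension $k$ is a quotient $\tilde U/\Gamma$, where $\tilde U$ is a connected, simply connected $k$-manifold and $\Gamma$ is a discrete (possibly infinite) group acting smoothly on $\tilde U$ so that the set of points where the action is free is connected and dense. If $\tilde U$ is not simply connected but the rest holds, $\tilde U/\Gamma$ is regarded as a model by replacing $\tilde U$ with its universal cover $U^\sharp$ and $\Gamma$ with the group $\Lambda$ of diffeomorphisms of $U^\sharp$ covering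 the action of some element of $\Gamma$. An open subset $W\subset\tilde U/\Gamma$ is a submodel if $W$ together with its preimage in $\tilde U$ defines a model in this way. A map of models is smooth if it lifts to a smooth map of the covering manifolds, and is a diffeomorphism of models if it is bijective and the lift is a diffeomorphism. A $k$-dimensional quasifold is a topological space with a maximal atlas of charts $(U_\alpha,\phi_\alpha,\tilde U_\alpha/\Gamma_\alpha)$: the $U_\alpha$ are an open cover, $\tilde U_\alpha\subset\mathbb R^k$ is open, connected and simply connected, $\tilde U_\alpha/\Gamma_\alpha$ is a model, $\phi_\alpha\colon\tilde U_\alpha/\Gamma_\alpha\to U_\alpha$ is a homeomorphism, and on overlaps the preimages are submodels and $\phi_\beta^{-1}\circ\phi_\alpha$ is a diffeomorphism of models. **Quasifold structure on the pieces.** Let $\mathcal I_\mu$, for $\mu$ a vertex, be the set of $I\subset I_\mu$ such that $\{X_j\}_{j\in I}$ is a basis of $\mathfrak d$, and $\mathcal I=\bigcup_\mu\mathcal I_\mu$. For $I\in\mathcal I$ define $a_{hk}$ by $X_k=\sum_{h\in I}a_{hk}X_h$, and let $\Gamma_I=N\cap T^I$, a discrete group. For $I\in\mathcal I_\mu$ let $\tilde U_I$ be the set of $\underline u\in\mathbb C^I$ with $\sum_{h\in I}a_{hk}|u_h|^2>0$ for $k\in I_\mu\setminus I$ and $\sum_{h\in I}a_{hr}(|u_h|^2+\lambda_h)-\lambda_r>0$ for $r\notin I_\mu$; let $F_I(\underline u)\in(\mathbb R_{>0})^{I^c}$ have components the positive square roots of these expressions. The atlas of $\mathcal T_\Delta$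 is generated by the charts $\tilde U_I/\Gamma_I\to(\Psi^{-1}(0)\cap(\mathbb C^I\times(\mathbb C^* )^{I^c}))/N$, $[\underline u]\mapsto[\underline u+F_I(\underline u)]$, $I\in\mathcal I$. For a singular vertex $\mu$, $\mathcal T_\mu$ is a point. For a singular $F$ of dimension $p>0$, choose a vertex $\mu\in\overline F$ and $I\in\mathcal I_\mu$ with $\mathrm{card}(I\cap I_F)=n-p$; let $\check\Gamma_{I\setminus(I\cap I_F)}$ be the image of $\Gamma_I$ under the projection $T^I\to T^{I\setminus(I\cap I_F)}$, and $\check U_{F,I}$ the set of $\underline w\in(\mathbb C^* )^{I\setminus(I\cap I_F)}$ with $\sum_{h\in I\setminus(I\cap I_F)}a_{hl}|w_h|^2>0$ for $l\in I_\mu\setminus(I\cup I_F)$ and $\sum_{h\in I\cap I_F}a_{hr}\lambda_h+\sum_{h\in I\setminus(I\cap I_F)}a_{hr}(|w_h|^2+\lambda_h)-\lambda_r>0$ for $r\notin I_\mu$. The atlas of $\mathcal T_F$ is generated by the chart $\check U_{F,I}/\check\Gamma_{I\setminus(I\cap I_F)}\to\mathcal T_F$, $[\underline w]\mapsto[\underline w+\check\phi_{F,I}(\underline w)]$, where $\check\phi_{F,I}(\underline w)$ has zero components for indices in $I\cup I_F$ and the other components are the positive square roots of the expressions just listed. (Any of the domains $\tilde U_I$, $\check U_{F,I}$ that is not simply connected is replaced by its universal cover, and the group $\Gamma_I$, respectively $\check\Gamma_{I\setminus(I\cap I_F)}$, acting on it is replaced by the group of diffeomorphisms of the universal cover covering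 the action of some element of that group.) **Forms.** A differential form on a quasifold is given by a $\Gamma_\alpha$-invariant form $\tilde\omega_\alpha$ on $\tilde U_\alpha$ for each chart, compatible (via the lifts) with changes of charts; it is symplectic if each $\tilde\omega_\alpha$ is symplectic. The pull-back of such a form via a smooth map from a manifold to the quasifold is defined locally as the pull-back of $\tilde\omega_\alpha$ under a smooth local lift of the map to $\tilde U_\alpha$. *)

theory Defs
  imports "HOL-Analysis.Analysis" "HOL-Algebra.Bij"
begin

section \<open>Smooth maps, tangent vectors and two-forms on subsets of Euclidean spaces\<close>

primrec Ck_on :: "nat \<Rightarrow> 'a::real_normed_vector set \<Rightarrow> ('a \<Rightarrow> 'b::real_normed_vector) \<Rightarrow> bool" where
  "Ck_on 0 U f \<longleftrightarrow> continuous_on U f"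
| "Ck_on (Suc m) U f \<longleftrightarrow>
     (\<exists>f'. (\<forall>x\<in>U. (f has_derivative f' x) (at x)) \<and> (\<forall>v. Ck_on m U (\<lambda>x. f' x v)))"

text \<open>A map on an arbitrary subset is smooth if it extends locally to a smooth map on an open
  set of the ambient space. On a submanifold this is smoothness in the usual sense.\<close>

definition smooth_on :: "'a::real_normed_vector set \<Rightarrow> ('a \<Rightarrow> 'b::real_normed_vector) \<Rightarrow> bool" where
  "smooth_on S f \<longleftrightarrow>
     (\<forall>x\<in>S. \<exists>U g. open U \<and> x \<in> U \<and> (\<forall>m. Ck_on m U g) \<and> (\<forall>y\<in>S \<inter> U. g y = f y))"

definition diffeo :: "'a::real_normed_vector set \<Rightarrow> 'b::real_normed_vector set \<Rightarrow> ('a \<Rightarrow> 'b) \<Rightarrow> bool" where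
  "diffeo S T f \<longleftrightarrow> bij_betw f S T \<and> smooth_on S f \<and> smooth_on T (inv_into S f)"

definition tangent_space :: "'a::real_normed_vector set \<Rightarrow> 'a \<Rightarrow> 'a set" where
  "tangent_space S x = {v. \<exists>(\<gamma> :: real \<Rightarrow> 'a) \<epsilon>. \<epsilon> > 0 \<and> smooth_on {-\<epsilon><..<\<epsilon>} \<gamma> \<and>
      \<gamma> ` {-\<epsilon><..<\<epsilon>} \<subseteq> S \<and> \<gamma> 0 = x \<and> (\<gamma> has_vector_derivative v) (at 0)}"

text \<open>The derivative \<open>frechet_derivative f (at x within S)\<close> of a smooth map on \<open>S\<close> is uniquely
  determined on vectors tangent to \<open>S\<close>; pull-backs are only evaluated on such vectors.\<close>

definition pullback_form ::
  "'a::real_normed_vector set \<Rightarrow> ('a \<Rightarrow> 'b::real_normed_vector) \<Rightarrow> ('b \<Rightarrow> 'b \<Rightarrow> 'b \<Rightarrow> real)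
     \<Rightarrow> 'a \<Rightarrow> 'a \<Rightarrow> 'a \<Rightarrow> real" where
  "pullback_form S f w x u v =
     w (f x) (frechet_derivative f (at x within S) u) (frechet_derivative f (at x within S) v)"

text \<open>Here \<open>\<real>\<^sup>k\<close> is realized as a \<open>k\<close>-dimensional linear subspace of an ambient Euclidean space
  (the span of the open set itself), so that spaces of different dimensions \<open>k\<close>, including
  \<open>k = 0\<close>, are treated uniformly.\<close>

definition open_in_Rk :: "nat \<Rightarrow> 'e::euclidean_space set \<Rightarrow> bool" where
  "open_in_Rk k U \<longleftrightarrow> U \<noteq> {} \<and> dim U = k \<and> openin (top_of_set (span U)) U"

text \<open>Symplectic forms on an open subset \<open>U\<close> of \<open>span U\<close>; the values of \<open>w x\<close> on vectors
  outside \<open>span U\<close> are irrelevant.\<close>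

definition two_form_on :: "'e::euclidean_space set \<Rightarrow> ('e \<Rightarrow> 'e \<Rightarrow> 'e \<Rightarrow> real) \<Rightarrow> bool" where
  "two_form_on U w \<longleftrightarrow>
     (\<forall>x\<in>U. bilinear (w x) \<and> (\<forall>u\<in>span U. w x u u = 0)) \<and>
     (\<forall>u\<in>span U. \<forall>v\<in>span U. smooth_on U (\<lambda>x. w x u v))"

definition closed_two_form_on :: "'e::euclidean_space set \<Rightarrow> ('e \<Rightarrow> 'e \<Rightarrow> 'e \<Rightarrow> real) \<Rightarrow> bool" where
  "closed_two_form_on U w \<longleftrightarrow>
     (\<forall>x\<in>U. \<forall>u\<in>span U. \<forall>v\<in>span U. \<forall>t\<in>span U.
        frechet_derivative (\<lambda>y. w y v t) (at x within U) u
      - frechet_derivative (\<lambda>y. w y u t) (at x within U) v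
      + frechet_derivative (\<lambda>y. w y u v) (at x within U) t = 0)"

definition nondegenerate_on :: "'e::euclidean_space set \<Rightarrow> ('e \<Rightarrow> 'e \<Rightarrow> 'e \<Rightarrow> real) \<Rightarrow> bool" where
  "nondegenerate_on U w \<longleftrightarrow>
     (\<forall>x\<in>U. \<forall>u\<in>span U. (\<forall>v\<in>span U. w x u v = 0) \<longrightarrow> u = 0)"

definition symplectic_on :: "'e::euclidean_space set \<Rightarrow> ('e \<Rightarrow> 'e \<Rightarrow> 'e \<Rightarrow> real) \<Rightarrow> bool" where
  "symplectic_on U w \<longleftrightarrow> two_form_on U w \<and> closed_two_form_on U w \<and> nondegenerate_on U w"

section \<open>Orbit spaces and models\<close>

definition quotient_top :: "'a topology \<Rightarrow> ('a \<Rightarrow> 'b) \<Rightarrow> 'b topology" where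
  "quotient_top T p =
     topology (\<lambda>W. W \<subseteq> p ` topspace T \<and> openin T {x \<in> topspace T. p x \<in> W})"

definition orb :: "('a \<Rightarrow> 'a) set \<Rightarrow> 'a \<Rightarrow> 'a set" where
  "orb \<Gamma> x = (\<lambda>g. g x) ` \<Gamma>"

definition orbits :: "'a set \<Rightarrow> ('a \<Rightarrow> 'a) set \<Rightarrow> 'a set set" where
  "orbits U \<Gamma> = orb \<Gamma> ` U"

definition free_points :: "'a set \<Rightarrow> ('a \<Rightarrow> 'a) set \<Rightarrow> 'a set" where
  "free_points U \<Gamma> = {x \<in> U. \<forall>g\<in>\<Gamma>. g x = x \<longrightarrow> (\<forall>y\<in>U. g y = y)}"

text \<open>Since the action is free somewhere, it is effective, so the group is given as a subgroup
  of the group of bijections of \<open>U\<close>. The group carries the discrete topology, which imposes no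
  condition.\<close>

definition premodel :: "nat \<Rightarrow> 'e::euclidean_space set \<Rightarrow> ('e \<Rightarrow> 'e) set \<Rightarrow> bool" where
  "premodel k U \<Gamma> \<longleftrightarrow>
     open_in_Rk k U \<and> connected U \<and> subgroup \<Gamma> (BijGroup U) \<and> (\<forall>g\<in>\<Gamma>. smooth_on U g) \<and>
     connected (free_points U \<Gamma>) \<and> U \<subseteq> closure (free_points U \<Gamma>)"

definition model :: "nat \<Rightarrow> 'e::euclidean_space set \<Rightarrow> ('e \<Rightarrow> 'e) set \<Rightarrow> bool" where
  "model k U \<Gamma> \<longleftrightarrow> premodel k U \<Gamma> \<and> simply_connected U"

definition universal_covering ::
  "'c::real_normed_vector set \<Rightarrow> ('c \<Rightarrow> 'e) \<Rightarrow> 'e::real_normed_vector set \<Rightarrow> bool" where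
  "universal_covering C q U \<longleftrightarrow>
     simply_connected C \<and> covering_space C q U \<and>
     (\<forall>x\<in>C. \<exists>W. x \<in> W \<and> openin (top_of_set C) W \<and> openin (top_of_set U) (q ` W) \<and> diffeo W (q ` W) q)"

definition covering_group ::
  "'c::real_normed_vector set \<Rightarrow> ('c \<Rightarrow> 'e) \<Rightarrow> ('e \<Rightarrow> 'e) set \<Rightarrow> ('c \<Rightarrow> 'c) set" where
  "covering_group C q \<Gamma> =
     {h \<in> extensional C. diffeo C C h \<and> (\<exists>g\<in>\<Gamma>. \<forall>x\<in>C. q (h x) = g (q x))}"

definition restrict_group :: "('a \<Rightarrow> 'a) set \<Rightarrow> 'a set \<Rightarrow> ('a \<Rightarrow> 'a) set" where
  "restrict_group \<Gamma> V = (\<lambda>g. restrict g V) ` \<Gamma>"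

text \<open>The map \<open>f\<close> of the orbit spaces \<open>U / \<Gamma>\<close> and \<open>U' / \<Gamma>'\<close> lifts to the smooth map \<open>F\<close> of
  universal coverings \<open>C\<close> and \<open>C'\<close>.\<close>

definition model_lift ::
  "'e::euclidean_space set \<Rightarrow> ('e \<Rightarrow> 'e) set \<Rightarrow> 'e set \<Rightarrow> ('e \<Rightarrow> 'e) set \<Rightarrow> ('e set \<Rightarrow> 'e set) \<Rightarrow>
   'c::euclidean_space set \<Rightarrow> ('c \<Rightarrow> 'e) \<Rightarrow> 'c set \<Rightarrow> ('c \<Rightarrow> 'e) \<Rightarrow> ('c \<Rightarrow> 'c) \<Rightarrow> bool" where
  "model_lift U \<Gamma> U' \<Gamma>' f C q C' q' F \<longleftrightarrow>
     universal_covering C q U \<and> universal_covering C' q' U' \<and>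
     smooth_on C F \<and> F ` C \<subseteq> C' \<and>
     (\<forall>x\<in>C. f (orb \<Gamma> (q x)) = orb \<Gamma>' (q' (F x)))"

text \<open>Universal coverings of open subsets of \<open>k\<close>-dimensional subspaces of \<open>'e\<close> are represented
  as submanifolds of \<open>'e \<times> 'e\<close>. Nothing is lost: \<open>k \<le> DIM('e)\<close>, and a \<open>k\<close>-manifold embeds in
  \<open>\<real>\<^sup>2\<^sup>k\<close> by Whitney's theorem.\<close>

definition model_diffeo ::
  "'e::euclidean_space set \<Rightarrow> ('e \<Rightarrow> 'e) set \<Rightarrow> 'e set \<Rightarrow> ('e \<Rightarrow> 'e) set \<Rightarrow> ('e set \<Rightarrow> 'e set) \<Rightarrow> bool" where
  "model_diffeo U \<Gamma> U' \<Gamma>' f \<longleftrightarrow>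
     bij_betw f (orbits U \<Gamma>) (orbits U' \<Gamma>') \<and>
     (\<exists>(C :: ('e \<times> 'e) set) q C' q' F. model_lift U \<Gamma> U' \<Gamma>' f C q C' q' F \<and> diffeo C C' F)"

section \<open>Quasifolds and their symplectic forms\<close>

text \<open>A chart has domain \<open>cdom / cgrp\<close>, which \<open>cmap\<close> maps onto the open set \<open>patch\<close>.\<close>

datatype ('p, 'e) qchart =
  QChart (patch: "'p set") (cmap: "'e set \<Rightarrow> 'p") (cdom: "'e set") (cgrp: "('e \<Rightarrow> 'e) set")

definition qchart_on :: "nat \<Rightarrow> 'p topology \<Rightarrow> ('p, 'e::euclidean_space) qchart \<Rightarrow> bool" where
  "qchart_on k T c \<longleftrightarrow>
     openin T (patch c) \<and> model k (cdom c) (cgrp c) \<and>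
     homeomorphic_map (quotient_top (top_of_set (cdom c)) (orb (cgrp c)))
       (subtopology T (patch c)) (cmap c)"

definition chart_pt :: "('p, 'e) qchart \<Rightarrow> 'e \<Rightarrow> 'p" where
  "chart_pt c x = cmap c (orb (cgrp c) x)"

definition chart_preimage :: "('p, 'e) qchart \<Rightarrow> 'p set \<Rightarrow> 'e set" where
  "chart_preimage c W = {x \<in> cdom c. chart_pt c x \<in> W}"

definition chart_change :: "('p, 'e) qchart \<Rightarrow> ('p, 'e) qchart \<Rightarrow> 'e set \<Rightarrow> 'e set" where
  "chart_change c c' = inv_into (orbits (cdom c') (cgrp c')) (cmap c') \<circ> cmap c"

definition overlap :: "('p, 'e) qchart \<Rightarrow> ('p, 'e) qchart \<Rightarrow> 'e set" where
  "overlap c c' = chart_preimage c (patch c \<inter> patch c')"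

definition overlap_group :: "('p, 'e) qchart \<Rightarrow> ('p, 'e) qchart \<Rightarrow> ('e \<Rightarrow> 'e) set" where
  "overlap_group c c' = restrict_group (cgrp c) (overlap c c')"

definition compatible :: "nat \<Rightarrow> ('p, 'e::euclidean_space) qchart \<Rightarrow> ('p, 'e) qchart \<Rightarrow> bool" where
  "compatible k c c' \<longleftrightarrow>
     (patch c \<inter> patch c' \<noteq> {} \<longrightarrow>
        premodel k (overlap c c') (overlap_group c c') \<and>
        premodel k (overlap c' c) (overlap_group c' c) \<and>
        model_diffeo (overlap c c') (overlap_group c c') (overlap c' c) (overlap_group c' c)
          (chart_change c c'))"

definition quasifold_atlas :: "nat \<Rightarrow> 'p topology \<Rightarrow> ('p, 'e::euclidean_space) qchart set \<Rightarrow> bool" where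
  "quasifold_atlas k T A \<longleftrightarrow>
     (\<forall>c\<in>A. qchart_on k T c) \<and> (\<Union>c\<in>A. patch c) = topspace T \<and>
     (\<forall>c\<in>A. \<forall>c'\<in>A. compatible k c c')"

definition quasifold :: "nat \<Rightarrow> 'p topology \<Rightarrow> ('p, 'e::euclidean_space) qchart set \<Rightarrow> bool" where
  "quasifold k T A \<longleftrightarrow>
     quasifold_atlas k T A \<and> (\<forall>B. quasifold_atlas k T B \<and> A \<subseteq> B \<longrightarrow> B = A)"

definition invariant_form :: "'e::euclidean_space set \<Rightarrow> ('e \<Rightarrow> 'e) set \<Rightarrow> ('e \<Rightarrow> 'e \<Rightarrow> 'e \<Rightarrow> real) \<Rightarrow> bool" where
  "invariant_form U \<Gamma> w \<longleftrightarrow>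
     (\<forall>g\<in>\<Gamma>. \<forall>x\<in>U. \<forall>u\<in>span U. \<forall>v\<in>span U. pullback_form U g w x u v = w x u v)"

text \<open>\<open>F\<^sup>* (q'\<^sup>* w') = q\<^sup>* w\<close> for every diffeomorphism \<open>F\<close> of the universal coverings of the two
  preimages of the overlap that lifts the change of charts.\<close>

definition forms_compatible ::
  "('p, 'e::euclidean_space) qchart \<Rightarrow> ('p, 'e) qchart \<Rightarrow>
   ('e \<Rightarrow> 'e \<Rightarrow> 'e \<Rightarrow> real) \<Rightarrow> ('e \<Rightarrow> 'e \<Rightarrow> 'e \<Rightarrow> real) \<Rightarrow> bool" where
  "forms_compatible c c' w w' \<longleftrightarrow>
     (\<forall>(C :: ('e \<times> 'e) set) q C' q' F.
        model_lift (overlap c c') (overlap_group c c') (overlap c' c) (overlap_group c' c)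
          (chart_change c c') C q C' q' F \<and> diffeo C C' F \<longrightarrow>
        (\<forall>x\<in>C. \<forall>u\<in>tangent_space C x. \<forall>v\<in>tangent_space C x.
           pullback_form C (q' \<circ> F) w' x u v = pullback_form C q w x u v))"

definition symplectic_form ::
  "('p, 'e::euclidean_space) qchart set \<Rightarrow> (('p, 'e) qchart \<Rightarrow> 'e \<Rightarrow> 'e \<Rightarrow> 'e \<Rightarrow> real) \<Rightarrow> bool" where
  "symplectic_form A \<omega> \<longleftrightarrow>
     (\<forall>c\<in>A. symplectic_on (cdom c) (\<omega> c) \<and> invariant_form (cdom c) (cgrp c) (\<omega> c)) \<and>
     (\<forall>c\<in>A. \<forall>c'\<in>A. forms_compatible c c' (\<omega> c) (\<omega> c'))"

definition local_lift ::
  "'m::real_normed_vector set \<Rightarrow> ('m \<Rightarrow> 'p) \<Rightarrow> ('p, 'e::euclidean_space) qchart \<Rightarrow> 'm set \<Rightarrow> ('m \<Rightarrow> 'e) \<Rightarrow> bool" where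
  "local_lift Z p c W f \<longleftrightarrow>
     openin (top_of_set Z) W \<and> f ` W \<subseteq> cdom c \<and> smooth_on W f \<and>
     (\<forall>z\<in>W. p z = chart_pt c (f z))"

definition smooth_to_quasifold ::
  "'m::real_normed_vector set \<Rightarrow> ('p, 'e::euclidean_space) qchart set \<Rightarrow> ('m \<Rightarrow> 'p) \<Rightarrow> bool" where
  "smooth_to_quasifold Z A p \<longleftrightarrow> (\<forall>z\<in>Z. \<exists>c\<in>A. \<exists>W f. z \<in> W \<and> local_lift Z p c W f)"

text \<open>\<open>p\<close> is smooth on the manifold \<open>Z\<close> and \<open>p\<^sup>* \<omega>\<close>, computed with any smooth local lift into any
  chart, is the restriction of the constant form \<open>\<eta>\<close> to the tangent spaces of \<open>Z\<close>.\<close>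

definition pullback_is_restriction ::
  "('p, 'e::euclidean_space) qchart set \<Rightarrow> (('p, 'e) qchart \<Rightarrow> 'e \<Rightarrow> 'e \<Rightarrow> 'e \<Rightarrow> real) \<Rightarrow>
   'm::real_normed_vector set \<Rightarrow> ('m \<Rightarrow> 'p) \<Rightarrow> ('m \<Rightarrow> 'm \<Rightarrow> real) \<Rightarrow> bool" where
  "pullback_is_restriction A \<omega> Z p \<eta> \<longleftrightarrow>
     smooth_to_quasifold Z A p \<and>
     (\<forall>c\<in>A. \<forall>W f. local_lift Z p c W f \<longrightarrow>
        (\<forall>z\<in>W. \<forall>u\<in>tangent_space Z z. \<forall>v\<in>tangent_space Z z.
           pullback_form W f (\<omega> c) z u v = \<eta> u v))"

section \<open>The space associated with a polytope\<close>

text \<open>\<open>\<dd>\<close> is a Euclidean space \<open>'a\<close>, and its dual is identified with \<open>'a\<close> by the inner product.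
  The indices \<open>1, \<dots>, d\<close> are the elements of a finite type \<open>'d\<close>; \<open>\<complex>\<^sup>d\<close> is \<^typ>\<open>complex ^ 'd\<close>,
  whose multiplication is componentwise.\<close>

definition zspan :: "'a::real_vector set \<Rightarrow> 'a set" where
  "zspan S = {\<Sum>v\<in>S. of_int (c v) *\<^sub>R v | c. True}"

definition quasilattice :: "'a::real_vector set \<Rightarrow> bool" where
  "quasilattice Q \<longleftrightarrow> (\<exists>S. finite S \<and> span S = UNIV \<and> Q = zspan S)"

definition Delta :: "('d::finite \<Rightarrow> 'a::euclidean_space) \<Rightarrow> ('d \<Rightarrow> real) \<Rightarrow> 'a set" where
  "Delta X lam = {\<mu>. \<forall>j. lam j \<le> \<mu> \<bullet> X j}"

definition proj :: "('d::finite \<Rightarrow> 'a::euclidean_space) \<Rightarrow> real ^ 'd \<Rightarrow> 'a" where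
  "proj X x = (\<Sum>j\<in>UNIV. x $ j *\<^sub>R X j)"

text \<open>\<open>T\<^sup>d = \<real>\<^sup>d / \<int>\<^sup>d\<close> is identified by \<open>exp\<close> with the tuples of complex numbers of modulus one.\<close>

definition texp :: "real ^ 'd \<Rightarrow> complex ^ 'd::finite" where
  "texp x = (\<chi> j. cis (2 * pi * x $ j))"

definition subtorus :: "'d::finite set \<Rightarrow> (complex ^ 'd) set" where
  "subtorus J = {a. (\<forall>j. cmod (a $ j) = 1) \<and> (\<forall>j. j \<notin> J \<longrightarrow> a $ j = 1)}"

text \<open>The kernel of \<open>T\<^sup>d \<rightarrow> \<dd> / Q\<close>, \<open>exp x \<mapsto> \<pi> x + Q\<close>.\<close>

definition Ngrp :: "('d::finite \<Rightarrow> 'a::euclidean_space) \<Rightarrow> 'a set \<Rightarrow> (complex ^ 'd) set" where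
  "Ngrp X Q = texp ` {x. proj X x \<in> Q}"

definition Upsilon :: "('d::finite \<Rightarrow> real) \<Rightarrow> complex ^ 'd \<Rightarrow> real ^ 'd" where
  "Upsilon lam z = (\<chi> j. (cmod (z $ j))\<^sup>2 + lam j)"

text \<open>\<open>\<Psi>\<^sup>-\<^sup>1(0)\<close>: the functional \<open>\<Upsilon> z\<close> vanishes on \<open>\<nn> = ker \<pi>\<close>.\<close>

definition zero_level :: "('d::finite \<Rightarrow> 'a::euclidean_space) \<Rightarrow> ('d \<Rightarrow> real) \<Rightarrow> (complex ^ 'd) set" where
  "zero_level X lam = {z. \<forall>x. proj X x = 0 \<longrightarrow> Upsilon lam z \<bullet> x = 0}"

definition pr :: "('d::finite \<Rightarrow> 'a::euclidean_space) \<Rightarrow> 'a set \<Rightarrow> complex ^ 'd \<Rightarrow> (complex ^ 'd) set" where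
  "pr X Q z = (\<lambda>a. a * z) ` Ngrp X Q"

definition Mtop :: "('d::finite \<Rightarrow> 'a::euclidean_space) \<Rightarrow> ('d \<Rightarrow> real) \<Rightarrow> 'a set \<Rightarrow> (complex ^ 'd) set topology" where
  "Mtop X lam Q = quotient_top (top_of_set (zero_level X lam)) (pr X Q)"

text \<open>The standard form \<open>1/(2\<pi>i) \<Sum>\<^sub>j dz\<^sub>j \<and> d(cnj z\<^sub>j)\<close>, which is real-valued and constant on \<open>\<complex>\<^sup>d\<close>.\<close>

definition std_form :: "complex ^ 'd::finite \<Rightarrow> complex ^ 'd \<Rightarrow> real" where
  "std_form u v =
     Re (1 / (2 * of_real pi * \<i>) * (\<Sum>j\<in>UNIV. u $ j * cnj (v $ j) - v $ j * cnj (u $ j)))"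

subsection \<open>Faces and pieces\<close>

definition open_face :: "('d::finite \<Rightarrow> 'a::euclidean_space) \<Rightarrow> ('d \<Rightarrow> real) \<Rightarrow> 'a set \<Rightarrow> bool" where
  "open_face X lam F \<longleftrightarrow>
     F \<noteq> {} \<and> (\<exists>J. F = {\<mu> \<in> Delta X lam. \<forall>j. \<mu> \<bullet> X j = lam j \<longleftrightarrow> j \<in> J})"

definition active :: "('d::finite \<Rightarrow> 'a::euclidean_space) \<Rightarrow> ('d \<Rightarrow> real) \<Rightarrow> 'a set \<Rightarrow> 'd set" where
  "active X lam F = {j. \<forall>\<mu>\<in>F. \<mu> \<bullet> X j = lam j}"

definition singular_face :: "('d::finite \<Rightarrow> 'a::euclidean_space) \<Rightarrow> ('d \<Rightarrow> real) \<Rightarrow> 'a set \<Rightarrow> bool" where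
  "singular_face X lam F \<longleftrightarrow>
     open_face X lam F \<and> int (card (active X lam F)) > int DIM('a) - aff_dim F"

definition nonsingular_face :: "('d::finite \<Rightarrow> 'a::euclidean_space) \<Rightarrow> ('d \<Rightarrow> real) \<Rightarrow> 'a set \<Rightarrow> bool" where
  "nonsingular_face X lam F \<longleftrightarrow>
     open_face X lam F \<and> int (card (active X lam F)) = int DIM('a) - aff_dim F"

definition Cspace :: "'d::finite set \<Rightarrow> (complex ^ 'd) set" where
  "Cspace J = {z. \<forall>j. j \<notin> J \<longrightarrow> z $ j = 0}"

definition Cstar :: "'d::finite set \<Rightarrow> (complex ^ 'd) set" where
  "Cstar J = {z. \<forall>j. z $ j \<noteq> 0 \<longleftrightarrow> j \<in> J}"

definition face_level :: "('d::finite \<Rightarrow> 'a::euclidean_space) \<Rightarrow> ('d \<Rightarrow> real) \<Rightarrow> 'a set \<Rightarrow> (complex ^ 'd) set" where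
  "face_level X lam F = zero_level X lam \<inter> Cstar (- active X lam F)"

definition regular_level :: "('d::finite \<Rightarrow> 'a::euclidean_space) \<Rightarrow> ('d \<Rightarrow> real) \<Rightarrow> (complex ^ 'd) set" where
  "regular_level X lam = (\<Union>F\<in>{F. nonsingular_face X lam F}. face_level X lam F)"

definition face_piece ::
  "('d::finite \<Rightarrow> 'a::euclidean_space) \<Rightarrow> ('d \<Rightarrow> real) \<Rightarrow> 'a set \<Rightarrow> 'a set \<Rightarrow> (complex ^ 'd) set topology" where
  "face_piece X lam Q F = subtopology (Mtop X lam Q) (pr X Q ` face_level X lam F)"

definition regular_piece ::
  "('d::finite \<Rightarrow> 'a::euclidean_space) \<Rightarrow> ('d \<Rightarrow> real) \<Rightarrow> 'a set \<Rightarrow> (complex ^ 'd) set topology" where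
  "regular_piece X lam Q = subtopology (Mtop X lam Q) (pr X Q ` regular_level X lam)"

subsection \<open>The charts of the pieces\<close>

definition vertex :: "('d::finite \<Rightarrow> 'a::euclidean_space) \<Rightarrow> ('d \<Rightarrow> real) \<Rightarrow> 'a \<Rightarrow> bool" where
  "vertex X lam \<mu> \<longleftrightarrow> open_face X lam {\<mu>}"

definition basis_sets :: "('d::finite \<Rightarrow> 'a::euclidean_space) \<Rightarrow> ('d \<Rightarrow> real) \<Rightarrow> 'a \<Rightarrow> 'd set set" where
  "basis_sets X lam \<mu> =
     {I. I \<subseteq> active X lam {\<mu>} \<and> inj_on X I \<and> independent (X ` I) \<and> span (X ` I) = UNIV}"

text \<open>\<open>X k = (\<Sum>h\<in>I. acoef X I h k *\<^sub>R X h)\<close>\<close>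

definition acoef :: "('d::finite \<Rightarrow> 'a::euclidean_space) \<Rightarrow> 'd set \<Rightarrow> 'd \<Rightarrow> 'd \<Rightarrow> real" where
  "acoef X I h k = representation (X ` I) (X k) (X h)"

text \<open>The expressions whose positivity defines the chart domains and whose square roots are the
  remaining components of the charts. The set \<open>K\<close> is \<open>I\<^sub>F\<close> for a singular face \<open>F\<close> and empty for
  the charts of the regular piece.\<close>

definition slack ::
  "('d::finite \<Rightarrow> 'a::euclidean_space) \<Rightarrow> ('d \<Rightarrow> real) \<Rightarrow> 'a \<Rightarrow> 'd set \<Rightarrow> 'd set \<Rightarrow> complex ^ 'd \<Rightarrow> 'd \<Rightarrow> real" where
  "slack X lam \<mu> I K w r =
     (if r \<in> active X lam {\<mu>} then (\<Sum>h\<in>I - K. acoef X I h r * (cmod (w $ h))\<^sup>2)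
      else (\<Sum>h\<in>I \<inter> K. acoef X I h r * lam h)
         + (\<Sum>h\<in>I - K. acoef X I h r * ((cmod (w $ h))\<^sup>2 + lam h)) - lam r)"

definition section_map ::
  "('d::finite \<Rightarrow> 'a::euclidean_space) \<Rightarrow> ('d \<Rightarrow> real) \<Rightarrow> 'a \<Rightarrow> 'd set \<Rightarrow> 'd set \<Rightarrow> complex ^ 'd \<Rightarrow> complex ^ 'd" where
  "section_map X lam \<mu> I K w =
     w + (\<chi> r. if r \<in> I \<union> K then 0 else of_real (sqrt (slack X lam \<mu> I K w r)))"

definition regular_domain ::
  "('d::finite \<Rightarrow> 'a::euclidean_space) \<Rightarrow> ('d \<Rightarrow> real) \<Rightarrow> 'a \<Rightarrow> 'd set \<Rightarrow> (complex ^ 'd) set" where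
  "regular_domain X lam \<mu> I = {u \<in> Cspace I. \<forall>r. r \<notin> I \<longrightarrow> slack X lam \<mu> I {} u r > 0}"

definition singular_domain ::
  "('d::finite \<Rightarrow> 'a::euclidean_space) \<Rightarrow> ('d \<Rightarrow> real) \<Rightarrow> 'a set \<Rightarrow> 'a \<Rightarrow> 'd set \<Rightarrow> (complex ^ 'd) set" where
  "singular_domain X lam F \<mu> I =
     {w \<in> Cstar (I - active X lam F).
        \<forall>r. r \<notin> I \<union> active X lam F \<longrightarrow> slack X lam \<mu> I (active X lam F) w r > 0}"

definition torus_proj :: "'d::finite set \<Rightarrow> complex ^ 'd \<Rightarrow> complex ^ 'd" where
  "torus_proj J a = (\<chi> j. if j \<in> J then a $ j else 1)"

definition torus_action :: "(complex ^ 'd::finite) set \<Rightarrow> (complex ^ 'd) set \<Rightarrow> (complex ^ 'd \<Rightarrow> complex ^ 'd) set" where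
  "torus_action U H = (\<lambda>a. restrict ((*) a) U) ` H"

text \<open>The charts induced by a map \<open>s\<close> from \<open>U\<close> onto \<open>P\<close> that is constant on the orbits of \<open>\<Gamma>\<close>,
  with \<open>U\<close> replaced by any universal covering of it that is an open subset of \<open>\<real>\<^sup>k\<close>. If \<open>U\<close> is
  simply connected, the identity covering gives \<open>U / \<Gamma>\<close> itself.\<close>

definition charts_from ::
  "nat \<Rightarrow> 'e::euclidean_space set \<Rightarrow> ('e \<Rightarrow> 'e) set \<Rightarrow> ('e \<Rightarrow> 'p) \<Rightarrow> 'p set \<Rightarrow> ('p, 'e) qchart set" where
  "charts_from k U \<Gamma> s P =
     {c. \<exists>q. open_in_Rk k (cdom c) \<and> universal_covering (cdom c) q U \<and>
             cgrp c = covering_group (cdom c) q \<Gamma> \<and> patch c = P \<and>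
             (\<forall>x\<in>cdom c. chart_pt c x = s (q x))}"

definition regular_charts ::
  "('d::finite \<Rightarrow> 'a::euclidean_space) \<Rightarrow> ('d \<Rightarrow> real) \<Rightarrow> 'a set \<Rightarrow> ((complex ^ 'd) set, complex ^ 'd) qchart set" where
  "regular_charts X lam Q =
     (\<Union>\<mu>\<in>{\<mu>. vertex X lam \<mu>}. \<Union>I\<in>basis_sets X lam \<mu>.
        charts_from (2 * DIM('a)) (regular_domain X lam \<mu> I)
          (torus_action (regular_domain X lam \<mu> I) (Ngrp X Q \<inter> subtorus I))
          (\<lambda>u. pr X Q (section_map X lam \<mu> I {} u))
          (pr X Q ` {z \<in> zero_level X lam. \<forall>j. j \<notin> I \<longrightarrow> z $ j \<noteq> 0}))"

text \<open>\<open>(\<mu>, I)\<close> is a choice of a vertex of the closure of \<open>F\<close> and of a basis adapted to \<open>F\<close>.\<close>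

definition adapted ::
  "('d::finite \<Rightarrow> 'a::euclidean_space) \<Rightarrow> ('d \<Rightarrow> real) \<Rightarrow> 'a set \<Rightarrow> 'a \<Rightarrow> 'd set \<Rightarrow> bool" where
  "adapted X lam F \<mu> I \<longleftrightarrow>
     vertex X lam \<mu> \<and> \<mu> \<in> closure F \<and> I \<in> basis_sets X lam \<mu> \<and>
     int (card (I \<inter> active X lam F)) = int DIM('a) - aff_dim F"

text \<open>For a singular vertex the domain is \<open>\<complex>\<^sup>0\<close> and the chart parametrizes the single point of
  the piece.\<close>

definition singular_charts ::
  "('d::finite \<Rightarrow> 'a::euclidean_space) \<Rightarrow> ('d \<Rightarrow> real) \<Rightarrow> 'a set \<Rightarrow> 'a set \<Rightarrow> 'a \<Rightarrow> 'd set
     \<Rightarrow> ((complex ^ 'd) set, complex ^ 'd) qchart set" where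
  "singular_charts X lam Q F \<mu> I =
     charts_from (2 * nat (aff_dim F)) (singular_domain X lam F \<mu> I)
       (torus_action (singular_domain X lam F \<mu> I)
          (torus_proj (I - active X lam F) ` (Ngrp X Q \<inter> subtorus I)))
       (\<lambda>w. pr X Q (section_map X lam \<mu> I (active X lam F) w))
       (pr X Q ` face_level X lam F)"

end

theory Submission
  imports Defs
begin

text \<open>Over the piece of an open face the points of the level set are, up to the torus, determined by
  a point of the polytope: the squared moduli of the components are the slacks of the defining
  inequalities. Hence a level set is swept out by \<open>N\<close> from the section \<open>u + \<phi>(u)\<close> over an open subset
  of \<open>\<complex>\<^sup>I\<close>, and since the components of \<open>\<phi>\<close> are real and \<open>N\<close> preserves the moment
  map, the standard form restricted to the level set is the pull-back of the constant standard form of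
  \<open>\<complex>\<^sup>I\<close>. Two local lifts of the same map into such a chart differ at each point by an
  element of a countable group; by Baire's theorem they differ by a fixed element on a dense open set,
  so they pull back the form to the same form. Therefore the form can be defined on every
  chart of an arbitrary compatible atlas through any local lift to such a chart.

  The domains of the charts are not simply connected in general. Taking logarithms of the
  components that never vanish gives a universal covering: a loop upstairs can be moved off the
  coordinate hyperplanes, where it is a loop of points of the polytope together with a loop in
  a torus, and each circle factor contracts through a point in the interior of the corresponding facet.\<close>


section \<open>Smooth maps\<close>

text \<open>The atlas is an arbitrary maximal one, so most of its charts come with nothing but
  compatibility, and compatibility supplies only some diffeomorphism of universal coverings.
  Conversely, the forms have to agree under every such diffeomorphism and to pull back correctly
  along every local lift of the projection. As the groups may be infinite with dense orbits, the
  group element that relates two lifts can a priori jump from point to point; here the countability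
  of \<open>Q\<close> enters, through Baire. Everything is therefore condensed into one statement,
  \<open>om_pullback\<close>, on relatively open subsets of linear subspaces, where directional
  derivatives are unambiguous; invariance, compatibility and the restriction property are instances
  of it. Since the model form is constant, closedness comes down to the symmetry of second
  derivatives, and nondegeneracy to a count of dimensions. Regular domains, singular domains and
  overlaps belong to one family of frames, so orbits, reduction and coverings are treated
  once.\<close>

lemma Ck_on_SucE:
  assumes "Ck_on (Suc m) U f"
  obtains f' where "\<And>x. x \<in> U \<Longrightarrow> (f has_derivative f' x) (at x)" "\<And>v. Ck_on m U (\<lambda>x. f' x v)"
proof -
  have "\<exists>f'. (\<forall>x\<in>U. (f has_derivative f' x) (at x)) \<and> (\<forall>v. Ck_on m U (\<lambda>x. f' x v))"
    using assms by simp
  then show ?thesis by (elim exE conjE) (rule that, auto)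
qed

lemma Ck_on_SucI:
  assumes "\<And>x. x \<in> U \<Longrightarrow> (f has_derivative f' x) (at x)" "\<And>v. Ck_on m U (\<lambda>x. f' x v)"
  shows "Ck_on (Suc m) U f"
  using assms by (auto intro!: exI[where x=f'])

lemma Ck_on_subset: "Ck_on m U f \<Longrightarrow> V \<subseteq> U \<Longrightarrow> Ck_on m V f"
proof (induction m arbitrary: f)
  case 0 then show ?case using continuous_on_subset by auto
next
  case (Suc m) then show ?case by simp (meson subsetD)
qed

lemma Ck_on_cong: "Ck_on m U f \<Longrightarrow> open U \<Longrightarrow> (\<And>x. x \<in> U \<Longrightarrow> f x = g x) \<Longrightarrow> Ck_on m U g"
proof (induction m arbitrary: f g)
  case 0 then show ?case using continuous_on_cong by (metis Ck_on.simps(1))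
next
  case (Suc m)
  from Suc.prems(1) obtain f' where f': "\<And>x. x \<in> U \<Longrightarrow> (f has_derivative f' x) (at x)" "\<And>v. Ck_on m U (\<lambda>x. f' x v)"
    by (rule Ck_on_SucE) (rule that)
  have "(g has_derivative f' x) (at x)" if "x \<in> U" for x
    using has_derivative_transform_within_open[OF f'(1)[OF that] \<open>open U\<close> that] Suc.prems(3) by blast
  with f'(2) show ?case by auto
qed

lemma Ck_on_continuous: "Ck_on m U f \<Longrightarrow> continuous_on U f"
proof (cases m)
  case (Suc k)
  assume "Ck_on m U f"
  with Suc obtain f' where "\<And>x. x \<in> U \<Longrightarrow> (f has_derivative f' x) (at x)" using Ck_on_SucE by metis
  then show ?thesis
    by (auto intro!: continuous_at_imp_continuous_on intro: has_derivative_continuous)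
qed auto

lemma Ck_on_Suc_D: "Ck_on (Suc m) U f \<Longrightarrow> Ck_on m U f"
proof (induction m arbitrary: f)
  case 0 then show ?case using Ck_on_continuous by (metis Ck_on.simps(1))
next
  case (Suc m)
  then obtain f' where "\<And>x. x \<in> U \<Longrightarrow> (f has_derivative f' x) (at x)" "\<And>v. Ck_on (Suc m) U (\<lambda>x. f' x v)"
    by (subst (asm) Ck_on.simps(2)) blast
  with Suc.IH show ?case by (subst Ck_on.simps(2)) blast
qed

lemma Ck_on_zero: "Ck_on m U (\<lambda>x. 0)"
proof (induction m)
  case (Suc m)
  then show ?case
    by (auto intro!: exI[where x="\<lambda>x v. 0"])
qed simp

lemma Ck_on_const: "Ck_on m U (\<lambda>x. c)"
proof (cases m)
  case (Suc k)
  then show ?thesis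
    by (auto intro!: exI[where x="\<lambda>x v. 0"] simp: Ck_on_zero)
qed simp

lemma Ck_on_bounded_linear: "bounded_linear f \<Longrightarrow> Ck_on m U f"
proof (cases m)
  case 0 assume "bounded_linear f" then show ?thesis using 0
    by (simp add: linear_continuous_on)
next
  case (Suc k)
  assume "bounded_linear f"
  then have "(\<forall>x\<in>U. (f has_derivative (\<lambda>v. f v)) (at x))"
    by (auto intro: bounded_linear_imp_has_derivative)
  then show ?thesis unfolding Suc Ck_on.simps
    by (intro exI[where x="\<lambda>x v. f v"]) (simp add: Ck_on_const)
qed

lemma Ck_on_compose_linear: "bounded_linear L \<Longrightarrow> Ck_on m U f \<Longrightarrow> Ck_on m U (\<lambda>x. L (f x))"
proof (induction m arbitrary: f)
  case 0 then show ?case by (simp add: bounded_linear.continuous_on)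
next
  case (Suc m)
  from Suc.prems(2) obtain f' where f': "\<And>x. x \<in> U \<Longrightarrow> (f has_derivative f' x) (at x)" "\<And>v. Ck_on m U (\<lambda>x. f' x v)"
    by (rule Ck_on_SucE) (rule that)
  show ?case unfolding Ck_on.simps
    using f' Suc bounded_linear.has_derivative
    by (intro exI[where x="\<lambda>x v. L (f' x v)"]) (auto simp: bounded_linear.has_derivative)
qed

lemma Ck_on_add: "Ck_on m U f \<Longrightarrow> Ck_on m U g \<Longrightarrow> Ck_on m U (\<lambda>x. f x + g x)"
proof (induction m arbitrary: f g)
  case 0 then show ?case by (simp add: continuous_on_add)
next
  case (Suc m)
  from Suc.prems(1) obtain f' where f': "\<And>x. x \<in> U \<Longrightarrow> (f has_derivative f' x) (at x)" "\<And>v. Ck_on m U (\<lambda>x. f' x v)"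
    by (rule Ck_on_SucE) (rule that)
  from Suc.prems(2) obtain g' where g': "\<And>x. x \<in> U \<Longrightarrow> (g has_derivative g' x) (at x)" "\<And>v. Ck_on m U (\<lambda>x. g' x v)"
    by (rule Ck_on_SucE) (rule that)
  show ?case unfolding Ck_on.simps
    using f' g' Suc
    by (intro exI[where x="\<lambda>x v. f' x v + g' x v"]) (auto intro: has_derivative_add)
qed

lemma Ck_on_bilinear:
  assumes "bounded_bilinear bop"
  shows "Ck_on m U f \<Longrightarrow> Ck_on m U g \<Longrightarrow> Ck_on m U (\<lambda>x. bop (f x) (g x))"
proof (induction m arbitrary: f g)
  case 0 then show ?case by (simp add: bounded_bilinear.continuous_on[OF assms])
next
  case (Suc m)
  from Suc.prems(1) obtain f' where f': "\<And>x. x \<in> U \<Longrightarrow> (f has_derivative f' x) (at x)" "\<And>v. Ck_on m U (\<lambda>x. f' x v)"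
    by (rule Ck_on_SucE) (rule that)
  from Suc.prems(2) obtain g' where g': "\<And>x. x \<in> U \<Longrightarrow> (g has_derivative g' x) (at x)" "\<And>v. Ck_on m U (\<lambda>x. g' x v)"
    by (rule Ck_on_SucE) (rule that)
  have "Ck_on m U f" "Ck_on m U g" using Suc.prems by (auto simp del: Ck_on.simps intro: Ck_on_Suc_D)
  then show ?case unfolding Ck_on.simps
    using f' g' Suc.IH
    by (intro exI[where x="\<lambda>x v. bop (f x) (g' x v) + bop (f' x v) (g x)"])
       (auto intro!: bounded_bilinear.FDERIV[OF assms] Ck_on_add)
qed

lemma Ck_on_sum: "(\<And>i. i \<in> A \<Longrightarrow> Ck_on m U (f i)) \<Longrightarrow> Ck_on m U (\<lambda>x. \<Sum>i\<in>A. f i x)"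
  by (induction A rule: infinite_finite_induct) (auto simp: Ck_on_const Ck_on_add)

text \<open>\<open>Ck_on\<close> asks for regularity of the derivative in each fixed direction,
  whereas the chain rule evaluates \<open>g' (f x)\<close> in the moving direction
  \<open>f' x v\<close>. Expanding that direction in the basis leaves finitely many products; this
  is why the intermediate space is Euclidean.\<close>

lemma Ck_on_compose:
  fixes f :: "'a::real_normed_vector \<Rightarrow> 'b::euclidean_space" and g :: "'b \<Rightarrow> 'c::real_normed_vector"
  shows "Ck_on m U f \<Longrightarrow> Ck_on m V g \<Longrightarrow> f ` U \<subseteq> V \<Longrightarrow> Ck_on m U (\<lambda>x. g (f x))"
proof (induction m arbitrary: f g)
  case 0 then show ?case by (auto intro: continuous_on_compose2)
next
  case (Suc m)
  from Suc.prems(1) obtain f' where f': "\<And>x. x \<in> U \<Longrightarrow> (f has_derivative f' x) (at x)" "\<And>v. Ck_on m U (\<lambda>x. f' x v)"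
    by (rule Ck_on_SucE) (rule that)
  from Suc.prems(2) obtain g' where g': "\<And>x. x \<in> V \<Longrightarrow> (g has_derivative g' x) (at x)" "\<And>v. Ck_on m V (\<lambda>x. g' x v)"
    by (rule Ck_on_SucE) (rule that)
  have C: "Ck_on m U f" using Suc.prems(1) by (rule Ck_on_Suc_D)
  define h where "h x v = (\<Sum>b\<in>Basis. (f' x v \<bullet> b) *\<^sub>R g' (f x) b)" for x v
  have "((\<lambda>x. g (f x)) has_derivative h x) (at x)" if "x \<in> U" for x
  proof -
    have "f x \<in> V" using that Suc.prems by auto
    have "((\<lambda>x. g (f x)) has_derivative (\<lambda>v. g' (f x) (f' x v))) (at x)"
      using has_derivative_compose[OF f'(1)[OF that]] g'(1)[OF \<open>f x \<in> V\<close>] by blast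
    moreover have *: "g' (f x) w = (\<Sum>b\<in>Basis. (w \<bullet> b) *\<^sub>R g' (f x) b)" for w
    proof -
      interpret linear "g' (f x)" using has_derivative_linear[OF g'(1)[OF \<open>f x \<in> V\<close>]] .
      have "g' (f x) w = g' (f x) (\<Sum>b\<in>Basis. (w \<bullet> b) *\<^sub>R b)" by (simp add: euclidean_representation)
      also have "\<dots> = (\<Sum>b\<in>Basis. (w \<bullet> b) *\<^sub>R g' (f x) b)" unfolding sum scale ..
      finally show ?thesis .
    qed
    moreover have "h x = (\<lambda>v. g' (f x) (f' x v))"
      unfolding h_def by (rule ext) (rule *[symmetric])
    ultimately show ?thesis by metis
  qed
  moreover have "Ck_on m U (\<lambda>x. h x v)" for v
    unfolding h_def
  proof (intro Ck_on_sum Ck_on_bilinear[OF bounded_bilinear_scaleR])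
    show "Ck_on m U (\<lambda>x. f' x v \<bullet> b)" for b
      by (rule Ck_on_compose_linear[OF bounded_linear_inner_left f'(2)])
    show "Ck_on m U (\<lambda>x. g' (f x) b)" for b
      using Suc.IH[OF C g'(2)] Suc.prems(3) by blast
  qed
  ultimately show ?case by auto
qed

definition Cinf :: "'a::real_normed_vector set \<Rightarrow> ('a \<Rightarrow> 'b::real_normed_vector) \<Rightarrow> bool" where
  "Cinf U f \<longleftrightarrow> (\<forall>m. Ck_on m U f)"

text \<open>Each order \<open>m\<close> comes with its own witness for the derivative. Uniqueness of
  derivatives identifies all of them with \<open>frechet_derivative\<close>, so one function serves
  every order.\<close>

lemma Cinf_derivative:
  assumes "open U" "Cinf U f"
  shows "x \<in> U \<Longrightarrow> (f has_derivative frechet_derivative f (at x)) (at x)"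
    and "Cinf U (\<lambda>x. frechet_derivative f (at x) v)"
proof -
  have D: "(f has_derivative frechet_derivative f (at x)) (at x)" if x: "x \<in> U" for x
  proof -
    have "Ck_on (Suc 0) U f" using assms by (auto simp: Cinf_def simp del: Ck_on.simps)
    then show ?thesis using x by (auto simp: frechet_derivative_works[symmetric] differentiable_def)
  qed
  then show "x \<in> U \<Longrightarrow> (f has_derivative frechet_derivative f (at x)) (at x)" .
  show "Cinf U (\<lambda>x. frechet_derivative f (at x) v)"
    unfolding Cinf_def
  proof
    fix m
    have "Ck_on (Suc m) U f" using assms by (auto simp: Cinf_def simp del: Ck_on.simps)
    then obtain f' where f': "\<And>x. x \<in> U \<Longrightarrow> (f has_derivative f' x) (at x)" "\<And>v. Ck_on m U (\<lambda>x. f' x v)"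
      by (rule Ck_on_SucE) (rule that)
    have "f' x v = frechet_derivative f (at x) v" if "x \<in> U" for x
      using has_derivative_unique[OF f'(1)[OF that] D[OF that]] by simp
    then show "Ck_on m U (\<lambda>x. frechet_derivative f (at x) v)" by (rule Ck_on_cong[OF f'(2)[of v] assms(1)])
  qed
qed

lemma smooth_on_Cinf: "smooth_on S f \<longleftrightarrow>
   (\<forall>x\<in>S. \<exists>U g. open U \<and> x \<in> U \<and> Cinf U g \<and> (\<forall>y\<in>S \<inter> U. g y = f y))"
  by (simp add: smooth_on_def Cinf_def)

lemma smooth_onE:
  assumes "smooth_on S f" "x \<in> S"
  obtains U g where "open U" "x \<in> U" "Cinf U g" "\<And>y. y \<in> S \<Longrightarrow> y \<in> U \<Longrightarrow> g y = f y"
proof -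
  have "\<exists>U g. open U \<and> x \<in> U \<and> Cinf U g \<and> (\<forall>y\<in>S \<inter> U. g y = f y)"
    using assms by (simp only: smooth_on_Cinf)
  then show ?thesis by (elim exE conjE) (rule that, assumption+, simp)
qed

lemma Cinf_imp_smooth_on: "open U \<Longrightarrow> Cinf U f \<Longrightarrow> smooth_on U f"
  unfolding smooth_on_Cinf by (intro ballI exI[where x=U] exI[where x=f]) auto

lemma smooth_on_subset: "smooth_on S f \<Longrightarrow> T \<subseteq> S \<Longrightarrow> smooth_on T f"
  unfolding smooth_on_Cinf
proof
  fix x assume S: "\<forall>x\<in>S. \<exists>U g. open U \<and> x \<in> U \<and> Cinf U g \<and> (\<forall>y\<in>S \<inter> U. g y = f y)" "T \<subseteq> S" "x \<in> T"
  then obtain U g where "open U" "x \<in> U" "Cinf U g" "\<forall>y\<in>S \<inter> U. g y = f y" by (meson subsetD)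
  with S(2) show "\<exists>U g. open U \<and> x \<in> U \<and> Cinf U g \<and> (\<forall>y\<in>T \<inter> U. g y = f y)"
    by (intro exI[where x=U] exI[where x=g]) auto
qed

lemma smooth_on_cong: "smooth_on S f \<Longrightarrow> (\<And>x. x \<in> S \<Longrightarrow> f x = g x) \<Longrightarrow> smooth_on S g"
  unfolding smooth_on_Cinf
proof
  fix x assume S: "\<forall>x\<in>S. \<exists>U g. open U \<and> x \<in> U \<and> Cinf U g \<and> (\<forall>y\<in>S \<inter> U. g y = f y)" "x \<in> S"
    and eq: "\<And>x. x \<in> S \<Longrightarrow> f x = g x"
  then obtain U h where "open U" "x \<in> U" "Cinf U h" "\<forall>y\<in>S \<inter> U. h y = f y" by meson
  with eq show "\<exists>U h. open U \<and> x \<in> U \<and> Cinf U h \<and> (\<forall>y\<in>S \<inter> U. h y = g y)"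
    by (intro exI[where x=U] exI[where x=h]) auto
qed

lemma smooth_on_locally:
  assumes "\<And>x. x \<in> S \<Longrightarrow> \<exists>T. openin (top_of_set S) T \<and> x \<in> T \<and> smooth_on T f"
  shows "smooth_on S f"
  unfolding smooth_on_Cinf
proof
  fix x assume "x \<in> S"
  then obtain T where T: "openin (top_of_set S) T" "x \<in> T" "smooth_on T f" using assms by blast
  then obtain G where G: "open G" "T = S \<inter> G" by (auto simp: openin_open)
  obtain U g where U: "open U" "x \<in> U" "Cinf U g" "\<And>y. y \<in> T \<Longrightarrow> y \<in> U \<Longrightarrow> g y = f y"
    by (rule smooth_onE[OF T(3,2)]) (rule that)
  show "\<exists>U g. open U \<and> x \<in> U \<and> Cinf U g \<and> (\<forall>y\<in>S \<inter> U. g y = f y)"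
    using U G T by (intro exI[where x="U \<inter> G"] exI[where x=g]) (auto simp: Cinf_def intro: Ck_on_subset)
qed

lemma smooth_on_const [simp, intro]: "smooth_on S (\<lambda>x. c)"
  unfolding smooth_on_Cinf Cinf_def using Ck_on_const by blast

lemma smooth_on_bounded_linear: "bounded_linear f \<Longrightarrow> smooth_on S f"
  unfolding smooth_on_Cinf Cinf_def using Ck_on_bounded_linear[of f _ UNIV] by blast

lemma smooth_on_id [simp, intro]: "smooth_on S (\<lambda>x. x)"
  by (rule smooth_on_bounded_linear[OF bounded_linear_ident])

lemma smooth_on_bilinear:
  assumes "bounded_bilinear bop" "smooth_on S f" "smooth_on S g"
  shows "smooth_on S (\<lambda>x. bop (f x) (g x))"
  unfolding smooth_on_Cinf
proof
  fix x assume "x \<in> S"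
  obtain U f' where U: "open U" "x \<in> U" "Cinf U f'" "\<And>y. y \<in> S \<Longrightarrow> y \<in> U \<Longrightarrow> f' y = f y"
    by (rule smooth_onE[OF assms(2) \<open>x \<in> S\<close>]) (rule that)
  obtain V g' where V: "open V" "x \<in> V" "Cinf V g'" "\<And>y. y \<in> S \<Longrightarrow> y \<in> V \<Longrightarrow> g' y = g y"
    by (rule smooth_onE[OF assms(3) \<open>x\<in>S\<close>]) (rule that)
  have "Cinf (U \<inter> V) (\<lambda>x. bop (f' x) (g' x))"
    using U V unfolding Cinf_def by (auto intro!: Ck_on_bilinear[OF assms(1)] intro: Ck_on_subset)
  show "\<exists>W h. open W \<and> x \<in> W \<and> Cinf W h \<and> (\<forall>y\<in>S \<inter> W. h y = bop (f y) (g y))"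
    using \<open>Cinf (U \<inter> V) _\<close> U V
    by (intro exI[where x="U \<inter> V"] exI[where x="\<lambda>x. bop (f' x) (g' x)"]) auto
qed

lemma smooth_on_add:
  assumes "smooth_on S f" "smooth_on S g"
  shows "smooth_on S (\<lambda>x. f x + g x)"
  unfolding smooth_on_Cinf
proof
  fix x assume "x \<in> S"
  obtain U f' where U: "open U" "x \<in> U" "Cinf U f'" "\<And>y. y \<in> S \<Longrightarrow> y \<in> U \<Longrightarrow> f' y = f y"
    by (rule smooth_onE[OF assms(1) \<open>x \<in> S\<close>]) (rule that)
  obtain V g' where V: "open V" "x \<in> V" "Cinf V g'" "\<And>y. y \<in> S \<Longrightarrow> y \<in> V \<Longrightarrow> g' y = g y"
    by (rule smooth_onE[OF assms(2) \<open>x\<in>S\<close>]) (rule that)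
  have "Cinf (U \<inter> V) (\<lambda>x. f' x + g' x)"
    using U V unfolding Cinf_def by (auto intro!: Ck_on_add intro: Ck_on_subset)
  then show "\<exists>W h. open W \<and> x \<in> W \<and> Cinf W h \<and> (\<forall>y\<in>S \<inter> W. h y = f y + g y)"
    using U V
    by (intro exI[where x="U \<inter> V"] exI[where x="\<lambda>x. f' x + g' x"]) auto
qed

lemma smooth_on_compose:
  fixes f :: "'a::real_normed_vector \<Rightarrow> 'b::euclidean_space" and g :: "'b \<Rightarrow> 'c::real_normed_vector"
  assumes "smooth_on S f" "smooth_on T g" "f ` S \<subseteq> T"
  shows "smooth_on S (\<lambda>x. g (f x))"
  unfolding smooth_on_Cinf
proof
  fix x assume "x \<in> S"
  obtain U f' where U: "open U" "x \<in> U" "Cinf U f'" "\<And>y. y \<in> S \<Longrightarrow> y \<in> U \<Longrightarrow> f' y = f y"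
    by (rule smooth_onE[OF assms(1) \<open>x \<in> S\<close>]) (rule that)
  have "f x \<in> T" using assms \<open>x \<in> S\<close> by auto
  obtain V g' where V: "open V" "f x \<in> V" "Cinf V g'" "\<And>y. y \<in> T \<Longrightarrow> y \<in> V \<Longrightarrow> g' y = g y"
    by (rule smooth_onE[OF assms(2) \<open>f x \<in> T\<close>]) (rule that)
  define W where "W = U \<inter> f' -` V"
  have "continuous_on U f'" using U(3) unfolding Cinf_def using Ck_on_continuous by blast
  then have "open W" using U V continuous_open_preimage unfolding W_def by blast
  moreover have "x \<in> W" using U V \<open>x \<in> S\<close> by (simp add: W_def)
  moreover have "Cinf W (\<lambda>x. g' (f' x))"
    unfolding Cinf_def
  proof
    fix m
    show "Ck_on m W (\<lambda>x. g' (f' x))"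
      using U V unfolding Cinf_def by (intro Ck_on_compose[of m W f' V g']) (auto simp: W_def intro: Ck_on_subset)
  qed
  moreover have "g' (f' y) = g (f y)" if "y \<in> S" "y \<in> W" for y
    using that U(4) V(4) assms(3) by (auto simp: W_def)
  ultimately show "\<exists>W h. open W \<and> x \<in> W \<and> Cinf W h \<and> (\<forall>y\<in>S \<inter> W. h y = g (f y))"
    by (intro exI[where x=W] exI[where x="\<lambda>x. g' (f' x)"]) auto
qed

lemma smooth_on_compose_linear:
  assumes "bounded_linear L" "smooth_on S f"
  shows "smooth_on S (\<lambda>x. L (f x))"
  unfolding smooth_on_Cinf
proof
  fix x assume "x \<in> S"
  obtain U f' where U: "open U" "x \<in> U" "Cinf U f'" "\<And>y. y \<in> S \<Longrightarrow> y \<in> U \<Longrightarrow> f' y = f y"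
    by (rule smooth_onE[OF assms(2) \<open>x \<in> S\<close>]) (rule that)
  moreover have "Cinf U (\<lambda>x. L (f' x))"
    using U(3) unfolding Cinf_def by (intro allI Ck_on_compose_linear[OF assms(1)]) simp
  ultimately show "\<exists>W h. open W \<and> x \<in> W \<and> Cinf W h \<and> (\<forall>y\<in>S \<inter> W. h y = L (f y))"
    by (intro exI[where x=U] exI[where x="\<lambda>x. L (f' x)"]) auto
qed

lemma smooth_on_imp_continuous_on:
  assumes "smooth_on S f"
  shows "continuous_on S f"
  unfolding continuous_on_eq_continuous_within
proof
  fix x assume "x \<in> S"
  obtain U f' where U: "open U" "x \<in> U" "Cinf U f'" "\<And>y. y \<in> S \<Longrightarrow> y \<in> U \<Longrightarrow> f' y = f y"
    by (rule smooth_onE[OF assms(1) \<open>x \<in> S\<close>]) (rule that)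
  have "continuous_on U f'" using U(3) unfolding Cinf_def using Ck_on_continuous by blast
  then have "continuous (at x within S) f'"
    using U by (meson continuous_at_imp_continuous_at_within continuous_on_eq_continuous_at)
  then show "continuous (at x within S) f"
    using U \<open>x \<in> S\<close>
    by (intro continuous_transform_within_openin[where S="S \<inter> U" and T=S and f=f' and g=f]) (auto simp: openin_open_Int)
qed

lemma smooth_on_sum:
  "(\<And>i. i \<in> A \<Longrightarrow> smooth_on S (f i)) \<Longrightarrow> smooth_on S (\<lambda>x. \<Sum>i\<in>A. f i x)"
  by (induction A rule: infinite_finite_induct) (auto simp: smooth_on_add)

lemma smooth_on_minus: "smooth_on S f \<Longrightarrow> smooth_on S (\<lambda>x. - f x)"
  by (rule smooth_on_compose_linear[OF bounded_linear_minus[OF bounded_linear_ident]])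

lemma smooth_on_diff: "smooth_on S f \<Longrightarrow> smooth_on S g \<Longrightarrow> smooth_on S (\<lambda>x. f x - g x)"
  using smooth_on_add[of S f "\<lambda>x. - g x"] smooth_on_minus by auto

lemma smooth_on_mult:
  fixes f :: "'a::real_normed_vector \<Rightarrow> 'b::real_normed_algebra"
  shows "smooth_on S f \<Longrightarrow> smooth_on S g \<Longrightarrow> smooth_on S (\<lambda>x. f x * g x)"
  by (rule smooth_on_bilinear[OF bounded_bilinear_mult])

lemmas smooth_on_scaleR = smooth_on_bilinear[OF bounded_bilinear_scaleR]

lemmas smooth_on_inner = smooth_on_bilinear[OF bounded_bilinear_inner]

lemma smooth_on_euclidean:
  fixes f :: "'a::real_normed_vector \<Rightarrow> 'b::euclidean_space"
  assumes "\<And>b. b \<in> Basis \<Longrightarrow> smooth_on S (\<lambda>x. f x \<bullet> b)"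
  shows "smooth_on S f"
proof -
  have "smooth_on S (\<lambda>x. \<Sum>b\<in>Basis. (f x \<bullet> b) *\<^sub>R b)"
    by (intro smooth_on_sum smooth_on_scaleR assms smooth_on_const)
  then show ?thesis by (simp add: euclidean_representation)
qed

lemma smooth_on_vec:
  fixes f :: "'a::real_normed_vector \<Rightarrow> 'b::euclidean_space ^ 'd::finite"
  assumes "\<And>i. smooth_on S (\<lambda>x. f x $ i)"
  shows "smooth_on S f"
proof (rule smooth_on_euclidean)
  fix b :: "'b ^ 'd" assume "b \<in> Basis"
  then obtain u i where "b = axis i u" by (auto simp: Basis_vec_def)
  then show "smooth_on S (\<lambda>x. f x \<bullet> b)"
    using smooth_on_compose_linear[OF bounded_linear_inner_left[of u] assms[of i]] by (simp add: inner_axis)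
qed

lemma smooth_on_nth: "smooth_on S f \<Longrightarrow> smooth_on S (\<lambda>x. f x $ i)"
  by (rule smooth_on_compose_linear[OF bounded_linear_vec_nth])

lemma smooth_on_Pair:
  fixes f :: "'a::real_normed_vector \<Rightarrow> 'b::real_normed_vector" and g :: "'a \<Rightarrow> 'c::real_normed_vector"
  assumes "smooth_on S f" "smooth_on S g"
  shows "smooth_on S (\<lambda>x. (f x, g x))"
proof -
  have "smooth_on S (\<lambda>x. (f x, 0) + (0, g x))"
    by (intro smooth_on_add smooth_on_compose_linear[OF _ assms(1)] smooth_on_compose_linear[OF _ assms(2)]
        bounded_linear_Pair bounded_linear_ident bounded_linear_zero)
  then show ?thesis by simp
qed

section \<open>Elementary functions\<close>

lemma Ck_on_inverse: "Ck_on m (-{0}) (inverse :: 'a::real_normed_field \<Rightarrow> 'a)"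
proof (induction m)
  case 0 show ?case by (auto intro!: continuous_intros)
next
  case (Suc m)
  have "Ck_on m (-{0}) (\<lambda>x::'a. - (inverse x * h * inverse x))" for h
    by (intro Ck_on_compose_linear[OF bounded_linear_minus[OF bounded_linear_ident]]
        Ck_on_bilinear[OF bounded_bilinear_mult] Suc Ck_on_const)
  moreover have "\<forall>x\<in>-{0::'a}. (inverse has_derivative (\<lambda>h. - (inverse x * h * inverse x))) (at x)"
    using has_derivative_inverse' by auto
  ultimately show ?case by (intro Ck_on_SucI[where f'="\<lambda>x h. - (inverse x * h * inverse x)"]) auto
qed

lemma Ck_on_exp: "Ck_on m UNIV (exp :: complex \<Rightarrow> complex)"
proof (induction m)
  case 0 show ?case by (auto intro!: continuous_intros)
next
  case (Suc m)
  have "Ck_on m UNIV (\<lambda>x::complex. h * exp x)" for h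
    by (intro Ck_on_bilinear[OF bounded_bilinear_mult] Suc Ck_on_const)
  moreover have "(exp has_derivative (\<lambda>h. h * exp x)) (at x)" for x :: complex
    using DERIV_exp[of x] by (simp add: has_field_derivative_def mult_commute_abs)
  ultimately show ?case by (intro Ck_on_SucI[where f'="\<lambda>x h. h * exp x"]) auto
qed

lemma smooth_on_exp:
  assumes "smooth_on S f" shows "smooth_on S (\<lambda>x. exp (f x :: complex))"
  by (rule smooth_on_compose[OF assms(1) Cinf_imp_smooth_on[of UNIV exp]])
     (use Ck_on_exp in \<open>auto simp: Cinf_def\<close>)

lemma Ck_on_Ln: "Ck_on m (- \<real>\<^sub>\<le>\<^sub>0) (Ln :: complex \<Rightarrow> complex)"
proof (cases m)
  case 0 then show ?thesis by (auto intro!: continuous_intros)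
next
  case (Suc k)
  have "Ck_on k (- \<real>\<^sub>\<le>\<^sub>0) (\<lambda>x::complex. inverse x * h)" for h
    by (intro Ck_on_bilinear[OF bounded_bilinear_mult] Ck_on_const Ck_on_subset[OF Ck_on_inverse]) auto
  moreover have "(Ln has_derivative (\<lambda>h. inverse x * h)) (at x)" if "x \<notin> \<real>\<^sub>\<le>\<^sub>0" for x :: complex
    using has_field_derivative_Ln[OF that] by (simp add: has_field_derivative_def)
  ultimately show ?thesis unfolding Suc by (intro Ck_on_SucI[where f'="\<lambda>x h. inverse x * h"]) auto
qed

lemma smooth_on_Ln:
  assumes "smooth_on S f" "\<And>x. x \<in> S \<Longrightarrow> f x \<notin> \<real>\<^sub>\<le>\<^sub>0" shows "smooth_on S (\<lambda>x. Ln (f x))"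
  by (rule smooth_on_compose[OF assms(1) Cinf_imp_smooth_on[of "-\<real>\<^sub>\<le>\<^sub>0" Ln]])
     (use Ck_on_Ln assms(2) in \<open>auto simp: Cinf_def open_Compl\<close>)

lemma smooth_on_of_real: "smooth_on S f \<Longrightarrow> smooth_on S (\<lambda>x. complex_of_real (f x))"
  by (rule smooth_on_compose_linear[OF bounded_linear_of_real])

lemma smooth_on_Re: "smooth_on S f \<Longrightarrow> smooth_on S (\<lambda>x. Re (f x))"
  by (rule smooth_on_compose_linear[OF bounded_linear_Re])

lemma smooth_on_Im: "smooth_on S f \<Longrightarrow> smooth_on S (\<lambda>x. Im (f x))"
  by (rule smooth_on_compose_linear[OF bounded_linear_Im])

lemma smooth_on_ln:
  assumes "smooth_on S f" "\<And>x. x \<in> S \<Longrightarrow> f x > 0" shows "smooth_on S (\<lambda>x. ln (f x :: real))"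
proof -
  have "smooth_on S (\<lambda>x. Re (Ln (of_real (f x))))"
    using assms by (intro smooth_on_Re smooth_on_Ln smooth_on_of_real) (force simp: complex_nonpos_Reals_iff)+
  then show ?thesis by (rule smooth_on_cong) (use assms(2) in \<open>simp add: Ln_of_real\<close>)
qed

text \<open>On positive values the root is the exponential of half the logarithm, which reduces it
  to the complex functions already treated.\<close>

lemma smooth_on_sqrt:
  assumes "smooth_on S f" "\<And>x. x \<in> S \<Longrightarrow> f x > 0" shows "smooth_on S (\<lambda>x. sqrt (f x))"
proof -
  have "smooth_on S (\<lambda>x. Re (exp (of_real ((1/2) * ln (f x)))))"
    using assms by (intro smooth_on_Re smooth_on_exp smooth_on_of_real smooth_on_ln smooth_on_mult smooth_on_const)
  then show ?thesis
  proof (rule smooth_on_cong)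
    fix x assume "x \<in> S"
    then have "f x > 0" using assms by auto
    moreover have "exp ((1/2) * ln (f x)) = sqrt (f x)"
    proof -
      have "(1/2) * ln (f x) = ln (sqrt (f x))" using \<open>f x > 0\<close> by (simp add: ln_sqrt)
      then show ?thesis using \<open>f x > 0\<close> by simp
    qed
    ultimately show "Re (exp (of_real ((1/2) * ln (f x)))) = sqrt (f x)"
      by (metis Re_complex_of_real exp_of_real)
  qed
qed

lemma smooth_on_cis:
  assumes "smooth_on S f" shows "smooth_on S (\<lambda>x. cis (f x))"
  unfolding cis_conv_exp
  by (intro smooth_on_exp smooth_on_mult smooth_on_const smooth_on_of_real assms)

lemma smooth_on_cmod2:
  assumes "smooth_on S f" shows "smooth_on S (\<lambda>x. (cmod (f x))\<^sup>2)"
  using smooth_on_inner[OF assms assms] by (simp add: power2_norm_eq_inner)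

section \<open>Directional derivatives and lifts through group actions\<close>

text \<open>No domain occurs in it: for a relatively open subset of a subspace \<open>V\<close> and
  \<open>u\<close> in \<open>V\<close> the value is the derivative within that set, and passing to a
  smaller open set changes nothing.\<close>

definition dd :: "('a::real_normed_vector \<Rightarrow> 'b::real_normed_vector) \<Rightarrow> 'a \<Rightarrow> 'a \<Rightarrow> 'b" where
  "dd f x u = vector_derivative (\<lambda>t::real. f (x + t *\<^sub>R u)) (at 0)"

text \<open>A derivative within an arbitrary set \<open>S\<close> is not unique as a linear map, but
  its value on the velocity of a curve inside \<open>S\<close> is forced. Both \<open>dd\<close> and
  tangent vectors rest on this.\<close>

lemma has_derivative_curve:
  assumes f: "(f has_derivative D) (at x within S)"
    and g: "(\<gamma> has_vector_derivative v) (at (0::real))" "\<gamma> 0 = x" "0 < \<epsilon>" "\<gamma> ` {-\<epsilon><..<\<epsilon>} \<subseteq> S"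
  shows "((\<lambda>t. f (\<gamma> t)) has_vector_derivative D v) (at 0)"
proof -
  have *: "(\<gamma> has_derivative (\<lambda>t. t *\<^sub>R v)) (at (0::real) within {-\<epsilon><..<\<epsilon>})"
    using g(1) by (auto simp: has_vector_derivative_def intro: has_derivative_at_withinI)
  have "(f has_derivative D) (at (\<gamma> 0) within \<gamma> ` {-\<epsilon><..<\<epsilon>})"
    unfolding g(2) by (rule has_derivative_subset[OF f g(4)])
  from has_derivative_in_compose[OF * this]
  have "((\<lambda>t. f (\<gamma> t)) has_derivative (\<lambda>t. D (t *\<^sub>R v))) (at 0 within {-\<epsilon><..<\<epsilon>})" .
  moreover have "D (t *\<^sub>R v) = t *\<^sub>R D v" for t
    using has_derivative_linear[OF f] by (simp add: linear_cmul)
  ultimately have "((\<lambda>t. f (\<gamma> t)) has_derivative (\<lambda>t. t *\<^sub>R D v)) (at 0)"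
    using g(3) by (simp add: at_within_open[of 0 "{-\<epsilon><..<\<epsilon>}"])
  then show ?thesis by (simp add: has_vector_derivative_def)
qed

lemma line_in_relopen:
  fixes x u :: "'a::real_normed_vector"
  assumes "subspace V" "openin (top_of_set V) A" "x \<in> A" "u \<in> V"
  obtains \<epsilon> where "\<epsilon> > 0" "(\<lambda>t. x + t *\<^sub>R u) ` {-\<epsilon><..<\<epsilon>::real} \<subseteq> A"
proof -
  obtain G where G: "open G" "A = V \<inter> G" using assms(2) by (auto simp: openin_open)
  have "open ((\<lambda>t::real. x + t *\<^sub>R u) -` G)"
    by (intro open_vimage G continuous_intros)
  moreover have "0 \<in> (\<lambda>t::real. x + t *\<^sub>R u) -` G" using assms G by auto
  ultimately obtain e where e: "e > 0" "ball 0 e \<subseteq> (\<lambda>t::real. x + t *\<^sub>R u) -` G"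
    by (meson open_contains_ball)
  have "x + t *\<^sub>R u \<in> V" for t using assms G by (simp add: subspace_add subspace_scale)
  with e have "(\<lambda>t. x + t *\<^sub>R u) ` {-e<..<e} \<subseteq> A"
    by (auto simp: G(2) subset_iff dist_real_def)
  with e(1) show ?thesis by (rule that)
qed

lemma dd_within_vd:
  assumes "subspace V" "openin (top_of_set V) A" "x \<in> A" "u \<in> V" "(f has_derivative D) (at x within A)"
  shows "((\<lambda>t. f (x + t *\<^sub>R u)) has_vector_derivative D u) (at 0)"
proof -
  obtain \<epsilon> where e: "\<epsilon> > 0" "(\<lambda>t. x + t *\<^sub>R u) ` {-\<epsilon><..<\<epsilon>::real} \<subseteq> A"
    by (rule line_in_relopen[OF assms(1-4)])
  have "((\<lambda>t. x + t *\<^sub>R u) has_vector_derivative u) (at 0)"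
    by (auto intro!: derivative_eq_intros simp: has_vector_derivative_def)
  from has_derivative_curve[OF assms(5) this _ e] show ?thesis by simp
qed

lemma dd_within:
  assumes "subspace V" "openin (top_of_set V) A" "x \<in> A" "u \<in> V" "(f has_derivative D) (at x within A)"
  shows "dd f x u = D u"
  unfolding dd_def using dd_within_vd[OF assms] by (rule vector_derivative_at)

lemma smooth_on_has_derivative:
  assumes "smooth_on S f" "x \<in> S"
  shows "(f has_derivative frechet_derivative f (at x within S)) (at x within S)"
proof -
  obtain U g where U: "open U" "x \<in> U" "Cinf U g" "\<And>y. y \<in> S \<Longrightarrow> y \<in> U \<Longrightarrow> g y = f y"
    by (rule smooth_onE[OF assms]) (rule that)
  have "(g has_derivative frechet_derivative g (at x)) (at x within S)"
    using Cinf_derivative(1)[OF U(1,3,2)] by (rule has_derivative_at_withinI)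
  moreover obtain e where "e > 0" "ball x e \<subseteq> U" using U by (meson open_contains_ball)
  ultimately have "(f has_derivative frechet_derivative g (at x)) (at x within S)"
    using assms(2) by (elim has_derivative_transform_within) (auto simp: dist_commute subset_iff intro!: U(4))
  then show ?thesis by (auto simp: frechet_derivative_works[symmetric] differentiable_def)
qed

lemma dd_frechet:
  assumes "subspace V" "openin (top_of_set V) A" "x \<in> A" "u \<in> V" "smooth_on A f"
  shows "dd f x u = frechet_derivative f (at x within A) u"
  using dd_within[OF assms(1-4) smooth_on_has_derivative[OF assms(5,3)]] .

lemma dd_vd:
  assumes "subspace V" "openin (top_of_set V) A" "x \<in> A" "u \<in> V" "smooth_on A f"
  shows "((\<lambda>t. f (x + t *\<^sub>R u)) has_vector_derivative dd f x u) (at 0)"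
  using dd_within_vd[OF assms(1-4) smooth_on_has_derivative[OF assms(5,3)]] dd_frechet[OF assms] by simp

lemma pullback_form_dd:
  assumes "subspace V" "openin (top_of_set V) A" "x \<in> A" "smooth_on A f" "u \<in> V" "v \<in> V"
  shows "pullback_form A f w x u v = w (f x) (dd f x u) (dd f x v)"
  using assms unfolding pullback_form_def by (simp add: dd_frechet)

lemma dd_Cinf:
  assumes "open U" "Cinf U g" "x \<in> U"
  shows "dd g x u = frechet_derivative g (at x) u"
proof -
  have "(g has_derivative frechet_derivative g (at x)) (at x within U)"
    using Cinf_derivative(1)[OF assms(1,2,3)] by (rule has_derivative_at_withinI)
  from dd_within[OF subspace_UNIV _ assms(3) UNIV_I this] show ?thesis using assms by simp
qed

lemma dd_cong:
  assumes "subspace V" "openin (top_of_set V) A" "x \<in> A" "u \<in> V" "\<And>y. y \<in> A \<Longrightarrow> f y = g y"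
  shows "dd f x u = dd g x u"
proof -
  obtain \<epsilon> where e: "\<epsilon> > 0" "(\<lambda>t. x + t *\<^sub>R u) ` {-\<epsilon><..<\<epsilon>::real} \<subseteq> A"
    by (rule line_in_relopen[OF assms(1-4)])
  have "((\<lambda>t. f (x + t *\<^sub>R u)) has_vector_derivative D) (at 0) \<longleftrightarrow> ((\<lambda>t. g (x + t *\<^sub>R u)) has_vector_derivative D) (at 0)" for D
  proof -
    have "f (x + t *\<^sub>R u) = g (x + t *\<^sub>R u)" if "t \<in> {-\<epsilon><..<\<epsilon>}" for t
      using subsetD[OF e(2) imageI[OF that]] by (rule assms(5))
    then show ?thesis
      using e(1) unfolding has_vector_derivative_def
      by (intro iffI; elim has_derivative_transform_within_open[where s="{-\<epsilon><..<\<epsilon>}"]) auto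
  qed
  then show ?thesis unfolding dd_def vector_derivative_def by simp
qed

text \<open>The formula for \<open>dd f\<close> is valid at all points of \<open>A\<close> near
  \<open>x\<close>, not just at \<open>x\<close>; thus \<open>dd f\<close> is again smooth and can
  be differentiated a second time.\<close>

lemma dd_extension:
  assumes V: "subspace V" "openin (top_of_set V) A" and f: "smooth_on A f" and x: "x \<in> A"
  obtains U g where "open U" "x \<in> U" "Cinf U g" "\<And>y. y \<in> A \<Longrightarrow> y \<in> U \<Longrightarrow> g y = f y"
    "\<And>y u. y \<in> A \<Longrightarrow> y \<in> U \<Longrightarrow> u \<in> V \<Longrightarrow> dd f y u = frechet_derivative g (at y) u"
proof -
  obtain U g where U: "open U" "x \<in> U" "Cinf U g" "\<And>y. y \<in> A \<Longrightarrow> y \<in> U \<Longrightarrow> g y = f y"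
    by (rule smooth_onE[OF f x]) (rule that)
  have "dd f y u = frechet_derivative g (at y) u" if "y \<in> A" "y \<in> U" "u \<in> V" for y u
  proof -
    have "openin (top_of_set V) (A \<inter> U)" using V U by (simp add: openin_Int_open)
    then have "dd f y u = dd g y u"
      by (rule dd_cong[OF V(1)]) (use that U(4) in auto)
    then show ?thesis using dd_Cinf[OF U(1,3) that(2)] by simp
  qed
  with U show ?thesis by (rule that)
qed

lemma smooth_on_dd:
  assumes V: "subspace V" "openin (top_of_set V) A" and f: "smooth_on A f" and u: "u \<in> V"
  shows "smooth_on A (\<lambda>x. dd f x u)"
  unfolding smooth_on_Cinf
proof
  fix x assume "x \<in> A"
  obtain U g where U: "open U" "x \<in> U" "Cinf U g" 
    "\<And>y u. y \<in> A \<Longrightarrow> y \<in> U \<Longrightarrow> u \<in> V \<Longrightarrow> dd f y u = frechet_derivative g (at y) u"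
    by (rule dd_extension[OF V f \<open>x \<in> A\<close>]) (rule that)
  then show "\<exists>W h. open W \<and> x \<in> W \<and> Cinf W h \<and> (\<forall>y\<in>A \<inter> W. h y = dd f y u)"
    using u Cinf_derivative(2)[OF U(1,3)]
    by (intro exI[where x=U] exI[where x="\<lambda>x. frechet_derivative g (at x) u"]) auto
qed

lemma dd_linear:
  assumes "subspace V" "openin (top_of_set V) A" "x \<in> A" "smooth_on A f"
  obtains D where "bounded_linear D" "\<And>u. u \<in> V \<Longrightarrow> dd f x u = D u"
    using dd_frechet[OF assms(1-3) _ assms(4)] has_derivative_bounded_linear[OF smooth_on_has_derivative[OF assms(4,3)]]
      by (rule that[rotated])

lemma dd_compose_within:
  assumes V: "subspace V" "openin (top_of_set V) A" "x \<in> A" and f: "smooth_on A f" "f ` A \<subseteq> S"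
    and g: "(g has_derivative D) (at (f x) within S)" and u: "u \<in> V"
  shows "dd (\<lambda>y. g (f y)) x u = D (dd f x u)"
proof -
  obtain \<epsilon> where e: "\<epsilon> > 0" "(\<lambda>t. x + t *\<^sub>R u) ` {-\<epsilon><..<\<epsilon>::real} \<subseteq> A"
    by (rule line_in_relopen[OF V u])
  have "((\<lambda>t. g (f (x + t *\<^sub>R u))) has_vector_derivative D (dd f x u)) (at 0)"
    by (rule has_derivative_curve[OF g dd_vd[OF V u f(1)] _ e(1)]) (use e(2) f(2) in auto)
  then show ?thesis unfolding dd_def[of "\<lambda>y. g (f y)"] by (rule vector_derivative_at)
qed

text \<open>Pairing the curve with the component of \<open>v\<close> orthogonal to \<open>W\<close>
  gives the zero function, whose derivative is the squared norm of that component.\<close>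

lemma curve_derivative_in_subspace:
  fixes \<gamma> :: "real \<Rightarrow> 'b::euclidean_space"
  assumes W: "subspace W" and g: "(\<gamma> has_vector_derivative v) (at 0)" "0 < \<epsilon>" "\<gamma> ` {-\<epsilon><..<\<epsilon>} \<subseteq> W"
  shows "v \<in> W"
proof -
  obtain y z where yz: "y \<in> W" "\<And>w. w \<in> W \<Longrightarrow> orthogonal z w" "v = y + z"
    using orthogonal_subspace_decomp_exists[of W v] W by (auto simp: span_eq_iff[THEN iffD2])
  have "((\<lambda>t. \<gamma> t \<bullet> z) has_vector_derivative v \<bullet> z) (at 0)"
    by (rule bounded_linear.has_vector_derivative[OF bounded_linear_inner_left g(1)])
  moreover have "((\<lambda>t. \<gamma> t \<bullet> z) has_vector_derivative 0) (at 0)"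
  proof (rule has_vector_derivative_transform_within_open[where f="\<lambda>t. 0" and S="{-\<epsilon><..<\<epsilon>}"])
    show "0 = \<gamma> t \<bullet> z" if "t \<in> {-\<epsilon><..<\<epsilon>}" for t
      using yz(2)[OF subsetD[OF g(3) imageI[OF that]]] by (simp add: orthogonal_def inner_commute)
  qed (use g in auto)
  ultimately have "v \<bullet> z = 0" by (rule vector_derivative_unique_at)
  then have "z = 0" using yz(2)[OF yz(1)] unfolding yz(3) by (simp add: inner_add_left inner_add_right orthogonal_def inner_commute)
  then show ?thesis using yz by simp
qed

lemma dd_in_subspace:
  fixes f :: "'a::real_normed_vector \<Rightarrow> 'b::euclidean_space"
  assumes V: "subspace V" "openin (top_of_set V) A" "x \<in> A" "u \<in> V" and f: "smooth_on A f" "f ` A \<subseteq> W" "subspace W"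
  shows "dd f x u \<in> W"
proof -
  obtain \<epsilon> where e: "\<epsilon> > 0" "(\<lambda>t. x + t *\<^sub>R u) ` {-\<epsilon><..<\<epsilon>::real} \<subseteq> A"
    by (rule line_in_relopen[OF V])
  show ?thesis
    by (rule curve_derivative_in_subspace[OF f(3) dd_vd[OF V f(1)] e(1)]) (use e f in auto)
qed

lemma dd_compose:
  fixes f :: "'a::real_normed_vector \<Rightarrow> 'b::euclidean_space"
  assumes V: "subspace V" "openin (top_of_set V) A" "x \<in> A" and f: "smooth_on A f" "f ` A \<subseteq> B"
    and W: "subspace W" "openin (top_of_set W) B" and g: "smooth_on B g" and u: "u \<in> V"
  shows "dd (\<lambda>y. g (f y)) x u = dd g (f x) (dd f x u)"
proof -
  have fx: "f x \<in> B" using V f by auto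
  have "B \<subseteq> W" using W(2) by (rule openin_imp_subset)
  then have "dd f x u \<in> W"
    using dd_in_subspace[OF V u f(1) _ W(1)] f(2) by blast
  then show ?thesis
    using dd_compose_within[OF V f smooth_on_has_derivative[OF g fx] u] dd_frechet[OF W fx _ g] by simp
qed

lemma dd_bilinear:
  assumes V: "subspace V" "openin (top_of_set V) A" "x \<in> A" and u: "u \<in> V"
    and f: "smooth_on A f" "smooth_on A g" and B: "bounded_bilinear B"
  shows "dd (\<lambda>y. B (f y) (g y)) x u = B (f x) (dd g x u) + B (dd f x u) (g x)"
proof -
  have "((\<lambda>t. B (f (x + t *\<^sub>R u)) (g (x + t *\<^sub>R u))) has_vector_derivative
     B (f (x + 0 *\<^sub>R u)) (dd g x u) + B (dd f x u) (g (x + 0 *\<^sub>R u))) (at 0)"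
    by (rule bounded_bilinear.has_vector_derivative[OF B dd_vd[OF V u f(1)] dd_vd[OF V u f(2)]])
  then show ?thesis unfolding dd_def[of "\<lambda>y. B (f y) (g y)"] by (simp add: vector_derivative_at)
qed

lemma dd_bounded_linear:
  assumes V: "subspace V" "openin (top_of_set V) A" "x \<in> A" and u: "u \<in> V"
    and f: "smooth_on A f" and L: "bounded_linear L"
  shows "dd (\<lambda>y. L (f y)) x u = L (dd f x u)"
  unfolding dd_def[of "\<lambda>y. L (f y)"]
  by (intro vector_derivative_at bounded_linear.has_vector_derivative[OF L] dd_vd[OF V u f])

text \<open>Symmetry of second derivatives: both mixed derivatives are, up to the choice of nearby
  points, the same second difference quotient.\<close>

lemma mixed_derivative_mean_value:
  fixes g :: "'a::real_normed_vector \<Rightarrow> real"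
  assumes U: "open U" "Cinf U g" and b: "ball x e \<subseteq> U" and s: "0 < s" "s * (norm u + norm v) < e"
  obtains p where "dist x p \<le> s * (norm u + norm v)"
    "g (x + s *\<^sub>R u + s *\<^sub>R v) - g (x + s *\<^sub>R u) - g (x + s *\<^sub>R v) + g x
       = s * s * frechet_derivative (\<lambda>y. frechet_derivative g (at y) u) (at p) v"
proof -
  define A where "A y = frechet_derivative g (at y) u" for y
  have CA: "Cinf U A" unfolding A_def using Cinf_derivative(2)[OF U] .
  have bd: "dist x (x + a *\<^sub>R u + c *\<^sub>R v) \<le> s * (norm u + norm v)" if "0 \<le> a" "a \<le> s" "0 \<le> c" "c \<le> s" for a c
  proof -
    have "norm (a *\<^sub>R u + c *\<^sub>R v) \<le> norm (a *\<^sub>R u) + norm (c *\<^sub>R v)" by (rule norm_triangle_ineq)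
    also have "\<dots> \<le> s * norm u + s * norm v" using that by (simp add: add_mono mult_right_mono)
    finally have "norm (a *\<^sub>R u + c *\<^sub>R v) \<le> s * (norm u + norm v)" by (simp add: algebra_simps)
    moreover have "dist x (x + a *\<^sub>R u + c *\<^sub>R v) = norm (a *\<^sub>R u + c *\<^sub>R v)"
      by (simp add: dist_norm add.assoc) (metis norm_minus_cancel minus_add_distrib add.commute diff_conv_add_uminus)
    ultimately show ?thesis by simp
  qed
  have inU: "x + a *\<^sub>R u + c *\<^sub>R v \<in> U" if "0 \<le> a" "a \<le> s" "0 \<le> c" "c \<le> s" for a c
    using bd[OF that] s b by auto
  have dg: "((\<lambda>t. g (x + t *\<^sub>R u + c *\<^sub>R v)) has_field_derivative A (x + a *\<^sub>R u + c *\<^sub>R v)) (at a)"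
    if "0 \<le> a" "a \<le> s" "0 \<le> c" "c \<le> s" for a c
  proof -
    have "(g has_derivative frechet_derivative g (at (x + a *\<^sub>R u + c *\<^sub>R v))) (at (x + a *\<^sub>R u + c *\<^sub>R v))"
      by (rule Cinf_derivative(1)[OF U inU[OF that]])
    moreover have "((\<lambda>t. x + t *\<^sub>R u + c *\<^sub>R v) has_vector_derivative u) (at a)"
      by (auto intro!: derivative_eq_intros simp: has_vector_derivative_def)
    ultimately show ?thesis
      unfolding A_def has_real_derivative_iff_has_vector_derivative
      using vector_derivative_diff_chain_within[of "\<lambda>t. x + t *\<^sub>R u + c *\<^sub>R v" u a UNIV g] by (auto simp: o_def intro: has_derivative_at_withinI)
  qed
  have dA: "((\<lambda>t. A (x + a *\<^sub>R u + t *\<^sub>R v)) has_field_derivative frechet_derivative A (at (x + a *\<^sub>R u + c *\<^sub>R v)) v) (at c)"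
    if "0 \<le> a" "a \<le> s" "0 \<le> c" "c \<le> s" for a c
  proof -
    have "(A has_derivative frechet_derivative A (at (x + a *\<^sub>R u + c *\<^sub>R v))) (at (x + a *\<^sub>R u + c *\<^sub>R v))"
      by (rule Cinf_derivative(1)[OF U(1) CA inU[OF that]])
    moreover have "((\<lambda>t. x + a *\<^sub>R u + t *\<^sub>R v) has_vector_derivative v) (at c)"
      by (auto intro!: derivative_eq_intros simp: has_vector_derivative_def)
    ultimately show ?thesis
      unfolding has_real_derivative_iff_has_vector_derivative
      using vector_derivative_diff_chain_within[of "\<lambda>t. x + a *\<^sub>R u + t *\<^sub>R v" v c UNIV A] by (auto simp: o_def intro: has_derivative_at_withinI)
  qed
  \<comment> \<open>The mean value theorem in direction \<open>u\<close>, applied to the difference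
    of \<open>g\<close> in direction \<open>v\<close>. What it leaves is a difference of
    \<open>A\<close> along \<open>v\<close>, to which the theorem is applied again.\<close>
  have "\<exists>\<xi>>0. \<xi> < s \<and> (g (x + s *\<^sub>R u + s *\<^sub>R v) - g (x + s *\<^sub>R u + 0 *\<^sub>R v)) - (g (x + 0 *\<^sub>R u + s *\<^sub>R v) - g (x + 0 *\<^sub>R u + 0 *\<^sub>R v))
     = (s - 0) * (A (x + \<xi> *\<^sub>R u + s *\<^sub>R v) - A (x + \<xi> *\<^sub>R u + 0 *\<^sub>R v))"
    using s by (intro MVT2[where f="\<lambda>t. g (x + t *\<^sub>R u + s *\<^sub>R v) - g (x + t *\<^sub>R u + 0 *\<^sub>R v)" and a=0 and b=s] DERIV_diff dg) auto
  then obtain \<xi> where xi: "\<xi> > 0" "\<xi> < s" "(g (x + s *\<^sub>R u + s *\<^sub>R v) - g (x + s *\<^sub>R u)) - (g (x + s *\<^sub>R v) - g x)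
     = s * (A (x + \<xi> *\<^sub>R u + s *\<^sub>R v) - A (x + \<xi> *\<^sub>R u + 0 *\<^sub>R v))" by auto
  have "\<exists>\<eta>>0. \<eta> < s \<and> A (x + \<xi> *\<^sub>R u + s *\<^sub>R v) - A (x + \<xi> *\<^sub>R u + 0 *\<^sub>R v) = (s - 0) * frechet_derivative A (at (x + \<xi> *\<^sub>R u + \<eta> *\<^sub>R v)) v"
    using s xi by (intro MVT2[where f="\<lambda>t. A (x + \<xi> *\<^sub>R u + t *\<^sub>R v)" and a=0 and b=s] dA) auto
  then obtain \<eta> where eta: "\<eta> > 0" "\<eta> < s" "A (x + \<xi> *\<^sub>R u + s *\<^sub>R v) - A (x + \<xi> *\<^sub>R u + 0 *\<^sub>R v) = s * frechet_derivative A (at (x + \<xi> *\<^sub>R u + \<eta> *\<^sub>R v)) v"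
    by auto
  show ?thesis
  proof (rule that[of "x + \<xi> *\<^sub>R u + \<eta> *\<^sub>R v"])
    show "dist x (x + \<xi> *\<^sub>R u + \<eta> *\<^sub>R v) \<le> s * (norm u + norm v)" using xi eta by (intro bd) auto
    show "g (x + s *\<^sub>R u + s *\<^sub>R v) - g (x + s *\<^sub>R u) - g (x + s *\<^sub>R v) + g x
       = s * s * frechet_derivative (\<lambda>y. frechet_derivative g (at y) u) (at (x + \<xi> *\<^sub>R u + \<eta> *\<^sub>R v)) v"
      using xi(3) unfolding eta(3) A_def[abs_def, symmetric] by (simp add: algebra_simps)
  qed
qed

lemma second_derivative_symmetric_real:
  fixes g :: "'a::real_normed_vector \<Rightarrow> real"
  assumes U: "open U" "Cinf U g" and x: "x \<in> U"
  shows "frechet_derivative (\<lambda>y. frechet_derivative g (at y) u) (at x) v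
    = frechet_derivative (\<lambda>y. frechet_derivative g (at y) v) (at x) u"
proof -
  define H where "H u v y = frechet_derivative (\<lambda>y. frechet_derivative g (at y) u) (at y) v" for u v y
  have cont: "isCont (H u v) x" for u v
  proof -
    have "Cinf U (H u v)" unfolding H_def by (intro Cinf_derivative(2) U)
    then have "continuous_on U (H u v)" unfolding Cinf_def using Ck_on_continuous by blast
    then show ?thesis using U x by (simp add: continuous_on_eq_continuous_at)
  qed
  have "\<bar>H u v x - H v u x\<bar> \<le> \<epsilon>" if eps: "\<epsilon> > 0" for \<epsilon>
  proof -
    obtain d1 where d1: "d1 > 0" "\<And>y. dist y x < d1 \<Longrightarrow> dist (H u v y) (H u v x) < \<epsilon>/2"
      using cont[of u v, unfolded continuous_at_eps_delta, rule_format, of "\<epsilon>/2"] half_gt_zero[OF eps] by blast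
    obtain d2 where d2: "d2 > 0" "\<And>y. dist y x < d2 \<Longrightarrow> dist (H v u y) (H v u x) < \<epsilon>/2"
      using cont[of v u, unfolded continuous_at_eps_delta, rule_format, of "\<epsilon>/2"] half_gt_zero[OF eps] by blast
    obtain e where e: "e > 0" "ball x e \<subseteq> U" using U x by (meson open_contains_ball)
    define m where "m = min e (min d1 d2)"
    \<comment> \<open>The parallelogram with sides \<open>s *\<^sub>R u\<close> and
      \<open>s *\<^sub>R v\<close> has to stay within distance \<open>m\<close> of \<open>x\<close>,
      where both continuity estimates hold; the summand 1 covers \<open>u = v = 0\<close>.\<close>
    define s where "s = m / (2 * (norm u + norm v + 1))"
    have m: "m > 0" using e d1 d2 by (simp add: m_def)
    have n: "norm u + norm v + 1 > 0" by (simp add: add_nonneg_pos)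
    have s0: "s > 0" using m n by (simp add: s_def)
    have "s * (norm u + norm v) \<le> s * (norm u + norm v + 1)" using s0 by simp
    also have "\<dots> = m / 2" using n by (simp add: s_def field_simps)
    finally have sm: "s * (norm u + norm v) < m" using m by simp
    obtain p where p: "dist x p \<le> s * (norm u + norm v)"
      "g (x + s *\<^sub>R u + s *\<^sub>R v) - g (x + s *\<^sub>R u) - g (x + s *\<^sub>R v) + g x = s * s * H u v p"
      by (rule mixed_derivative_mean_value[OF U e(2) s0, of u v]) (use sm in \<open>auto simp: m_def H_def\<close>)
    obtain p' where p': "dist x p' \<le> s * (norm v + norm u)"
      "g (x + s *\<^sub>R v + s *\<^sub>R u) - g (x + s *\<^sub>R v) - g (x + s *\<^sub>R u) + g x = s * s * H v u p'"
      by (rule mixed_derivative_mean_value[OF U e(2) s0, of v u]) (use sm in \<open>auto simp: m_def H_def add.commute\<close>)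
    have "s * s * H u v p = s * s * H v u p'"
      using p(2) p'(2) by (simp add: algebra_simps)
    then have "H u v p = H v u p'" using s0 by simp
    moreover have "dist (H u v p) (H u v x) < \<epsilon>/2" "dist (H v u p') (H v u x) < \<epsilon>/2"
      using p(1) p'(1) sm by (intro d1(2) d2(2); simp add: m_def dist_commute add.commute)+
    ultimately show ?thesis unfolding dist_real_def by linarith
  qed
  then have "\<bar>H u v x - H v u x\<bar> \<le> 0" by (rule field_le_epsilon[where y=0, simplified])
  then show ?thesis by (simp add: H_def)
qed

lemma second_derivative_symmetric:
  fixes f :: "'a::real_normed_vector \<Rightarrow> 'b::euclidean_space"
  assumes V: "subspace V" "openin (top_of_set V) A" "x \<in> A" and f: "smooth_on A f" and u: "u \<in> V" "v \<in> V"
  shows "dd (\<lambda>y. dd f y u) x v = dd (\<lambda>y. dd f y v) x u"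
proof (rule euclidean_eqI)
  fix b :: 'b assume "b \<in> Basis"
  define h where "h y = f y \<bullet> b" for y
  have h: "smooth_on A h" unfolding h_def by (intro smooth_on_compose_linear[OF bounded_linear_inner_left f])
  obtain U g where U: "open U" "x \<in> U" "Cinf U g" 
    "\<And>y u. y \<in> A \<Longrightarrow> y \<in> U \<Longrightarrow> u \<in> V \<Longrightarrow> dd h y u = frechet_derivative g (at y) u"
    by (rule dd_extension[OF V(1,2) h \<open>x \<in> A\<close>]) (rule that)
  have AU: "openin (top_of_set V) (A \<inter> U)" using V U by (simp add: openin_Int_open)
  have *: "dd (\<lambda>y. dd f y u) x v \<bullet> b = frechet_derivative (\<lambda>y. frechet_derivative g (at y) u) (at x) v"
    if "u \<in> V" "v \<in> V" for u v
  proof -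
    have "dd (\<lambda>y. dd f y u) x v \<bullet> b = dd (\<lambda>y. dd f y u \<bullet> b) x v"
      by (rule dd_bounded_linear[OF V that(2) smooth_on_dd[OF V(1,2) f that(1)] bounded_linear_inner_left, symmetric])
    also have "\<dots> = dd (\<lambda>y. frechet_derivative g (at y) u) x v"
    proof (rule dd_cong[OF V(1) AU])
      fix y assume y: "y \<in> A \<inter> U"
      have "dd f y u \<bullet> b = dd h y u" unfolding h_def
        by (rule dd_bounded_linear[OF V(1,2) _ that(1) f bounded_linear_inner_left, symmetric]) (use y in auto)
      then show "dd f y u \<bullet> b = frechet_derivative g (at y) u" using U(4) y that by auto
    qed (use U V that in auto)
    also have "\<dots> = frechet_derivative (\<lambda>y. frechet_derivative g (at y) u) (at x) v"
      by (rule dd_Cinf[OF U(1) Cinf_derivative(2)[OF U(1,3)] U(2)])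
    finally show ?thesis .
  qed
  show "dd (\<lambda>y. dd f y u) x v \<bullet> b = dd (\<lambda>y. dd f y v) x u \<bullet> b"
    using *[OF u] *[OF u(2,1)] second_derivative_symmetric_real[OF U(1,3,2)] by simp
qed

text \<open>A derivative of the local expression for \<open>w\<close> is a sum of two values of
  \<open>B\<close>, each at a first and a second derivative of \<open>f\<close>. In the cyclic sum
  these cancel in pairs, by antisymmetry of \<open>B\<close> and symmetry of second derivatives.
  Nondegeneracy is asked only at the centre \<open>x\<close> of each neighbourhood.\<close>

lemma symplectic_on_locally_pullback:
  fixes w :: "'e::euclidean_space \<Rightarrow> 'e \<Rightarrow> 'e \<Rightarrow> real" and B :: "'c::euclidean_space \<Rightarrow> 'c \<Rightarrow> real"
  assumes U: "openin (top_of_set (span U)) U" and B: "bounded_bilinear B" "\<And>a. B a a = 0"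
    and bil: "\<And>x. x \<in> U \<Longrightarrow> bilinear (w x)"
    and loc: "\<And>x. x \<in> U \<Longrightarrow> \<exists>A (f :: 'e \<Rightarrow> 'c). openin (top_of_set (span U)) A \<and> x \<in> A \<and> A \<subseteq> U \<and> smooth_on A f
       \<and> (\<forall>y\<in>A. \<forall>u\<in>span U. \<forall>v\<in>span U. w y u v = B (dd f y u) (dd f y v))
       \<and> (\<forall>u\<in>span U. (\<forall>v\<in>span U. B (dd f x u) (dd f x v) = 0) \<longrightarrow> u = 0)"
  shows "symplectic_on U w"
proof -
  define V where "V = span U"
  have V: "subspace V" by (simp add: V_def)
  have anti: "B a b = - B b a" for a b
  proof -
    have "B (a + b) (a + b) = B a a + B a b + (B b a + B b b)"
      by (simp add: bounded_bilinear.add_left[OF B(1)] bounded_bilinear.add_right[OF B(1)])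
    then show ?thesis using B(2) by simp
  qed
  have sm: "smooth_on U (\<lambda>x. w x u v)" if uv: "u \<in> V" "v \<in> V" for u v
  proof (rule smooth_on_locally)
    fix x assume "x \<in> U"
    then obtain A and f :: "'e \<Rightarrow> 'c" where A: "openin (top_of_set V) A" "x \<in> A" "A \<subseteq> U" "smooth_on A f"
      "\<And>y u v. \<lbrakk>y\<in>A; u \<in> V; v \<in> V\<rbrakk> \<Longrightarrow> w y u v = B (dd f y u) (dd f y v)"
      using loc unfolding V_def by metis
    have "smooth_on A (\<lambda>y. B (dd f y u) (dd f y v))"
      by (intro smooth_on_bilinear[OF B(1)] smooth_on_dd[OF V A(1,4)] uv)
    then have "smooth_on A (\<lambda>x. w x u v)" by (rule smooth_on_cong) (use A uv in auto)
    moreover have "openin (top_of_set U) A"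
      using A(1,3) U unfolding V_def by (meson openin_subset_trans openin_imp_subset)
    ultimately show "\<exists>T. openin (top_of_set U) T \<and> x \<in> T \<and> smooth_on T (\<lambda>x. w x u v)" using A by blast
  qed
  have "two_form_on U w"
    unfolding two_form_on_def using bil sm V_def
  proof (intro conjI ballI)
    fix x u assume "x \<in> U" "u \<in> span U"
    then show "w x u u = 0" using loc[OF \<open>x \<in> U\<close>] B(2) by auto
  qed auto
  moreover have "closed_two_form_on U w"
    unfolding closed_two_form_on_def V_def[symmetric]
  proof (intro ballI)
    fix x u v t assume x: "x \<in> U" and uvt: "u \<in> V" "v \<in> V" "t \<in> V"
    then obtain A and f :: "'e \<Rightarrow> 'c" where A: "openin (top_of_set V) A" "x \<in> A" "A \<subseteq> U" "smooth_on A f"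
      "\<And>y u v. \<lbrakk>y\<in>A; u \<in> V; v \<in> V\<rbrakk> \<Longrightarrow> w y u v = B (dd f y u) (dd f y v)"
      using loc unfolding V_def by metis
    have *: "frechet_derivative (\<lambda>y. w y b c) (at x within U) a = B (dd f x b) (dd (\<lambda>y. dd f y c) x a) + B (dd (\<lambda>y. dd f y b) x a) (dd f x c)"
      if "a \<in> V" "b \<in> V" "c \<in> V" for a b c
    proof -
      have "frechet_derivative (\<lambda>y. w y b c) (at x within U) a = dd (\<lambda>y. w y b c) x a"
        using dd_frechet[OF V _ x that(1) sm[OF that(2,3)]] U V_def by simp
      also have "\<dots> = dd (\<lambda>y. B (dd f y b) (dd f y c)) x a"
        by (rule dd_cong[OF V A(1,2) that(1)]) (use A(5) that in auto)
      also have "\<dots> = B (dd f x b) (dd (\<lambda>y. dd f y c) x a) + B (dd (\<lambda>y. dd f y b) x a) (dd f x c)"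
        by (intro dd_bilinear[OF V A(1,2) that(1) _ _ B(1)] smooth_on_dd[OF V A(1,4)] that)
      finally show ?thesis .
    qed
    show "frechet_derivative (\<lambda>y. w y v t) (at x within U) u
      - frechet_derivative (\<lambda>y. w y u t) (at x within U) v
      + frechet_derivative (\<lambda>y. w y u v) (at x within U) t = 0"
      using uvt second_derivative_symmetric[OF V A(1,2,4) uvt(1,2)] second_derivative_symmetric[OF V A(1,2,4) uvt(1,3)]
        second_derivative_symmetric[OF V A(1,2,4) uvt(2,3)]
        anti[of "dd (\<lambda>y. dd f y u) x v" "dd f x t"] anti[of "dd f x u" "dd (\<lambda>y. dd f y v) x t"] 
        anti[of "dd f x v" "dd (\<lambda>y. dd f y u) x t"]
      by (simp add: *)
  qed
  moreover have "nondegenerate_on U w"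
    unfolding nondegenerate_on_def
  proof (intro ballI impI)
    fix x u assume "x \<in> U" "u \<in> span U" "\<forall>v\<in>span U. w x u v = 0"
    then show "u = 0" using loc[OF \<open>x \<in> U\<close>] by metis
  qed
  ultimately show ?thesis by (simp add: symplectic_on_def)
qed

text \<open>The sets where \<open>f1\<close> agrees with a fixed \<open>g\<close> after
  \<open>f2\<close> are countably many relatively closed sets that cover a closed piece of
  \<open>A\<close>, so one of them has interior. The closed ball is there to meet the completeness
  requirement of Baire's theorem.\<close>

lemma baire_lifts:
  fixes V :: "'m::euclidean_space set" and f1 :: "'m \<Rightarrow> 'e::real_normed_vector"
  assumes V: "subspace V" "openin (top_of_set V) A" "A \<noteq> {}" and G: "countable G" "\<And>g. g \<in> G \<Longrightarrow> continuous_on UNIV g"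
    and f: "continuous_on A f1" "continuous_on A f2" "\<And>y. y \<in> A \<Longrightarrow> \<exists>g\<in>G. f1 y = g (f2 y)"
  shows "\<exists>g\<in>G. \<exists>W. openin (top_of_set V) W \<and> W \<noteq> {} \<and> W \<subseteq> A \<and> (\<forall>y\<in>W. f1 y = g (f2 y))"
proof -
  obtain x where x: "x \<in> A" using V by auto
  then obtain e where e: "e > 0" "cball x e \<inter> V \<subseteq> A"
    using V(2) unfolding openin_contains_cball by blast
  define S where "S = cball x e \<inter> V"
  have xS: "x \<in> S" using x e V by (auto simp: S_def dest: openin_imp_subset)
  have SA: "S \<subseteq> A" using e by (simp add: S_def)
  have clS: "closed S" unfolding S_def using V by (intro closed_Int) (auto simp: closed_subspace)
  define E where "E g = {y \<in> S. f1 y = g (f2 y)}" for g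
  have clE: "closedin (top_of_set S) (E g)" if "g \<in> G" for g
  proof -
    have "continuous_on S (\<lambda>y. f1 y - g (f2 y))"
      using f(1,2) SA G(2)[OF that]
      by (intro continuous_on_diff) (auto intro: continuous_on_subset continuous_on_compose2)
    then have "closedin (top_of_set S) (S \<inter> (\<lambda>y. f1 y - g (f2 y)) -` {0})"
      by (rule continuous_closedin_preimage) simp
    moreover have "S \<inter> (\<lambda>y. f1 y - g (f2 y)) -` {0} = E g" by (auto simp: E_def)
    ultimately show ?thesis by simp
  qed
  have "\<exists>g\<in>G. \<not> S \<subseteq> closure (S - E g)"
  proof (rule ccontr)
    assume "\<not> ?thesis"
    then have "S \<subseteq> closure (\<Inter>((\<lambda>g. S - E g) ` G))"
      using G(1) clE by (intro Baire[OF clS]) (auto simp: closedin_def openin_diff)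
    then obtain y where "y \<in> \<Inter>((\<lambda>g. S - E g) ` G)" using xS by (metis closure_empty empty_iff equals0I subsetD)
    moreover have "G \<noteq> {}" using f(3)[OF x] by auto
    ultimately have "y \<in> S" "\<And>g. g \<in> G \<Longrightarrow> f1 y \<noteq> g (f2 y)" by (auto simp: E_def)
    then show False using f(3) SA by blast
  qed
  then obtain g z where g: "g \<in> G" and z: "z \<in> S" "z \<notin> closure (S - E g)" by blast
  define T where "T = - closure (S - E g)"
  have T: "open T" "z \<in> T" "T \<inter> (S - E g) = {}"
    using z(2) closure_subset[of "S - E g"] by (auto simp: T_def)
  define W where "W = T \<inter> ball x e \<inter> V"
  \<comment> \<open>The interior point \<open>z\<close> may lie on the bounding sphere of the closed
    ball. Sliding it towards the centre \<open>x\<close> shows that the open ball is met as well,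
    which makes \<open>W\<close> nonempty and open in \<open>V\<close>.\<close>
  have "z \<in> closure (ball x e \<inter> V)"
  proof -
    define y where "y n = z + (1 / real (Suc n)) *\<^sub>R (x - z)" for n
    have "y \<longlonglongrightarrow> z + 0 *\<^sub>R (x - z)"
      unfolding y_def by (intro tendsto_intros LIMSEQ_inverse_real_of_nat[unfolded inverse_eq_divide])
    moreover have "y n \<in> ball x e \<inter> V" for n
    proof -
      have "x - y n = (1 - 1 / real (Suc n)) *\<^sub>R (x - z)" by (simp add: y_def algebra_simps)
      then have "dist x (y n) = (1 - 1 / real (Suc n)) * dist x z" by (simp add: dist_norm)
      also have "\<dots> \<le> (1 - 1 / real (Suc n)) * e"
        using z by (intro mult_left_mono) (auto simp: S_def)
      also have "\<dots> < e" using e by (simp add: field_simps)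
      finally show ?thesis using z x V by (auto simp: y_def S_def intro!: subspace_add subspace_scale subspace_diff dest: openin_imp_subset)
    qed
    ultimately show ?thesis by (auto simp: closure_sequential)
  qed
  then have "T \<inter> (ball x e \<inter> V) \<noteq> {}" using T(1,2) open_Int_closure_eq_empty by blast
  then have "W \<noteq> {}" by (simp add: W_def Int_assoc)
  moreover have "openin (top_of_set V) W"
    using openin_open_Int[of "T \<inter> ball x e" V] T by (simp add: W_def Int_commute open_Int)
  moreover have "W \<subseteq> S" by (auto simp: W_def S_def)
  moreover have "f1 y = g (f2 y)" if "y \<in> W" for y
  proof -
    have "y \<in> T" "y \<in> S" using that \<open>W \<subseteq> S\<close> by (auto simp: W_def)
    then show ?thesis using T(3) by (auto simp: E_def)
  qed
  ultimately show ?thesis using g SA by blast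
qed

text \<open>Two lifts into the same model agree up to a fixed group element on a dense open set, by
  Baire's theorem, so they pull back an invariant form to the same form.\<close>

lemma lifts_same_pullback:
  fixes V :: "'m::euclidean_space set" and f1 f2 :: "'m \<Rightarrow> 'e::euclidean_space"
  assumes V: "subspace V" "openin (top_of_set V) A" "x \<in> A"
    and G: "countable G" "\<And>g. g \<in> G \<Longrightarrow> bounded_linear g" "\<And>g a b. g \<in> G \<Longrightarrow> B (g a) (g b) = B a b"
    and B: "bounded_bilinear B"
    and f: "smooth_on A f1" "smooth_on A f2" "\<And>y. y \<in> A \<Longrightarrow> \<exists>g\<in>G. f1 y = g (f2 y)"
    and uv: "u \<in> V" "v \<in> V"
  shows "B (dd f1 x u) (dd f1 x v) = (B (dd f2 x u) (dd f2 x v) :: real)"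
proof (rule ccontr)
  assume neq: "\<not> ?thesis"
  define h where "h y = B (dd f1 y u) (dd f1 y v) - B (dd f2 y u) (dd f2 y v)" for y
  have "smooth_on A h" unfolding h_def
    by (intro smooth_on_diff smooth_on_bilinear[OF B] smooth_on_dd[OF V(1,2)] f uv)
  then have ch: "continuous_on A h" by (rule smooth_on_imp_continuous_on)
  \<comment> \<open>If the two values differ at \<open>x\<close>, they differ on the relatively open
    set \<open>A'\<close>. Baire, applied inside \<open>A'\<close>, yields a point near which the
    lifts differ by one linear map preserving \<open>B\<close>, where they cannot differ.\<close>
  define A' where "A' = A \<inter> h -` (-{0})"
  have A': "openin (top_of_set V) A'"
    using continuous_openin_preimage_gen[OF ch, of "-{0}"] V(2) unfolding A'_def
    using openin_trans by blast
  have "x \<in> A'" using V neq by (simp add: A'_def h_def)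
  have "\<exists>g\<in>G. \<exists>W. openin (top_of_set V) W \<and> W \<noteq> {} \<and> W \<subseteq> A' \<and> (\<forall>y\<in>W. f1 y = g (f2 y))"
  proof (rule baire_lifts[OF V(1) A' _ G(1)])
    show "continuous_on A' f1" "continuous_on A' f2"
      using f(1,2) by (auto intro!: smooth_on_imp_continuous_on intro: smooth_on_subset simp: A'_def)
  qed (use \<open>x \<in> A'\<close> G(2) f(3) in \<open>auto simp: A'_def intro: linear_continuous_on\<close>)
  then obtain g W y where W: "g \<in> G" "openin (top_of_set V) W" "W \<subseteq> A'" "\<And>y. y \<in> W \<Longrightarrow> f1 y = g (f2 y)" "y \<in> W"
    by blast
  have "dd f1 y u = g (dd f2 y u)" if "u \<in> V" for u
  proof -
    have "dd f1 y u = dd (\<lambda>z. g (f2 z)) y u" by (rule dd_cong[OF V(1) W(2,5) that W(4)])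
    also have "\<dots> = g (dd f2 y u)"
      by (rule dd_bounded_linear[OF V(1,2) _ that f(2) G(2)[OF W(1)]]) (use W in \<open>auto simp: A'_def\<close>)
    finally show ?thesis .
  qed
  then have "h y = 0" using uv G(3)[OF W(1)] by (simp add: h_def)
  then show False using W by (auto simp: A'_def)
qed

section \<open>Quotients, group actions and universal coverings\<close>

lemma openin_quotient_top:
  "openin (quotient_top T p) W \<longleftrightarrow> W \<subseteq> p ` topspace T \<and> openin T {x \<in> topspace T. p x \<in> W}"
proof -
  have "istopology (\<lambda>W. W \<subseteq> p ` topspace T \<and> openin T {x \<in> topspace T. p x \<in> W})"
    unfolding istopology_def
  proof (intro conjI allI impI)
    fix S S' assume "S \<subseteq> p ` topspace T \<and> openin T {x \<in> topspace T. p x \<in> S}"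
      "S' \<subseteq> p ` topspace T \<and> openin T {x \<in> topspace T. p x \<in> S'}"
    moreover have "{x \<in> topspace T. p x \<in> S \<inter> S'} = {x \<in> topspace T. p x \<in> S} \<inter> {x \<in> topspace T. p x \<in> S'}" by auto
    ultimately show "S \<inter> S' \<subseteq> p ` topspace T" "openin T {x \<in> topspace T. p x \<in> S \<inter> S'}" by auto
  next
    fix K assume K: "\<forall>S\<in>K. S \<subseteq> p ` topspace T \<and> openin T {x \<in> topspace T. p x \<in> S}"
    moreover have "{x \<in> topspace T. p x \<in> \<Union>K} = \<Union>((\<lambda>S. {x \<in> topspace T. p x \<in> S}) ` K)" by auto
    ultimately show "\<Union>K \<subseteq> p ` topspace T" "openin T {x \<in> topspace T. p x \<in> \<Union>K}" by auto
  qed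
  then show ?thesis unfolding quotient_top_def by simp
qed

lemma topspace_quotient_top [simp]: "topspace (quotient_top T p) = p ` topspace T"
proof
  show "topspace (quotient_top T p) \<subseteq> p ` topspace T"
    using openin_quotient_top[of T p "topspace (quotient_top T p)"] by simp
  have "{x \<in> topspace T. p x \<in> p ` topspace T} = topspace T" by auto
  then have "openin (quotient_top T p) (p ` topspace T)" by (simp add: openin_quotient_top)
  then show "p ` topspace T \<subseteq> topspace (quotient_top T p)" by (rule openin_subset)
qed

text \<open>Since \<open>f\<close> and \<open>p\<close> have the same fibres, images and preimages
  under \<open>h\<close> are images and preimages under \<open>f\<close> of sets saturated for
  \<open>p\<close>, so \<open>h\<close> inherits openness and continuity.\<close>

lemma homeomorphic_map_quotient_top:
  assumes c: "continuous_map T T' f" and o: "open_map T T' f" and s: "f ` topspace T = topspace T'"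
    and eq: "\<And>x y. x \<in> topspace T \<Longrightarrow> y \<in> topspace T \<Longrightarrow> f x = f y \<longleftrightarrow> p x = p y"
    and h: "\<And>x. x \<in> topspace T \<Longrightarrow> h (p x) = f x"
  shows "homeomorphic_map (quotient_top T p) T' h"
proof (rule bijective_open_imp_homeomorphic_map)
  show "h ` topspace (quotient_top T p) = topspace T'"
    unfolding topspace_quotient_top image_image s[symmetric] by (rule image_cong[OF refl h])
  show "inj_on h (topspace (quotient_top T p))"
    using h eq by (auto simp: inj_on_def)
  show "open_map (quotient_top T p) T' h"
    unfolding open_map_def
  proof (intro allI impI)
    fix W assume W: "openin (quotient_top T p) W"
    then have "W \<subseteq> p ` topspace T" "openin T {x \<in> topspace T. p x \<in> W}" by (auto simp: openin_quotient_top)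
    moreover have "f ` {x \<in> topspace T. p x \<in> W} = h ` W"
    proof -
      have "h ` W = h ` p ` {x \<in> topspace T. p x \<in> W}" using \<open>W \<subseteq> p ` topspace T\<close> by (intro arg_cong[where f="image h"]) blast
      also have "\<dots> = f ` {x \<in> topspace T. p x \<in> W}" unfolding image_image by (rule image_cong[OF refl]) (use h in auto)
      finally show ?thesis ..
    qed
    ultimately show "openin T' (h ` W)" using o unfolding open_map_def by metis
  qed
  show "continuous_map (quotient_top T p) T' h"
    unfolding continuous_map_def
  proof (intro conjI allI impI)
    show "h \<in> topspace (quotient_top T p) \<rightarrow> topspace T'" using h s by auto
    fix W assume W: "openin T' W"
    have "openin T {x \<in> topspace T. f x \<in> W}" using c W by (auto simp: continuous_map_def)
    moreover have "{x \<in> topspace T. p x \<in> {y \<in> topspace (quotient_top T p). h y \<in> W}} = {x \<in> topspace T. f x \<in> W}"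
      using h unfolding topspace_quotient_top by (intro Collect_cong conj_cong refl) simp
    ultimately show "openin (quotient_top T p) {y \<in> topspace (quotient_top T p). h y \<in> W}"
      by (auto simp: openin_quotient_top)
  qed
qed

section \<open>Groups of bijections and their orbits\<close>

lemma BijGroup_subgroupI:
  assumes "\<Gamma> \<subseteq> Bij U" "\<Gamma> \<noteq> {}" "\<And>g h. g \<in> \<Gamma> \<Longrightarrow> h \<in> \<Gamma> \<Longrightarrow> compose U g h \<in> \<Gamma>"
    and "\<And>g. g \<in> \<Gamma> \<Longrightarrow> \<exists>h\<in>\<Gamma>. \<forall>x\<in>U. h (g x) = x"
  shows "subgroup \<Gamma> (BijGroup U)"
proof (rule group.subgroupI[OF group_BijGroup])
  fix g assume g: "g \<in> \<Gamma>"
  then obtain h where h: "h \<in> \<Gamma>" "\<forall>x\<in>U. h (g x) = x" using assms(4) by blast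
  have gB: "g \<in> Bij U" "h \<in> Bij U" using g h assms by auto
  have "restrict (inv_into U g) U = h"
  proof (rule extensionalityI[where A=U])
    fix x assume "x \<in> U"
    then have "inv_into U g x \<in> U" "g (inv_into U g x) = x"
      using gB(1) by (auto simp: Bij_def bij_betw_def inv_into_into f_inv_into_f)
    then show "restrict (inv_into U g) U x = h x" using h(2) \<open>x \<in> U\<close> by (metis restrict_apply')
  qed (use gB in \<open>auto simp: Bij_def\<close>)
  then show "inv\<^bsub>BijGroup U\<^esub> g \<in> \<Gamma>" using gB h by (simp add: inv_BijGroup)
qed (use assms in \<open>auto simp: BijGroup_def subset_iff\<close>)

lemma BijGroup_subgroupD:
  assumes "subgroup \<Gamma> (BijGroup U)"
  shows "g \<in> \<Gamma> \<Longrightarrow> g \<in> extensional U" "g \<in> \<Gamma> \<Longrightarrow> bij_betw g U U"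
    "g \<in> \<Gamma> \<Longrightarrow> x \<in> U \<Longrightarrow> g x \<in> U"
    "restrict (\<lambda>x. x) U \<in> \<Gamma>" "g \<in> \<Gamma> \<Longrightarrow> h \<in> \<Gamma> \<Longrightarrow> compose U g h \<in> \<Gamma>"
    "g \<in> \<Gamma> \<Longrightarrow> restrict (inv_into U g) U \<in> \<Gamma>"
proof -
  have B: "g \<in> Bij U" if "g \<in> \<Gamma>" for g
    using subgroup.mem_carrier[OF assms that] by (simp add: BijGroup_def)
  then show "g \<in> \<Gamma> \<Longrightarrow> g \<in> extensional U" "g \<in> \<Gamma> \<Longrightarrow> bij_betw g U U" for g
    by (auto simp: Bij_def)
  show "g \<in> \<Gamma> \<Longrightarrow> x \<in> U \<Longrightarrow> g x \<in> U" using B[of g] by (auto simp: Bij_def bij_betw_def)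
  show "restrict (\<lambda>x. x) U \<in> \<Gamma>" using subgroup.one_closed[OF assms] by (simp add: BijGroup_def)
  show "g \<in> \<Gamma> \<Longrightarrow> h \<in> \<Gamma> \<Longrightarrow> compose U g h \<in> \<Gamma>"
    using subgroup.m_closed[OF assms, of g h] B by (simp add: BijGroup_def)
  show "g \<in> \<Gamma> \<Longrightarrow> restrict (inv_into U g) U \<in> \<Gamma>"
    using subgroup.m_inv_closed[OF assms, of g] B by (simp add: inv_BijGroup)
qed

lemma orb_refl:
  assumes "subgroup \<Gamma> (BijGroup U)" "x \<in> U" shows "x \<in> orb \<Gamma> x"
  unfolding orb_def using assms(2) by (intro image_eqI[OF _ BijGroup_subgroupD(4)[OF assms(1)]]) simp

lemma orb_eq_iff:
  assumes G: "subgroup \<Gamma> (BijGroup U)" and xy: "x \<in> U" "y \<in> U"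
  shows "orb \<Gamma> x = orb \<Gamma> y \<longleftrightarrow> y \<in> orb \<Gamma> x"
proof
  show "orb \<Gamma> x = orb \<Gamma> y \<Longrightarrow> y \<in> orb \<Gamma> x" using orb_refl[OF G xy(2)] by simp
  have sub: "orb \<Gamma> b \<subseteq> orb \<Gamma> a" if ab: "b \<in> orb \<Gamma> a" "a \<in> U" for a b
  proof
    fix z assume "z \<in> orb \<Gamma> b"
    then obtain g h where "g \<in> \<Gamma>" "h \<in> \<Gamma>" "z = g (h a)" using ab by (auto simp: orb_def)
    then have "z = compose U g h a" "compose U g h \<in> \<Gamma>"
      using ab BijGroup_subgroupD(5)[OF G] by (auto simp: compose_def)
    then show "z \<in> orb \<Gamma> a" by (auto simp: orb_def)
  qed
  assume y: "y \<in> orb \<Gamma> x"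
  then obtain g where g: "g \<in> \<Gamma>" "y = g x" by (auto simp: orb_def)
  have "inv_into U g y = x" using BijGroup_subgroupD(2)[OF G g(1)] g(2) xy(1) by (simp add: bij_betw_inv_into_left)
  then have "x = restrict (inv_into U g) U y" using xy by simp
  then have "x \<in> orb \<Gamma> y" using BijGroup_subgroupD(6)[OF G g(1)] unfolding orb_def by blast
  then show "orb \<Gamma> x = orb \<Gamma> y" using sub y xy by blast
qed

section \<open>Diffeomorphisms\<close>

lemma diffeoI:
  assumes "smooth_on S f" "smooth_on T g" "\<And>x. x \<in> S \<Longrightarrow> f x \<in> T" "\<And>y. y \<in> T \<Longrightarrow> g y \<in> S"
    "\<And>x. x \<in> S \<Longrightarrow> g (f x) = x" "\<And>y. y \<in> T \<Longrightarrow> f (g y) = y"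
  shows "diffeo S T f"
proof -
  have b: "bij_betw f S T" by (rule bij_betw_byWitness[where f'=g]) (use assms in auto)
  have "g y = inv_into S f y" if "y \<in> T" for y
    using b assms(4,6)[OF that] by (metis bij_betw_inv_into_left)
  then have "smooth_on T (inv_into S f)" by (rule smooth_on_cong[OF assms(2)])
  then show ?thesis using b assms(1) by (simp add: diffeo_def)
qed

lemma diffeoE:
  assumes "diffeo S T f"
  obtains g where "smooth_on S f" "smooth_on T g" "\<And>x. x \<in> S \<Longrightarrow> f x \<in> T" "\<And>y. y \<in> T \<Longrightarrow> g y \<in> S"
    "\<And>x. x \<in> S \<Longrightarrow> g (f x) = x" "\<And>y. y \<in> T \<Longrightarrow> f (g y) = y"
proof (rule that[of "inv_into S f"])
  show "smooth_on S f" "smooth_on T (inv_into S f)" using assms by (auto simp: diffeo_def)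
qed (use assms in \<open>auto simp: diffeo_def bij_betw_def inv_into_into f_inv_into_f inv_into_f_f\<close>)

lemma diffeo_inv: "diffeo S T f \<Longrightarrow> diffeo T S (inv_into S f)"
  by (rule diffeoI[where g=f])
     (auto simp: diffeo_def bij_betw_def inv_into_into f_inv_into_f inv_into_f_f)

lemma diffeo_compose:
  fixes f :: "'a::euclidean_space \<Rightarrow> 'b::euclidean_space" and g :: "'b \<Rightarrow> 'c::euclidean_space"
  assumes "diffeo S T f" "diffeo T R g" shows "diffeo S R (\<lambda>x. g (f x))"
proof -
  obtain f' where f: "smooth_on S f" "smooth_on T f'" "\<And>x. x \<in> S \<Longrightarrow> f x \<in> T" "\<And>y. y \<in> T \<Longrightarrow> f' y \<in> S"
    "\<And>x. x \<in> S \<Longrightarrow> f' (f x) = x" "\<And>y. y \<in> T \<Longrightarrow> f (f' y) = y" by (rule diffeoE[OF assms(1)]) (rule that)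
  obtain g' where g: "smooth_on T g" "smooth_on R g'" "\<And>x. x \<in> T \<Longrightarrow> g x \<in> R" "\<And>y. y \<in> R \<Longrightarrow> g' y \<in> T"
    "\<And>x. x \<in> T \<Longrightarrow> g' (g x) = x" "\<And>y. y \<in> R \<Longrightarrow> g (g' y) = y" by (rule diffeoE[OF assms(2)]) (rule that)
  show ?thesis
    by (rule diffeoI[where g="\<lambda>x. f' (g' x)"])
       (use f g in \<open>auto intro!: smooth_on_compose[OF f(1) g(1)] smooth_on_compose[OF g(2) f(2)]\<close>)
qed

lemma diffeo_homeomorphism: "diffeo S T f \<Longrightarrow> homeomorphism S T f (inv_into S f)"
  unfolding homeomorphism_def
  by (auto simp: diffeo_def bij_betw_def inv_into_into f_inv_into_f inv_into_f_f smooth_on_imp_continuous_on)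

lemma diffeo_subset:
  assumes "diffeo S T f" "S' \<subseteq> S" shows "diffeo S' (f ` S') f"
proof -
  obtain g where g: "smooth_on S f" "smooth_on T g" "\<And>x. x \<in> S \<Longrightarrow> f x \<in> T" "\<And>y. y \<in> T \<Longrightarrow> g y \<in> S"
    "\<And>x. x \<in> S \<Longrightarrow> g (f x) = x" "\<And>y. y \<in> T \<Longrightarrow> f (g y) = y" by (rule diffeoE[OF assms(1)]) (rule that)
  show ?thesis
    by (rule diffeoI[where g=g]) (use g assms(2) in \<open>auto intro: smooth_on_subset simp: subset_iff\<close>)
qed

section \<open>Universal coverings: smooth lifts and transport along diffeomorphisms\<close>

lemma universal_covering_local_inverse:
  fixes C :: "'c::euclidean_space set" and U :: "'e::euclidean_space set"
  assumes uc: "universal_covering C q U" and x: "x \<in> C" and N: "openin (top_of_set C) N" "x \<in> N"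
  obtains W s where "openin (top_of_set C) W" "x \<in> W" "W \<subseteq> N" "openin (top_of_set U) (q ` W)"
    "smooth_on W q" "smooth_on (q ` W) s" "\<And>y. y \<in> W \<Longrightarrow> s (q y) = y"
proof -
  obtain W0 where W0: "x \<in> W0" "openin (top_of_set C) W0" "diffeo W0 (q ` W0) q"
    using uc x unfolding universal_covering_def by meson
  define W where "W = W0 \<inter> N"
  have W: "openin (top_of_set C) W" using W0 N by (simp add: W_def openin_Int)
  have "diffeo W (q ` W) q" using diffeo_subset[OF W0(3), of W] by (simp add: W_def)
  then obtain s where "smooth_on W q" "smooth_on (q ` W) s" "\<And>y. y \<in> W \<Longrightarrow> s (q y) = y"
    by (rule diffeoE) (rule that)
  moreover have "openin (top_of_set U) (q ` W)"
    using covering_space_open_map[OF _ W] uc unfolding universal_covering_def by blast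
  ultimately show ?thesis using that[of W s] W W0(1) N(2) by (auto simp: W_def)
qed

lemma universal_coveringD:
  assumes "universal_covering C q U"
  shows "covering_space C q U" "simply_connected C" "continuous_on C q" "q ` C = U" "\<And>x. x \<in> C \<Longrightarrow> q x \<in> U"
  using assms covering_space_imp_continuous covering_space_imp_surjective unfolding universal_covering_def by blast+

lemma universal_covering_smooth:
  fixes C :: "'c::euclidean_space set" and U :: "'e::euclidean_space set"
  assumes uc: "universal_covering C q U" shows "smooth_on C q"
proof (rule smooth_on_locally)
  fix x assume x: "x \<in> C"
  obtain W s where "openin (top_of_set C) W" "x \<in> W" "W \<subseteq> C" "openin (top_of_set U) (q ` W)"
    "smooth_on W q" "smooth_on (q ` W) s" "\<And>y. y \<in> W \<Longrightarrow> s (q y) = y"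
    by (rule universal_covering_local_inverse[OF uc x, of C]) (use x in auto)
  then show "\<exists>T. openin (top_of_set C) T \<and> x \<in> T \<and> smooth_on T q" by blast
qed

text \<open>Locally the lift is a smooth local inverse of the covering applied to the given smooth
  map, so continuity of \<open>F\<close> is enough to make it smooth.\<close>

lemma smooth_lift:
  fixes C :: "'c::euclidean_space set" and U :: "'e::euclidean_space set" and F :: "'s::euclidean_space \<Rightarrow> 'c"
  assumes uc: "universal_covering C q U" and F: "continuous_on S F" "\<And>x. x \<in> S \<Longrightarrow> F x \<in> C"
    and f: "smooth_on S f" "\<And>x. x \<in> S \<Longrightarrow> q (F x) = f x"
  shows "smooth_on S F"
proof (rule smooth_on_locally)
  fix x assume x: "x \<in> S"
  obtain W s where W: "openin (top_of_set C) W" "F x \<in> W" "W \<subseteq> C" "openin (top_of_set U) (q ` W)"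
    "smooth_on W q" "smooth_on (q ` W) s" "\<And>y. y \<in> W \<Longrightarrow> s (q y) = y"
    by (rule universal_covering_local_inverse[OF uc F(2)[OF x], of C]) (use x F in auto)
  define T where "T = S \<inter> F -` W"
  have T: "openin (top_of_set S) T"
    unfolding T_def by (rule continuous_openin_preimage[OF F(1) _ W(1)]) (use F(2) in auto)
  have "smooth_on T (\<lambda>y. s (f y))"
    by (rule smooth_on_compose[OF _ W(6)]) (use f in \<open>auto simp: T_def intro: smooth_on_subset simp flip: f(2)\<close>)
  then have "smooth_on T F"
    by (rule smooth_on_cong) (use W(7) f(2) in \<open>auto simp: T_def simp flip: f(2)\<close>)
  then show "\<exists>T. openin (top_of_set S) T \<and> x \<in> T \<and> smooth_on T F"
    using T x W(2) by (auto simp: T_def)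
qed

text \<open>Lift \<open>g\<close> and its inverse with matching base points. Each of the two
  composites lifts an identity map and fixes a base point, so it is the identity by uniqueness of
  lifts.\<close>

lemma universal_covering_lift_diffeo:
  fixes C :: "'c::euclidean_space set" and U :: "'e::euclidean_space set"
    and C' :: "'d::euclidean_space set" and U' :: "'f::euclidean_space set"
  assumes uc: "universal_covering C q U" "universal_covering C' q' U'"
    and lc: "locally path_connected C" "locally path_connected C'"
    and g: "diffeo U U' g" and xy: "x0 \<in> C" "y0 \<in> C'" "g (q x0) = q' y0"
  obtains F where "diffeo C C' F" "F x0 = y0" "\<And>x. x \<in> C \<Longrightarrow> q' (F x) = g (q x)"
proof -
  obtain g' where g': "smooth_on U g" "smooth_on U' g'" "\<And>x. x \<in> U \<Longrightarrow> g x \<in> U'" "\<And>y. y \<in> U' \<Longrightarrow> g' y \<in> U"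
    "\<And>x. x \<in> U \<Longrightarrow> g' (g x) = x" "\<And>y. y \<in> U' \<Longrightarrow> g (g' y) = y" by (rule diffeoE[OF g]) (rule that)
  note uc1 = universal_coveringD[OF uc(1)] and uc2 = universal_coveringD[OF uc(2)]
  have s1: "smooth_on C (\<lambda>x. g (q x))"
    by (rule smooth_on_compose[OF universal_covering_smooth[OF uc(1)] g'(1)]) (use uc1 in auto)
  have s2: "smooth_on C' (\<lambda>x. g' (q' x))"
    by (rule smooth_on_compose[OF universal_covering_smooth[OF uc(2)] g'(2)]) (use uc2 in auto)
  obtain F where F: "continuous_on C F" "F \<in> C \<rightarrow> C'" "F x0 = y0" "\<And>y. y \<in> C \<Longrightarrow> q' (F y) = g (q y)"
    by (rule covering_space_lift_strong[OF uc2(1) xy(2,1) uc1(2) lc(1) smooth_on_imp_continuous_on[OF s1]])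
       (use g' uc1 xy in auto)
  obtain G where G: "continuous_on C' G" "G \<in> C' \<rightarrow> C" "G y0 = x0" "\<And>y. y \<in> C' \<Longrightarrow> q (G y) = g' (q' y)"
    by (rule covering_space_lift_strong[OF uc1(1) xy(1,2) uc2(2) lc(2) smooth_on_imp_continuous_on[OF s2]])
       (use g' uc2 uc1 xy(1) xy(3)[symmetric] in auto)
  have GF: "G (F x) = x" if "x \<in> C" for x
  proof (rule covering_space_lift_unique[OF uc1(1), of "\<lambda>x. G (F x)" x0 "\<lambda>x. x" C q])
    show "continuous_on C (\<lambda>x. G (F x))"
      using continuous_on_compose2[OF G(1) F(1)] F(2) by auto
    show "connected C" using uc1(2) by (rule simply_connected_imp_connected)
  qed (use F G uc1 xy that g' in \<open>auto simp: Pi_iff\<close>)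
  have FG: "F (G x) = x" if "x \<in> C'" for x
  proof (rule covering_space_lift_unique[OF uc2(1), of "\<lambda>x. F (G x)" y0 "\<lambda>x. x" C' q'])
    show "continuous_on C' (\<lambda>x. F (G x))"
      using continuous_on_compose2[OF F(1) G(1)] G(2) by auto
    show "connected C'" using uc2(2) by (rule simply_connected_imp_connected)
  qed (use F G uc2 xy that g' in \<open>auto simp: Pi_iff\<close>)
  have "smooth_on C F" by (rule smooth_lift[OF uc(2) F(1) _ s1 F(4)]) (use F in auto)
  moreover have "smooth_on C' G" by (rule smooth_lift[OF uc(1) G(1) _ s2 G(4)]) (use G in auto)
  ultimately have "diffeo C C' F"
    by (rule diffeoI) (use F(2) G(2) FG GF in auto)
  then show ?thesis using F by (intro that)
qed

text \<open>Used to move a covering into the product space in which \<open>model_diffeo\<close>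
  looks for its coverings.\<close>

lemma universal_covering_precompose:
  fixes C :: "'c::euclidean_space set" and U :: "'e::euclidean_space set" and C2 :: "'d::euclidean_space set"
  assumes uc: "universal_covering C q U" and f: "diffeo C2 C f"
  shows "universal_covering C2 (\<lambda>x. q (f x)) U"
proof -
  obtain f' where f': "smooth_on C2 f" "smooth_on C f'" "\<And>x. x \<in> C2 \<Longrightarrow> f x \<in> C" "\<And>y. y \<in> C \<Longrightarrow> f' y \<in> C2"
    "\<And>x. x \<in> C2 \<Longrightarrow> f' (f x) = x" "\<And>y. y \<in> C \<Longrightarrow> f (f' y) = y" by (rule diffeoE[OF f]) (rule that)
  note D = universal_coveringD[OF uc]
  have hom: "homeomorphism C2 C f f'"
    by (rule homeomorphismI) (use f' in \<open>auto simp: smooth_on_imp_continuous_on\<close>)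
  then have opn: "openin (top_of_set C2) (C2 \<inter> f -` W)" if "openin (top_of_set C) W" for W
    by (intro continuous_openin_preimage[OF _ _ that]) (auto simp: homeomorphism_def)
  have "covering_space C2 (\<lambda>x. q (f x)) U"
  proof
    show "continuous_on C2 (\<lambda>x. q (f x))"
      by (rule continuous_on_compose2[OF D(3)]) (use f' in \<open>auto simp: smooth_on_imp_continuous_on\<close>)
    have "f ` C2 = C" using hom by (simp add: homeomorphism_def)
    then show "(\<lambda>x. q (f x)) ` C2 = U" using D(4) by (metis image_image)
    fix x assume "x \<in> U"
    then obtain T v where T: "x \<in> T" "openin (top_of_set U) T" "\<Union>v = C \<inter> q -` T"
      "\<And>u. u \<in> v \<Longrightarrow> openin (top_of_set C) u" "pairwise disjnt v" "\<And>u. u \<in> v \<Longrightarrow> \<exists>h. homeomorphism u T q h"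
      using D(1) unfolding covering_space_def by meson
    define v' where "v' = (\<lambda>u. C2 \<inter> f -` u) ` v"
    have "\<Union>v' = C2 \<inter> (\<lambda>x. q (f x)) -` T"
      using T(3) f'(3) unfolding v'_def by (auto simp: set_eq_iff)
    moreover have "\<forall>u\<in>v'. openin (top_of_set C2) u" using opn T(4) by (auto simp: v'_def)
    moreover have "pairwise disjnt v'"
    proof (rule pairwiseI)
      fix a b assume "a \<in> v'" "b \<in> v'" "a \<noteq> b"
      then obtain a' b' where "a' \<in> v" "b' \<in> v" "a = C2 \<inter> f -` a'" "b = C2 \<inter> f -` b'" "a' \<noteq> b'"
        unfolding v'_def by blast
      then show "disjnt a b" using pairwiseD[OF T(5), of a' b'] unfolding disjnt_def by blast
    qed
    moreover have "\<exists>h. homeomorphism u' T (\<lambda>x. q (f x)) h" if u': "u' \<in> v'" for u'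
    proof -
      obtain u where u: "u \<in> v" "u' = C2 \<inter> f -` u" using u' by (auto simp: v'_def)
      obtain h where h: "homeomorphism u T q h" using T(6)[OF u(1)] by blast
      have uC: "u \<subseteq> C" using T(4)[OF u(1)] by (rule openin_imp_subset)
      have "f ` u' = u"
      proof
        show "u \<subseteq> f ` u'"
        proof
          fix y assume "y \<in> u"
          then have "f' y \<in> u'" "y = f (f' y)" using uC f'(4,6) unfolding u(2) by auto
          then show "y \<in> f ` u'" by (rule rev_image_eqI)
        qed
      qed (auto simp: u(2))
      then have "homeomorphism u' u f f'"
        by (intro homeomorphism_of_subsets[OF hom]) (use u uC f' in \<open>auto simp: image_iff\<close>)
      from homeomorphism_compose[OF this h] show ?thesis by (auto simp: o_def)
    qed
    ultimately show "\<exists>T. x \<in> T \<and> openin (top_of_set U) T \<and> (\<exists>v. \<Union> v = C2 \<inter> (\<lambda>x. q (f x)) -` T \<and>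
       (\<forall>u\<in>v. openin (top_of_set C2) u) \<and> pairwise disjnt v \<and> (\<forall>u\<in>v. \<exists>q'. homeomorphism u T (\<lambda>x. q (f x)) q'))"
      using T(1,2) by (intro exI[of _ T] conjI exI[of _ v']) auto
  qed
  moreover have "simply_connected C2"
    using hom D(2) homeomorphic_simply_connected_eq homeomorphic_def by blast
  moreover have "\<exists>W. x \<in> W \<and> openin (top_of_set C2) W \<and> openin (top_of_set U) ((\<lambda>x. q (f x)) ` W) \<and>
      diffeo W ((\<lambda>x. q (f x)) ` W) (\<lambda>x. q (f x))" if x: "x \<in> C2" for x
  proof -
    obtain W where W: "f x \<in> W" "openin (top_of_set C) W" "openin (top_of_set U) (q ` W)" "diffeo W (q ` W) q"
      using uc f'(3)[OF x] unfolding universal_covering_def by meson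
    define W' where "W' = C2 \<inter> f -` W"
    have "W \<subseteq> C" using W(2) by (rule openin_imp_subset)
    have fW: "f ` W' = W"
    proof
      show "W \<subseteq> f ` W'"
      proof
        fix y assume "y \<in> W"
        then have "f' y \<in> W'" "y = f (f' y)" using \<open>W \<subseteq> C\<close> f'(4,6) unfolding W'_def by auto
        then show "y \<in> f ` W'" by (rule rev_image_eqI)
      qed
    qed (auto simp: W'_def)
    then have qW: "(\<lambda>x. q (f x)) ` W' = q ` W" by (metis image_image)
    have "diffeo W' W f" using diffeo_subset[OF f, of W'] fW by (simp add: W'_def)
    from diffeo_compose[OF this W(4)] show ?thesis
      using W x opn[OF W(2)] qW by (intro exI[of _ W']) (auto simp: W'_def)
  qed
  ultimately show ?thesis unfolding universal_covering_def by blast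
qed

text \<open>Used to carry the explicit covering of a base domain over to an overlap inside the
  domain of an actual chart.\<close>

lemma universal_covering_postcompose:
  fixes C :: "'c::euclidean_space set" and U :: "'e::euclidean_space set" and U2 :: "'d::euclidean_space set"
  assumes uc: "universal_covering C q U" and f: "diffeo U U2 f"
  shows "universal_covering C (\<lambda>x. f (q x)) U2"
proof -
  obtain f' where f': "smooth_on U f" "smooth_on U2 f'" "\<And>x. x \<in> U \<Longrightarrow> f x \<in> U2" "\<And>y. y \<in> U2 \<Longrightarrow> f' y \<in> U"
    "\<And>x. x \<in> U \<Longrightarrow> f' (f x) = x" "\<And>y. y \<in> U2 \<Longrightarrow> f (f' y) = y" by (rule diffeoE[OF f]) (rule that)
  note D = universal_coveringD[OF uc]
  have hom: "homeomorphism U U2 f f'"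
    by (rule homeomorphismI) (use f' in \<open>auto simp: smooth_on_imp_continuous_on\<close>)
  have opn: "openin (top_of_set U2) (f ` W)" if "openin (top_of_set U) W" for W
    using homeomorphism_imp_open_map[OF hom that] .
  have "covering_space C (\<lambda>x. f (q x)) U2"
  proof
    show "continuous_on C (\<lambda>x. f (q x))"
      by (rule continuous_on_compose2[OF smooth_on_imp_continuous_on[OF f'(1)] D(3)]) (use D in auto)
    have "f ` U = U2" using hom by (simp add: homeomorphism_def)
    then show "(\<lambda>x. f (q x)) ` C = U2" using D(4) by (metis image_image)
    fix x assume x: "x \<in> U2"
    then have "f' x \<in> U" using f' by auto
    then obtain T v where T: "f' x \<in> T" "openin (top_of_set U) T" "\<Union>v = C \<inter> q -` T"
      "\<And>u. u \<in> v \<Longrightarrow> openin (top_of_set C) u" "pairwise disjnt v" "\<And>u. u \<in> v \<Longrightarrow> \<exists>h. homeomorphism u T q h"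
      using D(1) unfolding covering_space_def by meson
    have TU: "T \<subseteq> U" using T(2) by (rule openin_imp_subset)
    have "C \<inter> (\<lambda>x. f (q x)) -` (f ` T) = C \<inter> q -` T"
      using TU D(5) f'(5) by (auto simp: image_iff) (metis subsetD)
    moreover have "\<exists>h. homeomorphism u (f ` T) (\<lambda>x. f (q x)) h" if u: "u \<in> v" for u
    proof -
      obtain h where h: "homeomorphism u T q h" using T(6)[OF u] by blast
      have "homeomorphism T (f ` T) f f'"
        by (intro homeomorphism_of_subsets[OF hom]) (use TU f' in \<open>auto simp: image_iff subset_iff\<close>)
      from homeomorphism_compose[OF h this] show ?thesis by (auto simp: o_def)
    qed
    moreover have "x \<in> f ` T" using T(1) f'(6)[OF x] by (metis imageI)
    ultimately show "\<exists>T. x \<in> T \<and> openin (top_of_set U2) T \<and> (\<exists>v. \<Union> v = C \<inter> (\<lambda>x. f (q x)) -` T \<and>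
       (\<forall>u\<in>v. openin (top_of_set C) u) \<and> pairwise disjnt v \<and> (\<forall>u\<in>v. \<exists>q'. homeomorphism u T (\<lambda>x. f (q x)) q'))"
      using T(3-5) opn[OF T(2)] by (intro exI[of _ "f ` T"] conjI exI[of _ v]) auto
  qed
  moreover have "\<exists>W. x \<in> W \<and> openin (top_of_set C) W \<and> openin (top_of_set U2) ((\<lambda>x. f (q x)) ` W) \<and>
      diffeo W ((\<lambda>x. f (q x)) ` W) (\<lambda>x. f (q x))" if x: "x \<in> C" for x
  proof -
    obtain W where W: "x \<in> W" "openin (top_of_set C) W" "openin (top_of_set U) (q ` W)" "diffeo W (q ` W) q"
      using uc x unfolding universal_covering_def by meson
    have qW: "(\<lambda>x. f (q x)) ` W = f ` q ` W" by (metis image_image)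
    have "q ` W \<subseteq> U" using W(3) by (rule openin_imp_subset)
    from diffeo_compose[OF W(4) diffeo_subset[OF f this]] show ?thesis
      using W opn[OF W(3)] qW by (intro exI[of _ W]) auto
  qed
  ultimately show ?thesis using D(2) unfolding universal_covering_def by blast
qed

lemma universal_covering_id:
  assumes "simply_connected U" shows "universal_covering U (\<lambda>x. x) U"
  unfolding universal_covering_def
proof (intro conjI ballI)
  show "covering_space U (\<lambda>x. x) U"
    using homeomorphism_imp_covering_space[of U U "\<lambda>x. x" "\<lambda>x. x"] by (auto simp: homeomorphism_def)
  fix x assume "x \<in> U"
  moreover have "diffeo U U (\<lambda>x. x)" by (rule diffeoI[where g="\<lambda>x. x"]) auto
  ultimately show "\<exists>W. x \<in> W \<and> openin (top_of_set U) W \<and> openin (top_of_set U) ((\<lambda>x. x) ` W) \<and> diffeo W ((\<lambda>x. x) ` W) (\<lambda>x. x)"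
    by (intro exI[of _ U]) auto
qed (rule assms)

section \<open>Models of quasifolds and overlaps of charts\<close>

lemma locally_path_connected_relopen:
  fixes V A :: "'a::euclidean_space set"
  assumes "subspace V" "openin (top_of_set V) A"
  shows "locally path_connected A"
  using assms convex_imp_locally_path_connected locally_open_subset subspace_imp_convex by blast

lemma diffeo_cong:
  assumes "diffeo S T f" "\<And>x. x \<in> S \<Longrightarrow> f x = g x" shows "diffeo S T g"
proof -
  obtain f' where f': "smooth_on S f" "smooth_on T f'" "\<And>x. x \<in> S \<Longrightarrow> f x \<in> T" "\<And>y. y \<in> T \<Longrightarrow> f' y \<in> S"
    "\<And>x. x \<in> S \<Longrightarrow> f' (f x) = x" "\<And>y. y \<in> T \<Longrightarrow> f (f' y) = y" by (rule diffeoE[OF assms(1)]) (rule that)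
  show ?thesis
  proof (rule diffeoI[OF smooth_on_cong[OF f'(1) assms(2)] f'(2)])
    show "g x \<in> T" "f' (g x) = x" if "x \<in> S" for x using f'(3,5)[OF that] assms(2)[OF that] by auto
    show "f' y \<in> S" "g (f' y) = y" if "y \<in> T" for y using f'(4,6)[OF that] assms(2)[OF f'(4)[OF that]] by auto
  qed
qed

lemma span_relopen:
  fixes S V :: "'a::euclidean_space set"
  assumes "subspace S" "openin (top_of_set S) V" "V \<noteq> {}" shows "span V = S"
proof (rule subspace_dim_equal)
  show "span V \<subseteq> S" using assms span_minimal openin_imp_subset by blast
  show "dim (span V) \<ge> dim S" using dim_openin[OF assms(2,1,3)] by simp
qed (use assms in auto)

lemma orb_restrict_group: "x \<in> V \<Longrightarrow> orb (restrict_group \<Gamma> V) x = orb \<Gamma> x"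
  unfolding orb_def restrict_group_def image_image by (rule image_cong[OF refl]) simp

lemma subgroup_restrict_group:
  assumes G: "subgroup \<Gamma> (BijGroup U)" and V: "V \<subseteq> U" "\<And>x g. x \<in> V \<Longrightarrow> g \<in> \<Gamma> \<Longrightarrow> g x \<in> V"
  shows "subgroup (restrict_group \<Gamma> V) (BijGroup V)"
proof (rule BijGroup_subgroupI)
  have inv: "\<exists>h\<in>\<Gamma>. \<forall>x\<in>U. h (g x) = x \<and> g (h x) = x" if "g \<in> \<Gamma>" for g
    using BijGroup_subgroupD(2,3,6)[OF G that]
    by (intro bexI[of _ "restrict (inv_into U g) U"])
       (auto simp: bij_betw_def inv_into_f_f f_inv_into_f)
  show "restrict_group \<Gamma> V \<subseteq> Bij V"
  proof
    fix g' assume "g' \<in> restrict_group \<Gamma> V"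
    then obtain g where g: "g \<in> \<Gamma>" "g' = restrict g V" by (auto simp: restrict_group_def)
    obtain h where h: "h \<in> \<Gamma>" "\<forall>x\<in>U. h (g x) = x \<and> g (h x) = x" using inv[OF g(1)] by blast
    have "bij_betw g' V V"
      by (rule bij_betw_byWitness[where f'=h]) (use h g V in \<open>auto simp: subset_iff\<close>)
    then show "g' \<in> Bij V" by (simp add: Bij_def g(2))
  qed
  show "restrict_group \<Gamma> V \<noteq> {}" using BijGroup_subgroupD(4)[OF G] by (auto simp: restrict_group_def)
  fix g' assume "g' \<in> restrict_group \<Gamma> V"
  then obtain g where g: "g \<in> \<Gamma>" "g' = restrict g V" by (auto simp: restrict_group_def)
  obtain h where h: "h \<in> \<Gamma>" "\<forall>x\<in>U. h (g x) = x \<and> g (h x) = x" using inv[OF g(1)] by blast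
  have "restrict h V \<in> restrict_group \<Gamma> V" using h by (simp add: restrict_group_def)
  moreover have "\<forall>x\<in>V. restrict h V (g' x) = x" using g h V by (auto simp: subset_iff)
  ultimately show "\<exists>h\<in>restrict_group \<Gamma> V. \<forall>x\<in>V. h (g' x) = x" by blast
  fix h' assume "h' \<in> restrict_group \<Gamma> V"
  then obtain h where h: "h \<in> \<Gamma>" "h' = restrict h V" by (auto simp: restrict_group_def)
  have "compose V g' h' = restrict (compose U g h) V"
    by (rule ext) (use g h V in \<open>auto simp: compose_def restrict_def subset_iff\<close>)
  then show "compose V g' h' \<in> restrict_group \<Gamma> V"
    using BijGroup_subgroupD(5)[OF G g(1) h(1)] by (simp add: restrict_group_def)
qed

lemma restrict_group_id:
  assumes G: "subgroup \<Gamma> (BijGroup U)" shows "restrict_group \<Gamma> U = \<Gamma>"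
proof -
  have "restrict g U = g" if "g \<in> \<Gamma>" for g
    using BijGroup_subgroupD(1)[OF G that] by (rule extensional_restrict)
  then show ?thesis by (simp add: restrict_group_def)
qed

text \<open>\<open>U\<close> is a base domain, possibly not simply connected, and \<open>D\<close> a
  chart domain that replaces it.\<close>

locale covered_model =
  fixes k :: nat and D U :: "'e::euclidean_space set" and q :: "'e \<Rightarrow> 'e" and \<Gamma>
  assumes D: "open_in_Rk k D" and uc: "universal_covering D q U"
    and G: "subgroup \<Gamma> (BijGroup U)" and smG: "\<And>g. g \<in> \<Gamma> \<Longrightarrow> smooth_on U g"
begin

abbreviation "\<Lambda> \<equiv> covering_group D q \<Gamma>"

lemma lpc: "locally path_connected D"
  using D locally_path_connected_relopen[OF subspace_span] unfolding open_in_Rk_def by blast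

lemma diffeo_G: "g \<in> \<Gamma> \<Longrightarrow> diffeo U U g"
proof -
  assume g: "g \<in> \<Gamma>"
  have b: "bij_betw g U U" using BijGroup_subgroupD(2)[OF G g] .
  show "diffeo U U g"
    by (rule diffeoI[where g="restrict (inv_into U g) U"])
       (use b smG[OF g] smG[OF BijGroup_subgroupD(6)[OF G g]] in
         \<open>auto simp: bij_betw_def inv_into_f_f f_inv_into_f inv_into_into\<close>)
qed

lemma LambdaE:
  assumes "h \<in> \<Lambda>"
  obtains g where "h \<in> extensional D" "diffeo D D h" "g \<in> \<Gamma>" "\<And>x. x \<in> D \<Longrightarrow> q (h x) = g (q x)"
    "\<And>x. x \<in> D \<Longrightarrow> h x \<in> D"
  using assms that unfolding covering_group_def diffeo_def bij_betw_def by blast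

lemma LambdaI:
  "h \<in> extensional D \<Longrightarrow> diffeo D D h \<Longrightarrow> g \<in> \<Gamma> \<Longrightarrow> (\<And>x. x \<in> D \<Longrightarrow> q (h x) = g (q x)) \<Longrightarrow> h \<in> \<Lambda>"
  unfolding covering_group_def by blast

lemma Lambda_subgroup: "subgroup \<Lambda> (BijGroup D)"
proof (rule BijGroup_subgroupI)
  note uD = universal_coveringD[OF uc]
  show "\<Lambda> \<subseteq> Bij D" by (auto simp: covering_group_def Bij_def diffeo_def)
  have "restrict (\<lambda>x. x) D \<in> \<Lambda>"
  proof (rule LambdaI[OF _ _ BijGroup_subgroupD(4)[OF G]])
    show "diffeo D D (restrict (\<lambda>x. x) D)"
      by (rule diffeo_cong[of D D "\<lambda>x. x"]) (auto intro: diffeoI[where g="\<lambda>x. x"])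
  qed (use uD in auto)
  then show "\<Lambda> \<noteq> {}" by blast
  fix h1 assume "h1 \<in> \<Lambda>"
  then obtain g1 where h1: "h1 \<in> extensional D" "diffeo D D h1" "g1 \<in> \<Gamma>" "\<And>x. x \<in> D \<Longrightarrow> q (h1 x) = g1 (q x)"
    "\<And>x. x \<in> D \<Longrightarrow> h1 x \<in> D" by (rule LambdaE) (rule that)
  show "\<exists>h\<in>\<Lambda>. \<forall>x\<in>D. h (h1 x) = x"
  proof (intro bexI ballI)
    fix x assume "x \<in> D"
    show "restrict (inv_into D h1) D (h1 x) = x" using h1(2,5) \<open>x \<in> D\<close>
      by (simp add: diffeo_def) (metis bij_betw_inv_into_left)
  next
    show "restrict (inv_into D h1) D \<in> \<Lambda>"
    proof (rule LambdaI[OF _ _ BijGroup_subgroupD(6)[OF G h1(3)]])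
      show "diffeo D D (restrict (inv_into D h1) D)" by (rule diffeo_cong[OF diffeo_inv[OF h1(2)]]) simp
      fix x assume x: "x \<in> D"
      define y where "y = inv_into D h1 x"
      have y: "y \<in> D" "h1 y = x" using x h1(2)
        unfolding y_def diffeo_def bij_betw_def by (auto simp: inv_into_into f_inv_into_f)
      have "g1 (q y) = q x" using h1(4)[OF y(1)] y(2) by simp
      moreover have "q y \<in> U" "q x \<in> U" using uD(5) x y by auto
      ultimately have "inv_into U g1 (q x) = q y"
        using BijGroup_subgroupD(2)[OF G h1(3)] by (metis bij_betw_inv_into_left)
      then show "q (restrict (inv_into D h1) D x) = restrict (inv_into U g1) U (q x)"
        using x \<open>q x \<in> U\<close> by (simp add: y_def)
    qed simp
  qed
  fix h2 assume "h2 \<in> \<Lambda>"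
  then obtain g2 where h2: "h2 \<in> extensional D" "diffeo D D h2" "g2 \<in> \<Gamma>" "\<And>x. x \<in> D \<Longrightarrow> q (h2 x) = g2 (q x)"
    "\<And>x. x \<in> D \<Longrightarrow> h2 x \<in> D" by (rule LambdaE) (rule that)
  show "compose D h1 h2 \<in> \<Lambda>"
  proof (rule LambdaI[OF _ _ BijGroup_subgroupD(5)[OF G h1(3) h2(3)]])
    show "diffeo D D (compose D h1 h2)"
      by (rule diffeo_cong[OF diffeo_compose[OF h2(2) h1(2)]]) (simp add: compose_def)
  qed (use h1 h2 uD in \<open>auto simp: compose_def\<close>)
qed

text \<open>This is why \<open>D\<close> modulo \<open>\<Lambda>\<close> is the same space as
  \<open>U\<close> modulo \<open>\<Gamma>\<close>: every \<open>g\<close> lifts to a diffeomorphism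
  of the simply connected \<open>D\<close>, with any prescribed admissible value at
  \<open>x\<close>.\<close>

lemma orb_Lambda:
  assumes x: "x \<in> D" shows "orb \<Lambda> x = {y \<in> D. q y \<in> orb \<Gamma> (q x)}"
proof
  show "orb \<Lambda> x \<subseteq> {y \<in> D. q y \<in> orb \<Gamma> (q x)}"
  proof
    fix y assume "y \<in> orb \<Lambda> x"
    then obtain h where h: "h \<in> \<Lambda>" "y = h x" by (auto simp: orb_def)
    obtain g where "g \<in> \<Gamma>" "\<And>x. x \<in> D \<Longrightarrow> q (h x) = g (q x)" "\<And>x. x \<in> D \<Longrightarrow> h x \<in> D"
      by (rule LambdaE[OF h(1)]) (rule that)
    then show "y \<in> {y \<in> D. q y \<in> orb \<Gamma> (q x)}" using h x by (auto simp: orb_def)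
  qed
  show "{y \<in> D. q y \<in> orb \<Gamma> (q x)} \<subseteq> orb \<Lambda> x"
  proof clarify
    fix y assume y: "y \<in> D" "q y \<in> orb \<Gamma> (q x)"
    then obtain g where g: "g \<in> \<Gamma>" "q y = g (q x)" by (auto simp: orb_def)
    obtain F where F: "diffeo D D F" "F x = y" "\<And>x. x \<in> D \<Longrightarrow> q (F x) = g (q x)"
      by (rule universal_covering_lift_diffeo[OF uc uc lpc lpc diffeo_G[OF g(1)] x y(1) g(2)[symmetric]]) (rule that)
    have "restrict F D \<in> \<Lambda>"
      by (rule LambdaI[OF _ _ g(1)]) (use F diffeo_cong[OF F(1), of "restrict F D"] in auto)
    then show "y \<in> orb \<Lambda> x" using F(2) x by (auto simp: orb_def image_iff intro: bexI[of _ "restrict F D"])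
  qed
qed

lemma Lambda_smooth: "h \<in> \<Lambda> \<Longrightarrow> smooth_on D h"
  by (auto simp: covering_group_def diffeo_def)

text \<open>If \<open>h\<close> fixes \<open>x\<close>, the \<open>g\<close> that it covers fixes
  \<open>q x\<close> and is trivial by \<open>fr\<close>. Then \<open>h\<close> is a deck
  transformation with a fixed point, hence the identity.\<close>

lemma Lambda_free:
  assumes x: "x \<in> D" and fr: "\<And>g. g \<in> \<Gamma> \<Longrightarrow> g (q x) = q x \<Longrightarrow> \<forall>y\<in>U. g y = y"
    and h: "h \<in> \<Lambda>" "h x = x" and y: "y \<in> D"
  shows "h y = y"
proof -
  note uD = universal_coveringD[OF uc]
  obtain g where g: "diffeo D D h" "g \<in> \<Gamma>" "\<And>x. x \<in> D \<Longrightarrow> q (h x) = g (q x)" "\<And>x. x \<in> D \<Longrightarrow> h x \<in> D"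
    by (rule LambdaE[OF h(1)]) (rule that)
  have "\<forall>y\<in>U. g y = y" using fr[OF g(2)] g(3)[OF x] h(2) by simp
  then have qh: "q (h z) = q z" if "z \<in> D" for z using g(3)[OF that] uD(5)[OF that] by simp
  show ?thesis
    by (rule covering_space_lift_unique[OF uD(1), of h x "\<lambda>x. x" D q])
       (use x h y uD qh g smooth_on_imp_continuous_on[OF Lambda_smooth[OF h(1)]] simply_connected_imp_connected[OF uD(2)] in auto)
qed

text \<open>The set of free points itself is hard to describe. It suffices to exhibit a connected
  set \<open>N\<close> of free points that is dense in \<open>V\<close>: every set between
  \<open>N\<close> and its closure is connected, which settles \<open>V\<close> and the set of free
  points together.\<close>

lemma premodel_open_subset:
  assumes V: "openin (top_of_set D) V" "V \<noteq> {}" "\<And>x y. x \<in> V \<Longrightarrow> y \<in> D \<Longrightarrow> q y \<in> orb \<Gamma> (q x) \<Longrightarrow> y \<in> V"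
    and N: "N \<subseteq> V" "connected N" "V \<subseteq> closure N"
    and fr: "\<And>x g. x \<in> N \<Longrightarrow> g \<in> \<Gamma> \<Longrightarrow> g (q x) = q x \<Longrightarrow> \<forall>y\<in>U. g y = y"
  shows "premodel k V (restrict_group \<Lambda> V)"
proof -
  have VD: "V \<subseteq> D" using V(1) by (rule openin_imp_subset)
  have oD: "openin (top_of_set (span D)) D" "dim D = k" using D by (auto simp: open_in_Rk_def)
  have oV: "openin (top_of_set (span D)) V" using openin_trans[OF V(1) oD(1)] .
  have spV: "span V = span D" by (rule span_relopen[OF subspace_span oV V(2)])
  have "dim V = k" using spV oD(2) by (metis dim_span)
  then have 1: "open_in_Rk k V" using oV V(2) spV by (simp add: open_in_Rk_def)
  have inv: "h x \<in> V" if "x \<in> V" "h \<in> \<Lambda>" for x h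
  proof -
    have "h x \<in> orb \<Lambda> x" using that by (auto simp: orb_def)
    then show ?thesis using orb_Lambda[of x] V(3)[OF that(1)] that VD by auto
  qed
  have fp: "N \<subseteq> free_points V (restrict_group \<Lambda> V)"
  proof
    fix x assume x: "x \<in> N"
    then have xD: "x \<in> D" "x \<in> V" using N VD by auto
    show "x \<in> free_points V (restrict_group \<Lambda> V)"
      unfolding free_points_def
    proof (intro CollectI conjI ballI impI)
      fix h' y assume "h' \<in> restrict_group \<Lambda> V" "h' x = x" "y \<in> V"
      then obtain h where h: "h \<in> \<Lambda>" "h' = restrict h V" "h x = x" using xD by (auto simp: restrict_group_def)
      have "h y = y" by (rule Lambda_free[OF xD(1) fr[OF x] h(1,3)]) (use \<open>y \<in> V\<close> VD in auto)
      then show "h' y = y" using h \<open>y \<in> V\<close> by simp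
    qed (rule xD(2))
  qed
  have sub: "free_points V (restrict_group \<Lambda> V) \<subseteq> V" by (auto simp: free_points_def)
  have "connected V" using connected_intermediate_closure[OF N(2,1,3)] .
  moreover have "connected (free_points V (restrict_group \<Lambda> V))"
    using connected_intermediate_closure[OF N(2) fp] sub N(3) by blast
  moreover have "V \<subseteq> closure (free_points V (restrict_group \<Lambda> V))"
    using N(3) closure_mono[OF fp] by blast
  moreover have "subgroup (restrict_group \<Lambda> V) (BijGroup V)"
    by (rule subgroup_restrict_group[OF Lambda_subgroup VD]) (rule inv)
  moreover have "smooth_on V h" if h: "h \<in> restrict_group \<Lambda> V" for h
  proof -
    obtain h' where "h' \<in> \<Lambda>" "h = restrict h' V" using h by (auto simp: restrict_group_def)
    then show ?thesis using smooth_on_cong[OF smooth_on_subset[OF Lambda_smooth VD], of h' h] by simp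
  qed
  ultimately show ?thesis using 1 unfolding premodel_def by blast
qed

lemma qchart_onI:
  assumes c: "cdom c = D" "cgrp c = \<Lambda>" "patch c = P" "\<And>x. x \<in> D \<Longrightarrow> chart_pt c x = s (q x)"
    and P: "openin T P"
    and s: "continuous_map (top_of_set U) (subtopology T P) s" "open_map (top_of_set U) (subtopology T P) s"
      "s ` U = P" "\<And>u u'. u \<in> U \<Longrightarrow> u' \<in> U \<Longrightarrow> s u = s u' \<longleftrightarrow> u' \<in> orb \<Gamma> u"
    and N: "N \<subseteq> D" "connected N" "D \<subseteq> closure N"
    and fr: "\<And>x g. x \<in> N \<Longrightarrow> g \<in> \<Gamma> \<Longrightarrow> g (q x) = q x \<Longrightarrow> \<forall>y\<in>U. g y = y"
  shows "qchart_on k T c"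
  unfolding qchart_on_def c(1-3)
proof (intro conjI P)
  note uD = universal_coveringD[OF uc]
  have "D \<noteq> {}" using D by (auto simp: open_in_Rk_def)
  then have "premodel k D (restrict_group \<Lambda> D)"
    by (intro premodel_open_subset[OF _ _ _ N fr]) auto
  then show "model k D \<Lambda>"
    unfolding model_def restrict_group_id[OF Lambda_subgroup] using uD(2) by blast
  have PT: "topspace (subtopology T P) = P" using openin_subset[OF P] by auto
  show "homeomorphic_map (quotient_top (top_of_set D) (orb \<Lambda>)) (subtopology T P) (cmap c)"
  proof (rule homeomorphic_map_quotient_top[where f="\<lambda>x. s (q x)"])
    have "continuous_map (top_of_set D) (top_of_set U) q"
      using uD(3,5) by auto
    from continuous_map_compose[OF this s(1)] show "continuous_map (top_of_set D) (subtopology T P) (\<lambda>x. s (q x))"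
      by (simp add: o_def)
    show "open_map (top_of_set D) (subtopology T P) (\<lambda>x. s (q x))"
      unfolding open_map_def
    proof (intro allI impI)
      fix W assume "openin (top_of_set D) W"
      then have "openin (top_of_set U) (q ` W)" using covering_space_open_map[OF uD(1)] by blast
      then have "openin (subtopology T P) (s ` q ` W)" using s(2) unfolding open_map_def by blast
      then show "openin (subtopology T P) ((\<lambda>x. s (q x)) ` W)" by (simp add: image_image)
    qed
    show "(\<lambda>x. s (q x)) ` topspace (top_of_set D) = topspace (subtopology T P)"
      unfolding PT using s(3) uD(4) by (metis image_image topspace_euclidean_subtopology)
    fix x assume x: "x \<in> topspace (top_of_set D)"
    then show "cmap c (orb \<Lambda> x) = s (q x)" using c(4)[of x] unfolding chart_pt_def c(2) by simp
    fix y assume y: "y \<in> topspace (top_of_set D)"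
    have "s (q x) = s (q y) \<longleftrightarrow> y \<in> orb \<Lambda> x" using s(4) x y uD(5) orb_Lambda[of x] by simp
    also have "\<dots> \<longleftrightarrow> orb \<Lambda> x = orb \<Lambda> y" using orb_eq_iff[OF Lambda_subgroup, of x y] x y by simp
    finally show "s (q x) = s (q y) \<longleftrightarrow> orb \<Lambda> x = orb \<Lambda> y" .
  qed
qed

end

section \<open>Overlaps of charts and lifts of changes of charts\<close>

lemma chart_facts:
  assumes "qchart_on k T c"
  shows "\<And>x y. x \<in> cdom c \<Longrightarrow> y \<in> cdom c \<Longrightarrow> chart_pt c x = chart_pt c y \<longleftrightarrow> orb (cgrp c) x = orb (cgrp c) y"
    and "chart_pt c ` cdom c = patch c"
    and "continuous_map (top_of_set (cdom c)) (subtopology T (patch c)) (chart_pt c)"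
    and "inj_on (cmap c) (orbits (cdom c) (cgrp c))"
    and "openin T W \<Longrightarrow> openin (top_of_set (cdom c)) {x \<in> cdom c. chart_pt c x \<in> W}"
proof -
  have h: "homeomorphic_map (quotient_top (top_of_set (cdom c)) (orb (cgrp c))) (subtopology T (patch c)) (cmap c)"
    and P: "openin T (patch c)"
    using assms by (auto simp: qchart_on_def)
  have PT: "topspace (subtopology T (patch c)) = patch c" using openin_subset[OF P] by auto
  from homeomorphic_imp_injective_map[OF h] show i: "inj_on (cmap c) (orbits (cdom c) (cgrp c))"
    by (simp add: orbits_def)
  show "chart_pt c x = chart_pt c y \<longleftrightarrow> orb (cgrp c) x = orb (cgrp c) y" if "x \<in> cdom c" "y \<in> cdom c" for x y
    unfolding chart_pt_def by (rule inj_on_eq_iff[OF i]) (use that in \<open>simp_all add: orbits_def\<close>)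
  have "cmap c ` orb (cgrp c) ` cdom c = patch c"
    using homeomorphic_imp_surjective_map[OF h] PT by simp
  then show "chart_pt c ` cdom c = patch c" by (simp add: chart_pt_def[abs_def] image_image)
  have "continuous_map (top_of_set (cdom c)) (quotient_top (top_of_set (cdom c)) (orb (cgrp c))) (orb (cgrp c))"
    unfolding continuous_map_def openin_quotient_top by auto
  from continuous_map_compose[OF this homeomorphic_imp_continuous_map[OF h]]
  show cm: "continuous_map (top_of_set (cdom c)) (subtopology T (patch c)) (chart_pt c)"
    by (simp add: o_def chart_pt_def[abs_def])
  then have "continuous_map (top_of_set (cdom c)) T (chart_pt c)"
    by (rule continuous_map_into_fulltopology)
  then show "openin T W \<Longrightarrow> openin (top_of_set (cdom c)) {x \<in> cdom c. chart_pt c x \<in> W}"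
    by (auto simp: continuous_map_def)
qed

lemma overlap_eq:
  assumes "qchart_on k T c" shows "overlap c c' = {x \<in> cdom c. chart_pt c x \<in> patch c'}"
  using chart_facts(2)[OF assms] unfolding overlap_def chart_preimage_def by blast

lemma openin_overlap:
  assumes "qchart_on k T c" "qchart_on k T c'" shows "openin (top_of_set (cdom c)) (overlap c c')"
  unfolding overlap_eq[OF assms(1)] using chart_facts(5)[OF assms(1)] assms(2) by (simp add: qchart_on_def)

lemma chart_change_orb:
  assumes "qchart_on k T c'" "x \<in> cdom c" "y \<in> cdom c'" "chart_pt c x = chart_pt c' y"
  shows "chart_change c c' (orb (cgrp c) x) = orb (cgrp c') y"
proof -
  have "cmap c (orb (cgrp c) x) = cmap c' (orb (cgrp c') y)" using assms(4) by (simp add: chart_pt_def)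
  moreover have "orb (cgrp c') y \<in> orbits (cdom c') (cgrp c')" using assms by (simp add: orbits_def)
  ultimately show ?thesis using chart_facts(4)[OF assms(1)] by (simp add: chart_change_def)
qed

text \<open>Translates a statement about orbits of restricted groups into equality of points of the
  quasifold. Later arguments use lifts only in this form.\<close>

lemma model_lift_chart_pt:
  assumes c: "qchart_on k T c" "qchart_on k T c'"
    and l: "model_lift (overlap c c') (overlap_group c c') (overlap c' c) (overlap_group c' c) (chart_change c c') C q C' q' F"
    and x: "x \<in> C"
  shows "chart_pt c (q x) = chart_pt c' (q' (F x))"
proof -
  note l' = l[unfolded model_lift_def]
  have uc: "universal_covering C q (overlap c c')" "universal_covering C' q' (overlap c' c)"
    using l' by blast+
  have F: "F x \<in> C'" using l' x by blast
  have o: "chart_change c c' (orb (overlap_group c c') (q x)) = orb (overlap_group c' c) (q' (F x))"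
    using l'[THEN conjunct2, THEN conjunct2, THEN conjunct2, THEN conjunct2] x by (rule bspec)
  have q: "q x \<in> overlap c c'" "q' (F x) \<in> overlap c' c"
    using universal_coveringD(5)[OF uc(1) x] universal_coveringD(5)[OF uc(2) F] .
  then have q2: "q x \<in> cdom c" "chart_pt c (q x) \<in> patch c'" "q' (F x) \<in> cdom c'"
    by (auto simp: overlap_eq[OF c(1)] overlap_eq[OF c(2)])
  obtain y where y: "y \<in> cdom c'" "chart_pt c (q x) = chart_pt c' y"
    using chart_facts(2)[OF c(2)] q2(2) by (metis imageE)
  have "orb (cgrp c') y = orb (cgrp c') (q' (F x))"
    using o chart_change_orb[OF c(2) q2(1) y] q
    by (simp add: overlap_group_def orb_restrict_group)
  then show ?thesis using y q2 by (simp add: chart_pt_def)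
qed

text \<open>Coverings constructed inside the space of the charts are placed in the product demanded
  by \<open>model_diffeo\<close> as its zero slice.\<close>

lemma diffeo_Times_zero: "diffeo (C \<times> {0}) C (fst :: 'e::euclidean_space \<times> 'e \<Rightarrow> 'e)"
  by (rule diffeoI[where g="\<lambda>x. (x, 0)"])
     (auto intro: smooth_on_bounded_linear[OF bounded_linear_fst] smooth_on_Pair)

text \<open>Bijectivity of the change of charts on orbits is automatic, because both charts separate
  exactly the orbits; the lift is the only thing to provide.\<close>

lemma model_diffeoI:
  fixes c c' :: "('p, 'e::euclidean_space) qchart" and C C' :: "'e set" and F :: "'e \<Rightarrow> 'e"
  assumes c: "qchart_on k T c" "qchart_on k T c'"
    and uc: "universal_covering C q (overlap c c')" "universal_covering C' q' (overlap c' c)"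
    and F: "diffeo C C' F" "\<And>x. x \<in> C \<Longrightarrow> chart_pt c (q x) = chart_pt c' (q' (F x))"
  shows "model_diffeo (overlap c c') (overlap_group c c') (overlap c' c) (overlap_group c' c) (chart_change c c')"
  unfolding model_diffeo_def
proof (intro conjI exI)
  have orbs: "orbits (overlap a b) (overlap_group a b) = orb (cgrp a) ` overlap a b" for a b :: "('p, 'e) qchart"
    unfolding orbits_def overlap_group_def by (rule image_cong[OF refl orb_restrict_group])
  have ex: "\<exists>y. y \<in> overlap b a \<and> chart_pt a x = chart_pt b y" if ab: "qchart_on k T a" "qchart_on k T b" and x: "x \<in> overlap a b"
    for a b :: "('p, 'e) qchart" and x
  proof -
    have "x \<in> cdom a" "chart_pt a x \<in> patch b" "chart_pt a x \<in> patch a"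
      using x chart_facts(2)[OF ab(1)] by (auto simp: overlap_eq[OF ab(1)])
    then show ?thesis using chart_facts(2)[OF ab(2)] by (auto simp: overlap_eq[OF ab(2)]) (metis imageE)
  qed
  have dom: "overlap a b \<subseteq> cdom a" for a b :: "('p, 'e) qchart" by (auto simp: overlap_def chart_preimage_def)
  show "bij_betw (chart_change c c') (orbits (overlap c c') (overlap_group c c')) (orbits (overlap c' c) (overlap_group c' c))"
    unfolding orbs bij_betw_def
  proof
    show "inj_on (chart_change c c') (orb (cgrp c) ` overlap c c')"
    proof (rule inj_onI, clarify)
      fix x1 x2 assume x: "x1 \<in> overlap c c'" "x2 \<in> overlap c c'"
        and eq: "chart_change c c' (orb (cgrp c) x1) = chart_change c c' (orb (cgrp c) x2)"
      obtain y1 where y1: "y1 \<in> overlap c' c" "chart_pt c x1 = chart_pt c' y1" using ex[OF c x(1)] by blast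
      obtain y2 where y2: "y2 \<in> overlap c' c" "chart_pt c x2 = chart_pt c' y2" using ex[OF c x(2)] by blast
      note s = subsetD[OF dom x(1)] subsetD[OF dom x(2)] subsetD[OF dom y1(1)] subsetD[OF dom y2(1)]
      have "orb (cgrp c') y1 = orb (cgrp c') y2"
        using eq chart_change_orb[OF c(2) s(1,3) y1(2)] chart_change_orb[OF c(2) s(2,4) y2(2)] by simp
      then have "chart_pt c x1 = chart_pt c x2" using y1 y2 by (simp add: chart_pt_def)
      then show "orb (cgrp c) x1 = orb (cgrp c) x2" using chart_facts(1)[OF c(1) s(1,2)] by simp
    qed
    show "chart_change c c' ` orb (cgrp c) ` overlap c c' = orb (cgrp c') ` overlap c' c"
    proof (rule equalityI; rule subsetI)
      fix A assume "A \<in> chart_change c c' ` orb (cgrp c) ` overlap c c'"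
      then obtain x where x: "x \<in> overlap c c'" "A = chart_change c c' (orb (cgrp c) x)" by auto
      obtain y where y: "y \<in> overlap c' c" "chart_pt c x = chart_pt c' y" using ex[OF c x(1)] by blast
      then show "A \<in> orb (cgrp c') ` overlap c' c"
        using chart_change_orb[OF c(2) subsetD[OF dom x(1)] subsetD[OF dom y(1)] y(2)] x by auto
    next
      fix A assume "A \<in> orb (cgrp c') ` overlap c' c"
      then obtain y where y: "y \<in> overlap c' c" "A = orb (cgrp c') y" by auto
      obtain x where x: "x \<in> overlap c c'" "chart_pt c' y = chart_pt c x" using ex[OF c(2,1) y(1)] by blast
      then show "A \<in> chart_change c c' ` orb (cgrp c) ` overlap c c'"
        using chart_change_orb[OF c(2) subsetD[OF dom x(1)] subsetD[OF dom y(1)] x(2)[symmetric]] y by auto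
    qed
  qed
  obtain F' where F': "smooth_on C F" "smooth_on C' F'" "\<And>x. x \<in> C \<Longrightarrow> F x \<in> C'" "\<And>y. y \<in> C' \<Longrightarrow> F' y \<in> C"
    "\<And>x. x \<in> C \<Longrightarrow> F' (F x) = x" "\<And>y. y \<in> C' \<Longrightarrow> F (F' y) = y" by (rule diffeoE[OF F(1)]) (rule that)
  let ?F = "\<lambda>x :: 'e \<times> 'e. (F (fst x), 0) :: 'e \<times> 'e"
  have sF: "smooth_on (C \<times> {0::'e}) ?F"
    by (intro smooth_on_Pair smooth_on_const smooth_on_compose[OF smooth_on_bounded_linear[OF bounded_linear_fst] F'(1)]) auto
  show "diffeo (C \<times> {0::'e}) (C' \<times> {0::'e}) ?F"
    by (rule diffeoI[OF sF, where g="\<lambda>x. (F' (fst x), 0)"])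
       (use F' in \<open>auto intro!: smooth_on_Pair smooth_on_compose[OF smooth_on_bounded_linear[OF bounded_linear_fst] F'(2)]\<close>)
  show "model_lift (overlap c c') (overlap_group c c') (overlap c' c) (overlap_group c' c) (chart_change c c')
     (C \<times> {0::'e}) (\<lambda>x. q (fst x)) (C' \<times> {0::'e}) (\<lambda>x. q' (fst x)) ?F"
    unfolding model_lift_def
  proof (intro conjI ballI)
    show "universal_covering (C \<times> {0::'e}) (\<lambda>x. q (fst x)) (overlap c c')"
      by (rule universal_covering_precompose[OF uc(1) diffeo_Times_zero])
    show "universal_covering (C' \<times> {0::'e}) (\<lambda>x. q' (fst x)) (overlap c' c)"
      by (rule universal_covering_precompose[OF uc(2) diffeo_Times_zero])
    show "?F ` (C \<times> {0::'e}) \<subseteq> C' \<times> {0::'e}" using F' by auto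
    fix x :: "'e \<times> 'e" assume "x \<in> C \<times> {0::'e}"
    then have x: "fst x \<in> C" by auto
    have q: "q (fst x) \<in> overlap c c'" "q' (F (fst x)) \<in> overlap c' c"
      using universal_coveringD(5)[OF uc(1) x] universal_coveringD(5)[OF uc(2) F'(3)[OF x]] by auto
    then show "chart_change c c' (orb (overlap_group c c') (q (fst x))) = orb (overlap_group c' c) (q' (fst (?F x)))"
      using chart_change_orb[OF c(2) subsetD[OF dom q(1)] subsetD[OF dom q(2)] F(2)[OF x]]
      by (simp add: overlap_group_def orb_restrict_group)
  qed (rule sF)
qed

section \<open>Combinatorics of the polytope\<close>

locale quasi_polytope =
  fixes X :: "'d::finite \<Rightarrow> 'a::euclidean_space" and lam :: "'d \<Rightarrow> real" and Q :: "'a set"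
  assumes poly: "polytope (Delta X lam)"
    and full: "aff_dim (Delta X lam) = int DIM('a)"
    and facets: "bij_betw (\<lambda>j. {\<mu> \<in> Delta X lam. \<mu> \<bullet> X j = lam j}) UNIV {F. F facet_of Delta X lam}"
    and quasi: "quasilattice Q"
    and XQ: "range X \<subseteq> Q"
begin

abbreviation "act \<nu> \<equiv> active X lam {\<nu>}"

lemma act_iff: "j \<in> act \<nu> \<longleftrightarrow> \<nu> \<bullet> X j = lam j" by (simp add: active_def)

lemma Delta_iff: "\<nu> \<in> Delta X lam \<longleftrightarrow> (\<forall>j. lam j \<le> \<nu> \<bullet> X j)" by (simp add: Delta_def)

lemma Delta_nonempty: "Delta X lam \<noteq> {}" using full by auto

lemma orthogonal_span_eq_0:
  assumes "span S = UNIV" "\<And>x. x \<in> S \<Longrightarrow> v \<bullet> x = 0" shows "v = (0::'a)"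
proof -
  have "\<forall>x\<in>S. orthogonal v x" using assms(2) by (simp add: orthogonal_def)
  then have "orthogonal v v" using orthogonal_to_span[of v S v] assms(1) by (simp add: orthogonal_commute)
  then show ?thesis by (simp add: orthogonal_self)
qed

lemma exists_orthogonal:
  assumes "span S \<noteq> UNIV" obtains v where "v \<noteq> (0::'a)" "\<And>x. x \<in> S \<Longrightarrow> v \<bullet> x = 0"
proof -
  have "span S \<subset> UNIV" using assms by blast
  then obtain v where "v \<noteq> 0" "\<And>y. y \<in> span S \<Longrightarrow> orthogonal v y"
    using orthogonal_to_subspace_exists_gen[of S UNIV] by (auto simp: psubset_eq)
  then show ?thesis using that[of v] span_base by (metis orthogonal_def)
qed

lemma facet_face: "{\<mu> \<in> Delta X lam. \<mu> \<bullet> X j = lam j} facet_of Delta X lam"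
  using facets unfolding bij_betw_def by blast

text \<open>A relative interior point avoids every proper face, in particular every facet.\<close>

lemma interior_point: obtains \<nu> where "\<And>j. lam j < \<nu> \<bullet> X j"
proof -
  have cv: "convex (Delta X lam)" using poly by (rule polytope_imp_convex)
  obtain \<nu> where nu: "\<nu> \<in> rel_interior (Delta X lam)" using rel_interior_eq_empty[OF cv] Delta_nonempty by blast
  have "lam j < \<nu> \<bullet> X j" for j
  proof -
    let ?F = "{\<mu> \<in> Delta X lam. \<mu> \<bullet> X j = lam j}"
    have "?F face_of Delta X lam" "?F \<noteq> Delta X lam" using facet_face[of j] unfolding facet_of_def by auto
    then have "\<nu> \<notin> ?F" using face_of_disjoint_rel_interior nu by blast
    moreover have "\<nu> \<in> Delta X lam" using nu rel_interior_subset by blast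
    ultimately show ?thesis by (auto simp: Delta_iff less_le)
  qed
  then show ?thesis by (rule that)
qed

text \<open>No facet lies inside another one: it would be a face of equal dimension, hence the same
  facet, and the indices would agree. So a relative interior point of one facet avoids all the
  others. At such a point exactly one component of a level point vanishes.\<close>

lemma facet_point: obtains \<nu> where "\<nu> \<bullet> X h = lam h" "\<And>j. j \<noteq> h \<Longrightarrow> lam j < \<nu> \<bullet> X j"
proof -
  define Fc where "Fc j = {\<mu> \<in> Delta X lam. \<mu> \<bullet> X j = lam j}" for j
  have fc: "Fc j facet_of Delta X lam" for j unfolding Fc_def by (rule facet_face)
  have face: "Fc j face_of Delta X lam" "Fc j \<noteq> {}" "aff_dim (Fc j) = aff_dim (Delta X lam) - 1" "Fc j \<subseteq> Delta X lam" for j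
    using fc[of j] facet_of_imp_subset unfolding facet_of_def by (auto simp: Fc_def)
  have inj: "Fc j = Fc h \<Longrightarrow> j = h" for j
    using facets unfolding bij_betw_def inj_on_def Fc_def by blast
  have cv: "convex (Fc j)" for j using face_of_imp_convex[OF face(1)] .
  obtain \<nu> where nu: "\<nu> \<in> rel_interior (Fc h)" using rel_interior_eq_empty[OF cv] face(2) by blast
  have nuF: "\<nu> \<in> Fc h" using nu rel_interior_subset by blast
  show ?thesis
  proof (rule that)
    show "\<nu> \<bullet> X h = lam h" using nuF by (simp add: Fc_def)
    fix j assume j: "j \<noteq> h"
    have int: "Fc h \<inter> Fc j face_of Delta X lam" using face_of_Int face(1) by blast
    have "Fc h \<inter> Fc j \<noteq> Fc h"
    proof
      assume "Fc h \<inter> Fc j = Fc h"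
      then have "Fc h \<subseteq> Fc j" by blast
      then have "Fc h face_of Fc j" using face_of_subset[OF face(1) _ face(4)] by blast
      then have "Fc h = Fc j" using face_of_aff_dim_lt[OF cv] face(3) by force
      then show False using inj j by metis
    qed
    moreover have "Fc h \<inter> Fc j face_of Fc h" using face_of_subset[OF int _ face(4)] by blast
    ultimately have "\<nu> \<notin> Fc h \<inter> Fc j" using face_of_disjoint_rel_interior nu by blast
    then show "lam j < \<nu> \<bullet> X j" using nuF by (auto simp: Fc_def Delta_iff less_le)
  qed
qed

lemma open_positive: "open {y :: 'a. \<forall>j. j \<notin> J \<longrightarrow> lam j < y \<bullet> X j}"
proof -
  have "{y. \<forall>j. j \<notin> J \<longrightarrow> lam j < y \<bullet> X j} = (\<Inter>j\<in>-J. {y. lam j < y \<bullet> X j})" by auto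
  also have "open \<dots>" by (intro open_INT ballI open_Collect_less continuous_intros) auto
  finally show ?thesis .
qed

text \<open>Active equations are preserved by the choice of \<open>v\<close>; the inactive
  inequalities are strict and survive a small move in either direction. Having both signs is what
  contradicts extremality later.\<close>

lemma perturb:
  assumes nu: "\<nu> \<in> Delta X lam" and v: "\<And>j. j \<in> act \<nu> \<Longrightarrow> v \<bullet> X j = 0"
  obtains t where "t > 0" "\<nu> + t *\<^sub>R v \<in> Delta X lam" "\<nu> - t *\<^sub>R v \<in> Delta X lam" "act (\<nu> + t *\<^sub>R v) = act \<nu>"
proof -
  define S where "S = {y. \<forall>j. j \<notin> act \<nu> \<longrightarrow> lam j < y \<bullet> X j}"
  have "\<nu> \<in> S" using nu by (auto simp: S_def Delta_iff act_iff less_le)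
  then obtain e where e: "e > 0" "ball \<nu> e \<subseteq> S" using open_positive[of "act \<nu>"] unfolding S_def by (meson open_contains_ball)
  define t where "t = e / (2 * (norm v + 1))"
  have n: "norm v + 1 > 0" by (simp add: add_nonneg_pos)
  have t: "t > 0" using e n by (simp add: t_def)
  have "t * norm v < e"
  proof -
    have "t * norm v \<le> t * (norm v + 1)" using t by simp
    also have "\<dots> = e / 2" using n by (simp add: t_def field_simps)
    finally show ?thesis using e by simp
  qed
  then have "\<nu> + t *\<^sub>R v \<in> ball \<nu> e" "\<nu> - t *\<^sub>R v \<in> ball \<nu> e" using t by (auto simp: dist_norm)
  then have S: "\<nu> + t *\<^sub>R v \<in> S" "\<nu> - t *\<^sub>R v \<in> S" using e by auto
  have a: "(\<nu> + t *\<^sub>R v) \<bullet> X j = lam j" "(\<nu> - t *\<^sub>R v) \<bullet> X j = lam j" if "j \<in> act \<nu>" for j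
    using v[OF that] that by (auto simp: act_iff inner_add_left inner_diff_left)
  have D: "y \<in> Delta X lam" if "y \<in> S" "\<And>j. j \<in> act \<nu> \<Longrightarrow> y \<bullet> X j = lam j" for y
    unfolding Delta_iff
  proof
    fix j show "lam j \<le> y \<bullet> X j" using that(2)[of j] that(1) by (cases "j \<in> act \<nu>") (auto simp: S_def)
  qed
  have "act (\<nu> + t *\<^sub>R v) = act \<nu>"
  proof (rule Set.set_eqI)
    fix j show "j \<in> act (\<nu> + t *\<^sub>R v) \<longleftrightarrow> j \<in> act \<nu>"
      using a(1)[of j] S(1) by (cases "j \<in> act \<nu>") (auto simp: act_iff[of j "\<nu> + t *\<^sub>R v"] S_def)
  qed
  then show ?thesis using D[OF S(1) a(1)] D[OF S(2) a(2)] t by (intro that)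
qed

lemma open_faceE:
  assumes "open_face X lam F"
  shows "F \<noteq> {}" "F \<subseteq> Delta X lam" "F = {\<nu> \<in> Delta X lam. act \<nu> = active X lam F}"
proof -
  obtain J where F: "F \<noteq> {}" "F = {\<mu> \<in> Delta X lam. \<forall>j. \<mu> \<bullet> X j = lam j \<longleftrightarrow> j \<in> J}"
    using assms unfolding open_face_def by blast
  then have J: "active X lam F = J" unfolding active_def by blast
  show "F \<noteq> {}" "F \<subseteq> Delta X lam" using F by auto
  have "act \<nu> = J \<longleftrightarrow> (\<forall>j. \<nu> \<bullet> X j = lam j \<longleftrightarrow> j \<in> J)" for \<nu> by (simp add: act_iff set_eq_iff)
  then show "F = {\<nu> \<in> Delta X lam. act \<nu> = active X lam F}" unfolding J using F(2) by simp
qed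

lemma open_faceI:
  assumes "\<nu> \<in> Delta X lam" shows "open_face X lam {\<nu>' \<in> Delta X lam. act \<nu>' = act \<nu>}"
    "active X lam {\<nu>' \<in> Delta X lam. act \<nu>' = act \<nu>} = act \<nu>"
proof -
  show "open_face X lam {\<nu>' \<in> Delta X lam. act \<nu>' = act \<nu>}"
    unfolding open_face_def
  proof (intro conjI exI)
    show "{\<nu>' \<in> Delta X lam. act \<nu>' = act \<nu>} \<noteq> {}" using assms by auto
    show "{\<nu>' \<in> Delta X lam. act \<nu>' = act \<nu>} = {\<mu> \<in> Delta X lam. \<forall>j. \<mu> \<bullet> X j = lam j \<longleftrightarrow> j \<in> act \<nu>}"
      unfolding set_eq_iff by (simp add: act_iff)
  qed
  show "active X lam {\<nu>' \<in> Delta X lam. act \<nu>' = act \<nu>} = act \<nu>"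
    using assms unfolding active_def by (auto simp: set_eq_iff)
qed

text \<open>The face is relatively open in the affine subspace \<open>L\<close> cut out by its
  active equations, so its codimension is the rank of the active normals, whatever their
  number.\<close>

lemma aff_dim_open_face:
  assumes F: "open_face X lam F"
  shows "aff_dim F = int DIM('a) - int (dim (X ` active X lam F))"
proof -
  define K where "K = active X lam F"
  obtain \<nu> where nu: "\<nu> \<in> F" using open_faceE(1)[OF F] by blast
  define L where "L = {y. \<forall>k\<in>K. y \<bullet> X k = lam k}"
  define S where "S = {v. \<forall>k\<in>K. v \<bullet> X k = 0}"
  have Feq: "F = L \<inter> {y. \<forall>j. j \<notin> K \<longrightarrow> lam j < y \<bullet> X j}"
  proof -
    have "y \<in> F \<longleftrightarrow> (\<forall>j. lam j \<le> y \<bullet> X j) \<and> (\<forall>j. y \<bullet> X j = lam j \<longleftrightarrow> j \<in> K)" for y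
      by (subst open_faceE(3)[OF F]) (simp add: K_def[symmetric] Delta_iff set_eq_iff act_iff)
    also have "\<dots> y \<longleftrightarrow> y \<in> L \<inter> {y. \<forall>j. j \<notin> K \<longrightarrow> lam j < y \<bullet> X j}" for y
      unfolding L_def by (auto simp: less_le) (metis order_refl)
    finally show ?thesis by blast
  qed
  have S: "subspace S" by (auto simp: S_def subspace_def inner_add_left)
  have L: "L = (+) \<nu> ` S"
  proof -
    have "y \<in> L \<longleftrightarrow> y - \<nu> \<in> S" for y using nu Feq by (auto simp: L_def S_def inner_diff_left)
    moreover have "y \<in> (+) \<nu> ` S \<longleftrightarrow> y - \<nu> \<in> S" for y
      by (metis add_diff_cancel_left' diff_add_cancel add.commute image_iff)
    ultimately show ?thesis by blast
  qed
  have "aff_dim F = aff_dim L"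
  proof (rule aff_dim_openin)
    show "openin (top_of_set L) F" unfolding Feq using openin_open_Int[OF open_positive] by blast
    show "affine L" unfolding L using affine_translation subspace_imp_affine[OF S] by blast
  qed (use nu in auto)
  also have "\<dots> = int (dim S)" unfolding L by (simp add: aff_dim_translation_eq aff_dim_subspace[OF S])
  also have "S = {y \<in> UNIV. \<forall>x\<in>span (X ` K). orthogonal x y}"
  proof (intro equalityI subsetI)
    fix y assume "y \<in> S"
    then have "\<And>x. x \<in> X ` K \<Longrightarrow> orthogonal y x" by (auto simp: S_def orthogonal_def)
    then show "y \<in> {y \<in> UNIV. \<forall>x\<in>span (X ` K). orthogonal x y}"
      using orthogonal_to_span orthogonal_commute by blast
  next
    fix y assume "y \<in> {y \<in> UNIV. \<forall>x\<in>span (X ` K). orthogonal x y}"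
    then show "y \<in> S" by (auto simp: S_def orthogonal_def inner_commute span_base)
  qed
  also have "int (dim \<dots>) = int DIM('a) - int (dim (X ` K))"
    using dim_subspace_orthogonal_to_vectors[of "span (X ` K)" UNIV] by simp
  finally show ?thesis unfolding K_def .
qed

text \<open>A direction orthogonal to all active normals would move the vertex inside its own open
  face, which is a single point.\<close>

lemma vertex_span: assumes "vertex X lam \<mu>" shows "\<mu> \<in> Delta X lam" "span (X ` act \<mu>) = UNIV"
proof -
  have F: "open_face X lam {\<mu>}" using assms by (simp add: vertex_def)
  show mu: "\<mu> \<in> Delta X lam" using open_faceE(2)[OF F] by auto
  show "span (X ` act \<mu>) = UNIV"
  proof (rule ccontr)
    assume "span (X ` act \<mu>) \<noteq> UNIV"
    then obtain v where v: "v \<noteq> 0" "\<And>x. x \<in> X ` act \<mu> \<Longrightarrow> v \<bullet> x = 0" by (rule exists_orthogonal) (rule that)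
    obtain t where t: "t > 0" "\<mu> + t *\<^sub>R v \<in> Delta X lam" "act (\<mu> + t *\<^sub>R v) = act \<mu>"
      by (rule perturb[OF mu, of v]) (use v in auto)
    then have "\<mu> + t *\<^sub>R v \<in> {\<mu>}" using open_faceE(3)[OF F] by blast
    then show False using t v by simp
  qed
qed

text \<open>Take an extreme point of the compact closed face through \<open>\<nu>\<close>. Were its
  active normals not spanning, \<open>perturb\<close> would exhibit it as the midpoint of a segment
  in that face.\<close>

lemma vertex_exists:
  assumes nu: "\<nu> \<in> Delta X lam" obtains \<mu> where "vertex X lam \<mu>" "act \<nu> \<subseteq> act \<mu>"
proof -
  define G where "G = Delta X lam \<inter> (\<Inter>k\<in>act \<nu>. {y. X k \<bullet> y = lam k})"
  have "compact G" unfolding G_def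
    by (intro compact_Int_closed polytope_imp_compact poly closed_INT ballI closed_hyperplane)
  moreover have "convex G" unfolding G_def
    by (intro convex_Int polytope_imp_convex poly convex_INT convex_hyperplane)
  moreover have "\<nu> \<in> G" using nu by (auto simp: G_def act_iff inner_commute)
  ultimately obtain \<mu> where mu: "\<mu> extreme_point_of G" using extreme_point_exists_convex by blast
  then have muG: "\<mu> \<in> G" by (simp add: extreme_point_of_def)
  have sub: "act \<nu> \<subseteq> act \<mu>" using muG by (auto simp: G_def act_iff[of _ \<mu>] inner_commute)
  have muD: "\<mu> \<in> Delta X lam" using muG by (simp add: G_def)
  have sp: "span (X ` act \<mu>) = UNIV"
  proof (rule ccontr)
    assume "span (X ` act \<mu>) \<noteq> UNIV"
    then obtain v where v: "v \<noteq> 0" "\<And>x. x \<in> X ` act \<mu> \<Longrightarrow> v \<bullet> x = 0" by (rule exists_orthogonal) (rule that)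
    obtain t where t: "t > 0" "\<mu> + t *\<^sub>R v \<in> Delta X lam" "\<mu> - t *\<^sub>R v \<in> Delta X lam"
      by (rule perturb[OF muD, of v]) (use v in auto)
    have "\<mu> + t *\<^sub>R v \<in> G" "\<mu> - t *\<^sub>R v \<in> G"
    proof -
      have "v \<bullet> X k = 0" if "k \<in> act \<nu>" for k using v(2) sub that by blast
      then show "\<mu> + t *\<^sub>R v \<in> G" "\<mu> - t *\<^sub>R v \<in> G"
        using t muG by (auto simp: G_def inner_add_right inner_diff_right inner_commute[of v])
    qed
    moreover have "\<mu> \<in> open_segment (\<mu> + t *\<^sub>R v) (\<mu> - t *\<^sub>R v)"
    proof -
      have "midpoint (\<mu> + t *\<^sub>R v) (\<mu> - t *\<^sub>R v) = \<mu>" by (simp add: midpoint_def scaleR_2[symmetric])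
      moreover have "\<mu> + t *\<^sub>R v \<noteq> \<mu> - t *\<^sub>R v"
      proof
        assume "\<mu> + t *\<^sub>R v = \<mu> - t *\<^sub>R v"
        then have "t *\<^sub>R v + t *\<^sub>R v = 0" by (metis add_diff_cancel_left' diff_add_eq diff_self add_diff_eq)
        then have "(t + t) *\<^sub>R v = 0" by (simp only: scaleR_left_distrib)
        then show False using t v by simp
      qed
      ultimately show ?thesis using midpoint_in_open_segment[of "\<mu> + t *\<^sub>R v" "\<mu> - t *\<^sub>R v"] by simp
    qed
    ultimately show False using mu unfolding extreme_point_of_def by blast
  qed
  have "{\<mu>} = {\<nu> \<in> Delta X lam. act \<nu> = act \<mu>}"
  proof (intro equalityI subsetI)
    fix y assume y: "y \<in> {\<nu> \<in> Delta X lam. act \<nu> = act \<mu>}"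
    have "y - \<mu> = 0"
    proof (rule orthogonal_span_eq_0[OF sp])
      fix x assume "x \<in> X ` act \<mu>"
      then obtain j where j: "x = X j" "j \<in> act \<mu>" by auto
      then have "j \<in> act y" using y by auto
      then show "(y - \<mu>) \<bullet> x = 0" using j by (simp add: inner_diff_left act_iff)
    qed
    then show "y \<in> {\<mu>}" by simp
  qed (use muD in auto)
  then have "vertex X lam \<mu>" unfolding vertex_def using open_faceI(1)[OF muD] by simp
  then show ?thesis using sub by (rule that)
qed

lemma basis_extension:
  assumes mu: "vertex X lam \<mu>" and K: "K \<subseteq> act \<mu>" "inj_on X K" "independent (X ` K)"
  obtains I where "I \<in> basis_sets X lam \<mu>" "K \<subseteq> I"
proof -
  obtain B where B: "X ` K \<subseteq> B" "B \<subseteq> X ` act \<mu>" "independent B" "X ` act \<mu> \<subseteq> span B"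
    using maximal_independent_subset_extend[of "X ` K" "X ` act \<mu>"] K by blast
  have "span B = UNIV" using vertex_span(2)[OF mu] span_mono[OF B(4)] by (simp add: top.extremum_unique span_span)
  have "\<exists>L. L \<subseteq> act \<mu> - K \<and> inj_on X L \<and> X ` L = B - X ` K"
  proof -
    have "B - X ` K \<subseteq> X ` (act \<mu> - K)" using B by blast
    then obtain L where "L \<subseteq> act \<mu> - K" "inj_on X L" "B - X ` K = X ` L" by (auto simp: subset_image_inj)
    then show ?thesis by metis
  qed
  then obtain L where L: "L \<subseteq> act \<mu> - K" "inj_on X L" "X ` L = B - X ` K" by blast
  have "inj_on X (K \<union> L)" using K L by (auto simp: inj_on_Un)
  moreover have "X ` (K \<union> L) = B" using L B by auto
  ultimately have "K \<union> L \<in> basis_sets X lam \<mu>" using B \<open>span B = UNIV\<close> L K by (auto simp: basis_sets_def)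
  then show ?thesis by (rule that) simp
qed

text \<open>The codimension of the face is the rank of its active normals; hence singularity
  measures their linear dependence.\<close>

lemma nonsingular_iff:
  assumes F: "open_face X lam F"
  shows "nonsingular_face X lam F \<longleftrightarrow> inj_on X (active X lam F) \<and> independent (X ` active X lam F)"
proof -
  define K where "K = active X lam F"
  have "nonsingular_face X lam F \<longleftrightarrow> card K = dim (X ` K)"
    unfolding nonsingular_face_def aff_dim_open_face[OF F] K_def using F by auto
  also have "\<dots> \<longleftrightarrow> inj_on X K \<and> independent (X ` K)"
  proof
    assume a: "card K = dim (X ` K)"
    have "dim (X ` K) \<le> card (X ` K)" by (rule dim_le_card') simp
    then have c: "card (X ` K) = card K" using card_image_le[of K X] a by simp
    then have "inj_on X K" by (intro eq_card_imp_inj_on) auto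
    moreover have "independent (X ` K)"
      by (rule card_le_dim_spanning[of "X ` K" "X ` K"]) (use a c in \<open>auto simp: span_superset\<close>)
    ultimately show "inj_on X K \<and> independent (X ` K)" ..
  next
    assume "inj_on X K \<and> independent (X ` K)"
    then show "card K = dim (X ` K)" by (simp add: dim_eq_card_independent card_image)
  qed
  finally show ?thesis unfolding K_def .
qed

text \<open>The annihilator of the kernel of \<open>proj X\<close> is the image of the adjoint.
  Concretely, the component of \<open>Upsilon lam z\<close> orthogonal to that image lies in the
  kernel of \<open>proj X\<close>, and the level condition makes it vanish.\<close>

lemma zero_level_iff: "z \<in> zero_level X lam \<longleftrightarrow> (\<exists>\<nu>. \<forall>j. (cmod (z $ j))\<^sup>2 + lam j = \<nu> \<bullet> X j)"
proof
  have pr: "\<nu> \<bullet> proj X x = (\<chi> j. \<nu> \<bullet> X j) \<bullet> x" for \<nu> x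
    by (simp add: proj_def inner_sum_right inner_vec_def mult.commute)
  assume z: "z \<in> zero_level X lam"
  define T where "T = range (\<lambda>\<nu>. \<chi> j. \<nu> \<bullet> X j)"
  have "linear (\<lambda>\<nu>. \<chi> j. \<nu> \<bullet> X j)" by (auto simp: linear_iff inner_add_left vec_eq_iff)
  then have "subspace T" unfolding T_def by (metis linear_subspace_image subspace_UNIV)
  then obtain y w where yw: "y \<in> T" "\<And>v. v \<in> T \<Longrightarrow> orthogonal w v" "Upsilon lam z = y + w"
    using orthogonal_subspace_decomp_exists[of T "Upsilon lam z"] by (metis span_eq_iff)
  have "proj X w \<bullet> proj X w = 0"
    using yw(2)[of "\<chi> j. proj X w \<bullet> X j"] unfolding T_def pr orthogonal_def by (simp add: inner_commute[of w])
  then have "Upsilon lam z \<bullet> w = 0" using z by (simp add: zero_level_def)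
  moreover have "y \<bullet> w = 0" using yw(2)[OF yw(1)] by (simp add: orthogonal_def inner_commute)
  ultimately have "w = 0" unfolding yw(3) by (simp add: inner_add_left)
  then obtain \<nu> where "Upsilon lam z = (\<chi> j. \<nu> \<bullet> X j)" using yw by (auto simp: T_def)
  then show "\<exists>\<nu>. \<forall>j. (cmod (z $ j))\<^sup>2 + lam j = \<nu> \<bullet> X j" by (auto simp: Upsilon_def vec_eq_iff)
next
  assume "\<exists>\<nu>. \<forall>j. (cmod (z $ j))\<^sup>2 + lam j = \<nu> \<bullet> X j"
  then obtain \<nu> where nu: "\<forall>j. (cmod (z $ j))\<^sup>2 + lam j = \<nu> \<bullet> X j" by blast
  show "z \<in> zero_level X lam"
    unfolding zero_level_def
  proof (intro CollectI allI impI)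
    fix x assume "proj X x = 0"
    then have "\<nu> \<bullet> proj X x = 0" by simp
    then show "Upsilon lam z \<bullet> x = 0"
      by (simp add: proj_def inner_sum_right inner_vec_def Upsilon_def nu mult.commute)
  qed
qed

text \<open>\<open>\<nu>\<close> is the value of the moment map at the class of \<open>z\<close>:
  squared moduli are slacks, so \<open>\<nu>\<close> lies in the polytope and the vanishing
  components are its active facets.\<close>

lemma momentE:
  assumes "z \<in> zero_level X lam"
  obtains \<nu> where "\<nu> \<in> Delta X lam" "\<And>j. (cmod (z $ j))\<^sup>2 + lam j = \<nu> \<bullet> X j" "act \<nu> = {j. z $ j = 0}"
proof -
  obtain \<nu> where nu: "\<And>j. (cmod (z $ j))\<^sup>2 + lam j = \<nu> \<bullet> X j" using assms zero_level_iff by metis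
  have "lam j \<le> \<nu> \<bullet> X j" for j using nu[of j] zero_le_power2[of "cmod (z $ j)"] by linarith
  then have "\<nu> \<in> Delta X lam" by (simp add: Delta_iff)
  moreover have "act \<nu> = {j. z $ j = 0}"
  proof (rule Set.set_eqI)
    fix j
    have "\<nu> \<bullet> X j = lam j \<longleftrightarrow> (cmod (z $ j))\<^sup>2 = 0" using nu[of j] by linarith
    then show "j \<in> act \<nu> \<longleftrightarrow> j \<in> {j. z $ j = 0}" by (simp add: act_iff)
  qed
  ultimately show ?thesis using nu by (intro that)
qed

definition level_on :: "'d set \<Rightarrow> (complex ^ 'd) set" where
  "level_on I = {z \<in> zero_level X lam. \<forall>j. j \<notin> I \<longrightarrow> z $ j \<noteq> 0}"

text \<open>The normals at a nonsingular face are independent and extend to a basis at a vertex;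
  conversely, any subset of such a basis is independent. So the patches of the regular charts cover
  exactly the regular level.\<close>

lemma regular_level_eq:
  "regular_level X lam = (\<Union>\<mu>\<in>{\<mu>. vertex X lam \<mu>}. \<Union>I\<in>basis_sets X lam \<mu>. level_on I)"
proof (intro equalityI subsetI)
  fix z assume "z \<in> regular_level X lam"
  then obtain F where F: "nonsingular_face X lam F" "z \<in> zero_level X lam" "\<And>j. z $ j \<noteq> 0 \<longleftrightarrow> j \<notin> active X lam F"
    by (auto simp: regular_level_def face_level_def Cstar_def)
  have oF: "open_face X lam F" using F by (simp add: nonsingular_face_def)
  obtain \<nu> where nu: "\<nu> \<in> Delta X lam" "act \<nu> = {j. z $ j = 0}" by (rule momentE[OF F(2)]) (rule that)
  have "act \<nu> = active X lam F" using nu F(3) by auto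
  then have ind: "inj_on X (act \<nu>)" "independent (X ` act \<nu>)" using nonsingular_iff[OF oF] F(1) by auto
  obtain \<mu> where mu: "vertex X lam \<mu>" "act \<nu> \<subseteq> act \<mu>" by (rule vertex_exists[OF nu(1)]) (rule that)
  obtain I where I: "I \<in> basis_sets X lam \<mu>" "act \<nu> \<subseteq> I" by (rule basis_extension[OF mu ind]) (rule that)
  then have "z \<in> level_on I" using nu F(2) by (auto simp: level_on_def)
  then show "z \<in> (\<Union>\<mu>\<in>{\<mu>. vertex X lam \<mu>}. \<Union>I\<in>basis_sets X lam \<mu>. level_on I)" using mu I by blast
next
  fix z assume "z \<in> (\<Union>\<mu>\<in>{\<mu>. vertex X lam \<mu>}. \<Union>I\<in>basis_sets X lam \<mu>. level_on I)"
  then obtain \<mu> I where I: "I \<in> basis_sets X lam \<mu>" "z \<in> level_on I" by blast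
  then have z: "z \<in> zero_level X lam" by (simp add: level_on_def)
  obtain \<nu> where nu: "\<nu> \<in> Delta X lam" "act \<nu> = {j. z $ j = 0}" by (rule momentE[OF z]) (rule that)
  let ?F = "{\<nu>' \<in> Delta X lam. act \<nu>' = act \<nu>}"
  note F = open_faceI[OF nu(1)]
  have "act \<nu> \<subseteq> I" using nu I by (auto simp: level_on_def)
  then have "inj_on X (act \<nu>)" "independent (X ` act \<nu>)"
    using I(1) independent_mono[of "X ` I" "X ` act \<nu>"] by (auto simp: basis_sets_def intro: inj_on_subset)
  then have "nonsingular_face X lam ?F" using nonsingular_iff[OF F(1)] F(2) by simp
  moreover have "z \<in> face_level X lam ?F" using z nu F(2) by (auto simp: face_level_def Cstar_def)
  ultimately show "z \<in> regular_level X lam" unfolding regular_level_def by blast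
qed

lemma closure_active: "\<mu> \<in> closure F \<Longrightarrow> active X lam F \<subseteq> act \<mu>"
proof
  fix j assume "\<mu> \<in> closure F" "j \<in> active X lam F"
  then have "F \<subseteq> {y. X j \<bullet> y = lam j}" by (auto simp: active_def inner_commute)
  then have "closure F \<subseteq> {y. X j \<bullet> y = lam j}" using closure_minimal closed_hyperplane by blast
  with \<open>\<mu> \<in> closure F\<close> show "j \<in> act \<mu>" by (auto simp: act_iff inner_commute)
qed

text \<open>The cardinality condition in \<open>adapted\<close> equals the rank of the normals
  active on \<open>F\<close>, so the independent ones among \<open>I\<close> already span them. This
  is the condition on \<open>K\<close> in a frame.\<close>

lemma adapted_span:
  assumes "open_face X lam F" "adapted X lam F \<mu> I"
  shows "X ` active X lam F \<subseteq> span (X ` (I \<inter> active X lam F))"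
proof -
  define K where "K = active X lam F"
  have I: "inj_on X I" "independent (X ` I)" and c: "int (card (I \<inter> K)) = int DIM('a) - aff_dim F"
    using assms(2) by (auto simp: adapted_def basis_sets_def K_def)
  have "card (I \<inter> K) = dim (X ` K)" using c aff_dim_open_face[OF assms(1)] by (simp add: K_def)
  moreover have "card (X ` (I \<inter> K)) = card (I \<inter> K)" using I by (auto intro: card_image inj_on_subset)
  moreover have "independent (X ` (I \<inter> K))" by (rule independent_mono[OF I(2)]) auto
  ultimately show ?thesis unfolding K_def[symmetric]
    using card_ge_dim_independent[of "X ` (I \<inter> K)" "X ` K"] by auto
qed

end

section \<open>Frames and sections of the level sets\<close>

lemma zspan_closed:
  assumes "finite S"
  shows "x \<in> zspan S \<Longrightarrow> y \<in> zspan S \<Longrightarrow> x + y \<in> zspan S" "0 \<in> zspan S"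
    "x \<in> zspan S \<Longrightarrow> of_int n *\<^sub>R x \<in> zspan S"
proof -
  show "x \<in> zspan S \<Longrightarrow> y \<in> zspan S \<Longrightarrow> x + y \<in> zspan S"
  proof -
    assume "x \<in> zspan S" "y \<in> zspan S"
    then obtain c c' where "x = (\<Sum>v\<in>S. of_int (c v) *\<^sub>R v)" "y = (\<Sum>v\<in>S. of_int (c' v) *\<^sub>R v)" unfolding zspan_def by blast
    then have "x + y = (\<Sum>v\<in>S. of_int (c v + c' v) *\<^sub>R v)" by (simp add: sum.distrib scaleR_left_distrib)
    then show ?thesis unfolding zspan_def by (intro CollectI exI[of _ "\<lambda>v. c v + c' v"]) simp
  qed
  have "0 = (\<Sum>v\<in>S. of_int ((\<lambda>v. 0) v) *\<^sub>R v)" by simp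
  then show "0 \<in> zspan S" unfolding zspan_def by (intro CollectI exI[of _ "\<lambda>v. 0"]) simp
  show "x \<in> zspan S \<Longrightarrow> of_int n *\<^sub>R x \<in> zspan S"
  proof -
    assume "x \<in> zspan S"
    then obtain c where "x = (\<Sum>v\<in>S. of_int (c v) *\<^sub>R v)" unfolding zspan_def by blast
    then have "of_int n *\<^sub>R x = (\<Sum>v\<in>S. of_int (n * c v) *\<^sub>R v)" by (simp add: scaleR_sum_right)
    then show ?thesis unfolding zspan_def by (intro CollectI exI[of _ "\<lambda>v. n * c v"]) simp
  qed
qed

lemma countable_zspan:
  assumes "finite S" shows "countable (zspan S)"
proof -
  have "zspan S \<subseteq> (\<lambda>c. \<Sum>v\<in>S. of_int (c v) *\<^sub>R v) ` (S \<rightarrow>\<^sub>E UNIV)"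
  proof
    fix x assume "x \<in> zspan S"
    then obtain c where c: "x = (\<Sum>v\<in>S. of_int (c v) *\<^sub>R v)" unfolding zspan_def by blast
    show "x \<in> (\<lambda>c. \<Sum>v\<in>S. of_int (c v) *\<^sub>R v) ` (S \<rightarrow>\<^sub>E UNIV)"
      by (rule image_eqI[where x="restrict c S"]) (auto simp: c)
  qed
  moreover have "countable (S \<rightarrow>\<^sub>E (UNIV :: int set))" using assms by (rule countable_PiE) auto
  ultimately show ?thesis using countable_image countable_subset by blast
qed

lemma texp_add: "texp (x + y) = texp x * texp y"
  by (simp add: texp_def vec_eq_iff cis_mult ring_distribs)

lemma texp_0 [simp]: "texp 0 = 1"
  by (simp add: texp_def vec_eq_iff)

lemma texp_nth: "texp x $ j = cis (2 * pi * x $ j)"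
  by (simp add: texp_def)

lemma cis_2pi_int: "cis (2 * pi * t) = 1 \<longleftrightarrow> t \<in> \<int>"
proof
  assume "cis (2 * pi * t) = 1"
  then have "cos (2 * pi * t) = 1" by (simp add: complex_eq_iff)
  then obtain n :: int where "2 * pi * t = 2 * pi * of_int n"
    by (auto simp: cos_one_2pi_int mult_ac)
  then have "t = of_int n" by simp
  then show "t \<in> \<int>" by simp
next
  assume "t \<in> \<int>"
  then obtain n where "t = of_int n" by (rule Ints_cases)
  then show "cis (2 * pi * t) = 1" by (simp add: cis_multiple_2pi)
qed

lemma linear_proj: "linear (proj X)"
  by (auto simp: linear_iff proj_def sum.distrib scaleR_left_distrib scaleR_sum_right)

lemmas proj_simps = linear_add[OF linear_proj] linear_cmul[OF linear_proj] linear_diff[OF linear_proj]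
  linear_neg[OF linear_proj] linear_0[OF linear_proj]

lemma std_form_Im: "std_form u v = (\<Sum>j\<in>UNIV. Im (u $ j * cnj (v $ j))) / pi"
proof -
  have 1: "a * cnj b - b * cnj a = 2 * \<i> * of_real (Im (a * cnj b))" for a b
    by (simp add: complex_eq_iff)
  have "std_form u v = Re (1 / (2 * of_real pi * \<i>) * (\<Sum>j\<in>UNIV. 2 * \<i> * of_real (Im (u $ j * cnj (v $ j)))))"
    unfolding std_form_def by (simp only: 1)
  also have "(\<Sum>j\<in>UNIV. 2 * \<i> * of_real (Im (u $ j * cnj (v $ j)))) = 2 * \<i> * of_real (\<Sum>j\<in>UNIV. Im (u $ j * cnj (v $ j)))"
    by (simp only: sum_distrib_left of_real_sum)
  also have "1 / (2 * of_real pi * \<i>) * \<dots> = of_real ((\<Sum>j\<in>UNIV. Im (u $ j * cnj (v $ j))) / pi)"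
    by (simp add: field_simps)
  finally show ?thesis by simp
qed

lemma bounded_bilinear_std_form: "bounded_bilinear (std_form :: complex ^ 'd::finite \<Rightarrow> _)"
proof -
  have "bilinear (std_form :: complex ^ 'd \<Rightarrow> _)"
    unfolding bilinear_def linear_iff std_form_Im
    by (auto simp: sum.distrib algebra_simps add_divide_distrib diff_divide_distrib sum_distrib_left sum_subtractf sum_divide_distrib)
  then show ?thesis by (simp add: bilinear_conv_bounded_bilinear)
qed

lemma std_form_self: "std_form a a = 0"
  by (simp add: std_form_def)

text \<open>\<open>Cspace J\<close> is a complex subspace, so \<open>u\<close> may be paired with
  \<open>- \<i>\<close> times itself, which returns the squared norm of \<open>u\<close> up to the
  factor \<open>1 / pi\<close>.\<close>

lemma std_form_nondegenerate:
  assumes "\<And>v. v \<in> Cspace J \<Longrightarrow> std_form u v = 0" and u: "u \<in> Cspace J" shows "u = 0"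
proof -
  have "(\<chi> j. - \<i> * u $ j) \<in> Cspace J" using u by (simp add: Cspace_def)
  then have "std_form u (\<chi> j. - \<i> * u $ j) = 0" by (rule assms(1))
  moreover have "Im (u $ j * cnj (- \<i> * u $ j)) = (cmod (u $ j))\<^sup>2" for j
    by (simp add: cmod_power2) (simp add: power2_eq_square)
  ultimately have "(\<Sum>j\<in>UNIV. (cmod (u $ j))\<^sup>2) = 0" by (simp add: std_form_Im)
  then have "\<forall>j. (cmod (u $ j))\<^sup>2 = 0" by (subst (asm) sum_nonneg_eq_0_iff) auto
  then show ?thesis by (simp add: vec_eq_iff)
qed

lemma std_form_torus:
  assumes "\<And>j. cmod (a $ j) = 1" shows "std_form (a * u) (a * v) = std_form u v"
proof -
  have *: "(a * u) $ j * cnj ((a * v) $ j) = u $ j * cnj (v $ j)" for j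
  proof -
    have "a $ j * cnj (a $ j) = 1" using assms[of j] by (simp add: complex_norm_square[symmetric])
    have "(a * u) $ j * cnj ((a * v) $ j) = (a $ j * cnj (a $ j)) * (u $ j * cnj (v $ j))" by (simp add: mult_ac)
    then show ?thesis using \<open>a $ j * cnj (a $ j) = 1\<close> by simp
  qed
  show ?thesis unfolding std_form_Im by (simp only: *)
qed

lemma subspace_Cspace: "subspace (Cspace J)"
  by (auto simp: subspace_def Cspace_def)

context quasi_polytope
begin

lemma Q_closed: "x \<in> Q \<Longrightarrow> y \<in> Q \<Longrightarrow> x + y \<in> Q" "0 \<in> Q" "x \<in> Q \<Longrightarrow> of_int n *\<^sub>R x \<in> Q" "x \<in> Q \<Longrightarrow> - x \<in> Q"
  "countable Q"
proof -
  obtain S where S: "finite S" "Q = zspan S" using quasi unfolding quasilattice_def by blast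
  show "x \<in> Q \<Longrightarrow> y \<in> Q \<Longrightarrow> x + y \<in> Q" "0 \<in> Q" "x \<in> Q \<Longrightarrow> of_int n *\<^sub>R x \<in> Q" for n
    using zspan_closed[OF S(1)] S(2) by auto
  then show "x \<in> Q \<Longrightarrow> - x \<in> Q" using zspan_closed(3)[OF S(1), of x "-1"] S(2) by simp
  show "countable Q" using countable_zspan[OF S(1)] S(2) by simp
qed

lemma sum_Ints_Q: "finite A \<Longrightarrow> (\<And>k. k \<in> A \<Longrightarrow> x k \<in> \<int>) \<Longrightarrow> (\<Sum>k\<in>A. x k *\<^sub>R X k) \<in> Q"
proof (induction rule: finite_induct)
  case (insert k A)
  have "x k \<in> \<int>" using insert by auto
  then have "x k *\<^sub>R X k \<in> Q" using XQ Q_closed(3)[of "X k"] by (auto elim!: Ints_cases simp: subset_iff)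
  with insert show ?case by (simp add: Q_closed)
qed (simp add: Q_closed)

lemma pr_eq_iff: "pr X Q z = pr X Q z' \<longleftrightarrow> (\<exists>x. proj X x \<in> Q \<and> z' = texp x * z)"
proof
  have "z' \<in> pr X Q z'" unfolding pr_def Ngrp_def by (rule image_eqI[of _ _ 1]) (auto simp: Q_closed proj_simps intro!: image_eqI[of _ texp 0])
  moreover assume "pr X Q z = pr X Q z'"
  ultimately have "z' \<in> pr X Q z" by simp
  then show "\<exists>x. proj X x \<in> Q \<and> z' = texp x * z" by (auto simp: pr_def Ngrp_def)
next
  assume "\<exists>x. proj X x \<in> Q \<and> z' = texp x * z"
  then obtain x where x: "proj X x \<in> Q" "z' = texp x * z" by blast
  show "pr X Q z = pr X Q z'"
  proof (intro equalityI subsetI)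
    fix y assume "y \<in> pr X Q z'"
    then obtain t where "proj X t \<in> Q" "y = texp t * z'" by (auto simp: pr_def Ngrp_def)
    then have "y = texp (t + x) * z" "proj X (t + x) \<in> Q" using x by (auto simp: texp_add mult.assoc proj_simps Q_closed)
    then show "y \<in> pr X Q z" by (auto simp: pr_def Ngrp_def)
  next
    fix y assume "y \<in> pr X Q z"
    then obtain t where t: "proj X t \<in> Q" "y = texp t * z" by (auto simp: pr_def Ngrp_def)
    have "texp (t - x) * z' = texp t * z" using x texp_add[of "t - x" x] by (simp add: mult.assoc)
    moreover have "proj X (t - x) \<in> Q" using t x Q_closed(1)[of _ "- proj X x"] Q_closed(4) by (simp add: proj_simps)
    ultimately show "y \<in> pr X Q z'" unfolding t(2) pr_def Ngrp_def by (metis (mono_tags, lifting) image_eqI mem_Collect_eq)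
  qed
qed

lemma zero_level_torus: "texp x * z \<in> zero_level X lam \<longleftrightarrow> z \<in> zero_level X lam"
  by (simp add: zero_level_iff texp_nth norm_mult)

end

text \<open>The components in \<open>K\<close> are required to vanish, those in \<open>B\<close> not to. Thus \<open>K = B = {}\<close>
  gives the chart of the regular piece at \<open>I\<close>, and \<open>K = I\<^sub>F\<close>, \<open>B = I - I\<^sub>F\<close>
  the chart of the piece of a singular face \<open>F\<close>; \<open>K = {}\<close>, \<open>B = I - I'\<close> is the part of the regular
  chart at \<open>I\<close> that overlaps the one at \<open>I'\<close>.\<close>

locale frame = quasi_polytope X lam Q
  for X :: "'d::finite \<Rightarrow> 'a::euclidean_space" and lam Q +
  fixes \<mu> :: 'a and I K B :: "'d set"
  assumes I: "I \<in> basis_sets X lam \<mu>" and K: "K \<subseteq> act \<mu>" "X ` K \<subseteq> span (X ` (I \<inter> K))" and B: "B \<subseteq> I - K"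
begin

abbreviation "a \<equiv> acoef X I"

abbreviation "W \<equiv> Cspace (I - K)"

abbreviation "sl \<equiv> slack X lam \<mu> I K"

abbreviation "sec \<equiv> section_map X lam \<mu> I K"

definition "Dom = {w \<in> W. (\<forall>h\<in>B. w $ h \<noteq> 0) \<and> (\<forall>r. r \<notin> I \<union> K \<longrightarrow> sl w r > 0)}"

definition "Z = {z \<in> zero_level X lam. (\<forall>j\<in>K. z $ j = 0) \<and> (\<forall>j. j \<notin> I \<union> K \<longrightarrow> z $ j \<noteq> 0) \<and> (\<forall>j\<in>B. z $ j \<noteq> 0)}"

definition "Gam = torus_proj (I - K) ` (Ngrp X Q \<inter> subtorus I)"

lemma Ibase: "inj_on X I" "independent (X ` I)" "span (X ` I) = UNIV" "I \<subseteq> act \<mu>"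
  using I by (auto simp: basis_sets_def)

lemma expand: "X k = (\<Sum>h\<in>I. a h k *\<^sub>R X h)"
proof -
  have "(\<Sum>v\<in>X ` I. representation (X ` I) (X k) v *\<^sub>R v) = X k"
    using Ibase by (intro sum_representation_eq) auto
  then show ?thesis by (simp add: sum.reindex[OF Ibase(1)] acoef_def)
qed

lemma coeff_unique:
  assumes "(\<Sum>h\<in>I. c h *\<^sub>R X h) = 0" "h \<in> I" shows "c h = 0"
proof -
  have "(\<Sum>v\<in>X ` I. c (inv_into I X v) *\<^sub>R v) = 0" using assms(1) by (simp add: sum.reindex[OF Ibase(1)] Ibase(1))
  then have "c (inv_into I X (X h)) = 0" using Ibase(2) assms(2) by (subst (asm) independent_explicit) auto
  then show ?thesis using Ibase(1) assms(2) by simp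
qed

text \<open>Normals in \<open>K\<close> do not involve the coordinates in \<open>I - K\<close>.
  Hence those coordinates can move freely while all components in \<open>K\<close> stay
  zero.\<close>

lemma acoef_K: assumes "k \<in> K" "h \<in> I - K" shows "a h k = 0"
proof -
  have "X k \<in> span (X ` (I \<inter> K))" using K assms by auto
  then obtain c where c: "X k = (\<Sum>v\<in>X ` (I \<inter> K). c v *\<^sub>R v)"
    by (auto simp: span_finite)
  have "(\<Sum>v\<in>X ` (I \<inter> K). c v *\<^sub>R v) = (\<Sum>h\<in>I \<inter> K. c (X h) *\<^sub>R X h)"
    using Ibase(1) by (intro sum.reindex_cong[where l=X]) (auto intro: inj_on_subset)
  also have "\<dots> = (\<Sum>h\<in>I. (if h \<in> K then c (X h) else 0) *\<^sub>R X h)"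
    by (intro sum.mono_neutral_cong_left) auto
  finally have "(\<Sum>h\<in>I. (a h k - (if h \<in> K then c (X h) else 0)) *\<^sub>R X h) = 0"
    using c expand[of k] by (simp add: scaleR_left_diff_distrib sum_subtractf)
  from coeff_unique[OF this, of h] assms show ?thesis by simp
qed

lemma exists_moment: obtains \<nu> where "\<And>h. h \<in> I \<Longrightarrow> \<nu> \<bullet> X h = c h"
proof -
  obtain f where f: "linear f" "\<And>x. x \<in> X ` I \<Longrightarrow> f x = c (inv_into I X x)"
    using linear_independent_extend[OF Ibase(2), of "\<lambda>x. c (inv_into I X x)"] by blast
  define \<nu> where "\<nu> = (\<Sum>b\<in>Basis. f b *\<^sub>R b)"
  have "\<nu> \<bullet> x = f x" for x
  proof -
    have "f x = f (\<Sum>b\<in>Basis. (x \<bullet> b) *\<^sub>R b)" by (simp only: euclidean_representation)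
    also have "\<dots> = (\<Sum>b\<in>Basis. (x \<bullet> b) * f b)" using f(1) by (simp add: linear_sum linear_cmul)
    finally show ?thesis by (simp add: \<nu>_def inner_sum_left mult.commute inner_commute[of x])
  qed
  then show ?thesis using f(2) Ibase(1) by (intro that[of \<nu>]) simp
qed

lemma inner_expand: "\<nu> \<bullet> X r = (\<Sum>h\<in>I. a h r * (\<nu> \<bullet> X h))"
  by (subst expand[of r]) (simp add: inner_sum_right)

text \<open>The two branches of \<open>slack\<close> are one expression: \<open>I\<close> is active
  at \<open>\<mu>\<close>, so \<open>lam h\<close> is \<open>\<mu> \<bullet> X h\<close> for
  \<open>h\<close> in \<open>I\<close>, and for an active \<open>r\<close> the constant terms
  cancel.\<close>

lemma slack_alt: "sl w r = (\<Sum>h\<in>I - K. a h r * (cmod (w $ h))\<^sup>2) + \<mu> \<bullet> X r - lam r"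
proof (cases "r \<in> act \<mu>")
  case True then show ?thesis by (simp add: slack_def act_iff)
next
  case False
  have "\<mu> \<bullet> X r = (\<Sum>h\<in>I. a h r * lam h)"
    by (subst inner_expand, rule sum.cong) (use Ibase(4) act_iff in auto)
  also have "\<dots> = (\<Sum>h\<in>I \<inter> K. a h r * lam h) + (\<Sum>h\<in>I - K. a h r * lam h)"
    by (simp add: sum.Int_Diff)
  finally show ?thesis using False by (simp add: slack_def sum.distrib ring_distribs)
qed

text \<open>The slacks along the basis \<open>I\<close> determine a point \<open>\<nu>\<close>;
  expanding any other normal in the basis shows that \<open>sl\<close> is the slack of the same
  point there. Positivity in \<open>Dom\<close> is thus a condition on points of the
  polytope.\<close>

lemma slack_moment:
  assumes w: "w \<in> W" and nu: "\<And>h. h \<in> I \<Longrightarrow> \<nu> \<bullet> X h = lam h + (cmod (w $ h))\<^sup>2"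
  shows "sl w r = \<nu> \<bullet> X r - lam r" "k \<in> K \<Longrightarrow> \<nu> \<bullet> X k = lam k"
proof -
  have *: "\<nu> \<bullet> X r = (\<Sum>h\<in>I - K. a h r * (cmod (w $ h))\<^sup>2) + \<mu> \<bullet> X r" for r
  proof -
    have "\<nu> \<bullet> X r = (\<Sum>h\<in>I. a h r * (cmod (w $ h))\<^sup>2 + a h r * (\<mu> \<bullet> X h))"
      by (subst inner_expand, rule sum.cong) (use Ibase(4) act_iff nu in \<open>auto simp: ring_distribs\<close>)
    also have "\<dots> = (\<Sum>h\<in>I. a h r * (cmod (w $ h))\<^sup>2) + \<mu> \<bullet> X r"
      by (simp add: sum.distrib inner_expand[of \<mu> r])
    also have "(\<Sum>h\<in>I. a h r * (cmod (w $ h))\<^sup>2) = (\<Sum>h\<in>I - K. a h r * (cmod (w $ h))\<^sup>2)"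
      using w by (intro sum.mono_neutral_right) (auto simp: Cspace_def)
    finally show ?thesis .
  qed
  show "sl w r = \<nu> \<bullet> X r - lam r" unfolding * slack_alt by simp
  show "\<nu> \<bullet> X k = lam k" if "k \<in> K"
  proof -
    have "(\<Sum>h\<in>I - K. a h k * (cmod (w $ h))\<^sup>2) = 0" using acoef_K[OF that] by (intro sum.neutral) auto
    then show ?thesis unfolding * using K(1) that by (auto simp: act_iff)
  qed
qed

lemma sec_nth:
  assumes "w \<in> W" shows "sec w $ j = (if j \<in> I - K then w $ j else if j \<in> K then 0 else of_real (sqrt (sl w j)))"
  using assms by (auto simp: section_map_def Cspace_def)

lemma sec_Z: assumes w: "w \<in> Dom" shows "sec w \<in> Z"
proof -
  have wW: "w \<in> W" and wB: "\<And>h. h \<in> B \<Longrightarrow> w $ h \<noteq> 0" and ws: "\<And>r. r \<notin> I \<union> K \<Longrightarrow> sl w r > 0" using w by (auto simp: Dom_def)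
  obtain \<nu> where nu: "\<And>h. h \<in> I \<Longrightarrow> \<nu> \<bullet> X h = lam h + (cmod (w $ h))\<^sup>2" by (rule exists_moment) (rule that)
  have "(cmod (sec w $ j))\<^sup>2 + lam j = \<nu> \<bullet> X j" for j
  proof -
    consider "j \<in> I - K" | "j \<in> K" | "j \<notin> I \<union> K" by blast
    then show ?thesis
    proof cases
      case 1 then show ?thesis using nu by (simp add: sec_nth[OF wW])
    next
      case 2 then show ?thesis using slack_moment(2)[OF wW nu] by (simp add: sec_nth[OF wW])
    next
      case 3 then show ?thesis using slack_moment(1)[OF wW nu, of j] ws[OF 3] by (simp add: sec_nth[OF wW])
    qed
  qed
  then have "sec w \<in> zero_level X lam" unfolding zero_level_iff by blast
  moreover have "sec w $ j \<noteq> 0" if "j \<notin> I \<union> K" for j using ws[OF that] that by (simp add: sec_nth[OF wW])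
  ultimately show ?thesis using wB B by (auto simp: Z_def sec_nth[OF wW])
qed

lemma Z_torus: "texp x * z \<in> Z \<longleftrightarrow> z \<in> Z"
  by (simp add: Z_def zero_level_torus texp_nth)

text \<open>Only the phases outside \<open>I \<union> K\<close> matter: undoing them makes these
  components positive, hence equal to the roots in the section. Components in \<open>K\<close>
  vanish, and those in \<open>I - K\<close> absorb whatever rotation \<open>x\<close> brings
  along.\<close>

lemma reduce:
  assumes z: "z \<in> Z" and x: "\<And>k. k \<notin> I \<union> K \<Longrightarrow> cis (2 * pi * x $ k) * of_real (cmod (z $ k)) = z $ k"
  defines "u \<equiv> (\<chi> j. if j \<in> I - K then cis (- (2 * pi * x $ j)) * z $ j else 0)"
  shows "u \<in> Dom" "z = texp x * sec u"
proof -
  have uW: "u \<in> W" by (simp add: u_def Cspace_def)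
  have zZ: "z \<in> zero_level X lam" "\<And>j. j \<in> K \<Longrightarrow> z $ j = 0" "\<And>j. j \<notin> I \<union> K \<Longrightarrow> z $ j \<noteq> 0" "\<And>j. j \<in> B \<Longrightarrow> z $ j \<noteq> 0"
    using z by (auto simp: Z_def)
  obtain \<nu> where nu: "\<And>j. (cmod (z $ j))\<^sup>2 + lam j = \<nu> \<bullet> X j" using zZ(1) zero_level_iff by metis
  have nu': "\<nu> \<bullet> X h = lam h + (cmod (u $ h))\<^sup>2" if "h \<in> I" for h
    using nu[of h] that zZ(2)[of h] by (auto simp: u_def norm_mult)
  have s: "sl u r = (cmod (z $ r))\<^sup>2" for r using slack_moment(1)[OF uW nu', of r] nu[of r] by simp
  show "u \<in> Dom" unfolding Dom_def using uW s zZ B by (auto simp: u_def)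
  have "z $ j = texp x $ j * sec u $ j" for j
  proof -
    consider "j \<in> I - K" | "j \<in> K" | "j \<notin> I \<union> K" by blast
    then show ?thesis
    proof cases
      case 1
      have "cis (2 * pi * x $ j) * cis (- (2 * pi * x $ j)) = 1" by (simp add: cis_mult)
      moreover have "sec u $ j = cis (- (2 * pi * x $ j)) * z $ j" unfolding sec_nth[OF uW] using 1 by (simp add: u_def)
      ultimately show ?thesis by (simp add: texp_nth mult.assoc[symmetric])
    next
      case 2 then show ?thesis using zZ(2) by (simp add: sec_nth[OF uW])
    next
      case 3 then show ?thesis using x[OF 3] by (simp add: sec_nth[OF uW] texp_nth s)
    qed
  qed
  then show "z = texp x * sec u" by (simp add: vec_eq_iff)
qed

text \<open>Extends phases prescribed outside \<open>I \<union> K\<close> to an element of the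
  kernel of \<open>proj X\<close>, the Lie algebra of \<open>N\<close>: the coordinates in
  \<open>I\<close> compensate the others through the basis expansion.\<close>

definition kap :: "real ^ 'd \<Rightarrow> real ^ 'd" where
  "kap s = (\<chi> j. if j \<in> I then - (\<Sum>k\<in>-(I \<union> K). a j k * s $ k) else if j \<in> K then 0 else s $ j)"

lemma proj_kap: "proj X (kap s) = 0"
proof -
  have "proj X (kap s) = (\<Sum>j\<in>I. kap s $ j *\<^sub>R X j) + (\<Sum>j\<in>-I. kap s $ j *\<^sub>R X j)"
    unfolding proj_def by (subst sum.union_disjoint[symmetric]) (auto intro: sum.cong)
  also have "(\<Sum>j\<in>-I. kap s $ j *\<^sub>R X j) = (\<Sum>k\<in>-(I \<union> K). s $ k *\<^sub>R X k)"
    by (intro sum.mono_neutral_cong_right) (auto simp: kap_def)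
  also have "\<dots> = (\<Sum>k\<in>-(I \<union> K). \<Sum>j\<in>I. (a j k * s $ k) *\<^sub>R X j)"
    by (rule sum.cong[OF refl], subst expand) (simp add: scaleR_sum_right mult.commute)
  also have "\<dots> = (\<Sum>j\<in>I. (\<Sum>k\<in>-(I \<union> K). a j k * s $ k) *\<^sub>R X j)"
    by (subst sum.swap) (simp add: scaleR_sum_left)
  also have "(\<Sum>j\<in>I. kap s $ j *\<^sub>R X j) = - \<dots>"
    by (simp add: kap_def sum_negf)
  finally show ?thesis by simp
qed

text \<open>The arguments of the components outside \<open>I \<union> K\<close> can be removed by an
  element of the form \<open>texp (kap s)\<close>, so the kernel of \<open>proj X\<close> alone
  already moves every point to the section.\<close>

lemma Z_rep:
  assumes z: "z \<in> Z" obtains x u where "proj X x = 0" "u \<in> Dom" "z = texp x * sec u"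
proof -
  define x where "x = kap (\<chi> k. Arg (z $ k) / (2 * pi))"
  have "cis (2 * pi * x $ k) * of_real (cmod (z $ k)) = z $ k" if k: "k \<notin> I \<union> K" for k
  proof -
    have "2 * pi * x $ k = Arg (z $ k)" using k by (simp add: x_def kap_def)
    then show ?thesis using rcis_cmod_Arg[of "z $ k"] by (simp add: rcis_def mult.commute)
  qed
  note r = reduce[OF z this]
  show ?thesis by (rule that[OF _ r]) (simp_all add: x_def proj_kap)
qed

lemma Z_rep_pr:
  assumes "z \<in> Z" obtains u where "u \<in> Dom" "pr X Q z = pr X Q (sec u)"
proof -
  obtain x u where xu: "proj X x = 0" "u \<in> Dom" "z = texp x * sec u" by (rule Z_rep[OF assms]) (rule that)
  have "pr X Q (sec u) = pr X Q z" unfolding pr_eq_iff using xu Q_closed(2) by (intro exI[of _ x]) simp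
  then show ?thesis using that xu by metis
qed

lemma pr_Z_saturated: "pr X Q z = pr X Q z' \<Longrightarrow> z \<in> Z \<longleftrightarrow> z' \<in> Z"
  unfolding pr_eq_iff using Z_torus by auto

lemma Gam_cmod: "g \<in> Gam \<Longrightarrow> cmod (g $ j) = 1"
  by (auto simp: Gam_def torus_proj_def subtorus_def)

lemma Dom_torus:
  assumes "w \<in> Dom" "\<And>j. cmod (g $ j) = 1" shows "g * w \<in> Dom" "sl (g * w) r = sl w r"
proof -
  have g0: "g $ j \<noteq> 0" for j using assms(2)[of j] by auto
  show s: "sl (g * w) r = sl w r" for r unfolding slack_alt using assms(2) by (simp add: norm_mult)
  show "g * w \<in> Dom" using assms(1) g0 by (auto simp: Dom_def Cspace_def s)
qed

text \<open>For the converse, an element of \<open>N\<close> taking section to section is corrected,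
  without changing its effect, to one lying in the subtorus of \<open>I\<close>.\<close>

lemma orbit_sec:
  assumes w: "w \<in> Dom" "w' \<in> Dom"
  shows "pr X Q (sec w) = pr X Q (sec w') \<longleftrightarrow> (\<exists>g\<in>Gam. w' = g * w)"
proof
  have W: "w \<in> W" "w' \<in> W" and ws: "\<And>r. r \<notin> I \<union> K \<Longrightarrow> sl w r > 0" "\<And>r. r \<notin> I \<union> K \<Longrightarrow> sl w' r > 0"
    using w by (auto simp: Dom_def)
  assume "\<exists>g\<in>Gam. w' = g * w"
  then obtain b x where bx: "w' = torus_proj (I - K) (texp x) * w" "proj X x \<in> Q" "texp x \<in> subtorus I"
    by (auto simp: Gam_def Ngrp_def)
  let ?g = "torus_proj (I - K) (texp x)"
  have "cmod (?g $ j) = 1" for j by (simp add: torus_proj_def texp_nth)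
  then have s: "sl w' r = sl w r" for r unfolding bx(1) using Dom_torus(2)[OF w(1)] by simp
  have "sec w' = texp x * sec w"
    unfolding vec_eq_iff
  proof
    fix j
    have "j \<notin> I \<Longrightarrow> texp x $ j = 1" using bx(3) by (simp add: subtorus_def)
    moreover have "w' $ j = texp x $ j * w $ j" if "j \<in> I - K" using that by (simp add: bx(1) torus_proj_def)
    ultimately show "sec w' $ j = (texp x * sec w) $ j"
      unfolding vector_mult_component sec_nth[OF W(1)] sec_nth[OF W(2)] s by auto
  qed
  then show "pr X Q (sec w) = pr X Q (sec w')" unfolding pr_eq_iff using bx by blast
next
  have W: "w \<in> W" "w' \<in> W" and ws: "\<And>r. r \<notin> I \<union> K \<Longrightarrow> sl w r > 0" "\<And>r. r \<notin> I \<union> K \<Longrightarrow> sl w' r > 0"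
    using w by (auto simp: Dom_def)
  assume "pr X Q (sec w) = pr X Q (sec w')"
  then obtain x where x: "proj X x \<in> Q" "sec w' = texp x * sec w" unfolding pr_eq_iff by blast
  then have xj: "sec w' $ j = cis (2 * pi * x $ j) * sec w $ j" for j by (simp add: texp_nth)
  \<comment> \<open>Both sections have positive real components there, so a rotation between them is
    trivial.\<close>
  have int: "x $ k \<in> \<int>" if k: "k \<notin> I \<union> K" for k
  proof -
    have "of_real (sqrt (sl w' k)) = cis (2 * pi * x $ k) * of_real (sqrt (sl w k))"
      using xj[of k] k by (simp add: sec_nth[OF W(1)] sec_nth[OF W(2)])
    moreover from arg_cong[OF this, of cmod] have "sqrt (sl w' k) = sqrt (sl w k)"
      using ws[OF k] by (simp add: norm_mult)
    ultimately have "cis (2 * pi * x $ k) = 1" using ws(1)[OF k] by simp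
    then show ?thesis by (simp add: cis_2pi_int)
  qed
  \<comment> \<open>The integral coordinates outside \<open>I \<union> K\<close> are dropped, which
    changes the projection by an element of \<open>Q\<close>. The coordinates in
    \<open>K - I\<close>, where both points vanish, are rewritten through the basis; by
    \<open>acoef_K\<close> this leaves the coordinates in \<open>I - K\<close> alone.\<close>
  define y :: "real ^ 'd" where "y = (\<chi> j. if j \<in> I then x $ j + (\<Sum>k\<in>K - I. a j k * x $ k) else 0)"
  have yI: "y $ j = x $ j" if "j \<in> I - K" for j
  proof -
    have "(\<Sum>k\<in>K - I. a j k * x $ k) = 0" using acoef_K[OF _ that] by (intro sum.neutral) auto
    then show ?thesis using that by (simp add: y_def)
  qed
  have "proj X y = proj X x + (\<Sum>k\<in>-(I \<union> K). (- x $ k) *\<^sub>R X k)"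
  proof -
    have "proj X y = (\<Sum>j\<in>I. y $ j *\<^sub>R X j)"
      unfolding proj_def by (intro sum.mono_neutral_right) (auto simp: y_def)
    also have "\<dots> = (\<Sum>j\<in>I. x $ j *\<^sub>R X j) + (\<Sum>j\<in>I. \<Sum>k\<in>K - I. (a j k * x $ k) *\<^sub>R X j)"
      by (simp add: y_def scaleR_left_distrib sum.distrib scaleR_sum_left)
    also have "(\<Sum>j\<in>I. \<Sum>k\<in>K - I. (a j k * x $ k) *\<^sub>R X j) = (\<Sum>k\<in>K - I. x $ k *\<^sub>R X k)"
      by (subst sum.swap, rule sum.cong[OF refl], subst (2) expand) (simp add: scaleR_sum_right mult.commute)
    also have "(\<Sum>j\<in>I. x $ j *\<^sub>R X j) + \<dots> = (\<Sum>j\<in>I \<union> K. x $ j *\<^sub>R X j)"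
      by (subst sum.union_disjoint[symmetric]) (auto intro: sum.cong)
    also have "\<dots> = proj X x - (\<Sum>k\<in>-(I \<union> K). x $ k *\<^sub>R X k)"
    proof -
      have "proj X x = (\<Sum>j\<in>I \<union> K. x $ j *\<^sub>R X j) + (\<Sum>k\<in>-(I \<union> K). x $ k *\<^sub>R X k)"
        unfolding proj_def by (subst sum.union_disjoint[symmetric]) (auto intro: sum.cong)
      then show ?thesis by simp
    qed
    finally show ?thesis by (simp add: sum_negf)
  qed
  moreover have "(\<Sum>k\<in>-(I \<union> K). (- x $ k) *\<^sub>R X k) \<in> Q" by (rule sum_Ints_Q) (use int in auto)
  ultimately have "proj X y \<in> Q" using x Q_closed by simp
  then have "texp y \<in> Ngrp X Q" by (simp add: Ngrp_def)
  moreover have "texp y \<in> subtorus I" by (simp add: subtorus_def texp_nth y_def)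
  ultimately have "torus_proj (I - K) (texp y) \<in> Gam" by (simp add: Gam_def)
  moreover have "w' = torus_proj (I - K) (texp y) * w"
    unfolding vec_eq_iff
  proof
    fix j show "w' $ j = (torus_proj (I - K) (texp y) * w) $ j"
    proof (cases "j \<in> I - K")
      case True then show ?thesis using xj[of j] yI[OF True]
        by (simp add: sec_nth[OF W(1)] sec_nth[OF W(2)] torus_proj_def texp_nth)
    next
      case False then show ?thesis using W by (simp add: Cspace_def)
    qed
  qed
  ultimately show "\<exists>g\<in>Gam. w' = g * w" by blast
qed

text \<open>Modulo integers, an element comes from a vector supported on \<open>I\<close> that
  projects into \<open>Q\<close>. The projection is injective on such vectors and \<open>Q\<close>
  is countable.\<close>

lemma countable_Gam: "countable Gam"
proof -
  define S where "S = {x :: real ^ 'd. (\<forall>j. j \<notin> I \<longrightarrow> x $ j = 0) \<and> proj X x \<in> Q}"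
  have pI: "proj X x = (\<Sum>j\<in>I. x $ j *\<^sub>R X j)" if "\<And>j. j \<notin> I \<Longrightarrow> x $ j = 0" for x
    unfolding proj_def by (intro sum.mono_neutral_right) (auto simp: that)
  have "inj_on (proj X) S"
  proof (rule inj_onI)
    fix x y assume xy: "x \<in> S" "y \<in> S" "proj X x = proj X y"
    then have "(\<Sum>j\<in>I. (x $ j - y $ j) *\<^sub>R X j) = 0" using pI[of x] pI[of y] by (simp add: S_def scaleR_left_diff_distrib sum_subtractf)
    from coeff_unique[OF this] have "x $ j = y $ j" if "j \<in> I" for j using that by force
    then show "x = y" using xy unfolding vec_eq_iff S_def by (metis (mono_tags, lifting) mem_Collect_eq)
  qed
  moreover have "countable (proj X ` S)" by (rule countable_subset[OF _ Q_closed(5)]) (auto simp: S_def)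
  ultimately have "countable S" by (rule countable_image_inj_on[rotated])
  moreover have "Ngrp X Q \<inter> subtorus I \<subseteq> texp ` S"
  proof
    fix t assume "t \<in> Ngrp X Q \<inter> subtorus I"
    then obtain x where x: "t = texp x" "proj X x \<in> Q" "\<And>j. j \<notin> I \<Longrightarrow> x $ j \<in> \<int>"
      by (auto simp: Ngrp_def subtorus_def texp_nth cis_2pi_int)
    define y :: "real ^ 'd" where "y = (\<chi> j. if j \<in> I then x $ j else 0)"
    have "proj X x = (\<Sum>j\<in>I. x $ j *\<^sub>R X j) + (\<Sum>j\<in>-I. x $ j *\<^sub>R X j)"
      unfolding proj_def by (subst sum.union_disjoint[symmetric]) (auto intro: sum.cong)
    moreover have "proj X y = (\<Sum>j\<in>I. x $ j *\<^sub>R X j)" using pI[of y] by (simp add: y_def)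
    moreover have "(\<Sum>j\<in>-I. (- x $ j) *\<^sub>R X j) \<in> Q" by (rule sum_Ints_Q) (use x in auto)
    ultimately have "proj X y \<in> Q" using Q_closed(1)[OF x(2), of "\<Sum>j\<in>-I. (- x $ j) *\<^sub>R X j"] by (simp add: sum_negf)
    then have "y \<in> S" by (simp add: S_def y_def)
    moreover have "t = texp y" using x by (simp add: vec_eq_iff texp_nth y_def cis_2pi_int)
    ultimately show "t \<in> texp ` S" by blast
  qed
  ultimately show ?thesis unfolding Gam_def by (meson countable_image countable_subset)
qed

lemma Gam_group: "1 \<in> Gam" "g \<in> Gam \<Longrightarrow> h \<in> Gam \<Longrightarrow> g * h \<in> Gam" "g \<in> Gam \<Longrightarrow> \<exists>h\<in>Gam. h * g = 1"
proof -
  have mem: "torus_proj (I - K) (texp x) \<in> Gam" if "proj X x \<in> Q" "texp x \<in> subtorus I" for x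
    using that by (auto simp: Gam_def Ngrp_def)
  have ex: "\<exists>x. g = torus_proj (I - K) (texp x) \<and> proj X x \<in> Q \<and> texp x \<in> subtorus I" if "g \<in> Gam" for g
    using that by (auto simp: Gam_def Ngrp_def)
  have tp: "torus_proj (I - K) (b * c) = torus_proj (I - K) b * torus_proj (I - K) c" for b c :: "complex ^ 'd"
    by (simp add: torus_proj_def vec_eq_iff)
  have t1: "torus_proj (I - K) 1 = (1 :: complex ^ 'd)" by (simp add: torus_proj_def vec_eq_iff)
  show "1 \<in> Gam" using mem[of 0] by (simp add: proj_simps Q_closed t1 subtorus_def)
  show "g * h \<in> Gam" if gh: "g \<in> Gam" "h \<in> Gam"
  proof -
    obtain x y where "g = torus_proj (I - K) (texp x)" "proj X x \<in> Q" "texp x \<in> subtorus I"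
      "h = torus_proj (I - K) (texp y)" "proj X y \<in> Q" "texp y \<in> subtorus I" using ex[OF gh(1)] ex[OF gh(2)] by blast
    then show ?thesis using mem[of "x + y"] by (simp add: texp_add tp proj_simps Q_closed subtorus_def norm_mult)
  qed
  show "\<exists>h\<in>Gam. h * g = 1" if g: "g \<in> Gam"
  proof -
    obtain x where x: "g = torus_proj (I - K) (texp x)" "proj X x \<in> Q" "texp x \<in> subtorus I" using ex[OF g] by blast
    have inv: "texp (- x) * texp x = 1" using texp_add[of "-x" x] by simp
    have "texp (- x) $ j = 1" if "j \<notin> I" for j
      using x(3) that inv by (metis (mono_tags, lifting) mem_Collect_eq mult.right_neutral one_index subtorus_def vector_mult_component)
    then have "texp (- x) \<in> subtorus I" by (simp add: subtorus_def texp_nth)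
    then have "torus_proj (I - K) (texp (- x)) \<in> Gam" using mem x Q_closed(4) by (simp add: proj_simps)
    moreover have "torus_proj (I - K) (texp (- x)) * g = 1" unfolding x(1) tp[symmetric] inv t1 ..
    ultimately show ?thesis by blast
  qed
qed

end

section \<open>Local reduction of the standard form\<close>

lemma smooth_on_texp:
  assumes "smooth_on S f" shows "smooth_on S (\<lambda>y. texp (f y))"
proof (rule smooth_on_vec)
  fix j
  have "smooth_on S (\<lambda>y. cis (2 * pi * f y $ j))"
    by (intro smooth_on_cis smooth_on_mult smooth_on_const smooth_on_nth assms)
  then show "smooth_on S (\<lambda>y. texp (f y) $ j)" by (simp add: texp_nth)
qed

lemma smooth_on_vec_mult:
  fixes f g :: "'m::real_normed_vector \<Rightarrow> complex ^ 'd::finite"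
  assumes "smooth_on S f" "smooth_on S g" shows "smooth_on S (\<lambda>y. f y * g y)"
proof (rule smooth_on_vec)
  fix j
  have "smooth_on S (\<lambda>y. f y $ j * g y $ j)" by (intro smooth_on_mult smooth_on_nth assms)
  then show "smooth_on S (\<lambda>y. (f y * g y) $ j)" by simp
qed

lemma bounded_linear_vec_mult_left: "bounded_linear (\<lambda>z :: complex ^ 'd::finite. g * z)"
proof (rule linear_conv_bounded_linear[THEN iffD1])
  show "linear (\<lambda>z. g * z)" by (auto simp: linear_iff vec_eq_iff algebra_simps)
qed

lemma openin_preimage_relopen:
  assumes "openin (top_of_set V) A" "continuous_on A f" "f ` A \<subseteq> S" "openin (top_of_set S) N"
  shows "openin (top_of_set V) (A \<inter> f -` N)"
  using continuous_openin_preimage[OF assms(2) _ assms(4)] assms(1,3) openin_trans by blast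

context frame
begin

lemma smooth_slack: "smooth_on S f \<Longrightarrow> smooth_on S (\<lambda>y. sl (f y) r)"
  unfolding slack_alt
  by (intro smooth_on_diff smooth_on_add smooth_on_sum smooth_on_mult smooth_on_const smooth_on_cmod2 smooth_on_nth)

lemma DomD: "w \<in> Dom \<Longrightarrow> w \<in> W" "w \<in> Dom \<Longrightarrow> r \<notin> I \<union> K \<Longrightarrow> sl w r > 0"
  by (auto simp: Dom_def)

lemma smooth_sec:
  assumes f: "smooth_on S f" "\<And>y. y \<in> S \<Longrightarrow> f y \<in> Dom" shows "smooth_on S (\<lambda>y. sec (f y))"
proof (rule smooth_on_vec)
  fix j
  consider "j \<in> I - K" | "j \<in> K" | "j \<notin> I \<union> K" by blast
  then show "smooth_on S (\<lambda>y. sec (f y) $ j)"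
  proof cases
    case 1
    show ?thesis by (rule smooth_on_cong[OF smooth_on_nth[OF f(1), of j]]) (use 1 f(2) DomD(1) in \<open>simp add: sec_nth\<close>)
  next
    case 2
    show ?thesis by (rule smooth_on_cong[OF smooth_on_const[of S 0]]) (use 2 f(2) DomD(1) in \<open>simp add: sec_nth\<close>)
  next
    case 3
    have "smooth_on S (\<lambda>y. complex_of_real (sqrt (sl (f y) j)))"
      by (intro smooth_on_of_real smooth_on_sqrt smooth_slack f(1)) (use DomD(2)[OF f(2)] 3 in auto)
    then show ?thesis by (rule smooth_on_cong) (use 3 f(2) DomD(1) in \<open>simp add: sec_nth\<close>)
  qed
qed

lemma openin_Dom: "openin (top_of_set W) Dom"
proof -
  have "Dom = W \<inter> ((\<Inter>h\<in>B. {w. w $ h \<noteq> 0}) \<inter> (\<Inter>r\<in>-(I \<union> K). {w. 0 < sl w r}))"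
    by (auto simp: Dom_def)
  moreover have "open ((\<Inter>h\<in>B. {w :: complex ^ 'd. w $ h \<noteq> 0}) \<inter> (\<Inter>r\<in>-(I \<union> K). {w. 0 < sl w r}))"
  proof (intro open_Int open_INT ballI open_Collect_less open_Collect_neq continuous_intros)
    show "continuous_on UNIV (\<lambda>w. sl w r)" for r
      by (rule smooth_on_imp_continuous_on[OF smooth_slack]) (rule smooth_on_id)
  qed auto
  ultimately show ?thesis by (simp add: openin_open_Int)
qed

text \<open>Makes \<open>Z_rep\<close> smooth near a point. The reference \<open>x0\<close> is any
  vector that represents \<open>z0\<close>; only the correction \<open>\<tau>\<close> varies, and it
  stays in the kernel of \<open>proj X\<close>.\<close>

lemma local_reduction:
  assumes z0: "z0 \<in> Z" "z0 = texp x0 * sec u0" "u0 \<in> Dom"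
  obtains N f \<tau> where "openin (top_of_set Z) N" "z0 \<in> N" "smooth_on N f" "smooth_on N \<tau>" "f z0 = u0" "\<tau> z0 = 0"
    "\<And>z. z \<in> N \<Longrightarrow> f z \<in> Dom" "\<And>z. z \<in> N \<Longrightarrow> proj X (\<tau> z) = 0" "\<And>z. z \<in> N \<Longrightarrow> z = texp (x0 + \<tau> z) * sec (f z)"
proof -
  define N where "N = {z \<in> Z. \<forall>k\<in>-(I \<union> K). z $ k / z0 $ k \<notin> \<real>\<^sub>\<le>\<^sub>0}"
  \<comment> \<open>The change of argument relative to \<open>z0\<close>, counted in turns. On
    \<open>N\<close> the quotients avoid the branch cut, so the principal logarithm is smooth, and
    it vanishes at \<open>z0\<close>.\<close>
  define t where "t z = (\<chi> k. if k \<in> I \<union> K then 0 else Im (Ln (z $ k / z0 $ k)) / (2 * pi))" for z :: "complex ^ 'd"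
  define \<tau> where "\<tau> z = kap (t z)" for z
  define f where "f z = (\<chi> j. if j \<in> I - K then cis (- (2 * pi * (x0 + \<tau> z) $ j)) * z $ j else 0)" for z
  have u0W: "u0 \<in> W" using z0(3) by (rule DomD)
  have z0k: "z0 $ k \<noteq> 0" if "k \<notin> I \<union> K" for k using z0(1) that by (auto simp: Z_def)
  have N: "openin (top_of_set Z) N"
  proof -
    have "N = Z \<inter> (\<Inter>k\<in>-(I \<union> K). (\<lambda>z. z $ k / z0 $ k) -` (- \<real>\<^sub>\<le>\<^sub>0))" by (auto simp: N_def)
    moreover have "open (\<Inter>k\<in>-(I \<union> K). (\<lambda>z :: complex ^ 'd. z $ k / z0 $ k) -` (- \<real>\<^sub>\<le>\<^sub>0))"
    proof (intro open_INT ballI open_vimage)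
      fix k assume "k \<in> -(I \<union> K)"
      then show "continuous_on UNIV (\<lambda>z :: complex ^ 'd. z $ k / z0 $ k)"
        using z0k by (intro continuous_intros) auto
    qed (auto simp: open_Compl)
    ultimately show ?thesis by (simp add: openin_open_Int)
  qed
  have st: "smooth_on N t"
  proof (rule smooth_on_vec)
    fix k show "smooth_on N (\<lambda>z. t z $ k)"
    proof (cases "k \<in> I \<union> K")
      case False
      have "smooth_on N (\<lambda>z. Im (Ln (z $ k * inverse (z0 $ k))) * inverse (2 * pi))"
        by (intro smooth_on_mult smooth_on_const smooth_on_Im smooth_on_Ln smooth_on_nth smooth_on_id)
           (use False in \<open>auto simp: N_def divide_inverse\<close>)
      moreover have "t z $ k = Im (Ln (z $ k * inverse (z0 $ k))) * inverse (2 * pi)" for z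
        using False by (simp only: t_def vec_lambda_beta if_False divide_inverse)
      ultimately show ?thesis by (simp only:)
    qed (simp add: t_def)
  qed
  have s\<tau>: "smooth_on N \<tau>"
  proof (rule smooth_on_vec)
    fix j
    consider "j \<in> I" | "j \<in> K - I" | "j \<notin> I \<union> K" by blast
    then show "smooth_on N (\<lambda>z. \<tau> z $ j)"
    proof cases
      case 1
      then have "\<tau> z $ j = - (\<Sum>k\<in>-(I \<union> K). a j k * t z $ k)" for z by (simp add: \<tau>_def kap_def)
      then show ?thesis by (simp only:) (intro smooth_on_minus smooth_on_sum smooth_on_mult smooth_on_const smooth_on_nth st)
    next
      case 3
      then have "\<tau> z $ j = t z $ j" for z by (simp add: \<tau>_def kap_def)
      then show ?thesis by (simp only:) (intro smooth_on_nth st)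
    qed (simp add: \<tau>_def kap_def)
  qed
  have sf: "smooth_on N f"
  proof (rule smooth_on_vec)
    fix j show "smooth_on N (\<lambda>z. f z $ j)"
    proof (cases "j \<in> I - K")
      case True
      have "smooth_on N (\<lambda>z. cis (- (2 * pi * (x0 + \<tau> z) $ j)) * z $ j)"
        by (intro smooth_on_mult smooth_on_cis smooth_on_minus smooth_on_const smooth_on_nth smooth_on_add s\<tau> smooth_on_id)
      then show ?thesis using True by (simp add: f_def)
    next
      case False
      then have "f z $ j = 0" for z unfolding f_def by (simp only: vec_lambda_beta if_False)
      then show ?thesis by simp
    qed
  qed
  have red: "f z \<in> Dom \<and> z = texp (x0 + \<tau> z) * sec (f z)" if z: "z \<in> N" for z
  proof -
    have zZ: "z \<in> Z" using z by (simp add: N_def)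
    have x: "cis (2 * pi * (x0 + \<tau> z) $ k) * of_real (cmod (z $ k)) = z $ k" if k: "k \<notin> I \<union> K" for k
    proof -
      have s: "0 < sl u0 k" using z0(3) k DomD(2) by auto
      have e0: "z0 $ k = cis (2 * pi * x0 $ k) * of_real (sqrt (sl u0 k))"
        using k by (simp add: z0(2) texp_nth sec_nth[OF u0W])
      then have n0: "cmod (z0 $ k) = sqrt (sl u0 k)" using s by (simp add: norm_mult)
      have zk: "z $ k \<noteq> 0" using zZ k by (auto simp: Z_def)
      define q where "q = z $ k / z0 $ k"
      have q0: "q \<noteq> 0" using zk z0k[OF k] by (simp add: q_def)
      have "2 * pi * (x0 + \<tau> z) $ k = 2 * pi * x0 $ k + Im (Ln q)"
        using k by (simp add: \<tau>_def kap_def t_def ring_distribs q_def)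
      then have "cis (2 * pi * (x0 + \<tau> z) $ k) = cis (2 * pi * x0 $ k) * cis (Im (Ln q))" by (simp add: cis_mult)
      moreover have "of_real (cmod (z $ k)) = complex_of_real (cmod q) * of_real (sqrt (sl u0 k))"
        using n0 z0k[OF k] by (simp add: q_def norm_divide flip: n0)
      moreover have "cis (Im (Ln q)) * of_real (cmod q) = q"
      proof -
        have "q = exp (Ln q)" using q0 by simp
        also have "\<dots> = of_real (exp (Re (Ln q))) * cis (Im (Ln q))" by (simp add: exp_eq_polar)
        finally show ?thesis using q0 by (simp add: mult.commute)
      qed
      moreover have "(b * c) * (d * s) = (c * d) * (b * s)" for b c d s :: complex by (simp add: mult_ac)
      ultimately have "cis (2 * pi * (x0 + \<tau> z) $ k) * of_real (cmod (z $ k)) = q * z0 $ k"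
        unfolding e0 by (simp only:)
      then show ?thesis using z0k[OF k] by (simp add: q_def)
    qed
    show ?thesis using reduce[OF zZ x] unfolding f_def by blast
  qed
  have z0N: "z0 \<in> N" using z0(1) z0k by (auto simp: N_def)
  have t0: "t z0 = 0" using z0k by (simp add: t_def vec_eq_iff)
  have \<tau>0: "\<tau> z0 = 0" by (simp add: \<tau>_def t0 kap_def vec_eq_iff)
  have "f z0 $ j = u0 $ j" for j
  proof (cases "j \<in> I - K")
    case True
    have "cis (- (2 * pi * x0 $ j)) * cis (2 * pi * x0 $ j) = 1" by (simp add: cis_mult)
    moreover have "z0 $ j = cis (2 * pi * x0 $ j) * u0 $ j" using True by (simp add: z0(2) texp_nth sec_nth[OF u0W])
    ultimately show ?thesis using True by (simp add: f_def \<tau>0 mult.assoc[symmetric])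
  next
    case False
    then have "f z0 $ j = 0" unfolding f_def by (simp only: vec_lambda_beta if_False)
    then show ?thesis using u0W False by (simp add: Cspace_def)
  qed
  then have "f z0 = u0" by (simp add: vec_eq_iff)
  then show ?thesis using that[OF N z0N sf s\<tau> _ \<tau>0] red proj_kap by (simp add: \<tau>_def)
qed

text \<open>Reduction: the standard form restricted to the level set does not see the directions of
  \<open>N\<close>, because those pair with the differential of the moment map, and the components of the
  section outside \<open>I\<close> are real.\<close>

lemma std_form_reduction:
  fixes f :: "'m::real_normed_vector \<Rightarrow> complex ^ 'd" and x0 :: "real ^ 'd"
  assumes V: "subspace V" "openin (top_of_set V) A" "y \<in> A" and uv: "u \<in> V" "v \<in> V"
    and f: "smooth_on A f" "\<And>y. y \<in> A \<Longrightarrow> f y \<in> Dom"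
    and \<tau>: "smooth_on A \<tau>" "\<And>y. y \<in> A \<Longrightarrow> proj X (\<tau> y) = 0"
  defines "\<sigma> \<equiv> (\<lambda>y. texp (x0 + \<tau> y) * sec (f y))"
  shows "std_form (dd \<sigma> y u) (dd \<sigma> y v) = std_form (dd f y u) (dd f y v)" and "smooth_on A \<sigma>"
proof -
  define c where "c j y = sec (f y) $ j" for j y
  have ss: "smooth_on A (\<lambda>y. sec (f y))" by (rule smooth_sec[OF f])
  have sc: "smooth_on A (c j)" for j unfolding c_def by (rule smooth_on_nth[OF ss])
  show s\<sigma>: "smooth_on A \<sigma>" unfolding \<sigma>_def
    by (intro smooth_on_vec_mult smooth_on_texp smooth_on_add smooth_on_const \<tau>(1) ss)
  have nth: "dd g y u $ j = dd (\<lambda>y. g y $ j) y u" if "smooth_on A g" "u \<in> V" for g :: "'m \<Rightarrow> complex ^ 'd" and j u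
    by (rule dd_bounded_linear[OF V that(2,1) bounded_linear_vec_nth, symmetric])
  have nthr: "dd g y u $ j = dd (\<lambda>y. g y $ j) y u" if "smooth_on A g" "u \<in> V" for g :: "'m \<Rightarrow> real ^ 'd" and j u
    by (rule dd_bounded_linear[OF V that(2,1) bounded_linear_vec_nth, symmetric])
  define \<alpha> where "\<alpha> j u = 2 * pi * dd \<tau> y u $ j" for j u
  define e where "e j = cis (2 * pi * (x0 + \<tau> y) $ j)" for j
  \<comment> \<open>Product rule: the rotation contributes the term with
    \<open>\<alpha> j u\<close>, the motion of the section the other one, and the unit factor
    \<open>e j\<close> is common to both.\<close>
  have d\<sigma>: "dd \<sigma> y u $ j = e j * (\<i> * of_real (\<alpha> j u) * c j y + dd (c j) y u)" if u: "u \<in> V" for u j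
  proof -
    have s1: "smooth_on A (\<lambda>y. cis (2 * pi * (x0 + \<tau> y) $ j))"
      by (intro smooth_on_cis smooth_on_mult smooth_on_const smooth_on_nth smooth_on_add \<tau>(1))
    have "dd \<sigma> y u $ j = dd (\<lambda>y. cis (2 * pi * (x0 + \<tau> y) $ j) * c j y) y u"
      unfolding nth[OF s\<sigma> u] by (simp add: \<sigma>_def c_def texp_nth)
    also have "\<dots> = e j * dd (c j) y u + dd (\<lambda>y. cis (2 * pi * (x0 + \<tau> y) $ j)) y u * c j y"
      unfolding e_def by (rule dd_bilinear[OF V u s1 sc bounded_bilinear_mult])
    also have "dd (\<lambda>y. cis (2 * pi * (x0 + \<tau> y) $ j)) y u = of_real (\<alpha> j u) * (\<i> * e j)"
    proof -
      have "((\<lambda>t. \<tau> (y + t *\<^sub>R u) $ j) has_vector_derivative dd \<tau> y u $ j) (at 0)"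
        by (rule bounded_linear.has_vector_derivative[OF bounded_linear_vec_nth dd_vd[OF V u \<tau>(1)]])
      then have d1: "((\<lambda>t. 2 * pi * (x0 + \<tau> (y + t *\<^sub>R u)) $ j) has_vector_derivative \<alpha> j u) (at 0)"
        unfolding \<alpha>_def by (auto intro!: derivative_eq_intros simp: ring_distribs)
      have "((\<lambda>t. cis (2 * pi * (x0 + \<tau> (y + t *\<^sub>R u)) $ j)) has_vector_derivative \<alpha> j u *\<^sub>R (\<i> * cis (2 * pi * (x0 + \<tau> (y + 0 *\<^sub>R u)) $ j))) (at 0)"
        using has_derivative_cis[OF d1[unfolded has_vector_derivative_def]] by (simp add: has_vector_derivative_def)
      then show ?thesis unfolding dd_def[of "\<lambda>y. cis (2 * pi * (x0 + \<tau> y) $ j)"]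
        by (simp add: vector_derivative_at e_def scaleR_conv_of_real)
    qed
    finally show ?thesis by (simp add: algebra_simps)
  qed
  have e1: "e j * cnj (e j) = 1" for j by (simp add: e_def cis_cnj cis_mult)
  \<comment> \<open>The unit factor cancels against its conjugate and the product of the two
    rotation terms is real, so only mixed terms and the section term remain.\<close>
  have trm: "Im (dd \<sigma> y u $ j * cnj (dd \<sigma> y v $ j)) = \<alpha> j u * Re (c j y * cnj (dd (c j) y v))
     - \<alpha> j v * Re (c j y * cnj (dd (c j) y u)) + Im (dd (c j) y u * cnj (dd (c j) y v))" for j
  proof -
    define p where "p = dd (c j) y u"
    define q where "q = dd (c j) y v"
    have "dd \<sigma> y u $ j * cnj (dd \<sigma> y v $ j)
       = (e j * cnj (e j)) * ((\<i> * of_real (\<alpha> j u) * c j y + p) * cnj (\<i> * of_real (\<alpha> j v) * c j y + q))"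
      unfolding d\<sigma>[OF uv(1)] d\<sigma>[OF uv(2)] p_def q_def complex_cnj_mult by (simp only: mult_ac)
    also have "Im \<dots> = \<alpha> j u * Re (c j y * cnj q) - \<alpha> j v * Re (c j y * cnj p) + Im (p * cnj q)"
      unfolding e1 by (simp add: algebra_simps)
    finally show ?thesis by (simp add: p_def q_def)
  qed
  \<comment> \<open>The mixed terms are derivatives of squared moduli, weighted by the vector
    \<open>n\<close> of the kernel. Along the section \<open>Upsilon\<close> annihilates that
    vector, so the weighted sum of squared moduli is constant.\<close>
  have moment: "(\<Sum>j\<in>UNIV. \<alpha> j u * Re (c j y * cnj (dd (c j) y v))) = 0" if uv: "u \<in> V" "v \<in> V" for u v
  proof -
    define n where "n = dd \<tau> y u"
    have "\<tau> ` A \<subseteq> {x. proj X x = 0}" using \<tau>(2) by auto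
    moreover have "subspace {x. proj X x = 0}" by (rule linear_subspace_kernel[OF linear_proj])
    ultimately have n: "proj X n = 0" using dd_in_subspace[OF V uv(1) \<tau>(1)] unfolding n_def by blast
    define g where "g j y = (cmod (c j y))\<^sup>2" for j y
    have sg: "smooth_on A (g j)" for j unfolding g_def by (rule smooth_on_cmod2[OF sc])
    have "dd (g j) y v = 2 * Re (c j y * cnj (dd (c j) y v))" for j
    proof -
      have "dd (g j) y v = dd (\<lambda>y. c j y \<bullet> c j y) y v" by (simp add: g_def[abs_def] power2_norm_eq_inner)
      also have "\<dots> = c j y \<bullet> dd (c j) y v + dd (c j) y v \<bullet> c j y"
        by (rule dd_bilinear[OF V uv(2) sc sc bounded_bilinear_inner])
      finally show ?thesis by (simp add: inner_complex_def)
    qed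
    moreover have "(\<Sum>j\<in>UNIV. n $ j * dd (g j) y v) = 0"
    proof -
      have "(\<Sum>j\<in>UNIV. n $ j * dd (g j) y v) = (\<Sum>j\<in>UNIV. dd (\<lambda>y. n $ j * g j y) y v)"
        by (intro sum.cong refl dd_bounded_linear[OF V uv(2) sg bounded_linear_mult_right, symmetric])
      also have "\<dots> = dd (\<lambda>y. \<Sum>j\<in>UNIV. n $ j * g j y) y v"
      proof -
        have "((\<lambda>t. \<Sum>j\<in>UNIV. n $ j * g j (y + t *\<^sub>R v)) has_vector_derivative (\<Sum>j\<in>UNIV. dd (\<lambda>y. n $ j * g j y) y v)) (at 0)"
          by (intro has_vector_derivative_sum dd_vd[OF V uv(2)] smooth_on_mult smooth_on_const sg)
        then show ?thesis unfolding dd_def[of "\<lambda>y. \<Sum>j\<in>UNIV. n $ j * g j y"] by (simp add: vector_derivative_at)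
      qed
      also have "\<dots> = dd (\<lambda>y. - (\<Sum>j\<in>UNIV. n $ j * lam j)) y v"
      proof (rule dd_cong[OF V uv(2)])
        fix y assume "y \<in> A"
        then have "sec (f y) \<in> zero_level X lam" using sec_Z[OF f(2)] by (auto simp: Z_def)
        then have "Upsilon lam (sec (f y)) \<bullet> n = 0" using n by (simp add: zero_level_def)
        then have "(\<Sum>j\<in>UNIV. n $ j * (g j y + lam j)) = 0"
          by (simp add: Upsilon_def inner_vec_def g_def c_def mult.commute)
        then show "(\<Sum>j\<in>UNIV. n $ j * g j y) = - (\<Sum>j\<in>UNIV. n $ j * lam j)"
          by (simp add: ring_distribs sum.distrib)
      qed
      also have "\<dots> = 0" by (simp add: dd_def)
      finally show ?thesis .
    qed
    ultimately have "(\<Sum>j\<in>UNIV. n $ j * (2 * Re (c j y * cnj (dd (c j) y v)))) = 0" by simp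
    then have "(\<Sum>j\<in>UNIV. 2 * (n $ j * Re (c j y * cnj (dd (c j) y v)))) = 0" by (simp only: mult_ac)
    then have "(\<Sum>j\<in>UNIV. n $ j * Re (c j y * cnj (dd (c j) y v))) = 0" by (simp only: sum_distrib_left[symmetric])
    then have "2 * pi * (\<Sum>j\<in>UNIV. n $ j * Re (c j y * cnj (dd (c j) y v))) = 0" by simp
    then show ?thesis unfolding \<alpha>_def n_def[symmetric] by (simp only: sum_distrib_left mult.assoc)
  qed
  \<comment> \<open>In \<open>I - K\<close> the section has the components of \<open>f\<close>.
    Elsewhere its components are real and those of \<open>f\<close> are zero, so both sides
    vanish.\<close>
  have comp: "Im (dd (c j) y u * cnj (dd (c j) y v)) = Im (dd f y u $ j * cnj (dd f y v $ j))" for j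
  proof (cases "j \<in> I - K")
    case True
    have "dd (c j) y w = dd f y w $ j" if "w \<in> V" for w
      unfolding nth[OF f(1) that] by (rule dd_cong[OF V that]) (use True f(2) DomD(1) in \<open>simp add: c_def sec_nth\<close>)
    then show ?thesis using uv by simp
  next
    case False
    have "f ` A \<subseteq> W" using f(2) DomD(1) by blast
    then have "dd f y w \<in> W" if "w \<in> V" for w
      using dd_in_subspace[OF V that f(1) _ subspace_Cspace] by blast
    then have 1: "dd f y w $ j = 0" if "w \<in> V" for w using that False by (simp add: Cspace_def)
    have "c j ` A \<subseteq> \<real>" using False f(2) DomD(1) by (auto simp: c_def sec_nth)
    moreover have "subspace (\<real> :: complex set)" by (auto simp: subspace_def scaleR_conv_of_real)
    ultimately have "dd (c j) y w \<in> \<real>" if "w \<in> V" for w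
      using dd_in_subspace[OF V that sc] by blast
    then have "Im (dd (c j) y w) = 0" if "w \<in> V" for w using that by (simp add: complex_is_Real_iff)
    then show ?thesis using 1 uv by simp
  qed
  show "std_form (dd \<sigma> y u) (dd \<sigma> y v) = std_form (dd f y u) (dd f y v)"
    unfolding std_form_Im trm comp sum.distrib sum_subtractf moment[OF uv] moment[OF uv(2,1)] by simp
qed

end

locale two_frames = f1: frame X lam Q \<mu> I K B + f2: frame X lam Q \<mu>' I' K' B'
  for X :: "'d::finite \<Rightarrow> 'a::euclidean_space" and lam Q \<mu> I K B \<mu>' I' K' B'
begin

text \<open>Lifts into two different frames are not related by a group. The detour is through the
  points \<open>\<sigma>\<close> of the level set: reduction in the second frame compares
  \<open>g\<close> with \<open>\<sigma>\<close>, reduction in the first compares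
  \<open>\<sigma>\<close> with a lift \<open>h\<close>, and \<open>h\<close> and \<open>f\<close>
  have values in one domain and differ by elements of a countable group.\<close>

lemma base_lifts_pullback:
  fixes f g :: "'m::euclidean_space \<Rightarrow> complex ^ 'd"
  assumes V: "subspace V" "openin (top_of_set V) A" "y \<in> A" and uv: "u \<in> V" "v \<in> V"
    and f: "smooth_on A f" "\<And>y. y \<in> A \<Longrightarrow> f y \<in> f1.Dom"
    and g: "smooth_on A g" "\<And>y. y \<in> A \<Longrightarrow> g y \<in> f2.Dom"
    and eq: "\<And>y. y \<in> A \<Longrightarrow> pr X Q (section_map X lam \<mu> I K (f y)) = pr X Q (section_map X lam \<mu>' I' K' (g y))"
  shows "std_form (dd f y u) (dd f y v) = std_form (dd g y u) (dd g y v)"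
proof -
  define \<sigma> where "\<sigma> y = section_map X lam \<mu>' I' K' (g y)" for y
  have s\<sigma>: "smooth_on A \<sigma>" unfolding \<sigma>_def by (rule f2.smooth_sec[OF g])
  have \<sigma>Z: "\<sigma> y \<in> f1.Z" if "y \<in> A" for y
    using f1.pr_Z_saturated[OF eq[OF that]] f1.sec_Z[OF f(2)[OF that]] by (simp add: \<sigma>_def)
  obtain x0 where x0: "proj X x0 \<in> Q" "\<sigma> y = texp x0 * section_map X lam \<mu> I K (f y)"
    using eq[OF V(3)] unfolding f1.pr_eq_iff \<sigma>_def by blast
  obtain N F \<tau> where N: "openin (top_of_set f1.Z) N" "\<sigma> y \<in> N" "smooth_on N F" "smooth_on N \<tau>" "F (\<sigma> y) = f y"
    "\<And>z. z \<in> N \<Longrightarrow> F z \<in> f1.Dom" "\<And>z. z \<in> N \<Longrightarrow> proj X (\<tau> z) = 0"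
    "\<And>z. z \<in> N \<Longrightarrow> z = texp (x0 + \<tau> z) * section_map X lam \<mu> I K (F z)"
    by (rule f1.local_reduction[OF \<sigma>Z[OF V(3)] x0(2) f(2)[OF V(3)]]) (rule that)
  define A' where "A' = A \<inter> \<sigma> -` N"
  have A': "openin (top_of_set V) A'" unfolding A'_def
    by (rule openin_preimage_relopen[OF V(2) smooth_on_imp_continuous_on[OF s\<sigma>] _ N(1)]) (use \<sigma>Z in auto)
  have yA': "y \<in> A'" using V N by (simp add: A'_def)
  have AA: "A' \<subseteq> A" "\<And>y. y \<in> A' \<Longrightarrow> \<sigma> y \<in> N" by (auto simp: A'_def)
  define h where "h y = F (\<sigma> y)" for y
  have sh: "smooth_on A' h" unfolding h_def
    by (rule smooth_on_compose[OF smooth_on_subset[OF s\<sigma> AA(1)] N(3)]) (use AA in auto)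
  have st: "smooth_on A' (\<lambda>y. \<tau> (\<sigma> y))"
    by (rule smooth_on_compose[OF smooth_on_subset[OF s\<sigma> AA(1)] N(4)]) (use AA in auto)
  have hD: "h y \<in> f1.Dom" if "y \<in> A'" for y using N(6) AA(2)[OF that] by (simp add: h_def)
  let ?\<sigma>1 = "\<lambda>y. texp (x0 + \<tau> (\<sigma> y)) * section_map X lam \<mu> I K (h y)"
  let ?\<sigma>2 = "\<lambda>y. texp (0 + 0) * section_map X lam \<mu>' I' K' (g y)"
  have e1: "\<sigma> y = ?\<sigma>1 y" if "y \<in> A'" for y
    using N(8)[OF AA(2)[OF that]] by (simp add: h_def)
  have e2: "\<sigma> y = ?\<sigma>2 y" for y by (simp add: \<sigma>_def)
  have d1: "dd \<sigma> y w = dd ?\<sigma>1 y w" if "w \<in> V" for w by (rule dd_cong[OF V(1) A' yA' that e1])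
  have "std_form (dd f y u) (dd f y v) = std_form (dd h y u) (dd h y v)"
  proof (rule lifts_same_pullback[OF V(1) A' yA', where G="(\<lambda>g z. g * z) ` f1.Gam"])
    show "countable ((\<lambda>g z. g * z) ` f1.Gam)" using f1.countable_Gam by simp
    show "smooth_on A' f" by (rule smooth_on_subset[OF f(1) AA(1)])
    show "\<exists>g\<in>(\<lambda>g z. g * z) ` f1.Gam. f y = g (h y)" if y: "y \<in> A'" for y
    proof -
      have "pr X Q (section_map X lam \<mu> I K (h y)) = pr X Q (\<sigma> y)"
        unfolding f1.pr_eq_iff using e1[OF y] N(7)[OF AA(2)[OF y]] x0(1)
        by (intro exI[of _ "x0 + \<tau> (\<sigma> y)"]) (simp add: proj_simps)
      then have "pr X Q (section_map X lam \<mu> I K (h y)) = pr X Q (section_map X lam \<mu> I K (f y))"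
        using eq[of y] y AA(1) by (auto simp: \<sigma>_def)
      then show ?thesis using f1.orbit_sec[OF hD[OF y], of "f y"] f(2)[of y] y AA(1) by auto
    qed
  qed (use f1.Gam_cmod sh uv in \<open>auto simp: bounded_linear_vec_mult_left bounded_bilinear_std_form intro!: std_form_torus\<close>)
  also have "\<dots> = std_form (dd ?\<sigma>1 y u) (dd ?\<sigma>1 y v)"
    by (rule f1.std_form_reduction(1)[OF V(1) A' yA' uv sh hD st, symmetric]) (use N(7) AA(2) in auto)
  also have "\<dots> = std_form (dd \<sigma> y u) (dd \<sigma> y v)" by (simp add: d1 uv)
  also have "\<dots> = std_form (dd ?\<sigma>2 y u) (dd ?\<sigma>2 y v)" by (simp add: \<sigma>_def[abs_def])
  also have "\<dots> = std_form (dd g y u) (dd g y v)"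
    by (rule f2.std_form_reduction(1)[OF V uv g]) (auto simp: proj_simps)
  finally show ?thesis .
qed

end

section \<open>The covering of a base domain\<close>

text \<open>\<open>pt\<close> provides a base point for homotopies. For each component that may
  vanish in the domain, \<open>fpt\<close> provides a point of the polytope over which it does
  vanish, with no others than those in \<open>K\<close>; there its circle shrinks to a
  point.\<close>

locale good_frame = frame X lam Q \<mu> I K B
  for X :: "'d::finite \<Rightarrow> 'a::euclidean_space" and lam Q \<mu> I K B +
  assumes pt: "\<exists>\<nu>. (\<forall>k\<in>K. \<nu> \<bullet> X k = lam k) \<and> (\<forall>r. r \<notin> K \<longrightarrow> lam r < \<nu> \<bullet> X r)"
    and fpt: "\<And>h. h \<in> I - K - B \<Longrightarrow> \<exists>\<nu>. (\<forall>k\<in>K. \<nu> \<bullet> X k = lam k) \<and> \<nu> \<bullet> X h = lam h \<and> (\<forall>r. r \<notin> K \<longrightarrow> r \<noteq> h \<longrightarrow> lam r < \<nu> \<bullet> X r)"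
begin

text \<open>Only components in \<open>B\<close> are replaced by logarithms; the other components of
  a point of \<open>Dom\<close> may be zero.\<close>

definition E :: "complex ^ 'd \<Rightarrow> complex ^ 'd" where "E w = (\<chi> j. if j \<in> B then exp (w $ j) else w $ j)"

definition "CB = {w \<in> W. E w \<in> Dom}"

lemma E_nth: "E w $ j = (if j \<in> B then exp (w $ j) else w $ j)" by (simp add: E_def)

lemma smooth_E: "smooth_on S f \<Longrightarrow> smooth_on S (\<lambda>y. E (f y))"
proof (rule smooth_on_vec)
  fix j assume f: "smooth_on S f"
  show "smooth_on S (\<lambda>y. E (f y) $ j)"
    by (cases "j \<in> B") (simp_all add: E_nth smooth_on_exp smooth_on_nth f)
qed

lemma E_W: "w \<in> W \<Longrightarrow> E w \<in> W" using B by (auto simp: Cspace_def E_nth)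

lemma openin_CB: "openin (top_of_set W) CB"
proof -
  have "CB = W \<inter> E -` Dom" by (auto simp: CB_def)
  moreover have "openin (top_of_set W) (W \<inter> E -` Dom)"
    by (rule continuous_openin_preimage[OF smooth_on_imp_continuous_on[OF smooth_E[OF smooth_on_id]] _ openin_Dom])
       (use E_W in auto)
  ultimately show ?thesis by simp
qed

lemma DomI: "w \<in> W \<Longrightarrow> (\<And>h. h \<in> B \<Longrightarrow> w $ h \<noteq> 0) \<Longrightarrow> (\<And>r. r \<notin> I \<union> K \<Longrightarrow> sl w r > 0) \<Longrightarrow> w \<in> Dom"
  by (simp add: Dom_def)

lemma Dom_nonzero: "w \<in> Dom \<Longrightarrow> h \<in> B \<Longrightarrow> w $ h \<noteq> 0" by (simp add: Dom_def)

text \<open>A slit neighbourhood of \<open>u\<close>: quotients stay off the branch cut, so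
  logarithms over it differ from the principal one by integers alone.\<close>

definition "sheetbase u = {v \<in> Dom. \<forall>h\<in>B. v $ h / u $ h \<notin> \<real>\<^sub>\<le>\<^sub>0}"

text \<open>\<open>n h\<close> counts the periods by which the \<open>h\<close>-th logarithm is off
  the branch centred at \<open>w0\<close>; the strips have width \<open>2 * pi\<close> and do not
  overlap.\<close>

definition "sheet u w0 n = {w \<in> CB. E w \<in> sheetbase u \<and> (\<forall>h\<in>B. \<bar>Im (w $ h - w0 $ h) - 2 * pi * of_int (n h)\<bar> < pi)}"

lemma openin_sheetbase:
  assumes u: "u \<in> Dom" shows "openin (top_of_set Dom) (sheetbase u)"
proof -
  have "sheetbase u = Dom \<inter> (\<Inter>h\<in>B. (\<lambda>v. v $ h / u $ h) -` (- \<real>\<^sub>\<le>\<^sub>0))" by (auto simp: sheetbase_def)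
  moreover have "open (\<Inter>h\<in>B. (\<lambda>v :: complex ^ 'd. v $ h / u $ h) -` (- \<real>\<^sub>\<le>\<^sub>0))"
  proof (intro open_INT ballI open_vimage)
    fix h assume "h \<in> B"
    then show "continuous_on UNIV (\<lambda>v :: complex ^ 'd. v $ h / u $ h)"
      using Dom_nonzero[OF u] by (intro continuous_intros) auto
  qed (auto simp: open_Compl)
  ultimately show ?thesis by (simp add: openin_open_Int)
qed

lemma openin_sheet:
  assumes u: "u \<in> Dom" shows "openin (top_of_set CB) (sheet u w0 n)"
proof -
  have "sheet u w0 n = (CB \<inter> E -` sheetbase u) \<inter> (\<Inter>h\<in>B. {w. \<bar>Im (w $ h - w0 $ h) - 2 * pi * of_int (n h)\<bar> < pi})"
    by (auto simp: sheet_def)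
  moreover have "openin (top_of_set CB) (CB \<inter> E -` sheetbase u)"
    by (rule continuous_openin_preimage[OF smooth_on_imp_continuous_on[OF smooth_E[OF smooth_on_id]] _ openin_sheetbase[OF u]])
       (auto simp: CB_def)
  moreover have "open (\<Inter>h\<in>B. {w :: complex ^ 'd. \<bar>Im (w $ h - w0 $ h) - 2 * pi * of_int (n h)\<bar> < pi})"
    by (intro open_INT ballI open_Collect_less continuous_intros) auto
  ultimately show ?thesis by (simp add: openin_Int_open)
qed

lemma sheet_diffeo:
  assumes u: "u \<in> Dom" and w0: "w0 \<in> CB" "E w0 = u"
  shows "diffeo (sheet u w0 n) (sheetbase u) E"
proof -
  define g where "g v = (\<chi> h. if h \<in> B then w0 $ h + Ln (v $ h / u $ h) + of_real (2 * pi * of_int (n h)) * \<i> else v $ h)" for v :: "complex ^ 'd"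
  have g_nth: "g v $ h = (if h \<in> B then w0 $ h + Ln (v $ h / u $ h) + of_real (2 * pi * of_int (n h)) * \<i> else v $ h)" for v h
    by (simp add: g_def)
  have uB: "u $ h = exp (w0 $ h)" "u $ h \<noteq> 0" if "h \<in> B" for h using w0(2) that E_nth[of w0 h] by auto
  have periodic: "exp (z + of_real (2 * pi * of_int m) * \<i>) = exp z" for z and m :: int
    by (subst exp_eq) (auto simp: algebra_simps)
  have Eg: "E (g v) = v" if v: "v \<in> sheetbase u" for v
    unfolding vec_eq_iff
  proof
    fix h show "E (g v) $ h = v $ h"
    proof (cases "h \<in> B")
      case True
      have "v $ h / u $ h \<notin> \<real>\<^sub>\<le>\<^sub>0" using v True by (simp add: sheetbase_def)
      then have "v $ h / u $ h \<noteq> 0" by auto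
      have "E (g v) $ h = exp (w0 $ h + Ln (v $ h / u $ h))" using True by (simp only: E_nth g_nth if_True periodic)
      also have "\<dots> = u $ h * (v $ h / u $ h)" using \<open>v $ h / u $ h \<noteq> 0\<close> by (simp add: exp_add uB[OF True, symmetric])
      finally show ?thesis using uB[OF True] by simp
    qed (simp add: E_nth g_nth)
  qed
  have gW: "g v \<in> W" if "v \<in> W" for v using that B by (auto simp: Cspace_def g_nth)
  show ?thesis
  proof (rule diffeoI[where g=g])
    show "smooth_on (sheet u w0 n) E" by (rule smooth_E[OF smooth_on_id])
    show "smooth_on (sheetbase u) g"
    proof (rule smooth_on_vec)
      fix h show "smooth_on (sheetbase u) (\<lambda>v. g v $ h)"
      proof (cases "h \<in> B")
        case True
        have "smooth_on (sheetbase u) (\<lambda>v. w0 $ h + Ln (v $ h * inverse (u $ h)) + of_real (2 * pi * of_int (n h)) * \<i>)"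
          by (intro smooth_on_add smooth_on_const smooth_on_Ln smooth_on_mult smooth_on_nth smooth_on_id)
             (use True in \<open>auto simp: sheetbase_def divide_inverse\<close>)
        then show ?thesis using True by (simp only: g_nth if_True divide_inverse)
      qed (simp add: g_nth smooth_on_nth)
    qed
    show "E w \<in> sheetbase u" if "w \<in> sheet u w0 n" for w using that by (simp add: sheet_def)
    show "E (g v) = v" if "v \<in> sheetbase u" for v using Eg[OF that] .
    show "g v \<in> sheet u w0 n" if v: "v \<in> sheetbase u" for v
    proof -
      have vD: "v \<in> Dom" using v by (simp add: sheetbase_def)
      then have "g v \<in> CB" using gW Eg[OF v] DomD(1) by (simp add: CB_def)
      moreover have "\<bar>Im (g v $ h - w0 $ h) - 2 * pi * of_int (n h)\<bar> < pi" if h: "h \<in> B" for h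
      proof -
        have nr: "v $ h / u $ h \<notin> \<real>\<^sub>\<le>\<^sub>0" using v h by (simp add: sheetbase_def)
        then have "v $ h / u $ h \<noteq> 0" by auto
        then have "\<bar>Im (Ln (v $ h / u $ h))\<bar> < pi"
          using mpi_less_Im_Ln[of "v $ h / u $ h"] Im_Ln_le_pi[of "v $ h / u $ h"] nr Im_Ln_eq_pi[of "v $ h / u $ h"]
          by (auto simp: abs_less_iff complex_nonpos_Reals_iff)
        then show ?thesis using h by (simp add: g_nth)
      qed
      ultimately show ?thesis using Eg[OF v] v by (simp add: sheet_def)
    qed
    show "g (E w) = w" if w: "w \<in> sheet u w0 n" for w
      unfolding vec_eq_iff
    proof
      fix h show "g (E w) $ h = w $ h"
      proof (cases "h \<in> B")
        case True
        define z where "z = w $ h - w0 $ h + of_real (2 * pi * of_int (- n h)) * \<i>"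
        have "E w $ h / u $ h = exp (w $ h - w0 $ h)" using True by (simp add: E_nth uB[OF True] exp_diff)
        also have "\<dots> = exp z" unfolding z_def periodic ..
        finally have "Ln (E w $ h / u $ h) = Ln (exp z)" by simp
        also have "\<dots> = z"
          by (rule Ln_exp) (use w True in \<open>auto simp: sheet_def z_def abs_less_iff\<close>)
        finally show ?thesis using True by (simp add: g_nth z_def)
      qed (simp add: E_nth g_nth)
    qed
  qed
qed

lemma E_surj: assumes "u \<in> Dom" obtains w where "w \<in> CB" "E w = u"
proof -
  define w where "w = (\<chi> j. if j \<in> B then Ln (u $ j) else u $ j)"
  have "E w $ j = u $ j" for j using Dom_nonzero[OF assms] by (simp add: w_def E_nth)
  then have "E w = u" by (simp add: vec_eq_iff)
  moreover have "w \<in> W" using DomD(1)[OF assms] B by (auto simp: w_def Cspace_def)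
  ultimately show ?thesis using assms by (intro that[of w]) (auto simp: CB_def)
qed

lemma in_sheet:
  assumes u: "u \<in> Dom" and w0: "w0 \<in> CB" "E w0 = u" and w: "w \<in> CB" "E w \<in> sheetbase u"
  obtains n where "\<And>h. h \<notin> B \<Longrightarrow> n h = 0" "w \<in> sheet u w0 n"
proof -
  have "\<exists>m. \<bar>Im (w $ h - w0 $ h) - 2 * pi * of_int m\<bar> < pi" if h: "h \<in> B" for h
  proof -
    define q where "q = exp (w $ h - w0 $ h)"
    have "E w $ h = exp (w $ h)" "u $ h = exp (w0 $ h)" using h w0(2) by (auto simp: E_nth)
    then have "q = E w $ h / u $ h" by (simp add: q_def exp_diff)
    then have nr: "q \<notin> \<real>\<^sub>\<le>\<^sub>0" "q \<noteq> 0" using w(2) h by (auto simp: sheetbase_def)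
    have "exp (w $ h - w0 $ h) = exp (Ln q)" using nr by (simp add: q_def)
    then obtain m :: int where "w $ h - w0 $ h = Ln q + (of_int (2 * m) * pi) * \<i>" by (subst (asm) exp_eq) blast
    then have "Im (w $ h - w0 $ h) = Im (Ln q) + 2 * pi * of_int m" by simp
    moreover have "\<bar>Im (Ln q)\<bar> < pi"
      using mpi_less_Im_Ln[of q] Im_Ln_le_pi[of q] nr Im_Ln_eq_pi[of q]
      by (auto simp: abs_less_iff complex_nonpos_Reals_iff)
    ultimately show ?thesis by (intro exI[of _ m]) simp
  qed
  then obtain m where m: "\<And>h. h \<in> B \<Longrightarrow> \<bar>Im (w $ h - w0 $ h) - 2 * pi * of_int (m h)\<bar> < pi" by metis
  show ?thesis by (rule that[of "\<lambda>h. if h \<in> B then m h else 0"]) (use w m in \<open>auto simp: sheet_def\<close>)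
qed

lemma sheets_disjoint:
  assumes "\<And>h. h \<notin> B \<Longrightarrow> n h = 0" "\<And>h. h \<notin> B \<Longrightarrow> n' h = 0" "w \<in> sheet u w0 n" "w \<in> sheet u w0 n'"
  shows "n = n'"
proof
  fix h show "n h = n' h"
  proof (cases "h \<in> B")
    case True
    define x where "x = Im (w $ h - w0 $ h)"
    have "\<bar>x - 2 * pi * of_int (n h)\<bar> < pi" "\<bar>x - 2 * pi * of_int (n' h)\<bar> < pi"
      using assms(3,4) True by (simp_all add: sheet_def x_def)
    then have "\<bar>2 * pi * of_int (n h) - 2 * pi * of_int (n' h)\<bar> < 2 * pi" by linarith
    then have "2 * pi * \<bar>of_int (n h - n' h)\<bar> < 2 * pi * (1::real)"
      by (simp add: abs_mult right_diff_distrib[symmetric])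
    then have "\<bar>of_int (n h - n' h)\<bar> < (1::real)" by simp
    then have "n h - n' h = 0" by linarith
    then show ?thesis by simp
  qed (use assms in auto)
qed

lemma covering_E: "covering_space CB E Dom"
proof
  show "continuous_on CB E" by (rule smooth_on_imp_continuous_on[OF smooth_E[OF smooth_on_id]])
  show "E ` CB = Dom"
  proof (intro equalityI subsetI)
    fix u assume "u \<in> Dom" then show "u \<in> E ` CB" by (rule E_surj) auto
  qed (auto simp: CB_def)
  fix u assume u: "u \<in> Dom"
  obtain w0 where w0: "w0 \<in> CB" "E w0 = u" by (rule E_surj[OF u]) (rule that)
  \<comment> \<open>The values of \<open>n\<close> outside \<open>B\<close> do not affect the sheet.
    Normalizing them to 0 makes distinct indices give disjoint sheets.\<close>
  define v where "v = sheet u w0 ` {n. \<forall>h. h \<notin> B \<longrightarrow> n h = 0}"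
  have "u \<in> sheetbase u" using u Dom_nonzero[OF u] by (auto simp: sheetbase_def)
  moreover have "\<Union>v = CB \<inter> E -` sheetbase u"
  proof (intro equalityI subsetI)
    fix w assume w: "w \<in> CB \<inter> E -` sheetbase u"
    obtain n where "\<And>h. h \<notin> B \<Longrightarrow> n h = 0" "w \<in> sheet u w0 n" by (rule in_sheet[OF u w0, of w]) (use w in auto)
    then show "w \<in> \<Union>v" by (auto simp: v_def)
  qed (auto simp: v_def sheet_def)
  moreover have "pairwise disjnt v"
  proof (rule pairwiseI)
    fix S S' assume "S \<in> v" "S' \<in> v" "S \<noteq> S'"
    then obtain n n' where n: "\<And>h. h \<notin> B \<Longrightarrow> n h = 0" "\<And>h. h \<notin> B \<Longrightarrow> n' h = 0" "S = sheet u w0 n" "S' = sheet u w0 n'"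
      by (auto simp: v_def)
    then have "n \<noteq> n'" using \<open>S \<noteq> S'\<close> by auto
    then show "disjnt S S'" unfolding disjnt_iff n(3,4) using sheets_disjoint[of n n' _ u w0] n(1,2) by blast
  qed
  moreover have "\<forall>S\<in>v. openin (top_of_set CB) S" using openin_sheet[OF u] by (auto simp: v_def)
  moreover have "\<forall>S\<in>v. \<exists>g. homeomorphism S (sheetbase u) E g"
    using diffeo_homeomorphism[OF sheet_diffeo[OF u w0]] by (auto simp: v_def)
  ultimately show "\<exists>T. u \<in> T \<and> openin (top_of_set Dom) T \<and>
     (\<exists>v. \<Union> v = CB \<inter> E -` T \<and> (\<forall>u\<in>v. openin (top_of_set CB) u) \<and> pairwise disjnt v \<and> (\<forall>u\<in>v. \<exists>q. homeomorphism u T E q))"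
    using openin_sheetbase[OF u] by (intro exI[of _ "sheetbase u"] conjI exI[of _ v]) auto
qed

lemma local_diffeo_E:
  assumes x: "x \<in> CB"
  shows "\<exists>S. x \<in> S \<and> openin (top_of_set CB) S \<and> openin (top_of_set Dom) (E ` S) \<and> diffeo S (E ` S) E"
proof -
  have u: "E x \<in> Dom" using x by (simp add: CB_def)
  have b: "E x \<in> sheetbase (E x)" using u Dom_nonzero[OF u] by (auto simp: sheetbase_def)
  have d: "diffeo (sheet (E x) x (\<lambda>h. 0)) (sheetbase (E x)) E" by (rule sheet_diffeo[OF u x refl])
  then have "E ` sheet (E x) x (\<lambda>h. 0) = sheetbase (E x)" by (simp add: diffeo_def bij_betw_def)
  moreover have "x \<in> sheet (E x) x (\<lambda>h. 0)" using x b by (simp add: sheet_def)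
  ultimately show ?thesis using d openin_sheet[OF u] openin_sheetbase[OF u]
    by (intro exI[of _ "sheet (E x) x (\<lambda>h. 0)"]) auto
qed

text \<open>The part of the polytope under \<open>Dom\<close>. Its convexity makes straight segments
  available for every change of base point.\<close>

definition "R = {\<nu>. (\<forall>k\<in>K. \<nu> \<bullet> X k = lam k) \<and> (\<forall>r. r \<notin> I \<union> K \<longrightarrow> lam r < \<nu> \<bullet> X r) \<and>
   (\<forall>h\<in>I - K. lam h \<le> \<nu> \<bullet> X h) \<and> (\<forall>h\<in>B. lam h < \<nu> \<bullet> X h)}"

lemma convex_R: "convex R"
proof -
  have "R = (\<Inter>k\<in>K. {\<nu>. X k \<bullet> \<nu> = lam k}) \<inter> (\<Inter>r\<in>-(I \<union> K). {\<nu>. lam r < X r \<bullet> \<nu>}) \<inter>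
     (\<Inter>h\<in>I - K. {\<nu>. lam h \<le> X h \<bullet> \<nu>}) \<inter> (\<Inter>h\<in>B. {\<nu>. lam h < X h \<bullet> \<nu>})"
    by (auto simp: R_def inner_commute)
  then show ?thesis
    by (simp only:) (intro convex_Int convex_INT convex_hyperplane convex_halfspace_gt convex_halfspace_ge)
qed

text \<open>Action-angle coordinates on \<open>CB\<close>: the slack of \<open>\<nu>\<close> is the
  squared modulus and \<open>\<zeta> h\<close> the angle. In \<open>B\<close> the component is a
  logarithm, so its real part is half the logarithm of the slack and its angle is not reduced modulo
  \<open>2 * pi\<close>.\<close>

definition P :: "'a \<Rightarrow> ('d \<Rightarrow> real) \<Rightarrow> complex ^ 'd" where "P \<nu> \<zeta> = (\<chi> h. if h \<in> B then Complex (ln (\<nu> \<bullet> X h - lam h) / 2) (\<zeta> h)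
   else if h \<in> I - K then of_real (sqrt (\<nu> \<bullet> X h - lam h)) * cis (\<zeta> h) else 0)"

lemma P_nth: "P \<nu> \<zeta> $ h = (if h \<in> B then Complex (ln (\<nu> \<bullet> X h - lam h) / 2) (\<zeta> h)
   else if h \<in> I - K then of_real (sqrt (\<nu> \<bullet> X h - lam h)) * cis (\<zeta> h) else 0)"
  by (simp add: P_def)

lemma P_CB:
  assumes \<nu>: "\<nu> \<in> R" shows "P \<nu> \<zeta> \<in> CB"
proof -
  have W: "P \<nu> \<zeta> \<in> W" using B by (auto simp: Cspace_def P_nth)
  have m: "\<nu> \<bullet> X h = lam h + (cmod (E (P \<nu> \<zeta>) $ h))\<^sup>2" if h: "h \<in> I" for h
  proof -
    consider "h \<in> B" | "h \<in> I - K - B" | "h \<in> K" using h by blast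
    then show ?thesis
    proof cases
      case 1
      then have "0 < \<nu> \<bullet> X h - lam h" using \<nu> by (simp add: R_def)
      then have "(exp (ln (\<nu> \<bullet> X h - lam h) / 2))\<^sup>2 = \<nu> \<bullet> X h - lam h" by (simp flip: exp_double)
      then show ?thesis using 1 by (simp add: E_nth P_nth)
    next
      case 2
      then have "0 \<le> \<nu> \<bullet> X h - lam h" using \<nu> by (simp add: R_def)
      then show ?thesis using 2 by (simp add: E_nth P_nth norm_mult)
    next
      case 3
      then have "h \<notin> B" using B by blast
      then show ?thesis using 3 \<nu> by (simp add: E_nth P_nth R_def)
    qed
  qed
  have "E (P \<nu> \<zeta>) \<in> Dom"
  proof (rule DomI[OF E_W[OF W]])
    show "E (P \<nu> \<zeta>) $ h \<noteq> 0" if "h \<in> B" for h using that by (simp add: E_nth)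
    show "sl (E (P \<nu> \<zeta>)) r > 0" if "r \<notin> I \<union> K" for r
      using slack_moment(1)[OF E_W[OF W] m] \<nu> that by (simp add: R_def)
  qed
  then show ?thesis using W by (simp add: CB_def)
qed

lemma continuous_P:
  assumes "continuous_on S f" "\<And>h. continuous_on S (\<lambda>y. z y h)" "\<And>y. y \<in> S \<Longrightarrow> f y \<in> R"
  shows "continuous_on S (\<lambda>y. P (f y) (z y))"
proof -
  have "continuous_on S (\<lambda>y. P (f y) (z y) $ h)" for h
  proof -
    have "continuous_on S (\<lambda>y. Complex (ln (f y \<bullet> X h - lam h) / 2) (z y h))" if h: "h \<in> B"
    proof -
      have "f y \<bullet> X h - lam h \<noteq> 0" if "y \<in> S" for y using assms(3)[OF that] h by (auto simp: R_def)
      then show ?thesis unfolding Complex_eq using assms(1,2) by (intro continuous_intros) auto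
    qed
    moreover have "continuous_on S (\<lambda>y. of_real (sqrt (f y \<bullet> X h - lam h)) * cis (z y h))"
      using assms(1,2) by (intro continuous_intros)
    ultimately show ?thesis by (cases "h \<in> B"; cases "h \<in> I - K") (simp_all only: P_nth if_True if_False continuous_on_const)
  qed
  then have "continuous_on S (\<lambda>y. \<chi> h. P (f y) (z y) $ h)" by (rule continuous_on_vec_lambda)
  then show ?thesis by simp
qed

text \<open>The standard loop in the torus over \<open>\<nu>\<close> with winding numbers
  \<open>m\<close>. It closes up if \<open>m\<close> vanishes on \<open>B\<close>, where angles are
  not periodic.\<close>

definition tloop :: "'a \<Rightarrow> ('d \<Rightarrow> int) \<Rightarrow> real \<Rightarrow> complex ^ 'd" where
  "tloop \<nu> m t = P \<nu> (\<lambda>h. 2 * pi * of_int (m h) * t)"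

lemma homotopic_P:
  assumes "continuous_on ({0..1} \<times> {0..1}) n" "\<And>h. continuous_on ({0..1} \<times> {0..1}) (\<lambda>y. z y h)"
    and R: "\<And>s t. s \<in> {0..1} \<Longrightarrow> t \<in> {0..1} \<Longrightarrow> n (s, t) \<in> R"
    and b: "\<And>s. s \<in> {0..1} \<Longrightarrow> P (n (s, 1)) (z (s, 1)) = P (n (s, 0)) (z (s, 0))"
  shows "homotopic_loops CB (\<lambda>t :: real. P (n (0 :: real, t)) (z (0, t))) (\<lambda>t. P (n (1, t)) (z (1, t)))"
  unfolding homotopic_loops
proof (intro exI conjI ballI)
  show "continuous_on ({0..1} \<times> {0..1}) (\<lambda>y. P (n y) (z y))"
    by (rule continuous_P) (use assms in auto)
  show "(\<lambda>y. P (n y) (z y)) \<in> {0..1} \<times> {0..1} \<rightarrow> CB" using P_CB R by auto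
qed (use b in \<open>auto simp: pathfinish_def pathstart_def\<close>)

lemma P_periodic: "(\<And>h. h \<in> B \<Longrightarrow> m h = 0) \<Longrightarrow> P \<nu> (\<lambda>h. \<zeta> h + 2 * pi * of_int (m h)) = P \<nu> \<zeta>"
proof -
  assume m: "\<And>h. h \<in> B \<Longrightarrow> m h = 0"
  have "cis (\<zeta> h + 2 * pi * of_int (m h)) = cis (\<zeta> h)" for h
    by (simp add: cis_mult[symmetric] cis_multiple_2pi)
  then show ?thesis by (simp add: vec_eq_iff P_nth m)
qed

text \<open>Where the slack of a component outside \<open>B\<close> is zero, its angle is invisible.
  This is how windings disappear.\<close>

lemma P_cong: "(\<And>h. h \<in> B \<Longrightarrow> \<zeta> h = \<zeta>' h) \<Longrightarrow> (\<And>h. h \<in> I - K \<Longrightarrow> \<nu> \<bullet> X h \<noteq> lam h \<Longrightarrow> \<zeta> h = \<zeta>' h) \<Longrightarrow> P \<nu> \<zeta> = P \<nu> \<zeta>'"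
  unfolding vec_eq_iff P_nth by (intro allI if_cong refl) (metis diff_self mult_zero_left of_real_0 real_sqrt_zero)+

lemma segment_R: "\<nu> \<in> R \<Longrightarrow> \<nu>' \<in> R \<Longrightarrow> s \<in> {0..1} \<Longrightarrow> (1 - s) *\<^sub>R \<nu> + s *\<^sub>R \<nu>' \<in> R"
  using convex_R unfolding convex_alt by auto

lemma tloop_move:
  assumes m: "\<And>h. h \<in> B \<Longrightarrow> m h = 0" and \<nu>: "\<nu> \<in> R" "\<nu>' \<in> R"
  shows "homotopic_loops CB (tloop \<nu> m) (tloop \<nu>' m)"
proof -
  have "homotopic_loops CB (\<lambda>t. P ((1 - fst (0::real, t)) *\<^sub>R \<nu> + fst (0::real, t) *\<^sub>R \<nu>') (\<lambda>h. 2 * pi * of_int (m h) * snd (0::real, t)))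
     (\<lambda>t. P ((1 - fst (1::real, t)) *\<^sub>R \<nu> + fst (1::real, t) *\<^sub>R \<nu>') (\<lambda>h. 2 * pi * of_int (m h) * snd (1::real, t)))"
  proof (rule homotopic_P)
    fix s :: real assume "s \<in> {0..1}"
    show "P ((1 - fst (s, 1)) *\<^sub>R \<nu> + fst (s, 1) *\<^sub>R \<nu>') (\<lambda>h. 2 * pi * of_int (m h) * snd (s, 1)) =
      P ((1 - fst (s, 0)) *\<^sub>R \<nu> + fst (s, 0) *\<^sub>R \<nu>') (\<lambda>h. 2 * pi * of_int (m h) * snd (s, 0))"
      using P_periodic[where m=m and \<nu>="(1 - s) *\<^sub>R \<nu> + s *\<^sub>R \<nu>'" and \<zeta>="\<lambda>h. 0"] m by simp
  qed (use \<nu> segment_R in \<open>auto intro!: continuous_intros\<close>)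
  then show ?thesis by (simp add: tloop_def[abs_def])
qed

definition "R1 = {\<nu> \<in> R. \<forall>h\<in>I - K. lam h < \<nu> \<bullet> X h}"

lemma R1_point: obtains \<nu> where "\<nu> \<in> R1"
proof -
  obtain \<nu> where "\<forall>k\<in>K. \<nu> \<bullet> X k = lam k" "\<forall>r. r \<notin> K \<longrightarrow> lam r < \<nu> \<bullet> X r" using pt by blast
  then have "\<nu> \<in> R1" using B by (auto simp: R1_def R_def subset_iff intro: less_imp_le)
  then show ?thesis by (rule that)
qed

lemma R_facet: assumes "h \<in> I - K - B" obtains \<nu> where "\<nu> \<in> R" "\<nu> \<bullet> X h = lam h"
proof -
  obtain \<nu> where n: "\<forall>k\<in>K. \<nu> \<bullet> X k = lam k" "\<nu> \<bullet> X h = lam h" "\<forall>r. r \<notin> K \<longrightarrow> r \<noteq> h \<longrightarrow> lam r < \<nu> \<bullet> X r"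
    using fpt[OF assms] by blast
  have "\<nu> \<in> R"
    unfolding R_def
  proof (intro CollectI conjI ballI allI impI)
    show "lam r < \<nu> \<bullet> X r" if "r \<notin> I \<union> K" for r using that n(3) assms by auto
    show "lam r \<le> \<nu> \<bullet> X r" if "r \<in> I - K" for r using that n(2,3) by (cases "r = h") (auto intro: less_imp_le)
    show "lam r < \<nu> \<bullet> X r" if "r \<in> B" for r using that n(3) assms B by auto
  qed (use n(1) in auto)
  then show ?thesis using n(2) by (rule that)
qed

text \<open>One winding is removed at a time: move the base point to where component
  \<open>k\<close> vanishes, set \<open>m k\<close> to 0 there without changing the loop, and move
  back.\<close>

lemma tloop_contract:
  assumes \<nu>: "\<nu> \<in> R" and S: "finite S" "S \<subseteq> I - K - B"
  shows "(\<And>h. h \<in> B \<Longrightarrow> m h = 0) \<Longrightarrow> (\<And>h. h \<in> I - K - B \<Longrightarrow> h \<notin> S \<Longrightarrow> m h = 0)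
     \<Longrightarrow> homotopic_loops CB (tloop \<nu> m) (tloop \<nu> (\<lambda>h. 0))"
  using S
proof (induction S arbitrary: m rule: finite_induct)
  case empty
  then have "P \<nu> (\<lambda>h. 2 * pi * of_int (m h) * t) = P \<nu> (\<lambda>h. 2 * pi * of_int ((\<lambda>h. 0) h) * t)" for t
    by (intro P_cong) auto
  then have "tloop \<nu> m = tloop \<nu> (\<lambda>h. 0)" by (simp add: fun_eq_iff tloop_def)
  then show ?case using tloop_move[of "\<lambda>h. 0", OF _ \<nu> \<nu>] by simp
next
  case (insert k S)
  define m' where "m' = m(k := 0)"
  have k: "k \<in> I - K - B" using insert by auto
  obtain \<nu>' where n': "\<nu>' \<in> R" "\<nu>' \<bullet> X k = lam k" by (rule R_facet[OF k]) (rule that)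
  have mB: "m' h = 0" if "h \<in> B" for h using insert.prems(1)[OF that] by (simp add: m'_def)
  have "P \<nu>' (\<lambda>h. 2 * pi * of_int (m h) * t) = P \<nu>' (\<lambda>h. 2 * pi * of_int (m' h) * t)" for t
    by (intro P_cong) (use n'(2) k in \<open>auto simp: m'_def\<close>)
  then have e: "tloop \<nu>' m = tloop \<nu>' m'" by (simp add: fun_eq_iff tloop_def)
  have "homotopic_loops CB (tloop \<nu> m) (tloop \<nu>' m)" by (rule tloop_move[OF insert.prems(1) \<nu> n'(1)])
  moreover have "homotopic_loops CB (tloop \<nu>' m) (tloop \<nu> m')" unfolding e by (rule tloop_move[OF mB n'(1) \<nu>])
  moreover have "homotopic_loops CB (tloop \<nu> m') (tloop \<nu> (\<lambda>h. 0))"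
    by (rule insert.IH[OF mB]) (use insert.prems in \<open>auto simp: m'_def\<close>)
  ultimately show ?case by (meson homotopic_loops_trans)
qed

text \<open>With nonvanishing components, \<open>g\<close> has continuous angles and becomes a path
  of points of \<open>R\<close> with angles. In these coordinates it deforms linearly to the
  standard loop with the same windings, which is then contracted.\<close>

lemma generic_loop_contract:
  assumes g: "path g" "path_image g \<subseteq> CB" "pathfinish g = pathstart g"
    and nz: "\<And>t h. t \<in> {0..1} \<Longrightarrow> h \<in> I - K - B \<Longrightarrow> g t $ h \<noteq> 0" and \<nu>0: "\<nu>0 \<in> R"
  shows "homotopic_loops CB g (tloop \<nu>0 (\<lambda>h. 0))"
proof -
  have cg: "continuous_on {0..1} g" using g(1) by (simp add: path_def)
  have gC: "g t \<in> CB" if "t \<in> {0..1}" for t using g(2) that by (auto simp: path_image_def)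
  have gW: "g t \<in> W" "E (g t) \<in> Dom" if "t \<in> {0..1}" for t using gC[OF that] by (auto simp: CB_def)
  have g01: "g 1 = g 0" using g(3) by (simp add: pathfinish_def pathstart_def)
  have "\<forall>h\<in>I - K - B. \<exists>l. continuous_on {0..1} l \<and> (\<forall>t\<in>{0..1}. g t $ h = exp (l t))"
  proof
    fix h assume h: "h \<in> I - K - B"
    obtain l where "continuous_on {0..1::real} l" "\<And>t. t \<in> {0..1} \<Longrightarrow> g t $ h = exp (l t)"
      by (rule continuous_logarithm_on_contractible[of "{0..1::real}" "\<lambda>t. g t $ h"])
         (use cg nz[OF _ h] in \<open>auto intro!: continuous_intros convex_imp_contractible\<close>)
    then show "\<exists>l. continuous_on {0..1} l \<and> (\<forall>t\<in>{0..1}. g t $ h = exp (l t))" by blast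
  qed
  then obtain l where l: "\<And>h. h \<in> I - K - B \<Longrightarrow> continuous_on {0..1} (l h)"
    "\<And>h t. h \<in> I - K - B \<Longrightarrow> t \<in> {0..1} \<Longrightarrow> g t $ h = exp (l h t)" by metis
  define \<zeta> where "\<zeta> t h = (if h \<in> B then Im (g t $ h) else if h \<in> I - K then Im (l h t) else 0)" for t h
  \<comment> \<open>A dual basis, from which the point of \<open>R\<close> is recovered as a
    continuous function of the slacks along \<open>I\<close>.\<close>
  have "\<forall>h. \<exists>D. \<forall>k\<in>I. D \<bullet> X k = (if k = h then 1 else 0)"
  proof
    fix h
    obtain D where "\<And>k. k \<in> I \<Longrightarrow> D \<bullet> X k = (if k = h then 1 else 0)" by (rule exists_moment) (rule that)
    then show "\<exists>D. \<forall>k\<in>I. D \<bullet> X k = (if k = h then 1 else 0)" by blast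
  qed
  then obtain D where D: "\<And>h k. k \<in> I \<Longrightarrow> D h \<bullet> X k = (if k = h then 1 else 0)" by metis
  define n where "n t = (\<Sum>h\<in>I. (lam h + (cmod (E (g t) $ h))\<^sup>2) *\<^sub>R D h)" for t
  have nX: "n t \<bullet> X k = lam k + (cmod (E (g t) $ k))\<^sup>2" if "k \<in> I" for t k
    using that by (simp add: n_def inner_sum_left D if_distrib[of "\<lambda>x. _ * x"] sum.delta' cong: if_cong)
  have nR: "n t \<in> R" if t: "t \<in> {0..1}" for t
    unfolding R_def
  proof (intro CollectI conjI ballI allI impI)
    note s = slack_moment[OF DomD(1)[OF gW(2)[OF t]] nX]
    show "n t \<bullet> X k = lam k" if "k \<in> K" for k using s(2)[OF _ that] by auto
    show "lam r < n t \<bullet> X r" if "r \<notin> I \<union> K" for r using s(1)[of r] DomD(2)[OF gW(2)[OF t] that] by simp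
    show "lam h \<le> n t \<bullet> X h" if "h \<in> I - K" for h using that by (simp add: nX)
    show "lam h < n t \<bullet> X h" if "h \<in> B" for h
    proof -
      have "h \<in> I" "E (g t) $ h \<noteq> 0" using that B by (auto simp: E_nth)
      then show ?thesis by (simp add: nX)
    qed
  qed
  have cE: "continuous_on {0..1} (\<lambda>t. E (g t))"
    by (rule continuous_on_compose2[OF smooth_on_imp_continuous_on[OF smooth_E[OF smooth_on_id]] cg]) auto
  have cn: "continuous_on {0..1} n" unfolding n_def by (intro continuous_intros cE)
  have c\<zeta>: "continuous_on {0..1} (\<lambda>t. \<zeta> t h)" for h
    using l(1)[of h] cg unfolding \<zeta>_def by (cases "h \<in> B"; cases "h \<in> I - K") (auto intro!: continuous_intros)
  have Pg: "P (n t) (\<zeta> t) = g t" if t: "t \<in> {0..1}" for t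
    unfolding vec_eq_iff
  proof
    fix h
    consider "h \<in> B" | "h \<in> I - K - B" | "h \<notin> I - K" by blast
    then show "P (n t) (\<zeta> t) $ h = g t $ h"
    proof cases
      case 1
      then have "h \<in> I" using B by auto
      have "n t \<bullet> X h - lam h = (exp (Re (g t $ h)))\<^sup>2" using nX[OF \<open>h \<in> I\<close>, of t] 1 by (simp add: E_nth)
      also have "\<dots> = exp (2 * Re (g t $ h))" by (simp add: exp_double)
      finally show ?thesis using 1 by (simp add: P_nth \<zeta>_def complex_eq_iff)
    next
      case 2
      then have "n t \<bullet> X h - lam h = (cmod (g t $ h))\<^sup>2" using nX[of h t] by (simp add: E_nth)
      then have "P (n t) (\<zeta> t) $ h = of_real (exp (Re (l h t))) * cis (Im (l h t))"
        using 2 l(2)[OF 2 t] by (simp add: P_nth \<zeta>_def)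
      also have "\<dots> = exp (l h t)" by (simp add: exp_eq_polar)
      finally show ?thesis using l(2)[OF 2 t] by simp
    next
      case 3 then show ?thesis using B gW(1)[OF t] by (auto simp: P_nth Cspace_def)
    qed
  qed
  \<comment> \<open>Two logarithms of the same value differ by a period. In \<open>B\<close> the
    component of \<open>g\<close> is itself a logarithm and closes up, so it has no winding.\<close>
  have "\<exists>m :: int. \<zeta> 1 h = \<zeta> 0 h + 2 * pi * of_int m \<and> (h \<in> B \<longrightarrow> m = 0)" for h
  proof -
    consider "h \<in> I - K - B" | "h \<notin> I - K - B" by blast
    then show ?thesis
    proof cases
      case 1
      have "exp (l h 1) = exp (l h 0)" using l(2)[OF 1, of 0] l(2)[OF 1, of 1] g01 by simp
      then obtain k :: int where "l h 1 = l h 0 + (of_int (2 * k) * pi) * \<i>" by (subst (asm) exp_eq) blast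
      then show ?thesis using 1 by (intro exI[of _ k]) (simp add: \<zeta>_def)
    next
      case 2 then show ?thesis using g01 by (intro exI[of _ 0]) (auto simp: \<zeta>_def)
    qed
  qed
  then obtain m :: "'d \<Rightarrow> int" where m: "\<And>h. \<zeta> 1 h = \<zeta> 0 h + 2 * pi * of_int (m h)" "\<And>h. h \<in> B \<Longrightarrow> m h = 0" by metis
  \<comment> \<open>Points and angles are deformed together. The angles at the two ends of each
    intermediate path differ by the same \<open>2 * pi * of_int (m h)\<close>, so all of them are
    loops.\<close>
  let ?n = "\<lambda>y. (1 - fst y) *\<^sub>R n (snd y) + fst y *\<^sub>R \<nu>0"
  let ?z = "\<lambda>y h. (1 - fst y) * \<zeta> (snd y) h + fst y * (2 * pi * of_int (m h) * snd y)"
  have "homotopic_loops CB (\<lambda>t. P (?n (0::real, t)) (?z (0, t))) (\<lambda>t. P (?n (1, t)) (?z (1, t)))"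
  proof (rule homotopic_P)
    have "continuous_on ({0..1} \<times> {0..1}) (\<lambda>y :: real \<times> real. n (snd y))"
      by (rule continuous_on_compose2[OF cn continuous_on_snd[OF continuous_on_id]]) auto
    then show "continuous_on ({0..1} \<times> {0..1}) ?n" by (intro continuous_intros)
    fix h
    have "continuous_on ({0..1} \<times> {0..1}) (\<lambda>y :: real \<times> real. \<zeta> (snd y) h)"
      by (rule continuous_on_compose2[OF c\<zeta> continuous_on_snd[OF continuous_on_id]]) auto
    then show "continuous_on ({0..1} \<times> {0..1}) (\<lambda>y. ?z y h)" by (intro continuous_intros)
  next
    fix s t :: real assume st: "s \<in> {0..1}" "t \<in> {0..1}"
    show "?n (s, t) \<in> R" using segment_R[OF nR[OF st(2)] \<nu>0 st(1)] by simp
  next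
    fix s :: real assume "s \<in> {0..1}"
    have "?z (s, 1) = (\<lambda>h. ?z (s, 0) h + 2 * pi * of_int (m h))"
      by (rule ext) (simp add: m(1) algebra_simps)
    moreover have "?n (s, 1) = ?n (s, 0)" by (simp add: n_def g01)
    ultimately show "P (?n (s, 1)) (?z (s, 1)) = P (?n (s, 0)) (?z (s, 0))"
      using P_periodic[where m=m] m(2) by (simp only:)
  qed
  then have "homotopic_loops CB (\<lambda>t. P (n t) (\<zeta> t)) (tloop \<nu>0 m)" by (simp add: tloop_def[abs_def])
  moreover have "homotopic_loops CB g (\<lambda>t. P (n t) (\<zeta> t))"
    by (rule homotopic_loops_eq[OF g]) (simp add: Pg)
  moreover have "homotopic_loops CB (tloop \<nu>0 m) (tloop \<nu>0 (\<lambda>h. 0))"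
    by (rule tloop_contract[OF \<nu>0, of "I - K - B"]) (use m(2) in auto)
  ultimately show ?thesis by (meson homotopic_loops_trans)
qed

text \<open>The image of a polynomial curve is negligible in the complex plane, so each coordinate
  of an approximating polynomial loop avoids zero after an arbitrarily small constant shift. All
  points remain so close to \<open>g\<close> that the linear homotopy stays in the relatively open
  \<open>CB\<close>.\<close>

lemma loop_generic:
  assumes g: "path g" "path_image g \<subseteq> CB" "pathfinish g = pathstart g"
  obtains g' where "path g'" "path_image g' \<subseteq> CB" "pathfinish g' = pathstart g'" "homotopic_loops CB g g'"
    "\<And>t h. t \<in> {0..1} \<Longrightarrow> h \<in> I - K - B \<Longrightarrow> g' t $ h \<noteq> 0"
proof -
  obtain G where G: "open G" "CB = W \<inter> G" using openin_CB by (auto simp: openin_open)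
  have "compact (path_image g)" "path_image g \<subseteq> G" using g G by (auto simp: compact_path_image)
  then obtain e where e: "e > 0" "(\<Union>x\<in>path_image g. ball x e) \<subseteq> G" using compact_subset_open_imp_ball_epsilon_subset[OF _ G(1)] by metis
  obtain p where p: "polynomial_function p" "pathstart p = pathstart g" "pathfinish p = pathfinish g"
    "\<And>t. t \<in> {0..1} \<Longrightarrow> norm (p t - g t) < e / 2"
    by (rule path_approx_polynomial_function[OF g(1), of "e / 2"]) (use e in auto)
  \<comment> \<open>Half of \<open>e\<close> is spent on the polynomial approximation and half on
    the shifts of all coordinates; the extra 1 makes the second bound strict.\<close>
  define \<delta> where "\<delta> = e / (2 * (real CARD('d) + 1))"
  have d: "\<delta> > 0" using e by (simp add: \<delta>_def)
  have "\<exists>c. cmod c < \<delta> \<and> (\<forall>t\<in>{0..1}. p t $ h + c \<noteq> 0)" for h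
  proof -
    have "polynomial_function (\<lambda>t. p t $ h)"
      using polynomial_function_compose[OF p(1) polynomial_function_bounded_linear[OF bounded_linear_vec_nth]] by (simp add: o_def)
    then have "(\<lambda>t. p t $ h) differentiable_on {0..1}" by (rule differentiable_on_polynomial_function)
    then have "negligible ((\<lambda>t. p t $ h) ` {0..1})" by (intro negligible_differentiable_image_lowdim) simp
    then have "\<not> ball 0 \<delta> \<subseteq> (\<lambda>t. p t $ h) ` {0..1}"
    proof -
      assume neg: "negligible ((\<lambda>t. p t $ h) ` {0..1})"
      have "\<not> negligible (ball (0::complex) \<delta>)" using d by (intro open_not_negligible) auto
      then show ?thesis using negligible_subset[OF neg] by blast
    qed
    then obtain c where c: "c \<in> ball 0 \<delta>" "c \<notin> (\<lambda>t. p t $ h) ` {0..1}" by blast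
    then show ?thesis by (intro exI[of _ "- c"]) (auto simp: image_iff)
  qed
  then obtain c where c: "\<And>h. cmod (c h) < \<delta>" "\<And>h t. t \<in> {0..1} \<Longrightarrow> p t $ h + c h \<noteq> 0" by metis
  \<comment> \<open>Neither the polynomial nor the shift respects \<open>W\<close>; resetting the
    components outside \<open>I - K\<close> to zero restores it.\<close>
  define g' where "g' t = (\<chi> h. if h \<in> I - K then p t $ h + c h else 0)" for t
  have g'_nth: "g' t $ h = (if h \<in> I - K then p t $ h + c h else 0)" for t h by (simp add: g'_def)
  have cp: "continuous_on {0..1} p" using p(1) by (rule continuous_on_polymonial_function)
  have cg': "continuous_on {0..1} g'" unfolding g'_def
  proof (rule continuous_on_vec_lambda)
    fix h show "continuous_on {0..1} (\<lambda>t. if h \<in> I - K then p t $ h + c h else 0)"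
      using cp by (cases "h \<in> I - K") (auto intro!: continuous_intros)
  qed
  have close: "norm (g' t - g t) < e" if t: "t \<in> {0..1}" for t
  proof -
    have gW: "g t \<in> W" using g(2) t G by (auto simp: path_image_def)
    define a where "a = (\<chi> h. if h \<in> I - K then p t $ h - g t $ h else 0)"
    define b where "b = (\<chi> h. if h \<in> I - K then c h else 0)"
    have "norm (g' t - g t) = norm (a + b)"
      using gW by (intro arg_cong[of _ _ norm]) (auto simp: vec_eq_iff a_def b_def g'_nth Cspace_def)
    moreover have "norm a \<le> norm (p t - g t)"
      by (rule norm_le_componentwise_cart) (simp add: a_def)
    moreover have "norm b \<le> (\<Sum>h\<in>UNIV. norm (b $ h))" unfolding norm_vec_def by (rule L2_set_le_sum) simp
    moreover have "(\<Sum>h\<in>UNIV. norm (b $ h)) \<le> (\<Sum>h\<in>(UNIV :: 'd set). \<delta>)"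
      by (rule sum_mono) (use c(1) d in \<open>auto simp: b_def intro: less_imp_le\<close>)
    moreover have "(\<Sum>h\<in>(UNIV :: 'd set). \<delta>) < e / 2"
    proof -
      have "real CARD('d) * \<delta> < (real CARD('d) + 1) * \<delta>" using d by simp
      also have "\<dots> = e / 2" by (simp add: \<delta>_def field_simps)
      finally show ?thesis by simp
    qed
    ultimately show ?thesis using p(4)[OF t] norm_triangle_ineq[of a b] by linarith
  qed
  have seg: "closed_segment (g t) (g' t) \<subseteq> CB" if t: "t \<in> {0..1}" for t
  proof -
    have gt: "g t \<in> path_image g" using t by (simp add: path_image_def)
    have "closed_segment (g t) (g' t) \<subseteq> ball (g t) e"
      using close[OF t] e(1) by (intro closed_segment_subset convex_ball) (auto simp: dist_norm norm_minus_commute)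
    also have "\<dots> \<subseteq> G" using e(2) gt by blast
    finally have "closed_segment (g t) (g' t) \<subseteq> G" .
    moreover have "closed_segment (g t) (g' t) \<subseteq> W"
      using gt g(2) G(2) by (intro closed_segment_subset subspace_imp_convex subspace_Cspace) (auto simp: Cspace_def g'_nth)
    ultimately show ?thesis using G(2) by blast
  qed
  have lp: "pathfinish g' = pathstart g'"
    using p(2,3) g(3) by (simp add: pathfinish_def pathstart_def vec_eq_iff g'_nth)
  have pg': "path g'" using cg' by (simp add: path_def)
  have "homotopic_loops CB g g'" by (rule homotopic_loops_linear[OF g(1) pg' g(3) lp seg])
  moreover have "path_image g' \<subseteq> CB"
  proof -
    have "g' t \<in> CB" if "t \<in> {0..1}" for t using seg[OF that] ends_in_segment(2) by blast
    then show ?thesis unfolding path_image_def by blast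
  qed
  ultimately show ?thesis using lp pg' c(2) by (intro that) (auto simp: g'_nth)
qed

text \<open>Every loop, wherever it is based, is freely homotopic to one constant loop, which gives
  path connectedness at the same time.\<close>

lemma simply_connected_CB: "simply_connected CB"
  unfolding simply_connected_homotopic_loops
proof (intro allI impI)
  fix p q assume pq: "homotopic_loops CB p p \<and> homotopic_loops CB q q"
  obtain \<nu>0 where "\<nu>0 \<in> R1" by (rule R1_point) (rule that)
  then have n: "\<nu>0 \<in> R" by (simp add: R1_def)
  have *: "homotopic_loops CB g (tloop \<nu>0 (\<lambda>h. 0))" if "homotopic_loops CB g g" for g
  proof -
    have g: "path g" "path_image g \<subseteq> CB" "pathfinish g = pathstart g"
      using homotopic_loops_imp_path[OF that] homotopic_loops_imp_subset[OF that] homotopic_loops_imp_loop[OF that] by auto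
    obtain g' where g': "path g'" "path_image g' \<subseteq> CB" "pathfinish g' = pathstart g'" "homotopic_loops CB g g'"
      "\<And>t h. t \<in> {0..1} \<Longrightarrow> h \<in> I - K - B \<Longrightarrow> g' t $ h \<noteq> 0" by (rule loop_generic[OF g]) (rule that)
    show ?thesis using homotopic_loops_trans[OF g'(4) generic_loop_contract[OF g'(1-3,5) n]] .
  qed
  show "homotopic_loops CB p q" using *[of p] *[of q] pq homotopic_loops_trans homotopic_loops_sym by blast
qed

lemma universal_covering_E: "universal_covering CB E Dom"
  unfolding universal_covering_def using simply_connected_CB covering_E local_diffeo_E by blast

lemma Dom_nonempty: "Dom \<noteq> {}"
proof -
  obtain \<nu> where "\<nu> \<in> R1" by (rule R1_point) (rule that)
  then have "P \<nu> (\<lambda>h. 0) \<in> CB" by (intro P_CB) (simp add: R1_def)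
  then show ?thesis by (auto simp: CB_def)
qed

end

section \<open>Charts of the pieces\<close>

lemma dim_Cspace: "dim (Cspace J :: (complex ^ 'd::finite) set) = 2 * card J"
proof -
  define d where "d = (\<Union>j\<in>J. (\<lambda>b. axis j b) ` (Basis :: complex set))"
  have dB: "d \<subseteq> (Basis :: (complex ^ 'd) set)" by (auto simp: d_def Basis_vec_def)
  have "Cspace J = {x :: complex ^ 'd. \<forall>i\<in>Basis. i \<notin> d \<longrightarrow> x \<bullet> i = 0}"
  proof (intro equalityI subsetI)
    fix x :: "complex ^ 'd" assume x: "x \<in> Cspace J"
    show "x \<in> {x. \<forall>i\<in>Basis. i \<notin> d \<longrightarrow> x \<bullet> i = 0}"
    proof (intro CollectI ballI impI)
      fix i :: "complex ^ 'd" assume "i \<in> Basis" "i \<notin> d"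
      then obtain j b where "i = axis j b" "b \<in> Basis" "j \<notin> J" by (auto simp: Basis_vec_def d_def)
      then show "x \<bullet> i = 0" using x by (simp add: inner_axis Cspace_def)
    qed
  next
    fix x :: "complex ^ 'd" assume x: "x \<in> {x. \<forall>i\<in>Basis. i \<notin> d \<longrightarrow> x \<bullet> i = 0}"
    have "x $ j = 0" if "j \<notin> J" for j
    proof (rule euclidean_eqI)
      fix b :: complex assume b: "b \<in> Basis"
      have "axis j b \<notin> d"
      proof
        assume "axis j b \<in> d"
        then obtain j' b' where "j' \<in> J" "b' \<in> Basis" "axis j b = axis j' b'" by (auto simp: d_def)
        then show False using that b by (auto simp: axis_eq_axis)
      qed
      moreover have "axis j b \<in> Basis" using b by (simp add: axis_in_Basis_iff)
      ultimately have "x \<bullet> axis j b = 0" using x by blast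
      then show "x $ j \<bullet> b = 0 \<bullet> b" by (simp add: inner_axis)
    qed
    then show "x \<in> Cspace J" by (simp add: Cspace_def)
  qed
  then have "dim (Cspace J :: (complex ^ 'd) set) = card d" using dim_substandard[OF dB] by simp
  also have "card d = (\<Sum>j\<in>J. card ((\<lambda>b. axis j b :: complex ^ 'd) ` Basis))"
    unfolding d_def by (rule card_UN_disjoint) (auto simp: axis_eq_axis)
  also have "\<dots> = (\<Sum>j\<in>J. 2)"
    by (intro sum.cong refl, subst card_image) (auto simp: inj_on_def axis_eq_axis)
  finally show ?thesis by simp
qed

section \<open>The quotient topology of \<open>M\<close>\<close>

context quasi_polytope
begin

lemma topspace_Mtop: "topspace (Mtop X lam Q) = pr X Q ` zero_level X lam"
  by (simp add: Mtop_def)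

lemma continuous_pr: "continuous_map (top_of_set (zero_level X lam)) (Mtop X lam Q) (pr X Q)"
  unfolding continuous_map_def Mtop_def openin_quotient_top by auto

text \<open>The saturation of \<open>V\<close> is the union of its translates by elements of
  \<open>N\<close>, each of them open because \<open>N\<close> acts on the level set by
  homeomorphisms.\<close>

lemma open_pr:
  assumes V: "openin (top_of_set (zero_level X lam)) V" shows "openin (Mtop X lam Q) (pr X Q ` V)"
  unfolding Mtop_def openin_quotient_top
proof
  have VZ: "V \<subseteq> zero_level X lam" using V by (rule openin_imp_subset)
  then show "pr X Q ` V \<subseteq> pr X Q ` topspace (top_of_set (zero_level X lam))" by auto
  have "{z \<in> zero_level X lam. pr X Q z \<in> pr X Q ` V}
     = (\<Union>x\<in>{x. proj X x \<in> Q}. zero_level X lam \<inter> (\<lambda>z. texp x * z) -` V)"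
  proof (intro equalityI subsetI)
    fix z assume "z \<in> {z \<in> zero_level X lam. pr X Q z \<in> pr X Q ` V}"
    then obtain v where v: "z \<in> zero_level X lam" "v \<in> V" "pr X Q z = pr X Q v" by auto
    then obtain x where "proj X x \<in> Q" "v = texp x * z" unfolding pr_eq_iff by blast
    then show "z \<in> (\<Union>x\<in>{x. proj X x \<in> Q}. zero_level X lam \<inter> (\<lambda>z. texp x * z) -` V)" using v by auto
  next
    fix z assume "z \<in> (\<Union>x\<in>{x. proj X x \<in> Q}. zero_level X lam \<inter> (\<lambda>z. texp x * z) -` V)"
    then obtain x where x: "proj X x \<in> Q" "z \<in> zero_level X lam" "texp x * z \<in> V" by auto
    then have "pr X Q z = pr X Q (texp x * z)" unfolding pr_eq_iff by blast
    then show "z \<in> {z \<in> zero_level X lam. pr X Q z \<in> pr X Q ` V}" using x by blast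
  qed
  moreover
  have "openin (top_of_set (zero_level X lam)) (zero_level X lam \<inter> (\<lambda>z. texp x * z) -` V)" for x
    by (rule continuous_openin_preimage[OF linear_continuous_on[OF bounded_linear_vec_mult_left] _ V])
       (use zero_level_torus in auto)
  from this have "openin (top_of_set (zero_level X lam)) (\<Union>x\<in>{x. proj X x \<in> Q}. zero_level X lam \<inter> (\<lambda>z. texp x * z) -` V)"
    by (intro openin_Union) auto
  ultimately show "openin (top_of_set (zero_level X lam)) {x \<in> topspace (top_of_set (zero_level X lam)). pr X Q x \<in> pr X Q ` V}"
    by (simp only: topspace_euclidean_subtopology)
qed

end

section \<open>Base charts: their groups, parametrizations and free points\<close>

context frame
begin

definition "s u = pr X Q (sec u)"

definition "Gm = torus_action Dom Gam"

text \<open>Where no component in \<open>I - K\<close> vanishes the torus acts freely. This is the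
  explicit dense set of free points over which connectedness is checked.\<close>

definition "DomS = {u \<in> Dom. \<forall>h\<in>I - K. u $ h \<noteq> 0}"

lemma Gm_subgroup: "subgroup Gm (BijGroup Dom)"
proof (rule BijGroup_subgroupI)
  have bij: "bij_betw (restrict ((*) g) Dom) Dom Dom" and ex: "\<exists>h\<in>Gam. \<forall>x. h * (g * x) = x" if g: "g \<in> Gam" for g
  proof -
    obtain h where h: "h \<in> Gam" "h * g = 1" using Gam_group(3)[OF g] by blast
    have hg: "h * (g * x) = x" "g * (h * x) = x" for x using h(2) by (simp_all add: mult.assoc[symmetric] mult.commute[of g h])
    show "\<exists>h\<in>Gam. \<forall>x. h * (g * x) = x" using h hg by blast
    show "bij_betw (restrict ((*) g) Dom) Dom Dom"
      by (rule bij_betw_byWitness[where f'="(*) h"]) (use hg Dom_torus(1) Gam_cmod g h in auto)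
  qed
  show "Gm \<subseteq> Bij Dom" using bij by (auto simp: Gm_def torus_action_def Bij_def)
  show "Gm \<noteq> {}" using Gam_group(1) by (auto simp: Gm_def torus_action_def)
  fix f assume "f \<in> Gm"
  then obtain g where g: "g \<in> Gam" "f = restrict ((*) g) Dom" by (auto simp: Gm_def torus_action_def)
  obtain h where h: "h \<in> Gam" "\<forall>x. h * (g * x) = x" using ex[OF g(1)] by blast
  have "\<forall>x\<in>Dom. restrict ((*) h) Dom (f x) = x" using h g Dom_torus(1) Gam_cmod by auto
  moreover have "restrict ((*) h) Dom \<in> Gm" using h by (auto simp: Gm_def torus_action_def)
  ultimately show "\<exists>h\<in>Gm. \<forall>x\<in>Dom. h (f x) = x" by blast
  fix f' assume "f' \<in> Gm"
  then obtain g' where g': "g' \<in> Gam" "f' = restrict ((*) g') Dom" by (auto simp: Gm_def torus_action_def)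
  have "compose Dom f f' = restrict ((*) (g * g')) Dom"
    by (rule ext) (use g g' Dom_torus(1) Gam_cmod in \<open>auto simp: compose_def mult.assoc\<close>)
  then show "compose Dom f f' \<in> Gm" using Gam_group(2)[OF g(1) g'(1)] by (auto simp: Gm_def torus_action_def)
qed

lemma Gm_smooth: "f \<in> Gm \<Longrightarrow> smooth_on Dom f"
proof -
  assume "f \<in> Gm"
  then obtain g where "f = restrict ((*) g) Dom" by (auto simp: Gm_def torus_action_def)
  then show ?thesis
    using smooth_on_cong[OF smooth_on_bounded_linear[OF bounded_linear_vec_mult_left[of g]], of Dom f] by auto
qed

lemma orb_Gm: "u \<in> Dom \<Longrightarrow> orb Gm u = (\<lambda>g. g * u) ` Gam"
  by (auto simp: orb_def Gm_def torus_action_def image_image)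

lemma s_eq_iff: "u \<in> Dom \<Longrightarrow> u' \<in> Dom \<Longrightarrow> s u = s u' \<longleftrightarrow> u' \<in> orb Gm u"
  unfolding s_def using orbit_sec by (auto simp: orb_Gm)

lemma s_image: "s ` Dom = pr X Q ` Z"
proof (intro equalityI subsetI)
  fix y assume "y \<in> pr X Q ` Z"
  then obtain z where z: "z \<in> Z" "y = pr X Q z" by blast
  obtain u where "u \<in> Dom" "pr X Q z = pr X Q (sec u)" by (rule Z_rep_pr[OF z(1)]) (rule that)
  then show "y \<in> s ` Dom" using z by (simp add: s_def)
qed (use sec_Z in \<open>auto simp: s_def\<close>)

lemma Z_zero_level: "Z \<subseteq> zero_level X lam" by (auto simp: Z_def)

lemma s_continuous: "continuous_map (top_of_set Dom) (subtopology (Mtop X lam Q) (pr X Q ` Z)) s"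
proof -
  have "continuous_on Dom sec" using smooth_on_imp_continuous_on[OF smooth_sec[OF smooth_on_id]] by blast
  then have "continuous_map (top_of_set Dom) (top_of_set (zero_level X lam)) sec"
    using sec_Z Z_zero_level by auto
  from continuous_map_compose[OF this continuous_pr] have "continuous_map (top_of_set Dom) (Mtop X lam Q) s"
    by (simp add: s_def[abs_def] o_def)
  then show ?thesis using s_image by (auto simp: continuous_map_in_subtopology)
qed

text \<open>The preimage in \<open>Z\<close> of the image of \<open>V\<close> is open, since near
  each of its points \<open>local_reduction\<close> gives a continuous map to \<open>Dom\<close>
  whose values parametrize the same classes. Openness of the projection, together with saturation of
  \<open>Z\<close>, then carries over to the quotient.\<close>

lemma s_open: "open_map (top_of_set Dom) (subtopology (Mtop X lam Q) (pr X Q ` Z)) s"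
  unfolding open_map_def
proof (intro allI impI)
  fix V assume V: "openin (top_of_set Dom) V"
  have VD: "V \<subseteq> Dom" using V by (rule openin_imp_subset)
  define Z' where "Z' = {z \<in> Z. pr X Q z \<in> s ` V}"
  have "openin (top_of_set Z) Z'"
  proof (subst openin_subopen, intro ballI)
    fix z assume z: "z \<in> Z'"
    then obtain u0 where u0: "u0 \<in> V" "pr X Q (sec u0) = pr X Q z" by (auto simp: Z'_def s_def)
    then obtain x0 where x0: "proj X x0 \<in> Q" "z = texp x0 * sec u0" unfolding pr_eq_iff by blast
    obtain N f \<tau> where N: "openin (top_of_set Z) N" "z \<in> N" "smooth_on N f" "f z = u0"
      "\<And>z. z \<in> N \<Longrightarrow> f z \<in> Dom" "\<And>z. z \<in> N \<Longrightarrow> proj X (\<tau> z) = 0" "\<And>z. z \<in> N \<Longrightarrow> z = texp (x0 + \<tau> z) * sec (f z)"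
      by (rule local_reduction[of z x0 u0]) (use z u0 x0 VD in \<open>auto simp: Z'_def\<close>)
    define N' where "N' = N \<inter> f -` V"
    have "openin (top_of_set Z) N'" unfolding N'_def
      by (rule openin_preimage_relopen[OF N(1) smooth_on_imp_continuous_on[OF N(3)] _ V]) (use N(5) in auto)
    moreover have "z \<in> N'" using N u0 by (simp add: N'_def)
    moreover have "N' \<subseteq> Z'"
    proof
      fix y assume y: "y \<in> N'"
      then have yN: "y \<in> N" "f y \<in> V" by (auto simp: N'_def)
      have "pr X Q (sec (f y)) = pr X Q y" unfolding pr_eq_iff
        using N(6,7)[OF yN(1)] x0(1) by (intro exI[of _ "x0 + \<tau> y"]) (simp add: proj_simps)
      then show "y \<in> Z'" using yN openin_imp_subset[OF N(1)] by (auto simp: Z'_def s_def image_iff intro!: bexI[of _ "f y"])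
    qed
    ultimately show "\<exists>T. openin (top_of_set Z) T \<and> z \<in> T \<and> T \<subseteq> Z'" by blast
  qed
  then obtain G where G: "open G" "Z' = Z \<inter> G" by (auto simp: openin_open)
  have "openin (Mtop X lam Q) (pr X Q ` (zero_level X lam \<inter> G))"
    by (rule open_pr) (simp add: openin_open_Int G)
  moreover have "s ` V = pr X Q ` (zero_level X lam \<inter> G) \<inter> pr X Q ` Z"
  proof (intro equalityI subsetI)
    fix y assume "y \<in> s ` V"
    then obtain u where u: "u \<in> V" "y = s u" by blast
    then have "sec u \<in> Z'" using sec_Z VD by (auto simp: Z'_def s_def)
    then show "y \<in> pr X Q ` (zero_level X lam \<inter> G) \<inter> pr X Q ` Z" using u G Z_zero_level by (auto simp: s_def)
  next
    fix y assume "y \<in> pr X Q ` (zero_level X lam \<inter> G) \<inter> pr X Q ` Z"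
    then obtain z z1 where z: "y = pr X Q z" "z \<in> G" "z1 \<in> Z" "pr X Q z = pr X Q z1" by auto
    then have "z \<in> Z'" using pr_Z_saturated[OF z(4)] G by blast
    then show "y \<in> s ` V" using z by (simp add: Z'_def)
  qed
  ultimately show "openin (subtopology (Mtop X lam Q) (pr X Q ` Z)) (s ` V)" unfolding openin_subtopology by blast
qed

lemma DomS_free:
  assumes "u \<in> DomS" "f \<in> Gm" "f u = u" shows "\<forall>y\<in>Dom. f y = y"
proof -
  obtain g where g: "g \<in> Gam" "f = restrict ((*) g) Dom" using assms(2) by (auto simp: Gm_def torus_action_def)
  have "g $ j = 1" for j
  proof (cases "j \<in> I - K")
    case True
    have "g * u = u" using assms g by (simp add: DomS_def)
    then have "g $ j * u $ j = u $ j" by (metis vector_mult_component)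
    then show ?thesis using assms(1) True by (auto simp: DomS_def)
  next
    case False then show ?thesis using g(1) by (auto simp: Gam_def torus_proj_def)
  qed
  then have "g = 1" by (simp add: vec_eq_iff)
  then show ?thesis using g(2) by simp
qed

text \<open>Vanishing components are replaced by small positive numbers; this stays in
  \<open>Dom\<close>, which is relatively open in \<open>W\<close>.\<close>

lemma DomS_dense: "Dom \<subseteq> closure DomS"
proof
  fix u assume u: "u \<in> Dom"
  define v where "v e = (\<chi> h. if h \<in> I - K \<and> u $ h = 0 then complex_of_real e else u $ h)" for e
  obtain G where G: "open G" "Dom = W \<inter> G" using openin_Dom by (auto simp: openin_open)
  have vW: "v e \<in> W" for e using DomD(1)[OF u] by (auto simp: v_def Cspace_def)
  have "continuous_on UNIV v" unfolding v_def
  proof (rule continuous_on_vec_lambda)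
    fix h show "continuous_on UNIV (\<lambda>e. if h \<in> I - K \<and> u $ h = 0 then complex_of_real e else u $ h)"
      by (cases "h \<in> I - K \<and> u $ h = 0") (auto simp: continuous_on_of_real_id)
  qed
  moreover have v0: "v 0 = u" by (simp add: v_def vec_eq_iff)
  ultimately have lim: "((\<lambda>n. v (1 / real (Suc n))) \<longlongrightarrow> u) sequentially"
    using continuous_on_tendsto_compose[of UNIV v "\<lambda>n. 1 / real (Suc n)" 0 sequentially] LIMSEQ_inverse_real_of_nat
    by (simp add: inverse_eq_divide)
  then have "\<forall>\<^sub>F n in sequentially. v (1 / real (Suc n)) \<in> G"
    using topological_tendstoD[OF lim G(1)] u G(2) by blast
  then have "\<forall>\<^sub>F n in sequentially. v (1 / real (Suc n)) \<in> closure DomS"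
  proof (rule eventually_mono)
    fix n assume "v (1 / real (Suc n)) \<in> G"
    then have "v (1 / real (Suc n)) \<in> Dom" using vW G by simp
    moreover have "\<forall>h\<in>I - K. v (1 / real (Suc n)) $ h \<noteq> 0" by (auto simp: v_def simp del: of_nat_Suc)
    ultimately have "v (1 / real (Suc n)) \<in> DomS" by (simp add: DomS_def)
    then show "v (1 / real (Suc n)) \<in> closure DomS" using closure_subset by blast
  qed
  from Lim_in_closed_set[OF closed_closure this _ lim] show "u \<in> closure DomS" by simp
qed

lemma covered_modelI:
  assumes "open_in_Rk k D" "universal_covering D q Dom" shows "covered_model k D Dom q Gm"
  using assms Gm_subgroup Gm_smooth by (intro covered_model.intro)

text \<open>An open set missing the preimage would have, the covering being an open map, an open
  image missing the dense set below.\<close>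

lemma preimage_DomS_dense:
  assumes uc: "universal_covering D q Dom" shows "D \<subseteq> closure {x \<in> D. q x \<in> DomS}"
proof
  fix x assume x: "x \<in> D"
  show "x \<in> closure {x \<in> D. q x \<in> DomS}"
  proof (rule ccontr)
    assume nx: "x \<notin> closure {x \<in> D. q x \<in> DomS}"
    define N where "N = D \<inter> - closure {x \<in> D. q x \<in> DomS}"
    have "openin (top_of_set D) N" unfolding N_def by (intro openin_open_Int open_Compl closed_closure)
    then have "openin (top_of_set Dom) (q ` N)" by (rule covering_space_open_map[OF universal_coveringD(1)[OF uc]])
    then obtain G where G: "open G" "q ` N = Dom \<inter> G" by (auto simp: openin_open)
    have "q x \<in> q ` N" using x nx by (simp add: N_def)
    then have "q x \<in> G" "q x \<in> closure DomS" using G DomS_dense by auto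
    then have "G \<inter> DomS \<noteq> {}" using G(1) open_Int_closure_eq_empty by blast
    then obtain y where y: "y \<in> G" "y \<in> DomS" by blast
    then have "y \<in> q ` N" using G by (auto simp: DomS_def)
    then obtain x' where "x' \<in> N" "q x' \<in> DomS" using y by auto
    then show False using closure_subset[of "{x \<in> D. q x \<in> DomS}"] by (auto simp: N_def)
  qed
qed

lemma frame_qchart_on:
  fixes c :: "((complex ^ 'd) set, complex ^ 'd) qchart"
  assumes k: "open_in_Rk k (cdom c)" and uc: "universal_covering (cdom c) q Dom"
    and c: "cgrp c = covering_group (cdom c) q Gm" "patch c = pr X Q ` Z" "\<And>x. x \<in> cdom c \<Longrightarrow> chart_pt c x = s (q x)"
    and T: "openin T (pr X Q ` Z)" "subtopology T (pr X Q ` Z) = subtopology (Mtop X lam Q) (pr X Q ` Z)"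
    and con: "connected {x \<in> cdom c. q x \<in> DomS}"
  shows "qchart_on k T c"
proof -
  interpret cm: covered_model k "cdom c" Dom q Gm by (rule covered_modelI[OF k uc])
  show ?thesis
    by (rule cm.qchart_onI[where s=s and N="{x \<in> cdom c. q x \<in> DomS}"])
       (use c T s_continuous s_open s_image s_eq_iff con preimage_DomS_dense[OF uc] DomS_free in auto)
qed

lemma frame_premodel:
  fixes c :: "((complex ^ 'd) set, complex ^ 'd) qchart"
  assumes k: "open_in_Rk k (cdom c)" and uc: "universal_covering (cdom c) q Dom"
    and c: "cgrp c = covering_group (cdom c) q Gm" "\<And>x. x \<in> cdom c \<Longrightarrow> chart_pt c x = s (q x)"
    and V: "openin (top_of_set (cdom c)) V" "{x \<in> cdom c. q x \<in> DomS} \<subseteq> V" "V = {x \<in> cdom c. chart_pt c x \<in> P}"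
    and con: "connected {x \<in> cdom c. q x \<in> DomS}"
  shows "premodel k V (restrict_group (cgrp c) V)"
proof -
  interpret cm: covered_model k "cdom c" Dom q Gm by (rule covered_modelI[OF k uc])
  have VD: "V \<subseteq> cdom c" using V(1) by (rule openin_imp_subset)
  have "cdom c \<noteq> {}" using k by (auto simp: open_in_Rk_def)
  then obtain x where "x \<in> cdom c" by (meson ex_in_conv)
  then have "x \<in> closure {x \<in> cdom c. q x \<in> DomS}" using preimage_DomS_dense[OF uc] by (rule rev_subsetD)
  then have "{x \<in> cdom c. q x \<in> DomS} \<noteq> {}" by (metis closure_empty empty_iff)
  then have "V \<noteq> {}" using V(2) by blast
  show ?thesis unfolding c(1)
  proof (rule cm.premodel_open_subset[OF V(1) \<open>V \<noteq> {}\<close> _ V(2) con])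
    show "V \<subseteq> closure {x \<in> cdom c. q x \<in> DomS}" using VD preimage_DomS_dense[OF uc] by blast
    fix x y assume xy: "x \<in> V" "y \<in> cdom c" "q y \<in> orb Gm (q x)"
    then have "chart_pt c x = chart_pt c y"
      using s_eq_iff[of "q x" "q y"] c(2) VD universal_coveringD(5)[OF uc] by auto
    then show "y \<in> V" using xy VD unfolding V(3) by auto
  qed (use DomS_free in auto)
qed

text \<open>A chart map is defined on orbits as sets. An arbitrary representative of the orbit may
  be used, because \<open>s\<close> after \<open>q\<close> is constant on orbits.\<close>

lemma chart_exists:
  fixes D :: "(complex ^ 'd) set"
  assumes k: "open_in_Rk k D" and uc: "universal_covering D q Dom"
  shows "\<exists>c. cdom c = D \<and> cgrp c = covering_group D q Gm \<and> patch c = P \<and> (\<forall>x\<in>D. chart_pt c x = s (q x))"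
proof -
  interpret cm: covered_model k D Dom q Gm by (rule covered_modelI[OF k uc])
  let ?c = "QChart P (\<lambda>A. s (q (SOME x. x \<in> A))) D cm.\<Lambda>"
  have "chart_pt ?c x = s (q x)" if x: "x \<in> D" for x
  proof -
    have "x \<in> orb cm.\<Lambda> x" by (rule orb_refl[OF cm.Lambda_subgroup x])
    then have "(SOME y. y \<in> orb cm.\<Lambda> x) \<in> orb cm.\<Lambda> x" by (rule someI)
    then have "(SOME y. y \<in> orb cm.\<Lambda> x) \<in> D" "q (SOME y. y \<in> orb cm.\<Lambda> x) \<in> orb Gm (q x)"
      using cm.orb_Lambda[OF x] by auto
    then have "s (q x) = s (q (SOME y. y \<in> orb cm.\<Lambda> x))"
      using s_eq_iff[of "q x"] universal_coveringD(5)[OF uc] x by auto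
    then show ?thesis by (simp add: chart_pt_def)
  qed
  then show ?thesis by (intro exI[of _ ?c]) auto
qed

end

context good_frame
begin

lemma dim_CB: "open_in_Rk (2 * card (I - K)) CB"
proof -
  have "CB \<noteq> {}" using Dom_nonempty E_surj by (metis all_not_in_conv)
  moreover have "span CB = W" by (rule span_relopen[OF subspace_Cspace openin_CB \<open>CB \<noteq> {}\<close>])
  ultimately show ?thesis using openin_CB dim_Cspace[of "I - K"] unfolding open_in_Rk_def by (metis dim_span)
qed

lemma connected_Dom: "connected Dom"
  using connected_continuous_image[OF smooth_on_imp_continuous_on[OF smooth_E[OF smooth_on_id]], of CB]
    simply_connected_imp_connected[OF simply_connected_CB] covering_space_imp_surjective[OF covering_E] by simp

lemma good_frame_all: "good_frame X lam Q \<mu> I K (I - K)"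
  using pt K by unfold_locales (use I in auto)

text \<open>\<open>DomS\<close> is the domain of the frame with \<open>B\<close> enlarged to
  \<open>I - K\<close>. That frame is good as well, its condition on facet points being void, so the
  set is the image of a simply connected covering.\<close>

lemma connected_DomS: "connected DomS"
proof -
  interpret J: good_frame X lam Q \<mu> I K "I - K" by (rule good_frame_all)
  have "DomS = J.Dom" using B by (auto simp: DomS_def Dom_def J.Dom_def)
  then show ?thesis using J.connected_Dom by simp
qed

end

section \<open>Compatibility of the charts\<close>

text \<open>The regular charts at \<open>I\<close> and \<open>I'\<close> overlap where all
  components outside \<open>I \<inter> I'\<close> are nonzero. The two frames describe this set from
  either side.\<close>

locale overlap_frames = f1: good_frame X lam Q \<mu> I "{}" "I - I'" + f2: good_frame X lam Q \<mu>' I' "{}" "I' - I"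
  for X :: "'d::finite \<Rightarrow> 'a::euclidean_space" and lam Q \<mu> I \<mu>' I'
begin

text \<open>Minus the phases of the components in \<open>I - I'\<close>, completed to the kernel of
  \<open>proj X\<close>. On the covering the phase is the imaginary part of a logarithm, hence
  globally defined.\<close>

definition tau :: "complex ^ 'd \<Rightarrow> real ^ 'd" where
  "tau w = f2.kap (\<chi> k. if k \<in> I - I' then - Im (w $ k) / (2 * pi) else 0)"

text \<open>The change of charts in logarithmic coordinates: rotate the section over
  \<open>I\<close> by \<open>tau\<close> until its components outside \<open>I'\<close> are
  positive, then read off those in \<open>I'\<close>, as logarithms on
  \<open>I' - I\<close>.\<close>

definition FF :: "complex ^ 'd \<Rightarrow> complex ^ 'd" where
  "FF w = (\<chi> j. if j \<in> I' - I then Complex (ln (f1.sl (f1.E w) j) / 2) (2 * pi * tau w $ j)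
     else if j \<in> I \<inter> I' then cis (2 * pi * tau w $ j) * w $ j else 0)"

lemma FF_nth: "FF w $ j = (if j \<in> I' - I then Complex (ln (f1.sl (f1.E w) j) / 2) (2 * pi * tau w $ j)
     else if j \<in> I \<inter> I' then cis (2 * pi * tau w $ j) * w $ j else 0)"
  by (simp add: FF_def)

lemma tau_nth:
  "k \<in> I - I' \<Longrightarrow> tau w $ k = - Im (w $ k) / (2 * pi)" "k \<notin> I \<union> I' \<Longrightarrow> tau w $ k = 0"
  by (auto simp: tau_def f2.kap_def)

lemma proj_tau: "proj X (tau w) = 0" by (simp add: tau_def f2.proj_kap)

lemma smooth_tau: "smooth_on S tau"
proof (rule smooth_on_vec)
  fix j
  define t where "t k w = (if k \<in> I - I' then - Im (w $ k) / (2 * pi) else 0)" for k and w :: "complex ^ 'd"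
  have t: "smooth_on S (t k)" for k
  proof (cases "k \<in> I - I'")
    case True
    then have "t k = (\<lambda>w. - Im (w $ k) * inverse (2 * pi))" by (simp only: t_def fun_eq_iff if_True divide_inverse simp_thms)
    then show ?thesis by (simp only:) (intro smooth_on_mult smooth_on_minus smooth_on_Im smooth_on_nth smooth_on_id smooth_on_const)
  next
    case False
    then have "t k = (\<lambda>w. 0)" by (simp only: t_def fun_eq_iff if_False simp_thms)
    then show ?thesis by simp
  qed
  have "tau w $ j = (if j \<in> I' then - (\<Sum>k\<in>-(I' \<union> {}). f2.a j k * t k w) else t j w)" for w
    by (simp add: tau_def f2.kap_def t_def)
  then show "smooth_on S (\<lambda>w. tau w $ j)"
    by (cases "j \<in> I'") (simp_all only: if_True if_False smooth_on_minus smooth_on_sum smooth_on_mult smooth_on_const t)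
qed

lemma smooth_FF: "smooth_on f1.CB FF"
proof (rule smooth_on_vec)
  fix j
  consider "j \<in> I' - I" | "j \<in> I \<inter> I'" | "j \<notin> I'" by blast
  then show "smooth_on f1.CB (\<lambda>w. FF w $ j)"
  proof cases
    case 1
    have pos: "f1.sl (f1.E w) j > 0" if "w \<in> f1.CB" for w
    proof -
      have "f1.E w \<in> f1.Dom" using that by (simp add: f1.CB_def)
      then show ?thesis by (rule f1.DomD(2)) (use 1 in simp)
    qed
    have "smooth_on f1.CB (\<lambda>w. of_real (ln (f1.sl (f1.E w) j) * inverse 2) + \<i> * of_real (2 * pi * tau w $ j))"
      by (intro smooth_on_add smooth_on_of_real smooth_on_mult smooth_on_const smooth_on_ln f1.smooth_slack f1.smooth_E smooth_on_id
          smooth_on_nth smooth_tau) (rule pos)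
    then show ?thesis by (rule smooth_on_cong) (use 1 in \<open>simp add: FF_nth complex_eq_iff\<close>)
  next
    case 2
    have "smooth_on f1.CB (\<lambda>w. cis (2 * pi * tau w $ j) * w $ j)"
      by (intro smooth_on_mult smooth_on_cis smooth_on_const smooth_on_nth smooth_tau smooth_on_id)
    then show ?thesis using 2 by (simp add: FF_nth)
  qed (simp add: FF_nth)
qed

lemma Z_eq: "f1.Z = f2.Z" by (auto simp: f1.Z_def f2.Z_def)

text \<open>This is \<open>reduce\<close> in the second frame with the phases
  \<open>- tau w\<close>: on \<open>I - I'\<close> they are the imaginary parts of the logarithms,
  and outside both index sets the section is positive already.\<close>

lemma FF_key:
  assumes w: "w \<in> f1.CB"
  shows "FF w \<in> f2.CB" "section_map X lam \<mu> I {} (f1.E w) = texp (- tau w) * section_map X lam \<mu>' I' {} (f2.E (FF w))"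
proof -
  define z where "z = section_map X lam \<mu> I {} (f1.E w)"
  have ED: "f1.E w \<in> f1.Dom" and wW: "w \<in> Cspace (I - {})" using w by (auto simp: f1.CB_def)
  have EW: "f1.E w \<in> Cspace (I - {})" using ED by (rule f1.DomD)
  have zZ: "z \<in> f2.Z" unfolding Z_eq[symmetric] z_def by (rule f1.sec_Z[OF ED])
  have znth: "z $ j = (if j \<in> I then f1.E w $ j else of_real (sqrt (f1.sl (f1.E w) j)))" for j
    unfolding z_def by (simp add: f1.sec_nth[OF EW])
  have spos: "f1.sl (f1.E w) j > 0" if "j \<notin> I" for j using f1.DomD(2)[OF ED, of j] that by simp
  have x: "cis (2 * pi * (- tau w) $ k) * of_real (cmod (z $ k)) = z $ k" if k: "k \<notin> I' \<union> {}" for k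
  proof (cases "k \<in> I")
    case True
    then have kk: "k \<in> I - I'" using k by simp
    have "2 * pi * (- tau w) $ k = Im (w $ k)" by (simp add: tau_nth(1)[OF kk])
    moreover have "z $ k = exp (w $ k)" using True kk by (simp add: znth f1.E_nth)
    ultimately show ?thesis by (simp add: exp_eq_polar[of "w $ k"] norm_mult mult.commute)
  next
    case False
    then have "(- tau w) $ k = 0" using k tau_nth(2)[of k w] by simp
    then show ?thesis using False spos[OF False] by (simp add: znth del: vector_uminus_component)
  qed
  define u where "u = (\<chi> j. if j \<in> I' - {} then cis (- (2 * pi * (- tau w) $ j)) * z $ j else 0)"
  have u: "u \<in> f2.Dom" "z = texp (- tau w) * section_map X lam \<mu>' I' {} u"
    using f2.reduce[OF zZ x] unfolding u_def by auto
  have "f2.E (FF w) $ j = u $ j" for j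
  proof -
    consider "j \<in> I' - I" | "j \<in> I \<inter> I'" | "j \<notin> I'" by blast
    then show ?thesis
    proof cases
      case 1
      have "exp (ln (f1.sl (f1.E w) j) / 2) = sqrt (f1.sl (f1.E w) j)"
      proof -
        have p: "f1.sl (f1.E w) j > 0" using spos[of j] 1 by simp
        then have "ln (f1.sl (f1.E w) j) / 2 = ln (sqrt (f1.sl (f1.E w) j))" by (simp add: ln_sqrt)
        then show ?thesis using p by simp
      qed
      then show ?thesis using 1 by (simp add: f2.E_nth FF_nth u_def znth exp_eq_polar mult.commute)
    next
      case 2 then show ?thesis by (simp add: f2.E_nth FF_nth u_def znth f1.E_nth)
    next
      case 3 then show ?thesis by (simp add: f2.E_nth FF_nth u_def)
    qed
  qed
  then have EF: "f2.E (FF w) = u" by (simp add: vec_eq_iff)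
  have "FF w \<in> Cspace (I' - {})" by (auto simp: Cspace_def FF_nth)
  then show "FF w \<in> f2.CB" using u EF by (simp add: f2.CB_def)
  show "section_map X lam \<mu> I {} (f1.E w) = texp (- tau w) * section_map X lam \<mu>' I' {} (f2.E (FF w))"
    using u(2) unfolding EF z_def .
qed

lemma swap: "overlap_frames X lam Q \<mu>' I' \<mu> I"
  by (intro overlap_frames.intro f1.good_frame_axioms f2.good_frame_axioms)

text \<open>The two phase vectors add up to \<open>\<delta>\<close>, which lies in the kernel of
  \<open>proj X\<close> and vanishes outside \<open>I\<close>. Independence of the normals in
  \<open>I\<close> forces it to be zero, so the rotations undo each other.\<close>

lemma FF_inverse:
  assumes w: "w \<in> f1.CB"
  shows "overlap_frames.FF X lam \<mu>' I' I (FF w) = w"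
proof -
  interpret r: overlap_frames X lam Q \<mu>' I' \<mu> I by (rule swap)
  have ED: "f1.E w \<in> f1.Dom" and wW: "w \<in> Cspace I" using w by (auto simp: f1.CB_def)
  define \<delta> where "\<delta> = tau w + r.tau (FF w)"
  have d0: "\<delta> $ k = 0" if "k \<notin> I" for k
    using that tau_nth(2)[of k w] r.tau_nth(2)[of k "FF w"] r.tau_nth(1)[of k "FF w"] by (cases "k \<in> I'") (auto simp: \<delta>_def FF_nth)
  have "proj X \<delta> = 0" unfolding \<delta>_def by (simp add: proj_simps proj_tau r.proj_tau)
  moreover have "proj X \<delta> = (\<Sum>j\<in>I. \<delta> $ j *\<^sub>R X j)"
    unfolding proj_def by (intro sum.mono_neutral_right) (auto simp: d0)
  ultimately have "(\<Sum>j\<in>I. \<delta> $ j *\<^sub>R X j) = 0" by simp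
  from f1.coeff_unique[OF this] have "\<delta> $ h = 0" if "h \<in> I" for h using that by blast
  with d0 have "\<delta> $ h = 0" for h by blast
  then have rt: "r.tau (FF w) $ h = - tau w $ h" for h by (metis \<delta>_def add.commute eq_neg_iff_add_eq_0 vector_add_component)
  have "r.FF (FF w) $ h = w $ h" for h
  proof -
    consider "h \<in> I - I'" | "h \<in> I \<inter> I'" | "h \<notin> I" by blast
    then show ?thesis
    proof cases
      case 1
      have D2: "f2.E (FF w) \<in> f2.Dom" using FF_key(1)[OF w] by (simp add: f2.CB_def)
      have pos: "f2.sl (f2.E (FF w)) h > 0" using f2.DomD(2)[OF D2, of h] 1 by simp
      \<comment> \<open>The real part is recovered from the modulus, which the torus element
        relating the two sections leaves unchanged.\<close>
      have "exp (Re (w $ h)) = cmod (section_map X lam \<mu> I {} (f1.E w) $ h)"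
        using f1.sec_nth[OF f1.DomD(1)[OF ED], of h] 1 by (simp add: f1.E_nth)
      also have "\<dots> = cmod (section_map X lam \<mu>' I' {} (f2.E (FF w)) $ h)"
        unfolding FF_key(2)[OF w] by (simp add: norm_mult texp_nth)
      also have "\<dots> = sqrt (f2.sl (f2.E (FF w)) h)"
        unfolding f2.sec_nth[OF f2.DomD(1)[OF D2]] using 1 pos by simp
      finally have "exp (Re (w $ h)) = sqrt (f2.sl (f2.E (FF w)) h)" .
      then have "ln (exp (Re (w $ h))) = ln (sqrt (f2.sl (f2.E (FF w)) h))" by (rule arg_cong)
      then have "Re (w $ h) = ln (f2.sl (f2.E (FF w)) h) / 2" using pos by (simp add: ln_sqrt)
      moreover have "Im (w $ h) = 2 * pi * r.tau (FF w) $ h" unfolding rt tau_nth(1)[OF 1] by simp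
      ultimately show ?thesis using 1 by (simp add: r.FF_nth complex_eq_iff)
    next
      case 2
      have "cis (2 * pi * r.tau (FF w) $ h) * cis (2 * pi * tau w $ h) = 1" unfolding rt by (simp add: cis_mult)
      then show ?thesis using 2 by (simp add: r.FF_nth FF_nth mult.assoc[symmetric])
    next
      case 3 then show ?thesis using wW by (auto simp: r.FF_nth Cspace_def)
    qed
  qed
  then show ?thesis by (simp add: vec_eq_iff)
qed

lemma diffeo_FF: "diffeo f1.CB f2.CB FF"
proof -
  interpret r: overlap_frames X lam Q \<mu>' I' \<mu> I by (rule swap)
  show ?thesis
    by (rule diffeoI[OF smooth_FF r.smooth_FF]) (use FF_key(1) r.FF_key(1) FF_inverse r.FF_inverse in auto)
qed

lemma FF_pr:
  assumes "w \<in> f1.CB" shows "pr X Q (section_map X lam \<mu> I {} (f1.E w)) = pr X Q (section_map X lam \<mu>' I' {} (f2.E (FF w)))"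
proof -
  have "pr X Q (section_map X lam \<mu>' I' {} (f2.E (FF w))) = pr X Q (section_map X lam \<mu> I {} (f1.E w))"
    unfolding f1.pr_eq_iff using FF_key(2)[OF assms] proj_tau f1.Q_closed(2)
    by (intro exI[of _ "- tau w"]) (simp add: proj_simps)
  then show ?thesis ..
qed

end

context frame
begin

definition frame_chart :: "nat \<Rightarrow> ((complex ^ 'd) set, complex ^ 'd) qchart \<Rightarrow> (complex ^ 'd \<Rightarrow> complex ^ 'd) \<Rightarrow> bool" where
  "frame_chart k c q \<longleftrightarrow> open_in_Rk k (cdom c) \<and> universal_covering (cdom c) q Dom \<and>
     cgrp c = covering_group (cdom c) q Gm \<and> patch c = pr X Q ` Z \<and> (\<forall>x\<in>cdom c. chart_pt c x = s (q x))"

end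

context quasi_polytope
begin

text \<open>Here the bijection between indices and facets is used: each index has a point lying in
  its own facet and in no other.\<close>

lemma good_frame_regular:
  assumes "I \<in> basis_sets X lam \<mu>" "B \<subseteq> I" shows "good_frame X lam Q \<mu> I {} B"
proof unfold_locales
  obtain \<nu> where "\<And>j. lam j < \<nu> \<bullet> X j" by (rule interior_point) (rule that)
  then show "\<exists>\<nu>. (\<forall>k\<in>{}. \<nu> \<bullet> X k = lam k) \<and> (\<forall>r. r \<notin> {} \<longrightarrow> lam r < \<nu> \<bullet> X r)" by auto
  fix h assume "h \<in> I - {} - B"
  obtain \<nu> where "\<nu> \<bullet> X h = lam h" "\<And>j. j \<noteq> h \<Longrightarrow> lam j < \<nu> \<bullet> X j" by (rule facet_point) (rule that)
  then show "\<exists>\<nu>. (\<forall>k\<in>{}. \<nu> \<bullet> X k = lam k) \<and> \<nu> \<bullet> X h = lam h \<and> (\<forall>r. r \<notin> {} \<longrightarrow> r \<noteq> h \<longrightarrow> lam r < \<nu> \<bullet> X r)" by auto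
qed (use assms in auto)

text \<open>With \<open>B = I - K\<close> no free component may vanish, so the only point to provide
  is one of \<open>F\<close> itself.\<close>

lemma good_frame_singular:
  assumes F: "open_face X lam F" and ad: "adapted X lam F \<mu> I"
  shows "good_frame X lam Q \<mu> I (active X lam F) (I - active X lam F)"
proof unfold_locales
  obtain \<nu> where nu: "\<nu> \<in> F" using open_faceE(1)[OF F] by blast
  then have "\<nu> \<in> Delta X lam" "act \<nu> = active X lam F" using open_faceE(3)[OF F] by auto
  then show "\<exists>\<nu>. (\<forall>k\<in>active X lam F. \<nu> \<bullet> X k = lam k) \<and> (\<forall>r. r \<notin> active X lam F \<longrightarrow> lam r < \<nu> \<bullet> X r)"
    by (intro exI[of _ \<nu>]) (auto simp: Delta_iff less_le act_iff set_eq_iff)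
  show "I \<in> basis_sets X lam \<mu>" using ad by (simp add: adapted_def)
  show "active X lam F \<subseteq> act \<mu>" using ad closure_active by (simp add: adapted_def)
  show "X ` active X lam F \<subseteq> span (X ` (I \<inter> active X lam F))" by (rule adapted_span[OF F ad])
qed auto

lemma card_basis: "I \<in> basis_sets X lam \<mu> \<Longrightarrow> card I = DIM('a)"
proof -
  assume "I \<in> basis_sets X lam \<mu>"
  then have I: "inj_on X I" "independent (X ` I)" "span (X ` I) = UNIV" by (auto simp: basis_sets_def)
  have "card (X ` I) = dim (X ` I)" using dim_eq_card_independent[OF I(2)] ..
  also have "\<dots> = dim (span (X ` I))" by (simp only: dim_span)
  also have "\<dots> = DIM('a)" unfolding I(3) by simp
  finally show ?thesis using card_image[OF I(1)] by simp
qed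

lemma torus_proj_subtorus: "torus_proj (I - {}) ` (Ngrp X Q \<inter> subtorus I) = Ngrp X Q \<inter> subtorus I"
proof -
  have "torus_proj (I - {}) a = a" if "a \<in> subtorus I" for a
    using that by (auto simp: torus_proj_def subtorus_def vec_eq_iff)
  then show ?thesis by force
qed

lemma regular_charts_iff:
  "c \<in> regular_charts X lam Q \<longleftrightarrow>
     (\<exists>\<mu> I q. vertex X lam \<mu> \<and> I \<in> basis_sets X lam \<mu> \<and> frame.frame_chart X lam Q \<mu> I {} {} (2 * DIM('a)) c q)"
proof -
  have "c \<in> charts_from (2 * DIM('a)) (regular_domain X lam \<mu> I)
          (torus_action (regular_domain X lam \<mu> I) (Ngrp X Q \<inter> subtorus I))
          (\<lambda>u. pr X Q (section_map X lam \<mu> I {} u))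
          (pr X Q ` {z \<in> zero_level X lam. \<forall>j. j \<notin> I \<longrightarrow> z $ j \<noteq> 0}) \<longleftrightarrow>
        (\<exists>q. frame.frame_chart X lam Q \<mu> I {} {} (2 * DIM('a)) c q)" if I: "I \<in> basis_sets X lam \<mu>" for \<mu> I
  proof -
    interpret f: good_frame X lam Q \<mu> I "{}" "{}" by (rule good_frame_regular[OF I]) simp
    have "regular_domain X lam \<mu> I = f.Dom" by (auto simp: regular_domain_def f.Dom_def)
    moreover have "{z \<in> zero_level X lam. \<forall>j. j \<notin> I \<longrightarrow> z $ j \<noteq> 0} = f.Z" by (auto simp: f.Z_def)
    ultimately show ?thesis
      by (simp add: charts_from_def f.frame_chart_def f.Gm_def f.Gam_def f.s_def torus_proj_subtorus[simplified])
  qed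
  then show ?thesis unfolding regular_charts_def by blast
qed

lemma singular_charts_iff:
  assumes F: "open_face X lam F" and ad: "adapted X lam F \<mu> I"
  shows "c \<in> singular_charts X lam Q F \<mu> I \<longleftrightarrow>
     (\<exists>q. frame.frame_chart X lam Q \<mu> I (active X lam F) (I - active X lam F) (2 * nat (aff_dim F)) c q)"
proof -
  interpret f: good_frame X lam Q \<mu> I "active X lam F" "I - active X lam F" by (rule good_frame_singular[OF F ad])
  have "singular_domain X lam F \<mu> I = f.Dom" by (auto simp: singular_domain_def f.Dom_def Cspace_def Cstar_def)
  moreover have "face_level X lam F = f.Z" by (auto simp: face_level_def Cstar_def f.Z_def)
  ultimately show ?thesis
    by (simp add: singular_charts_def charts_from_def f.frame_chart_def f.Gm_def f.Gam_def f.s_def)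
qed

lemma regular_topology:
  assumes "vertex X lam \<mu>" "I \<in> basis_sets X lam \<mu>"
  shows "openin (regular_piece X lam Q) (pr X Q ` level_on I)"
    "subtopology (regular_piece X lam Q) (pr X Q ` level_on I) = subtopology (Mtop X lam Q) (pr X Q ` level_on I)"
proof -
  have sub: "level_on I \<subseteq> regular_level X lam" unfolding regular_level_eq using assms by blast
  have "level_on I = zero_level X lam \<inter> (\<Inter>j\<in>-I. {z. z $ j \<noteq> 0})" by (auto simp: level_on_def)
  moreover have "open (\<Inter>j\<in>-I. {z :: complex ^ 'd. z $ j \<noteq> 0})"
    by (intro open_INT ballI open_Collect_neq continuous_intros) auto
  ultimately have "openin (top_of_set (zero_level X lam)) (level_on I)" by (simp add: openin_open_Int)
  then have "openin (Mtop X lam Q) (pr X Q ` level_on I)" by (rule open_pr)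
  moreover have "pr X Q ` level_on I = pr X Q ` level_on I \<inter> pr X Q ` regular_level X lam" using sub by blast
  ultimately show "openin (regular_piece X lam Q) (pr X Q ` level_on I)"
    unfolding regular_piece_def openin_subtopology by blast
  have "pr X Q ` regular_level X lam \<inter> pr X Q ` level_on I = pr X Q ` level_on I" using sub by blast
  then show "subtopology (regular_piece X lam Q) (pr X Q ` level_on I) = subtopology (Mtop X lam Q) (pr X Q ` level_on I)"
    unfolding regular_piece_def subtopology_subtopology by simp
qed

lemma topspace_pieces:
  "topspace (regular_piece X lam Q) = pr X Q ` regular_level X lam"
  "topspace (face_piece X lam Q F) = pr X Q ` face_level X lam F"
proof -
  have "regular_level X lam \<subseteq> zero_level X lam" by (auto simp: regular_level_def face_level_def)
  then show "topspace (regular_piece X lam Q) = pr X Q ` regular_level X lam"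
    unfolding regular_piece_def topspace_subtopology topspace_Mtop by blast
  have "face_level X lam F \<subseteq> zero_level X lam" by (auto simp: face_level_def)
  then show "topspace (face_piece X lam Q F) = pr X Q ` face_level X lam F"
    unfolding face_piece_def topspace_subtopology topspace_Mtop by blast
qed

lemma regular_chart_props:
  assumes mu: "vertex X lam \<mu>" "I \<in> basis_sets X lam \<mu>" and c: "frame.frame_chart X lam Q \<mu> I {} {} (2 * DIM('a)) c q"
  shows "diffeo (cdom c) (frame.Dom X lam \<mu> I {} {}) q"
    and "connected {x \<in> cdom c. q x \<in> frame.DomS X lam \<mu> I {} {}}"
    and "qchart_on (2 * DIM('a)) (regular_piece X lam Q) c"
proof -
  interpret f: good_frame X lam Q \<mu> I "{}" "{}" by (rule good_frame_regular[OF mu(2)]) simp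
  have fc: "open_in_Rk (2 * DIM('a)) (cdom c)" "universal_covering (cdom c) q f.Dom" "cgrp c = covering_group (cdom c) q f.Gm"
    "patch c = pr X Q ` f.Z" "\<And>x. x \<in> cdom c \<Longrightarrow> chart_pt c x = f.s (q x)"
    using c by (auto simp: f.frame_chart_def)
  have Zl: "f.Z = level_on I" by (auto simp: f.Z_def level_on_def)
  have "f.CB = f.Dom"
  proof -
    have "f.E w = w" for w by (simp add: vec_eq_iff f.E_nth)
    then show ?thesis using f.DomD(1) by (auto simp: f.CB_def)
  qed
  then have scD: "simply_connected f.Dom" using f.simply_connected_CB by simp
  have lp: "locally path_connected f.Dom" "locally path_connected (cdom c)"
    using locally_path_connected_relopen[OF subspace_Cspace f.openin_Dom]
      locally_path_connected_relopen[OF subspace_span, of "cdom c" "cdom c"] fc(1) by (auto simp: open_in_Rk_def)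
  obtain x0 where x0: "x0 \<in> cdom c" using fc(1) by (auto simp: open_in_Rk_def)
  have "diffeo f.Dom f.Dom (\<lambda>x. x)" by (rule diffeoI[where g="\<lambda>x. x"]) auto
  then obtain F where F: "diffeo (cdom c) f.Dom F" "\<And>x. x \<in> cdom c \<Longrightarrow> F x = q x"
    by (rule universal_covering_lift_diffeo[OF fc(2) universal_covering_id[OF scD] lp(2,1) _ x0, of "\<lambda>x. x" "q x0"])
       (use universal_coveringD(5)[OF fc(2) x0] that in auto)
  then show dq: "diffeo (cdom c) f.Dom q" by (rule diffeo_cong)
  obtain q' where q': "smooth_on (cdom c) q" "smooth_on f.Dom q'" "\<And>x. x \<in> cdom c \<Longrightarrow> q x \<in> f.Dom" "\<And>y. y \<in> f.Dom \<Longrightarrow> q' y \<in> cdom c"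
    "\<And>x. x \<in> cdom c \<Longrightarrow> q' (q x) = x" "\<And>y. y \<in> f.Dom \<Longrightarrow> q (q' y) = y" by (rule diffeoE[OF dq]) (rule that)
  have sub: "f.DomS \<subseteq> f.Dom" by (auto simp: f.DomS_def)
  have "{x \<in> cdom c. q x \<in> f.DomS} = q' ` f.DomS"
  proof (intro equalityI subsetI)
    fix x assume "x \<in> {x \<in> cdom c. q x \<in> f.DomS}"
    then show "x \<in> q' ` f.DomS" using q'(5)[of x] by (intro image_eqI[of _ _ "q x"]) auto
  next
    fix x assume "x \<in> q' ` f.DomS"
    then show "x \<in> {x \<in> cdom c. q x \<in> f.DomS}" using q'(4,6) sub by auto
  qed
  then show con: "connected {x \<in> cdom c. q x \<in> f.DomS}"
    using connected_continuous_image[OF continuous_on_subset[OF smooth_on_imp_continuous_on[OF q'(2)] sub] f.connected_DomS] by simp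
  show "qchart_on (2 * DIM('a)) (regular_piece X lam Q) c"
    by (rule f.frame_qchart_on[OF fc(1,2,3,4) _ _ _ con]) (use fc(5) regular_topology[OF mu] Zl in auto)
qed

text \<open>The overlaps can fail to be simply connected although the domains are: seen in the base
  domain, the hyperplanes of the components in \<open>I - I'\<close> are removed. Their universal
  covering is the one by \<open>E\<close> with \<open>B = I - I'\<close>, and \<open>FF\<close> is
  the lift of the change of charts.\<close>

lemma regular_compatible:
  assumes mu: "vertex X lam \<mu>" "I \<in> basis_sets X lam \<mu>" and c: "frame.frame_chart X lam Q \<mu> I {} {} (2 * DIM('a)) c q"
    and mu': "vertex X lam \<mu>'" "I' \<in> basis_sets X lam \<mu>'" and c': "frame.frame_chart X lam Q \<mu>' I' {} {} (2 * DIM('a)) c' q'"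
  shows "compatible (2 * DIM('a)) c c'"
proof -
  have pre: "premodel (2 * DIM('a)) (overlap c c') (overlap_group c c') \<and>
      diffeo (overlap c c') (frame.Dom X lam \<mu> I {} (I - I')) q"
    if mu: "vertex X lam \<mu>" "I \<in> basis_sets X lam \<mu>" and c: "frame.frame_chart X lam Q \<mu> I {} {} (2 * DIM('a)) c q"
      and mu': "vertex X lam \<mu>'" "I' \<in> basis_sets X lam \<mu>'" and c': "frame.frame_chart X lam Q \<mu>' I' {} {} (2 * DIM('a)) c' q'"
    for c c' :: "((complex ^ 'd) set, complex ^ 'd) qchart" and \<mu> I q \<mu>' I' q'
  proof -
    interpret f: good_frame X lam Q \<mu> I "{}" "{}" by (rule good_frame_regular[OF mu(2)]) simp
    interpret g: good_frame X lam Q \<mu> I "{}" "I - I'" by (rule good_frame_regular[OF mu(2)]) auto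
    interpret f': good_frame X lam Q \<mu>' I' "{}" "{}" by (rule good_frame_regular[OF mu'(2)]) simp
    have fc: "open_in_Rk (2 * DIM('a)) (cdom c)" "universal_covering (cdom c) q f.Dom" "cgrp c = covering_group (cdom c) q f.Gm"
      "patch c = pr X Q ` f.Z" "\<And>x. x \<in> cdom c \<Longrightarrow> chart_pt c x = f.s (q x)"
      using c by (auto simp: f.frame_chart_def)
    have P': "patch c' = pr X Q ` f'.Z" using c' by (auto simp: f'.frame_chart_def)
    note rp = regular_chart_props[OF mu c]
    note rp' = regular_chart_props[OF mu' c']
    \<comment> \<open>A section point belongs to the other patch iff its components outside
      \<open>I'\<close> are nonzero. Those outside \<open>I\<close> are positive anyway, which
      leaves the indices in \<open>I - I'\<close>.\<close>
    have ov: "overlap c c' = {x \<in> cdom c. q x \<in> g.Dom}"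
    proof -
      have "chart_pt c x \<in> patch c' \<longleftrightarrow> q x \<in> g.Dom" if x: "x \<in> cdom c" for x
      proof -
        have qD: "q x \<in> f.Dom" using universal_coveringD(5)[OF fc(2) x] .
        have "chart_pt c x \<in> patch c' \<longleftrightarrow> section_map X lam \<mu> I {} (q x) \<in> f'.Z"
          unfolding fc(5)[OF x] f.s_def P' using f'.pr_Z_saturated by blast
        also have "\<dots> \<longleftrightarrow> (\<forall>j. j \<notin> I' \<longrightarrow> section_map X lam \<mu> I {} (q x) $ j \<noteq> 0)"
          using f.sec_Z[OF qD] by (auto simp: f.Z_def f'.Z_def)
        also have "\<dots> \<longleftrightarrow> (\<forall>j\<in>I - I'. q x $ j \<noteq> 0)"
          using f.DomD[OF qD] by (auto simp: f.sec_nth less_le)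
        also have "\<dots> \<longleftrightarrow> q x \<in> g.Dom" using qD by (auto simp: f.Dom_def g.Dom_def)
        finally show ?thesis .
      qed
      then show ?thesis unfolding overlap_eq[OF rp(3)] by blast
    qed
    have "premodel (2 * DIM('a)) (overlap c c') (restrict_group (cgrp c) (overlap c c'))"
    proof (rule f.frame_premodel[OF fc(1,2,3,5)])
      show "openin (top_of_set (cdom c)) (overlap c c')" by (rule openin_overlap[OF rp(3) rp'(3)])
      show "{x \<in> cdom c. q x \<in> f.DomS} \<subseteq> overlap c c'"
        unfolding ov by (auto simp: f.DomS_def f.Dom_def g.Dom_def)
    qed (use overlap_eq[OF rp(3)] rp(2) in auto)
    moreover have "diffeo (overlap c c') (q ` overlap c c') q"
      by (rule diffeo_subset[OF rp(1)]) (auto simp: ov)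
    moreover have "q ` overlap c c' = g.Dom"
    proof -
      have qD: "q ` cdom c = f.Dom" using rp(1) by (simp add: diffeo_def bij_betw_def)
      have gf: "g.Dom \<subseteq> f.Dom" by (auto simp: f.Dom_def g.Dom_def)
      show ?thesis
      proof (intro equalityI subsetI)
        fix u assume u: "u \<in> g.Dom"
        then have "u \<in> q ` cdom c" using gf qD by blast
        then show "u \<in> q ` overlap c c'" using u unfolding ov by blast
      qed (auto simp: ov)
    qed
    ultimately show ?thesis by (simp add: overlap_group_def)
  qed
  note p1 = pre[OF mu c mu' c'] and p2 = pre[OF mu' c' mu c]
  interpret f: good_frame X lam Q \<mu> I "{}" "{}" by (rule good_frame_regular[OF mu(2)]) simp
  interpret f': good_frame X lam Q \<mu>' I' "{}" "{}" by (rule good_frame_regular[OF mu'(2)]) simp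
  interpret o: overlap_frames X lam Q \<mu> I \<mu>' I'
    by (intro overlap_frames.intro good_frame_regular mu(2) mu'(2)) auto
  note rp = regular_chart_props[OF mu c] and rp' = regular_chart_props[OF mu' c']
  define r where "r = inv_into (overlap c c') q"
  define r' where "r' = inv_into (overlap c' c) q'"
  have dr: "diffeo o.f1.Dom (overlap c c') r" "diffeo o.f2.Dom (overlap c' c) r'"
    using diffeo_inv p1 p2 by (auto simp: r_def r'_def)
  have qr: "q (r u) = u" "r u \<in> cdom c" if "u \<in> o.f1.Dom" for u
  proof -
    have "q ` overlap c c' = o.f1.Dom" using p1 by (simp add: diffeo_def bij_betw_def)
    then show "q (r u) = u" "r u \<in> cdom c" using that f_inv_into_f[of u q "overlap c c'"] inv_into_into[of u q "overlap c c'"]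
      by (auto simp: r_def overlap_eq[OF rp(3)])
  qed
  have qr': "q' (r' u) = u" "r' u \<in> cdom c'" if "u \<in> o.f2.Dom" for u
  proof -
    have "q' ` overlap c' c = o.f2.Dom" using p2 by (simp add: diffeo_def bij_betw_def)
    then show "q' (r' u) = u" "r' u \<in> cdom c'" using that f_inv_into_f[of u q' "overlap c' c"] inv_into_into[of u q' "overlap c' c"]
      by (auto simp: r'_def overlap_eq[OF rp'(3)])
  qed
  have uc: "universal_covering o.f1.CB (\<lambda>w. r (o.f1.E w)) (overlap c c')"
    "universal_covering o.f2.CB (\<lambda>w. r' (o.f2.E w)) (overlap c' c)"
    by (rule universal_covering_postcompose[OF o.f1.universal_covering_E dr(1)],
        rule universal_covering_postcompose[OF o.f2.universal_covering_E dr(2)])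
  have "model_diffeo (overlap c c') (overlap_group c c') (overlap c' c) (overlap_group c' c) (chart_change c c')"
  proof (rule model_diffeoI[OF rp(3) rp'(3) uc o.diffeo_FF])
    fix w assume w: "w \<in> o.f1.CB"
    have 1: "o.f1.E w \<in> o.f1.Dom" "o.f2.E (o.FF w) \<in> o.f2.Dom"
      using w o.FF_key(1)[OF w] by (auto simp: o.f1.CB_def o.f2.CB_def)
    have "chart_pt c x = f.s (q x)" if "x \<in> cdom c" for x using c that by (simp add: f.frame_chart_def)
    moreover have "chart_pt c' x = f'.s (q' x)" if "x \<in> cdom c'" for x using c' that by (simp add: f'.frame_chart_def)
    ultimately show "chart_pt c (r (o.f1.E w)) = chart_pt c' (r' (o.f2.E (o.FF w)))"
      using qr[OF 1(1)] qr'[OF 1(2)] o.FF_pr[OF w] by (simp add: f.s_def f'.s_def)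
  qed
  then show ?thesis unfolding compatible_def using p1 p2 by blast
qed

lemma regular_atlas: "quasifold_atlas (2 * DIM('a)) (regular_piece X lam Q) (regular_charts X lam Q)"
  unfolding quasifold_atlas_def
proof (intro conjI ballI)
  fix c assume "c \<in> regular_charts X lam Q"
  then obtain \<mu> I q where c: "vertex X lam \<mu>" "I \<in> basis_sets X lam \<mu>" "frame.frame_chart X lam Q \<mu> I {} {} (2 * DIM('a)) c q"
    unfolding regular_charts_iff by blast
  then show "qchart_on (2 * DIM('a)) (regular_piece X lam Q) c" by (rule regular_chart_props(3))
  fix c' assume "c' \<in> regular_charts X lam Q"
  then obtain \<mu>' I' q' where c': "vertex X lam \<mu>'" "I' \<in> basis_sets X lam \<mu>'" "frame.frame_chart X lam Q \<mu>' I' {} {} (2 * DIM('a)) c' q'"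
    unfolding regular_charts_iff by blast
  show "compatible (2 * DIM('a)) c c'" by (rule regular_compatible[OF c c'])
next
  have Zl: "frame.Z X lam I {} {} = level_on I" if "I \<in> basis_sets X lam \<mu>" for \<mu> I
  proof -
    interpret f: good_frame X lam Q \<mu> I "{}" "{}" by (rule good_frame_regular[OF that]) simp
    show ?thesis by (auto simp: f.Z_def level_on_def)
  qed
  show "(\<Union>c\<in>regular_charts X lam Q. patch c) = topspace (regular_piece X lam Q)"
    unfolding topspace_pieces
  proof (intro equalityI subsetI)
    fix y assume "y \<in> (\<Union>c\<in>regular_charts X lam Q. patch c)"
    then obtain c where c0: "y \<in> patch c" "c \<in> regular_charts X lam Q" by (elim UN_E)
    obtain \<mu> I q where c: "vertex X lam \<mu>" "I \<in> basis_sets X lam \<mu>" "frame.frame_chart X lam Q \<mu> I {} {} (2 * DIM('a)) c q"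
      using c0(2)[unfolded regular_charts_iff] by (elim exE conjE) (rule that)
    note c = c0(1) c
    interpret f: good_frame X lam Q \<mu> I "{}" "{}" by (rule good_frame_regular[OF c(3)]) simp
    have "y \<in> pr X Q ` level_on I" using c(1,4) Zl[OF c(3)] by (simp add: f.frame_chart_def)
    then show "y \<in> pr X Q ` regular_level X lam" unfolding regular_level_eq using c(2,3) by blast
  next
    fix y assume "y \<in> pr X Q ` regular_level X lam"
    then obtain \<mu> I where I: "vertex X lam \<mu>" "I \<in> basis_sets X lam \<mu>" "y \<in> pr X Q ` level_on I"
      unfolding regular_level_eq by blast
    interpret f: good_frame X lam Q \<mu> I "{}" "{}" by (rule good_frame_regular[OF I(2)]) simp
    have k: "open_in_Rk (2 * DIM('a)) f.CB" using f.dim_CB card_basis[OF I(2)] by simp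
    obtain c where c: "cdom c = f.CB" "cgrp c = covering_group f.CB f.E f.Gm" "patch c = pr X Q ` f.Z"
      "\<forall>x\<in>f.CB. chart_pt c x = f.s (f.E x)"
      using f.chart_exists[OF k f.universal_covering_E, of "pr X Q ` f.Z"] by (elim exE conjE) (rule that)
    have "f.frame_chart (2 * DIM('a)) c f.E" unfolding f.frame_chart_def c(1-3) using c(4) k f.universal_covering_E by blast
    then have "c \<in> regular_charts X lam Q" unfolding regular_charts_iff using I by blast
    moreover have "y \<in> patch c" using I(3) c(3) Zl[OF I(2)] by simp
    ultimately show "y \<in> (\<Union>c\<in>regular_charts X lam Q. patch c)" by blast
  qed
qed

lemma dim_singular:
  assumes F: "open_face X lam F" and ad: "adapted X lam F \<mu> I"
  shows "2 * card (I - active X lam F) = 2 * nat (aff_dim F)"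
proof -
  have I: "I \<in> basis_sets X lam \<mu>" and c: "int (card (I \<inter> active X lam F)) = int DIM('a) - aff_dim F"
    using ad by (auto simp: adapted_def)
  have "card (I \<inter> active X lam F) + card (I - active X lam F) = card I"
    by (rule card_Int_Diff[symmetric]) simp
  then show ?thesis using c card_basis[OF I] by linarith
qed

text \<open>All charts of the family cover the same base domain and have the whole piece as patch.
  Overlaps are therefore full domains, and a change of charts is covered by a lift of the identity
  of the base domain.\<close>

lemma singular_atlas:
  assumes F: "open_face X lam F" and ad: "adapted X lam F \<mu> I"
  shows "quasifold_atlas (2 * nat (aff_dim F)) (face_piece X lam Q F) (singular_charts X lam Q F \<mu> I)"
proof -
  define k where "k = 2 * nat (aff_dim F)"
  interpret f: good_frame X lam Q \<mu> I "active X lam F" "I - active X lam F" by (rule good_frame_singular[OF F ad])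
  have Zf: "f.Z = face_level X lam F" by (auto simp: face_level_def Cstar_def f.Z_def)
  have DS: "f.DomS = f.Dom" by (auto simp: f.DomS_def f.Dom_def)
  note iff = singular_charts_iff[OF F ad, folded k_def]
  have T: "openin (face_piece X lam Q F) (pr X Q ` f.Z)"
    "subtopology (face_piece X lam Q F) (pr X Q ` f.Z) = subtopology (Mtop X lam Q) (pr X Q ` f.Z)"
    using openin_topspace[of "face_piece X lam Q F"] topspace_pieces(2)[of F]
    by (auto simp: Zf face_piece_def subtopology_subtopology)
  have fcD: "open_in_Rk k (cdom c)" "universal_covering (cdom c) q f.Dom" "cgrp c = covering_group (cdom c) q f.Gm"
    "patch c = pr X Q ` f.Z" "\<And>x. x \<in> cdom c \<Longrightarrow> chart_pt c x = f.s (q x)" if "f.frame_chart k c q" for c q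
    using that by (auto simp: f.frame_chart_def)
  have full: "{x \<in> cdom c. q x \<in> f.DomS} = cdom c" if "f.frame_chart k c q" for c q
    using universal_coveringD(5)[OF fcD(2)[OF that]] DS by auto
  have con: "connected {x \<in> cdom c. q x \<in> f.DomS}" if "f.frame_chart k c q" for c q
    unfolding full[OF that] using simply_connected_imp_connected[OF universal_coveringD(2)[OF fcD(2)[OF that]]] .
  have qc: "qchart_on k (face_piece X lam Q F) c" if fc: "f.frame_chart k c q" for c q
    by (rule f.frame_qchart_on[OF fcD(1-4)[OF fc] _ T con[OF fc]]) (use fcD(5)[OF fc] in auto)
  have ov: "overlap c c' = cdom c" if fc: "f.frame_chart k c q" "f.frame_chart k c' q'" for c q c' q'
  proof -
    have "chart_pt c x \<in> patch c'" if "x \<in> cdom c" for x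
      using imageI[OF that, of "chart_pt c"] unfolding chart_facts(2)[OF qc[OF fc(1)]] fcD(4)[OF fc(1)] fcD(4)[OF fc(2)] .
    then show ?thesis unfolding overlap_eq[OF qc[OF fc(1)]] by blast
  qed
  have pre: "premodel k (overlap c c') (overlap_group c c')" if fc: "f.frame_chart k c q" "f.frame_chart k c' q'" for c q c' q'
    unfolding overlap_group_def
  proof (rule f.frame_premodel[OF fcD(1-3)[OF fc(1)]])
    show "openin (top_of_set (cdom c)) (overlap c c')" by (rule openin_overlap[OF qc[OF fc(1)] qc[OF fc(2)]])
    show "overlap c c' = {x \<in> cdom c. chart_pt c x \<in> patch c'}" by (rule overlap_eq[OF qc[OF fc(1)]])
  qed (use fcD(5)[OF fc(1)] con[OF fc(1)] ov[OF fc] in auto)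
  have comp: "compatible k c c'" if fc: "f.frame_chart k c q" "f.frame_chart k c' q'" for c q c' q'
  proof -
    have lp: "locally path_connected (cdom c)" if "f.frame_chart k c q" for c q
      using locally_path_connected_relopen[OF subspace_span, of "cdom c" "cdom c"] fcD(1)[OF that] by (auto simp: open_in_Rk_def)
    obtain x0 where x0: "x0 \<in> cdom c" using fcD(1)[OF fc(1)] by (auto simp: open_in_Rk_def)
    have "q x0 \<in> q' ` cdom c'"
      using universal_coveringD(5)[OF fcD(2)[OF fc(1)] x0] universal_coveringD(4)[OF fcD(2)[OF fc(2)]] by simp
    then obtain y0 where y0: "y0 \<in> cdom c'" "q x0 = q' y0" by blast
    have "diffeo f.Dom f.Dom (\<lambda>x. x)" by (rule diffeoI[where g="\<lambda>x. x"]) auto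
    from universal_covering_lift_diffeo[OF fcD(2)[OF fc(1)] fcD(2)[OF fc(2)] lp[OF fc(1)] lp[OF fc(2)] this x0 y0]
    obtain G where G: "diffeo (cdom c) (cdom c') G" "\<And>x. x \<in> cdom c \<Longrightarrow> q' (G x) = q x" by blast
    have "model_diffeo (overlap c c') (overlap_group c c') (overlap c' c) (overlap_group c' c) (chart_change c c')"
    proof (rule model_diffeoI[OF qc[OF fc(1)] qc[OF fc(2)] _ _ G(1)])
      show "universal_covering (cdom c) (\<lambda>x. x) (overlap c c')" unfolding ov[OF fc]
        by (rule universal_covering_id[OF universal_coveringD(2)[OF fcD(2)[OF fc(1)]]])
      show "universal_covering (cdom c') (\<lambda>x. x) (overlap c' c)" unfolding ov[OF fc(2,1)]
        by (rule universal_covering_id[OF universal_coveringD(2)[OF fcD(2)[OF fc(2)]]])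
      fix x assume x: "x \<in> cdom c"
      then have "G x \<in> cdom c'" using G(1) by (auto simp: diffeo_def bij_betw_def)
      then show "chart_pt c x = chart_pt c' (G x)" using fcD(5)[OF fc(1) x] fcD(5)[OF fc(2)] G(2)[OF x] by simp
    qed
    then show ?thesis unfolding compatible_def using pre[OF fc] pre[OF fc(2,1)] by blast
  qed
  have kc: "open_in_Rk k f.CB" using f.dim_CB dim_singular[OF F ad] by (simp add: k_def)
  obtain c0 where c0: "cdom c0 = f.CB" "cgrp c0 = covering_group f.CB f.E f.Gm" "patch c0 = pr X Q ` f.Z"
    "\<forall>x\<in>f.CB. chart_pt c0 x = f.s (f.E x)"
    using f.chart_exists[OF kc f.universal_covering_E, of "pr X Q ` f.Z"] by (elim exE conjE) (rule that)
  have fc0: "f.frame_chart k c0 f.E" unfolding f.frame_chart_def c0(1-3) using c0(4) kc f.universal_covering_E by blast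
  show ?thesis
    unfolding quasifold_atlas_def k_def[symmetric]
  proof (intro conjI ballI)
    show "qchart_on k (face_piece X lam Q F) c" if "c \<in> singular_charts X lam Q F \<mu> I" for c using that qc unfolding iff by blast
    show "compatible k c c'" if "c \<in> singular_charts X lam Q F \<mu> I" "c' \<in> singular_charts X lam Q F \<mu> I" for c c'
      using that comp unfolding iff by blast
    have "c0 \<in> singular_charts X lam Q F \<mu> I" unfolding iff using fc0 by blast
    moreover have "patch c = pr X Q ` f.Z" if "c \<in> singular_charts X lam Q F \<mu> I" for c using that fcD(4) unfolding iff by blast
    ultimately show "(\<Union>c\<in>singular_charts X lam Q F \<mu> I. patch c) = topspace (face_piece X lam Q F)"
      unfolding topspace_pieces Zf by auto
  qed
qed

end

section \<open>The symplectic forms\<close>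

lemma tangent_space_open:
  assumes "u \<in> tangent_space S x" "openin (top_of_set S) W" "x \<in> W" shows "u \<in> tangent_space W x"
proof -
  obtain \<gamma> :: "real \<Rightarrow> _" and \<epsilon> where g: "\<epsilon> > 0" "smooth_on {-\<epsilon><..<\<epsilon>} \<gamma>" "\<gamma> ` {-\<epsilon><..<\<epsilon>} \<subseteq> S" "\<gamma> 0 = x" "(\<gamma> has_vector_derivative u) (at 0)"
    using assms(1) unfolding tangent_space_def by blast
  obtain G where G: "open G" "W = S \<inter> G" using assms(2) by (auto simp: openin_open)
  have "continuous (at 0) \<gamma>" using g(5) by (rule has_vector_derivative_continuous)
  then have "(\<gamma> \<longlongrightarrow> x) (at 0)" using g(4) by (simp add: continuous_at)
  then have "\<forall>\<^sub>F t in at 0. \<gamma> t \<in> G" using topological_tendstoD[OF _ G(1)] assms(3) G(2) by blast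
  then obtain d where d: "d > 0" "\<And>t. t \<noteq> 0 \<Longrightarrow> \<bar>t\<bar> < d \<Longrightarrow> \<gamma> t \<in> G"
    unfolding eventually_at by (auto simp: dist_real_def)
  have G0: "\<gamma> 0 \<in> G" using g(4) assms(3) G(2) by simp
  define e where "e = min \<epsilon> d"
  have sub: "{-e<..<e} \<subseteq> {-\<epsilon><..<\<epsilon>}" by (auto simp: e_def)
  have "\<gamma> t \<in> W" if "t \<in> {-e<..<e}" for t
  proof -
    have "\<gamma> t \<in> S" using g(3) sub that by blast
    moreover have "\<gamma> t \<in> G" using that d(2)[of t] G0 by (cases "t = 0") (auto simp: e_def)
    ultimately show ?thesis using G by simp
  qed
  then show ?thesis
    unfolding tangent_space_def using g d(1) smooth_on_subset[OF g(2) sub]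
    by (intro CollectI exI[of _ \<gamma>] exI[of _ e]) (auto simp: e_def)
qed

lemma tangent_derivative_unique:
  assumes u: "u \<in> tangent_space S x" and D: "(f has_derivative D) (at x within S)" "(f has_derivative D') (at x within S)"
  shows "D u = D' u"
proof -
  obtain \<gamma> :: "real \<Rightarrow> _" and \<epsilon> where g: "\<epsilon> > 0" "\<gamma> ` {-\<epsilon><..<\<epsilon>} \<subseteq> S" "\<gamma> 0 = x" "(\<gamma> has_vector_derivative u) (at 0)"
    using u unfolding tangent_space_def by blast
  show ?thesis
    by (rule vector_derivative_unique_at[OF has_derivative_curve[OF D(1) g(4,3,1,2)] has_derivative_curve[OF D(2) g(4,3,1,2)]])
qed

lemma tangent_derivative_in_subspace:
  fixes f :: "'a::real_normed_vector \<Rightarrow> 'b::euclidean_space"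
  assumes u: "u \<in> tangent_space S x" and D: "(f has_derivative D) (at x within S)" and V: "subspace V" "f ` S \<subseteq> V"
  shows "D u \<in> V"
proof -
  obtain \<gamma> :: "real \<Rightarrow> _" and \<epsilon> where g: "\<epsilon> > 0" "\<gamma> ` {-\<epsilon><..<\<epsilon>} \<subseteq> S" "\<gamma> 0 = x" "(\<gamma> has_vector_derivative u) (at 0)"
    using u unfolding tangent_space_def by blast
  show ?thesis
    by (rule curve_derivative_in_subspace[OF V(1) has_derivative_curve[OF D g(4,3,1,2)] g(1)]) (use g(2) V(2) in auto)
qed

text \<open>The chain rule on tangent vectors of an arbitrary set, through a map into an open subset of
  a linear subspace.\<close>

lemma tangent_chain:
  fixes p :: "'a::real_normed_vector \<Rightarrow> 'b::euclidean_space" and \<phi> :: "'a \<Rightarrow> 'c::real_normed_vector"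
  assumes u: "u \<in> tangent_space S x" and W: "openin (top_of_set S) W" "x \<in> W"
    and Dp: "(p has_derivative Dp) (at x within W)" and pA: "p ` W \<subseteq> A"
    and V: "subspace V" "openin (top_of_set V) A" and h: "smooth_on A h"
    and D: "(\<phi> has_derivative D) (at x within S)" and eq: "\<And>y. y \<in> W \<Longrightarrow> \<phi> y = h (p y)"
  shows "Dp u \<in> V" "D u = dd h (p x) (Dp u)"
proof -
  have uW: "u \<in> tangent_space W x" by (rule tangent_space_open[OF u W])
  have AV: "A \<subseteq> V" using V(2) by (rule openin_imp_subset)
  show uV: "Dp u \<in> V" by (rule tangent_derivative_in_subspace[OF uW Dp V(1)]) (use pA AV in auto)
  have px: "p x \<in> A" using W pA by auto
  define Dh where "Dh = frechet_derivative h (at (p x) within A)"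
  have "(h has_derivative Dh) (at (p x) within p ` W)"
    unfolding Dh_def by (rule has_derivative_subset[OF smooth_on_has_derivative[OF h px] pA])
  from has_derivative_in_compose[OF Dp this] have 1: "((\<lambda>y. h (p y)) has_derivative (\<lambda>v. Dh (Dp v))) (at x within W)" .
  have WS: "W \<subseteq> S" using W(1) by (rule openin_imp_subset)
  have "(\<phi> has_derivative D) (at x within W)" by (rule has_derivative_subset[OF D WS])
  then have 2: "((\<lambda>y. h (p y)) has_derivative D) (at x within W)"
    by (rule has_derivative_transform[rotated 2]) (use W(2) eq in auto)
  have "D u = Dh (Dp u)" by (rule tangent_derivative_unique[OF uW 2 1])
  then show "D u = dd h (p x) (Dp u)" unfolding Dh_def using dd_frechet[OF V px uV h] by simp
qed

context quasi_polytope
begin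

text \<open>A smooth lift of \<open>P\<close> to the domain of some base chart. The frame is hidden
  in the existential because \<open>blift_pullback\<close> makes its choice immaterial.\<close>

definition blift :: "'m::euclidean_space set \<Rightarrow> ('m \<Rightarrow> (complex ^ 'd) set) \<Rightarrow> ('m \<Rightarrow> complex ^ 'd) \<Rightarrow> bool" where
  "blift A P f \<longleftrightarrow> (\<exists>\<mu> I K B. good_frame X lam Q \<mu> I K B \<and> smooth_on A f \<and>
     (\<forall>y\<in>A. f y \<in> frame.Dom X lam \<mu> I K B \<and> pr X Q (section_map X lam \<mu> I K (f y)) = P y))"

lemma blift_pullback:
  assumes V: "subspace V" "openin (top_of_set V) A" "y \<in> A" "u \<in> V" "v \<in> V"
    and fg: "blift A P f" "blift A P g"
  shows "std_form (dd f y u) (dd f y v) = std_form (dd g y u) (dd g y v)"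
proof -
  obtain \<mu> I K B where f: "good_frame X lam Q \<mu> I K B" "smooth_on A f"
     "\<And>y. y \<in> A \<Longrightarrow> f y \<in> frame.Dom X lam \<mu> I K B" "\<And>y. y \<in> A \<Longrightarrow> pr X Q (section_map X lam \<mu> I K (f y)) = P y"
    using fg(1) unfolding blift_def by blast
  obtain \<mu>' I' K' B' where g: "good_frame X lam Q \<mu>' I' K' B'" "smooth_on A g"
     "\<And>y. y \<in> A \<Longrightarrow> g y \<in> frame.Dom X lam \<mu>' I' K' B'" "\<And>y. y \<in> A \<Longrightarrow> pr X Q (section_map X lam \<mu>' I' K' (g y)) = P y"
    using fg(2) unfolding blift_def by blast
  interpret t: two_frames X lam Q \<mu> I K B \<mu>' I' K' B'
    by (intro two_frames.intro good_frame.axioms(1) f(1) g(1))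
  show ?thesis
    by (rule t.base_lifts_pullback[OF V f(2,3) g(2,3)]) (use f(4) g(4) in auto)
qed

lemma blift_subset: "blift A P f \<Longrightarrow> A' \<subseteq> A \<Longrightarrow> blift A' P f"
  unfolding blift_def by (meson smooth_on_subset subsetD)

lemma blift_compose:
  fixes h :: "'m::euclidean_space \<Rightarrow> 'n::euclidean_space"
  assumes "blift A P f" "smooth_on S h" "h ` S \<subseteq> A" shows "blift S (\<lambda>y. P (h y)) (\<lambda>y. f (h y))"
proof -
  obtain \<mu> I K B where f: "good_frame X lam Q \<mu> I K B" "smooth_on A f"
     "\<And>y. y \<in> A \<Longrightarrow> f y \<in> frame.Dom X lam \<mu> I K B" "\<And>y. y \<in> A \<Longrightarrow> pr X Q (section_map X lam \<mu> I K (f y)) = P y"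
    using assms(1) unfolding blift_def by blast
  have "smooth_on S (\<lambda>y. f (h y))" by (rule smooth_on_compose[OF assms(2) f(2) assms(3)])
  moreover have "h y \<in> A" if "y \<in> S" for y using assms(3) that by blast
  ultimately show ?thesis unfolding blift_def
    using f by (intro exI[of _ \<mu>] exI[of _ I] exI[of _ K] exI[of _ B] conjI ballI) auto
qed

lemma blift_cong: "blift A P f \<Longrightarrow> (\<And>y. y \<in> A \<Longrightarrow> P y = P' y) \<Longrightarrow> blift A P' f"
proof -
  assume b: "blift A P f" and eq: "\<And>y. y \<in> A \<Longrightarrow> P y = P' y"
  obtain \<mu> I K B where f: "good_frame X lam Q \<mu> I K B" "smooth_on A f"
     "\<And>y. y \<in> A \<Longrightarrow> f y \<in> frame.Dom X lam \<mu> I K B" "\<And>y. y \<in> A \<Longrightarrow> pr X Q (section_map X lam \<mu> I K (f y)) = P y"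
    using b unfolding blift_def by blast
  then show "blift A P' f" unfolding blift_def
    using eq by (intro exI[of _ \<mu>] exI[of _ I] exI[of _ K] exI[of _ B] conjI ballI) auto
qed

end

text \<open>\<open>A\<close> is any compatible atlas. By \<open>cover\<close> it contains, at each
  point of the level manifold \<open>L\<close>, one chart of the explicit kind and of the right
  dimension; the form is transported from there.\<close>

locale form_setup = quasi_polytope X lam Q
  for X :: "'d::finite \<Rightarrow> 'a::euclidean_space" and lam Q +
  fixes k :: nat and T :: "(complex ^ 'd) set topology" and A :: "((complex ^ 'd) set, complex ^ 'd) qchart set"
    and L :: "(complex ^ 'd) set"
  assumes atlas: "quasifold_atlas k T A" and top: "topspace T = pr X Q ` L"
    and cover: "\<And>z. z \<in> L \<Longrightarrow> \<exists>c\<in>A. \<exists>\<mu> I K B q. good_frame X lam Q \<mu> I K B \<and> frame.frame_chart X lam Q \<mu> I K B k c q \<and>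
       z \<in> frame.Z X lam I K B \<and> openin (top_of_set L) (frame.Z X lam I K B) \<and> k = 2 * card (I - K)"
begin

lemma chart: "c \<in> A \<Longrightarrow> qchart_on k T c" using atlas by (simp add: quasifold_atlas_def)

lemma cdom_open: "c \<in> A \<Longrightarrow> openin (top_of_set (span (cdom c))) (cdom c)" "c \<in> A \<Longrightarrow> dim (cdom c) = k"
  using chart by (auto simp: qchart_on_def model_def premodel_def open_in_Rk_def)

lemma coverE:
  assumes "z \<in> L"
  obtains c \<mu> I K B q where "c \<in> A" "good_frame X lam Q \<mu> I K B" "frame.frame_chart X lam Q \<mu> I K B k c q"
    "z \<in> frame.Z X lam I K B" "openin (top_of_set L) (frame.Z X lam I K B)" "k = 2 * card (I - K)"
  using cover[OF assms] by (elim bexE exE conjE) (rule that)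

text \<open>A local lift to the domain of a base chart is a composition of local diffeomorphisms; its
  smooth left inverse makes the pulled back form nondegenerate.\<close>

lemma blift_exists:
  assumes c: "c \<in> A" and x: "x \<in> cdom c"
  obtains S f where "openin (top_of_set (span (cdom c))) S" "x \<in> S" "S \<subseteq> cdom c" "blift S (chart_pt c) f"
    "\<forall>u\<in>span (cdom c). (\<forall>v\<in>span (cdom c). std_form (dd f x u) (dd f x v) = 0) \<longrightarrow> u = 0"
proof -
  note qc = chart[OF c]
  have "chart_pt c x \<in> patch c" using chart_facts(2)[OF qc] x by blast
  moreover have "patch c \<subseteq> topspace T" using qc by (simp add: qchart_on_def openin_subset)
  ultimately obtain z where z: "z \<in> L" "chart_pt c x = pr X Q z" unfolding top by blast
  obtain c0 \<mu> I K B q0 where c0: "c0 \<in> A" "good_frame X lam Q \<mu> I K B" "frame.frame_chart X lam Q \<mu> I K B k c0 q0"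
    "z \<in> frame.Z X lam I K B" and kk: "k = 2 * card (I - K)" by (rule coverE[OF z(1)]) (rule that)
  interpret g: good_frame X lam Q \<mu> I K B by (rule c0(2))
  note qc0 = chart[OF c0(1)]
  have fc: "universal_covering (cdom c0) q0 g.Dom" "patch c0 = pr X Q ` g.Z" "\<And>y. y \<in> cdom c0 \<Longrightarrow> chart_pt c0 y = g.s (q0 y)"
    using c0(3) by (auto simp: g.frame_chart_def)
  have xp: "chart_pt c x \<in> patch c0" using z(2) c0(4) fc(2) by simp
  then have "patch c \<inter> patch c0 \<noteq> {}" using \<open>chart_pt c x \<in> patch c\<close> by blast
  moreover have "compatible k c c0" using atlas c c0(1) by (simp add: quasifold_atlas_def)
  ultimately have "model_diffeo (overlap c c0) (overlap_group c c0) (overlap c0 c) (overlap_group c0 c) (chart_change c c0)"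
    by (simp add: compatible_def)
  then obtain C :: "((complex ^ 'd) \<times> (complex ^ 'd)) set" and q C' q' F where
    ml: "model_lift (overlap c c0) (overlap_group c c0) (overlap c0 c) (overlap_group c0 c) (chart_change c c0) C q C' q' F"
    and dF: "diffeo C C' F" unfolding model_diffeo_def by (elim conjE exE) (rule that)
  have uc: "universal_covering C q (overlap c c0)" "universal_covering C' q' (overlap c0 c)"
    using ml by (simp_all add: model_lift_def)
  obtain F' where F: "smooth_on C F" "smooth_on C' F'" "\<And>x. x \<in> C \<Longrightarrow> F x \<in> C'" "\<And>y. y \<in> C' \<Longrightarrow> F' y \<in> C"
    "\<And>x. x \<in> C \<Longrightarrow> F' (F x) = x" "\<And>y. y \<in> C' \<Longrightarrow> F (F' y) = y" by (rule diffeoE[OF dF]) (rule that)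
  have xo: "x \<in> overlap c c0" using x xp by (simp add: overlap_eq[OF qc])
  then have "x \<in> q ` C" using universal_coveringD(4)[OF uc(1)] by simp
  then obtain y where y: "y \<in> C" "x = q y" by blast
  have Fy: "F y \<in> C'" using F(3)[OF y(1)] .
  have sub0: "overlap c0 c \<subseteq> cdom c0" by (auto simp: overlap_eq[OF qc0])
  obtain W s where W: "openin (top_of_set C) W" "y \<in> W" "W \<subseteq> C" "openin (top_of_set (overlap c c0)) (q ` W)"
    "smooth_on W q" "smooth_on (q ` W) s" "\<And>y. y \<in> W \<Longrightarrow> s (q y) = y"
    by (rule universal_covering_local_inverse[OF uc(1) y(1), of C]) (use y in auto)
  obtain W' s' where W': "openin (top_of_set C') W'" "F y \<in> W'" "W' \<subseteq> C'"
    "smooth_on W' q'" "smooth_on (q' ` W') s'" "\<And>y. y \<in> W' \<Longrightarrow> s' (q' y) = y"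
    by (rule universal_covering_local_inverse[OF uc(2) Fy, of C']) (use Fy in auto)
  have qFy: "q' (F y) \<in> cdom c0" using universal_coveringD(5)[OF uc(2) Fy] sub0 by blast
  obtain W0 s0 where W0: "openin (top_of_set (cdom c0)) W0" "q' (F y) \<in> W0" "W0 \<subseteq> cdom c0"
    "smooth_on W0 q0" "smooth_on (q0 ` W0) s0" "\<And>y. y \<in> W0 \<Longrightarrow> s0 (q0 y) = y"
    by (rule universal_covering_local_inverse[OF fc(1) qFy, of "cdom c0"]) (use qFy in auto)
  define S where "S = q ` W"
  define h where "h z = F (s z)" for z
  define f where "f z = q0 (q' (h z))" for z
  have sW: "s z \<in> W" "q (s z) = z" if "z \<in> S" for z using that W(7) by (auto simp: S_def)
  have hC: "h z \<in> C'" if "z \<in> S" for z unfolding h_def by (rule F(3)[OF subsetD[OF W(3) sW(1)[OF that]]])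
  have sh: "smooth_on S h" unfolding h_def
    by (rule smooth_on_compose[OF W(6)[folded S_def] F(1)]) (use sW W(3) in auto)
  have sqh: "smooth_on S (\<lambda>z. q' (h z))"
    by (rule smooth_on_compose[OF sh universal_covering_smooth[OF uc(2)]]) (use hC in auto)
  have q'h: "q' (h z) \<in> cdom c0" if "z \<in> S" for z using universal_coveringD(5)[OF uc(2) hC[OF that]] sub0 by blast
  have sf: "smooth_on S f" unfolding f_def
    by (rule smooth_on_compose[OF sqh universal_covering_smooth[OF fc(1)]]) (use q'h in auto)
  have fD: "f z \<in> g.Dom" if "z \<in> S" for z unfolding f_def using universal_coveringD(5)[OF fc(1) q'h[OF that]] .
  have fP: "pr X Q (section_map X lam \<mu> I K (f z)) = chart_pt c z" if z: "z \<in> S" for z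
  proof -
    have "s z \<in> C" using sW(1)[OF z] W(3) by blast
    from model_lift_chart_pt[OF qc qc0 ml this] have "chart_pt c z = chart_pt c0 (q' (h z))"
      using sW(2)[OF z] by (simp add: h_def)
    then show ?thesis using fc(3)[OF q'h[OF z]] by (simp add: f_def g.s_def)
  qed
  have b: "blift S (chart_pt c) f"
    unfolding blift_def using c0(2) sf fD fP by (intro exI[of _ \<mu>] exI[of _ I] exI[of _ K] exI[of _ B]) auto
  have So: "openin (top_of_set (span (cdom c))) S"
    using openin_trans[OF W(4)[folded S_def] openin_trans[OF openin_overlap[OF qc qc0] cdom_open(1)[OF c]]] .
  have xS: "x \<in> S" using y W(2) by (simp add: S_def)
  have Sc: "S \<subseteq> cdom c" using W(4) overlap_eq[OF qc] unfolding S_def by (auto dest: openin_imp_subset)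
  \<comment> \<open>On \<open>N\<close> the local inverses of all coverings involved are available,
    so \<open>f\<close> has the explicit smooth left inverse \<open>G\<close>.\<close>
  define N where "N = (S \<inter> h -` W') \<inter> ((\<lambda>z. q' (h z)) -` W0 \<inter> S)"
  have "openin (top_of_set (span (cdom c))) (S \<inter> h -` W')"
    by (rule openin_preimage_relopen[OF So smooth_on_imp_continuous_on[OF sh] _ W'(1)]) (use hC in auto)
  moreover have "openin (top_of_set (span (cdom c))) (S \<inter> (\<lambda>z. q' (h z)) -` W0)"
    by (rule openin_preimage_relopen[OF So smooth_on_imp_continuous_on[OF sqh] _ W0(1)]) (use q'h in auto)
  ultimately have No: "openin (top_of_set (span (cdom c))) N" unfolding N_def by (simp add: Int_commute openin_Int)
  have hx: "h x = F y" unfolding y(2) h_def W(7)[OF W(2)] ..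
  have xN: "x \<in> N" using xS W'(2) W0(2) by (simp add: N_def hx)
  have NS: "N \<subseteq> S" by (auto simp: N_def)
  define G where "G w = q (F' (s' (s0 w)))" for w
  have rt: "s0 (f z) = q' (h z)" "s' (s0 (f z)) = h z" "G (f z) = z" if z: "z \<in> N" for z
  proof -
    have zz: "h z \<in> W'" "q' (h z) \<in> W0" "z \<in> S" using z by (auto simp: N_def)
    show 1: "s0 (f z) = q' (h z)" unfolding f_def using W0(6)[OF zz(2)] .
    show 2: "s' (s0 (f z)) = h z" unfolding 1 using W'(6)[OF zz(1)] .
    have "F' (h z) = s z" unfolding h_def using F(5) sW(1)[OF zz(3)] W(3) by blast
    then show "G (f z) = z" unfolding G_def 2 using sW(2)[OF zz(3)] by simp
  qed
  have sG: "smooth_on (f ` N) G"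
  proof -
    have 1: "smooth_on (f ` N) s0" by (rule smooth_on_subset[OF W0(5)]) (auto simp: f_def N_def)
    have 2: "smooth_on (f ` N) (\<lambda>w. s' (s0 w))"
      by (rule smooth_on_compose[OF 1 W'(5)]) (use rt(1) in \<open>auto simp: N_def\<close>)
    have 3: "smooth_on (f ` N) (\<lambda>w. F' (s' (s0 w)))"
      by (rule smooth_on_compose[OF 2 F(2)]) (use rt(2) hC NS in auto)
    have FhC: "F' (s' (s0 w)) \<in> C" if w: "w \<in> f ` N" for w
    proof -
      obtain z where z: "z \<in> N" "w = f z" using w by blast
      show ?thesis unfolding z(2) rt(2)[OF z(1)] by (rule F(4)[OF hC[OF subsetD[OF NS z(1)]]])
    qed
    show ?thesis unfolding G_def
      by (rule smooth_on_compose[OF 3 universal_covering_smooth[OF uc(1)]]) (use FhC in blast)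
  qed
  define DG where "DG = frechet_derivative G (at (f x) within f ` N)"
  have DG: "(G has_derivative DG) (at (f x) within f ` N)"
    unfolding DG_def by (rule smooth_on_has_derivative[OF sG]) (use xN in auto)
  have sfN: "smooth_on N f" using smooth_on_subset[OF sf NS] .
  have left: "DG (dd f x u) = u" if u: "u \<in> span (cdom c)" for u
  proof -
    have "dd (\<lambda>z. G (f z)) x u = DG (dd f x u)"
      by (rule dd_compose_within[OF subspace_span No xN sfN subset_refl DG u])
    moreover have "dd (\<lambda>z. G (f z)) x u = dd (\<lambda>z. z) x u"
      by (rule dd_cong[OF subspace_span No xN u rt(3)])
    moreover have "dd (\<lambda>z. z) x u = u"
      unfolding dd_def by (rule vector_derivative_at) (auto intro!: derivative_eq_intros simp: has_vector_derivative_def)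
    ultimately show ?thesis by simp
  qed
  obtain Df where Df: "bounded_linear Df" "\<And>u. u \<in> span (cdom c) \<Longrightarrow> dd f x u = Df u"
    by (rule dd_linear[OF subspace_span No xN sfN]) (rule that)
  \<comment> \<open>The left inverse makes the derivative injective, and equality of dimensions
    makes it onto. Surjectivity is what allows testing against all of \<open>Cspace (I - K)\<close>,
    where \<open>std_form\<close> is nondegenerate.\<close>
  have im: "Df ` span (cdom c) = Cspace (I - K)"
  proof (rule subspace_dim_equal)
    show "subspace (Df ` span (cdom c))"
      by (intro linear_subspace_image bounded_linear.linear[OF Df(1)] subspace_span)
    show "subspace (Cspace (I - K) :: (complex ^ 'd) set)" by (rule subspace_Cspace)
    have "f ` N \<subseteq> Cspace (I - K)" using fD NS g.DomD(1) by blast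
    then have "dd f x u \<in> Cspace (I - K)" if "u \<in> span (cdom c)" for u
      using dd_in_subspace[OF subspace_span No xN that sfN _ subspace_Cspace] by blast
    then show "Df ` span (cdom c) \<subseteq> Cspace (I - K)" using Df(2) by auto
    have "inj_on Df (span (cdom c))" by (rule inj_on_inverseI[of _ DG]) (use left Df(2) in auto)
    then have "dim (Df ` cdom c) = dim (cdom c)" by (rule dim_image_eq[OF bounded_linear.linear[OF Df(1)]])
    moreover have "dim (Df ` cdom c) \<le> dim (Df ` span (cdom c))" by (rule dim_subset) (use span_superset in blast)
    ultimately show "dim (Cspace (I - K) :: (complex ^ 'd) set) \<le> dim (Df ` span (cdom c))"
      using cdom_open(2)[OF c] kk dim_Cspace[of "I - K"] by simp
  qed
  have nd: "u = 0" if u: "u \<in> span (cdom c)" and z: "\<forall>v\<in>span (cdom c). std_form (dd f x u) (dd f x v) = 0" for u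
  proof -
    have "dd f x u = 0"
    proof (rule std_form_nondegenerate[where J="I - K"])
      show "dd f x u \<in> Cspace (I - K)" using im Df(2)[OF u] u by blast
      fix w :: "complex ^ 'd" assume "w \<in> Cspace (I - K)"
      then obtain v where "v \<in> span (cdom c)" "w = Df v" using im by blast
      then show "std_form (dd f x u) w = 0" using bspec[OF z, of v] Df(2)[of v] by simp
    qed
    then have "u = DG 0" using left[OF u] by simp
    then show "u = 0" using linear_0[OF has_derivative_linear[OF DG]] by simp
  qed
  show ?thesis by (rule that[OF So xS Sc b]) (simp add: nd)
qed

text \<open>The derivative at \<open>x\<close> of some base lift, chosen pointwise. Asking for a
  linear map on the whole space makes \<open>om\<close> bilinear outside the span as well, as
  \<open>two_form_on\<close> demands; \<open>om_pullback\<close> shows that the choice of the lift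
  does not matter.\<close>

definition omD :: "((complex ^ 'd) set, complex ^ 'd) qchart \<Rightarrow> complex ^ 'd \<Rightarrow> complex ^ 'd \<Rightarrow> complex ^ 'd" where
  "omD c x = (SOME D. bounded_linear D \<and> (\<exists>S f. openin (top_of_set (span (cdom c))) S \<and> x \<in> S \<and> S \<subseteq> cdom c \<and>
     blift S (chart_pt c) f \<and> (\<forall>u\<in>span (cdom c). dd f x u = D u)))"

definition om where "om c x u v = std_form (omD c x u) (omD c x v)"

lemma blift_smooth: "blift S P f \<Longrightarrow> smooth_on S f" by (auto simp: blift_def)

lemma omD:
  assumes c: "c \<in> A" and x: "x \<in> cdom c"
  shows "bounded_linear (omD c x)" "\<exists>S f. openin (top_of_set (span (cdom c))) S \<and> x \<in> S \<and> S \<subseteq> cdom c \<and>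
     blift S (chart_pt c) f \<and> (\<forall>u\<in>span (cdom c). dd f x u = omD c x u)"
proof -
  obtain S f where S: "openin (top_of_set (span (cdom c))) S" "x \<in> S" "S \<subseteq> cdom c" "blift S (chart_pt c) f"
    by (rule blift_exists[OF c x]) (rule that)
  obtain D where D: "bounded_linear D" "\<And>u. u \<in> span (cdom c) \<Longrightarrow> dd f x u = D u"
    by (rule dd_linear[OF subspace_span S(1,2) blift_smooth[OF S(4)]]) (rule that)
  have "\<exists>D. bounded_linear D \<and> (\<exists>S f. openin (top_of_set (span (cdom c))) S \<and> x \<in> S \<and> S \<subseteq> cdom c \<and>
     blift S (chart_pt c) f \<and> (\<forall>u\<in>span (cdom c). dd f x u = D u))"
    using S D by (intro exI[of _ D] conjI exI[of _ S] exI[of _ f] ballI) auto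
  from someI_ex[OF this, folded omD_def]
  show "bounded_linear (omD c x)" "\<exists>S f. openin (top_of_set (span (cdom c))) S \<and> x \<in> S \<and> S \<subseteq> cdom c \<and>
     blift S (chart_pt c) f \<and> (\<forall>u\<in>span (cdom c). dd f x u = omD c x u)" by (rule conjunct1, rule conjunct2)
qed

text \<open>The lift hidden in \<open>omD\<close>, composed with \<open>h\<close>, and the given
  \<open>g\<close> are two base lifts of one map, so they pull \<open>std_form\<close> back to the
  same form. It is applied with \<open>h\<close> the identity, an element of the chart group, a
  local change of charts, and a lift of the projection along a parametrization of
  \<open>L\<close>.\<close>

lemma om_pullback:
  fixes h :: "'m::euclidean_space \<Rightarrow> complex ^ 'd"
  assumes c: "c \<in> A" and V: "subspace V" "openin (top_of_set V) S" "y \<in> S" and uv: "u \<in> V" "v \<in> V"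
    and h: "smooth_on S h" "h ` S \<subseteq> cdom c" and b: "blift S (\<lambda>y. chart_pt c (h y)) g"
  shows "om c (h y) (dd h y u) (dd h y v) = std_form (dd g y u) (dd g y v)"
proof -
  have hy: "h y \<in> cdom c" using V h by auto
  obtain R f where R: "openin (top_of_set (span (cdom c))) R" "h y \<in> R" "R \<subseteq> cdom c" "blift R (chart_pt c) f"
    "\<And>u. u \<in> span (cdom c) \<Longrightarrow> dd f (h y) u = omD c (h y) u"
    using omD(2)[OF c hy] by (elim exE conjE) (rule that, auto)
  define S' where "S' = S \<inter> h -` R"
  have hs: "h ` S \<subseteq> span (cdom c)" using h(2) span_superset by blast
  have S': "openin (top_of_set V) S'" unfolding S'_def
    by (rule openin_preimage_relopen[OF V(2) smooth_on_imp_continuous_on[OF h(1)] hs R(1)])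
  have yS': "y \<in> S'" "S' \<subseteq> S" using V R by (auto simp: S'_def)
  have sh': "smooth_on S' h" "h ` S' \<subseteq> R" using smooth_on_subset[OF h(1) yS'(2)] by (auto simp: S'_def)
  have 1: "blift S' (\<lambda>y. chart_pt c (h y)) (\<lambda>y. f (h y))" by (rule blift_compose[OF R(4) sh'])
  have 2: "blift S' (\<lambda>y. chart_pt c (h y)) g" by (rule blift_subset[OF b yS'(2)])
  have "omD c (h y) (dd h y w) = dd (\<lambda>y. f (h y)) y w" if w: "w \<in> V" for w
  proof -
    have "dd h y w \<in> span (cdom c)" by (rule dd_in_subspace[OF V w h(1) hs subspace_span])
    then show ?thesis
      using dd_compose[OF V(1) S' yS'(1) sh' subspace_span R(1) blift_smooth[OF R(4)] w] R(5) by simp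
  qed
  then show ?thesis unfolding om_def using blift_pullback[OF V(1) S' yS'(1) uv 1 2] uv by simp
qed

lemma om_eq:
  assumes c: "c \<in> A" and S: "openin (top_of_set (span (cdom c))) S" "y \<in> S" "S \<subseteq> cdom c"
    and uv: "u \<in> span (cdom c)" "v \<in> span (cdom c)" and b: "blift S (chart_pt c) g"
  shows "om c y u v = std_form (dd g y u) (dd g y v)"
proof -
  have "dd (\<lambda>z. z) y w = w" for w :: "complex ^ 'd"
    unfolding dd_def by (rule vector_derivative_at) (auto intro!: derivative_eq_intros simp: has_vector_derivative_def)
  then show ?thesis
    using om_pullback[OF c subspace_span S(1,2) uv smooth_on_id _ b] S(3) by simp
qed

lemma om_symplectic: assumes c: "c \<in> A" shows "symplectic_on (cdom c) (om c)"
proof (rule symplectic_on_locally_pullback[OF cdom_open(1)[OF c] bounded_bilinear_std_form std_form_self])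
  fix x assume x: "x \<in> cdom c"
  interpret D: bounded_linear "omD c x" by (rule omD(1)[OF c x])
  interpret B: bounded_bilinear "std_form :: complex ^ 'd \<Rightarrow> _" by (rule bounded_bilinear_std_form)
  show "bilinear (om c x)"
    unfolding bilinear_def linear_iff om_def by (simp add: D.add D.scaleR B.add_left B.add_right B.scaleR_left B.scaleR_right)
  obtain S f where S: "openin (top_of_set (span (cdom c))) S" "x \<in> S" "S \<subseteq> cdom c" "blift S (chart_pt c) f"
    "\<forall>u\<in>span (cdom c). (\<forall>v\<in>span (cdom c). std_form (dd f x u) (dd f x v) = 0) \<longrightarrow> u = 0"
    by (rule blift_exists[OF c x]) (rule that)
  have "om c y u v = std_form (dd f y u) (dd f y v)" if "y \<in> S" "u \<in> span (cdom c)" "v \<in> span (cdom c)" for y u v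
    by (rule om_eq[OF c S(1) that(1) S(3) that(2,3) S(4)])
  then show "\<exists>S (f :: complex ^ 'd \<Rightarrow> complex ^ 'd). openin (top_of_set (span (cdom c))) S \<and> x \<in> S \<and> S \<subseteq> cdom c \<and> smooth_on S f
       \<and> (\<forall>y\<in>S. \<forall>u\<in>span (cdom c). \<forall>v\<in>span (cdom c). om c y u v = std_form (dd f y u) (dd f y v))
       \<and> (\<forall>u\<in>span (cdom c). (\<forall>v\<in>span (cdom c). std_form (dd f x u) (dd f x v) = 0) \<longrightarrow> u = 0)"
    using S(1-3,5) blift_smooth[OF S(4)] by - (rule exI[of _ S], rule exI[of _ f], simp)
qed

lemma om_invariant: assumes c: "c \<in> A" shows "invariant_form (cdom c) (cgrp c) (om c)"
  unfolding invariant_form_def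
proof (intro ballI)
  fix g x u v assume g: "g \<in> cgrp c" and x: "x \<in> cdom c" and uv: "u \<in> span (cdom c)" "v \<in> span (cdom c)"
  have pm: "subgroup (cgrp c) (BijGroup (cdom c))" "smooth_on (cdom c) g"
    using chart[OF c] g by (auto simp: qchart_on_def model_def premodel_def)
  have gc: "g y \<in> cdom c" if "y \<in> cdom c" for y using BijGroup_subgroupD(3)[OF pm(1) g that] .
  have gp: "chart_pt c (g y) = chart_pt c y" if y: "y \<in> cdom c" for y
  proof -
    have "g y \<in> orb (cgrp c) y" using g by (auto simp: orb_def)
    then show ?thesis using orb_eq_iff[OF pm(1) y gc[OF y]] chart_facts(1)[OF chart[OF c] y gc[OF y]] by simp
  qed
  obtain S f where S: "openin (top_of_set (span (cdom c))) S" "x \<in> S" "S \<subseteq> cdom c" "blift S (chart_pt c) f"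
    by (rule blift_exists[OF c x]) (rule that)
  have "pullback_form (cdom c) g (om c) x u v = om c (g x) (dd g x u) (dd g x v)"
    by (rule pullback_form_dd[OF subspace_span cdom_open(1)[OF c] x pm(2) uv])
  also have "\<dots> = std_form (dd f x u) (dd f x v)"
  proof (rule om_pullback[OF c subspace_span S(1,2) uv])
    show "smooth_on S g" using smooth_on_subset[OF pm(2) S(3)] .
    show "g ` S \<subseteq> cdom c" using gc S(3) by auto
    show "blift S (\<lambda>y. chart_pt c (g y)) f" by (rule blift_cong[OF S(4)]) (use gp S(3) in auto)
  qed
  also have "\<dots> = om c x u v" by (rule om_eq[OF c S(1-3) uv S(4), symmetric])
  finally show "pullback_form (cdom c) g (om c) x u v = om c x u v" .
qed

text \<open>The coverings \<open>C\<close> are submanifolds of a product, not open sets of a linear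
  space. A local inverse of \<open>q\<close> replaces the lift by a map \<open>h\<close> from an
  open part of one chart domain to the other, and \<open>tangent_chain\<close> brings tangent
  vectors of \<open>C\<close> down to it.\<close>

lemma om_compatible: assumes c: "c \<in> A" "c' \<in> A" shows "forms_compatible c c' (om c) (om c')"
  unfolding forms_compatible_def
proof (intro allI impI ballI)
  fix C :: "((complex ^ 'd) \<times> (complex ^ 'd)) set" and q C' q' F x u v
  assume m: "model_lift (overlap c c') (overlap_group c c') (overlap c' c) (overlap_group c' c) (chart_change c c') C q C' q' F \<and> diffeo C C' F"
    and x: "x \<in> C" and uv: "u \<in> tangent_space C x" "v \<in> tangent_space C x"
  note qc = chart[OF c(1)] and qc' = chart[OF c(2)]
  have ml: "model_lift (overlap c c') (overlap_group c c') (overlap c' c) (overlap_group c' c) (chart_change c c') C q C' q' F"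
    and dF: "diffeo C C' F" using m by blast+
  have uc: "universal_covering C q (overlap c c')" "universal_covering C' q' (overlap c' c)"
    using ml by (simp_all add: model_lift_def)
  have F: "smooth_on C F" "\<And>y. y \<in> C \<Longrightarrow> F y \<in> C'" using dF by (auto simp: diffeo_def bij_betw_def)
  have sub: "overlap c c' \<subseteq> cdom c" "overlap c' c \<subseteq> cdom c'" by (auto simp: overlap_eq[OF qc] overlap_eq[OF qc'])
  have sq: "smooth_on C q" by (rule universal_covering_smooth[OF uc(1)])
  have qx: "q x \<in> cdom c" using universal_coveringD(5)[OF uc(1) x] sub by blast
  have sqF: "smooth_on C (\<lambda>y. q' (F y))"
    by (rule smooth_on_compose[OF F(1) universal_covering_smooth[OF uc(2)]]) (use F(2) in auto)
  obtain W s where W: "openin (top_of_set C) W" "x \<in> W" "W \<subseteq> C" "openin (top_of_set (overlap c c')) (q ` W)"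
    "smooth_on W q" "smooth_on (q ` W) s" "\<And>y. y \<in> W \<Longrightarrow> s (q y) = y"
    by (rule universal_covering_local_inverse[OF uc(1) x, of C]) (use x in auto)
  have qWo: "openin (top_of_set (span (cdom c))) (q ` W)"
    using openin_trans[OF W(4) openin_trans[OF openin_overlap[OF qc qc'] cdom_open(1)[OF c(1)]]] .
  define h where "h z = q' (F (s z))" for z
  have hq: "h (q y) = q' (F y)" if "y \<in> W" for y using W(7)[OF that] by (simp add: h_def)
  have sh: "smooth_on (q ` W) h" unfolding h_def
    by (rule smooth_on_compose[OF W(6) sqF]) (use W(3,7) in auto)
  have q'F: "q' (F y) \<in> cdom c'" if "y \<in> C" for y using universal_coveringD(5)[OF uc(2) F(2)[OF that]] sub by blast
  have hc: "h ` q ` W \<subseteq> cdom c'" using hq q'F W(3) by auto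
  have hp: "chart_pt c' (h z) = chart_pt c z" if "z \<in> q ` W" for z
    using that model_lift_chart_pt[OF qc qc' ml] W(3) hq by auto
  obtain R f where R: "openin (top_of_set (span (cdom c))) R" "q x \<in> R" "R \<subseteq> cdom c" "blift R (chart_pt c) f"
    by (rule blift_exists[OF c(1) qx]) (rule that)
  define S where "S = q ` W \<inter> R"
  have S: "openin (top_of_set (span (cdom c))) S" "q x \<in> S" "S \<subseteq> cdom c" "S \<subseteq> q ` W"
    using qWo R W(2) by (auto simp: S_def openin_Int)
  have bS: "blift S (chart_pt c) f" by (rule blift_subset[OF R(4)]) (simp add: S_def)
  define Dq where "Dq = frechet_derivative q (at x within C)"
  define D where "D = frechet_derivative (q' \<circ> F) (at x within C)"
  have Dq: "(q has_derivative Dq) (at x within C)" unfolding Dq_def by (rule smooth_on_has_derivative[OF sq x])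
  have DqW: "(q has_derivative Dq) (at x within W)" by (rule has_derivative_subset[OF Dq W(3)])
  have D: "((q' \<circ> F) has_derivative D) (at x within C)" unfolding D_def o_def by (rule smooth_on_has_derivative[OF sqF x])
  have tang: "Dq w \<in> span (cdom c)" "D w = dd h (q x) (Dq w)" if "w \<in> tangent_space C x" for w
    by (rule tangent_chain[OF that W(1,2) DqW subset_refl subspace_span qWo sh D], simp add: hq)+
  have "om c' (h (q x)) (dd h (q x) (Dq u)) (dd h (q x) (Dq v)) = std_form (dd f (q x) (Dq u)) (dd f (q x) (Dq v))"
  proof (rule om_pullback[OF c(2) subspace_span S(1,2) tang(1)[OF uv(1)] tang(1)[OF uv(2)]])
    show "smooth_on S h" by (rule smooth_on_subset[OF sh S(4)])
    show "h ` S \<subseteq> cdom c'" by (rule order_trans[OF image_mono[OF S(4)] hc])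
    show "blift S (\<lambda>y. chart_pt c' (h y)) f" by (rule blift_cong[OF bS]) (use hp S(4) in auto)
  qed
  also have "\<dots> = om c (q x) (Dq u) (Dq v)"
    by (rule om_eq[OF c(1) S(1-3) tang(1)[OF uv(1)] tang(1)[OF uv(2)] bS, symmetric])
  finally show "pullback_form C (q' \<circ> F) (om c') x u v = pullback_form C q (om c) x u v"
    unfolding pullback_form_def D_def[symmetric] Dq_def[symmetric] using tang(2)[OF uv(1)] tang(2)[OF uv(2)] hq[OF W(2)] by simp
qed

text \<open>\<open>local_reduction\<close> maps a neighbourhood in the level manifold smoothly to
  the base domain, and a local inverse of the covering continues into the chart domain.\<close>

lemma smooth_projection: "smooth_to_quasifold L A (pr X Q)"
  unfolding smooth_to_quasifold_def
proof
  fix z assume z: "z \<in> L"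
  obtain c \<mu> I K B q where c: "c \<in> A" "good_frame X lam Q \<mu> I K B" "frame.frame_chart X lam Q \<mu> I K B k c q"
    "z \<in> frame.Z X lam I K B" "openin (top_of_set L) (frame.Z X lam I K B)" by (rule coverE[OF z]) (rule that)
  interpret g: good_frame X lam Q \<mu> I K B by (rule c(2))
  have fc: "universal_covering (cdom c) q g.Dom" "\<And>y. y \<in> cdom c \<Longrightarrow> chart_pt c y = g.s (q y)"
    using c(3) by (auto simp: g.frame_chart_def)
  obtain x0 u0 where x0: "proj X x0 = 0" "u0 \<in> g.Dom" "z = texp x0 * section_map X lam \<mu> I K u0" by (rule g.Z_rep[OF c(4)]) (rule that)
  obtain N f \<tau> where N: "openin (top_of_set g.Z) N" "z \<in> N" "smooth_on N f" "f z = u0"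
      "\<And>z. z \<in> N \<Longrightarrow> f z \<in> g.Dom" "\<And>z. z \<in> N \<Longrightarrow> proj X (\<tau> z) = 0" "\<And>z. z \<in> N \<Longrightarrow> z = texp (x0 + \<tau> z) * section_map X lam \<mu> I K (f z)"
    by (rule g.local_reduction[OF c(4) x0(3,2)]) (rule that)
  have "u0 \<in> q ` cdom c" using x0(2) universal_coveringD(4)[OF fc(1)] by simp
  then obtain y0 where y0: "y0 \<in> cdom c" "u0 = q y0" by blast
  obtain W s where W: "W \<subseteq> cdom c" "y0 \<in> W" "openin (top_of_set g.Dom) (q ` W)" "smooth_on (q ` W) s" "\<And>y. y \<in> W \<Longrightarrow> s (q y) = y"
    by (rule universal_covering_local_inverse[OF fc(1) y0(1), of "cdom c"]) (use y0 in auto)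
  define R where "R = N \<inter> f -` (q ` W)"
  have No: "openin (top_of_set L) N" using openin_trans[OF N(1) c(5)] .
  have "openin (top_of_set L) R" unfolding R_def
    by (rule openin_preimage_relopen[OF No smooth_on_imp_continuous_on[OF N(3)] _ W(3)]) (use N(5) in auto)
  moreover have "z \<in> R" using N(2,4) y0 W(2) by (simp add: R_def)
  moreover have sR: "q (s (f y)) = f y" "s (f y) \<in> cdom c" if "y \<in> R" for y using that W(1,5) by (auto simp: R_def)
  moreover have "smooth_on R (\<lambda>y. s (f y))"
    by (rule smooth_on_compose[OF smooth_on_subset[OF N(3)] W(4)]) (auto simp: R_def)
  moreover have "pr X Q y = chart_pt c (s (f y))" if y: "y \<in> R" for y
  proof -
    have yN: "y \<in> N" using y by (simp add: R_def)
    have "pr X Q (section_map X lam \<mu> I K (f y)) = pr X Q y" unfolding pr_eq_iff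
      using N(6,7)[OF yN] x0(1) Q_closed(2) by (intro exI[of _ "x0 + \<tau> y"]) (simp add: proj_simps)
    then show ?thesis using fc(2)[OF sR(2)[OF y]] sR(1)[OF y] by (simp add: g.s_def)
  qed
  ultimately have "local_lift L (pr X Q) c R (\<lambda>y. s (f y)) \<and> z \<in> R" unfolding local_lift_def by auto
  then show "\<exists>c\<in>A. \<exists>W f. z \<in> W \<and> local_lift L (pr X Q) c W f" using c(1) by blast
qed

text \<open>\<open>om_pullback\<close> speaks of open sets in linear subspaces, so \<open>L\<close>
  is parametrized near \<open>z\<close> by base points and kernel directions. On the parameters the
  lift has the base lift \<open>fst\<close>, and \<open>std_form_reduction\<close> identifies the
  form pulled back by \<open>fst\<close> with the one pulled back by the parametrization.\<close>

lemma om_restriction: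
  assumes c: "c \<in> A" and ll: "local_lift L (pr X Q) c W f" and z: "z \<in> W"
    and uv: "u \<in> tangent_space L z" "v \<in> tangent_space L z"
  shows "pullback_form W f (om c) z u v = std_form u v"
proof -
  have W: "openin (top_of_set L) W" "f ` W \<subseteq> cdom c" "smooth_on W f" "\<And>y. y \<in> W \<Longrightarrow> pr X Q y = chart_pt c (f y)"
    using ll by (auto simp: local_lift_def)
  have zL: "z \<in> L" using W(1) z by (auto dest: openin_imp_subset)
  obtain c0 \<mu> I K B q0 where c0: "good_frame X lam Q \<mu> I K B"
    "z \<in> frame.Z X lam I K B" "openin (top_of_set L) (frame.Z X lam I K B)" by (rule coverE[OF zL]) (rule that)
  interpret g: good_frame X lam Q \<mu> I K B by (rule c0(1))
  obtain x0 u0 where x0: "proj X x0 = 0" "u0 \<in> g.Dom" "z = texp x0 * section_map X lam \<mu> I K u0" by (rule g.Z_rep[OF c0(2)]) (rule that)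
  obtain N r \<tau> where N: "openin (top_of_set g.Z) N" "z \<in> N" "smooth_on N r" "smooth_on N \<tau>" "r z = u0" "\<tau> z = 0"
      "\<And>z. z \<in> N \<Longrightarrow> r z \<in> g.Dom" "\<And>z. z \<in> N \<Longrightarrow> proj X (\<tau> z) = 0" "\<And>z. z \<in> N \<Longrightarrow> z = texp (x0 + \<tau> z) * section_map X lam \<mu> I K (r z)"
    by (rule g.local_reduction[OF c0(2) x0(3,2)]) (rule that)
  define V where "V = (Cspace (I - K) :: (complex ^ 'd) set) \<times> {t :: real ^ 'd. proj X t = 0}"
  have sk: "subspace {t. proj X t = 0}" by (rule linear_subspace_kernel[OF linear_proj])
  have V: "subspace V" unfolding V_def by (rule subspace_Times[OF subspace_Cspace sk])
  define E where "E = g.Dom \<times> {t :: real ^ 'd. proj X t = 0}"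
  have E: "openin (top_of_set V) E" unfolding V_def E_def using openin_Times[OF g.openin_Dom, of "{t. proj X t = 0}"] by simp
  define \<Phi> where "\<Phi> = (\<lambda>y :: (complex ^ 'd) \<times> (real ^ 'd). texp (x0 + snd y) * section_map X lam \<mu> I K (fst y))"
  have sfst: "smooth_on S (fst :: (complex ^ 'd) \<times> (real ^ 'd) \<Rightarrow> _)" and ssnd: "smooth_on S (snd :: (complex ^ 'd) \<times> (real ^ 'd) \<Rightarrow> _)" for S
    by (rule smooth_on_bounded_linear[OF bounded_linear_fst], rule smooth_on_bounded_linear[OF bounded_linear_snd])
  have s\<Phi>: "smooth_on E \<Phi>" unfolding \<Phi>_def
    by (intro smooth_on_vec_mult smooth_on_texp smooth_on_add smooth_on_const ssnd g.smooth_sec sfst) (auto simp: E_def)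
  have \<Phi>Z: "\<Phi> y \<in> g.Z" if "y \<in> E" for y
    using that g.sec_Z unfolding \<Phi>_def g.Z_torus by (auto simp: E_def)
  have ZL: "g.Z \<subseteq> L" using c0(3) by (rule openin_imp_subset)
  define W' where "W' = W \<inter> N"
  have W': "openin (top_of_set L) W'" unfolding W'_def by (rule openin_Int[OF W(1) openin_trans[OF N(1) c0(3)]])
  define E' where "E' = E \<inter> \<Phi> -` W'"
  have E': "openin (top_of_set V) E'" unfolding E'_def
    by (rule openin_preimage_relopen[OF E smooth_on_imp_continuous_on[OF s\<Phi>] _ W']) (use \<Phi>Z ZL in auto)
  have zW': "z \<in> W'" using z N(2) by (simp add: W'_def)
  \<comment> \<open>\<open>\<Phi>\<close> need not be injective: kernel directions that move only
    components in \<open>K\<close> fix the section. \<open>\<Xi>\<close> is a smooth right inverse,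
    and through its derivative every tangent vector of \<open>L\<close> is the image of a parameter
    vector.\<close>
  define \<Xi> where "\<Xi> y = (r y, \<tau> y)" for y
  have \<Phi>\<Xi>: "\<Phi> (\<Xi> y) = y" if "y \<in> W'" for y using that N(9)[of y] by (simp add: \<Phi>_def \<Xi>_def W'_def)
  have \<Xi>E: "\<Xi> ` W' \<subseteq> E'"
  proof
    fix y assume "y \<in> \<Xi> ` W'"
    then obtain y' where y': "y' \<in> W'" "y = \<Xi> y'" by blast
    have "\<Xi> y' \<in> E" using y'(1) N(7,8) by (auto simp: E_def \<Xi>_def W'_def)
    then show "y \<in> E'" using \<Phi>\<Xi>[OF y'(1)] y' by (simp add: E'_def)
  qed
  have s\<Xi>: "smooth_on W' \<Xi>" unfolding \<Xi>_def
    by (intro smooth_on_Pair) (auto intro: smooth_on_subset[OF N(3)] smooth_on_subset[OF N(4)] simp: W'_def)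
  have E'E: "E' \<subseteq> E" "\<And>y. y \<in> E' \<Longrightarrow> \<Phi> y \<in> W" by (auto simp: E'_def W'_def)
  define h where "h y = f (\<Phi> y)" for y
  have sh: "smooth_on E' h" unfolding h_def
    by (rule smooth_on_compose[OF smooth_on_subset[OF s\<Phi> E'E(1)] W(3)]) (use E'E in auto)
  have hc: "h ` E' \<subseteq> cdom c" using W(2) E'E(2) by (auto simp: h_def)
  have E'D: "fst y \<in> g.Dom" "proj X (snd y) = 0" if "y \<in> E'" for y using that E'E(1) by (auto simp: E_def)
  have E'P: "pr X Q (section_map X lam \<mu> I K (fst y)) = chart_pt c (h y)" if y: "y \<in> E'" for y
  proof -
    have "pr X Q (section_map X lam \<mu> I K (fst y)) = pr X Q (\<Phi> y)" unfolding pr_eq_iff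
      using E'D(2)[OF y] x0(1) Q_closed(2) by (intro exI[of _ "x0 + snd y"]) (simp add: proj_simps \<Phi>_def)
    then show ?thesis using W(4)[OF E'E(2)[OF y]] by (simp add: h_def)
  qed
  have "good_frame X lam Q \<mu> I K B \<and> smooth_on E' fst \<and> (\<forall>y\<in>E'. fst y \<in> g.Dom)
      \<and> (\<forall>y\<in>E'. pr X Q (section_map X lam \<mu> I K (fst y)) = chart_pt c (h y))"
    using c0(1) sfst E'D(1) E'P by blast
  then have b: "blift E' (\<lambda>y. chart_pt c (h y)) fst" unfolding blift_def
    by - (rule exI[of _ \<mu>], rule exI[of _ I], rule exI[of _ K], rule exI[of _ B], simp)
  define y0 where "y0 = \<Xi> z"
  have y0: "y0 \<in> E'" using \<Xi>E zW' by (auto simp: y0_def)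
  define D\<Xi> where "D\<Xi> = frechet_derivative \<Xi> (at z within W')"
  have D\<Xi>: "(\<Xi> has_derivative D\<Xi>) (at z within W')" unfolding D\<Xi>_def by (rule smooth_on_has_derivative[OF s\<Xi> zW'])
  define Df where "Df = frechet_derivative f (at z within W)"
  have Df: "(f has_derivative Df) (at z within W)" unfolding Df_def by (rule smooth_on_has_derivative[OF W(3) z])
  have W'W: "openin (top_of_set W) W'"
    using W' openin_imp_subset[OF W(1)] openin_subset_trans[of L W' W] by (auto simp: W'_def)
  have uvW: "u \<in> tangent_space W z" "v \<in> tangent_space W z"
    using tangent_space_open[OF uv(1) W(1) z] tangent_space_open[OF uv(2) W(1) z] .
  have tf: "D\<Xi> w \<in> V" "Df w = dd h y0 (D\<Xi> w)" if "w \<in> tangent_space W z" for w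
    unfolding y0_def by (rule tangent_chain[OF that W'W zW' D\<Xi> \<Xi>E V E' sh Df], simp add: h_def \<Phi>\<Xi>)+
  have ti: "w = dd \<Phi> y0 (D\<Xi> w)" if w: "w \<in> tangent_space W z" for w
    using tangent_chain(2)[OF w W'W zW' D\<Xi> \<Xi>E V E' smooth_on_subset[OF s\<Phi> E'E(1)] has_derivative_ident]
    by (simp add: y0_def \<Phi>\<Xi>)
  have "om c (h y0) (dd h y0 (D\<Xi> u)) (dd h y0 (D\<Xi> v)) = std_form (dd fst y0 (D\<Xi> u)) (dd fst y0 (D\<Xi> v))"
    by (rule om_pullback[OF c V E' y0 tf(1)[OF uvW(1)] tf(1)[OF uvW(2)] sh hc b])
  also have "\<dots> = std_form (dd \<Phi> y0 (D\<Xi> u)) (dd \<Phi> y0 (D\<Xi> v))"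
    unfolding \<Phi>_def
    by (rule g.std_form_reduction(1)[OF V E' y0 tf(1)[OF uvW(1)] tf(1)[OF uvW(2)] sfst _ ssnd, symmetric])
       (use E'E(1) in \<open>auto simp: E_def\<close>)
  also have "\<dots> = std_form u v" using ti[OF uvW(1)] ti[OF uvW(2)] by simp
  finally have "om c (h y0) (Df u) (Df v) = std_form u v" using tf(2)[OF uvW(1)] tf(2)[OF uvW(2)] by simp
  moreover have "h y0 = f z" by (simp add: h_def y0_def \<Phi>\<Xi>[OF zW'])
  ultimately show ?thesis by (simp add: pullback_form_def Df_def)
qed

lemma forms_exist: "\<exists>\<omega>. symplectic_form A \<omega> \<and> pullback_is_restriction A \<omega> L (pr X Q) std_form"
proof (intro exI conjI)
  show "symplectic_form A om"
    unfolding symplectic_form_def using om_symplectic om_invariant om_compatible by blast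
  show "pullback_is_restriction A om L (pr X Q) std_form"
    unfolding pullback_is_restriction_def using smooth_projection om_restriction by blast
qed

end

text \<open>Given the two atlases, each kind of piece is an instance of \<open>form_setup\<close>;
  what is left to check is that an atlas containing the generated charts has an explicit one at each
  point of the level manifold.\<close>

theorem theorem5p10:
  fixes X :: "'d::finite \<Rightarrow> 'a::euclidean_space" and lam :: "'d \<Rightarrow> real" and Q :: "'a set"
  assumes "polytope (Delta X lam)"
    and "aff_dim (Delta X lam) = int DIM('a)"
    and "bij_betw (\<lambda>j. {\<mu> \<in> Delta X lam. \<mu> \<bullet> X j = lam j}) UNIV {F. F facet_of Delta X lam}"
    and "quasilattice Q"
    and "range X \<subseteq> Q"
  shows
    "(\<forall>F \<mu> I. singular_face X lam F \<and> adapted X lam F \<mu> I \<longrightarrow>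
        quasifold_atlas (2 * nat (aff_dim F)) (face_piece X lam Q F) (singular_charts X lam Q F \<mu> I) \<and>
        (\<forall>A. quasifold (2 * nat (aff_dim F)) (face_piece X lam Q F) A \<and>
             singular_charts X lam Q F \<mu> I \<subseteq> A \<longrightarrow>
             (\<exists>\<omega>. symplectic_form A \<omega> \<and>
                   pullback_is_restriction A \<omega> (face_level X lam F) (pr X Q) std_form))) \<and>
     quasifold_atlas (2 * DIM('a)) (regular_piece X lam Q) (regular_charts X lam Q) \<and>
     (\<forall>A. quasifold (2 * DIM('a)) (regular_piece X lam Q) A \<and> regular_charts X lam Q \<subseteq> A \<longrightarrow>
          (\<exists>\<omega>. symplectic_form A \<omega> \<and>
                pullback_is_restriction A \<omega> (regular_level X lam) (pr X Q) std_form))"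
proof -
  interpret quasi_polytope X lam Q by (rule quasi_polytope.intro[OF assms])
  have sing: "\<exists>\<omega>. symplectic_form A \<omega> \<and> pullback_is_restriction A \<omega> (face_level X lam F) (pr X Q) std_form"
    if F: "singular_face X lam F" and ad: "adapted X lam F \<mu> I"
      and A: "quasifold (2 * nat (aff_dim F)) (face_piece X lam Q F) A" and sub: "singular_charts X lam Q F \<mu> I \<subseteq> A"
    for F \<mu> I A
  proof -
    have oF: "open_face X lam F" using F by (simp add: singular_face_def)
    let ?K = "active X lam F"
    interpret g: good_frame X lam Q \<mu> I ?K "I - ?K" by (rule good_frame_singular[OF oF ad])
    have Zf: "g.Z = face_level X lam F" by (auto simp: face_level_def Cstar_def g.Z_def)
    have "form_setup X lam Q (2 * nat (aff_dim F)) (face_piece X lam Q F) A (face_level X lam F)"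
    proof unfold_locales
      show "quasifold_atlas (2 * nat (aff_dim F)) (face_piece X lam Q F) A" using A by (simp add: quasifold_def)
      show "topspace (face_piece X lam Q F) = pr X Q ` face_level X lam F" by (rule topspace_pieces)
      fix z assume z: "z \<in> face_level X lam F"
      have "pr X Q z \<in> topspace (face_piece X lam Q F)" using z topspace_pieces(2) by blast
      then have "pr X Q z \<in> (\<Union>c\<in>singular_charts X lam Q F \<mu> I. patch c)"
        using singular_atlas[OF oF ad] by (simp add: quasifold_atlas_def)
      then obtain c where c: "c \<in> singular_charts X lam Q F \<mu> I" by blast
      then obtain q where "g.frame_chart (2 * nat (aff_dim F)) c q" unfolding singular_charts_iff[OF oF ad] by blast
      moreover have "openin (top_of_set (face_level X lam F)) g.Z" unfolding Zf by simp
      ultimately show "\<exists>c\<in>A. \<exists>\<mu> I K B q. good_frame X lam Q \<mu> I K B \<and> frame.frame_chart X lam Q \<mu> I K B (2 * nat (aff_dim F)) c q \<and>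
         z \<in> frame.Z X lam I K B \<and> openin (top_of_set (face_level X lam F)) (frame.Z X lam I K B) \<and> 2 * nat (aff_dim F) = 2 * card (I - K)"
        using c sub z[folded Zf] g.good_frame_axioms dim_singular[OF oF ad]
        by (intro bexI[of _ c] exI[of _ \<mu>] exI[of _ I] exI[of _ ?K] exI[of _ "I - ?K"] exI[of _ q] conjI) auto
    qed
    then show ?thesis by (rule form_setup.forms_exist)
  qed
  have reg: "\<exists>\<omega>. symplectic_form A \<omega> \<and> pullback_is_restriction A \<omega> (regular_level X lam) (pr X Q) std_form"
    if A: "quasifold (2 * DIM('a)) (regular_piece X lam Q) A" and sub: "regular_charts X lam Q \<subseteq> A" for A
  proof -
    have "form_setup X lam Q (2 * DIM('a)) (regular_piece X lam Q) A (regular_level X lam)"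
    proof unfold_locales
      show "quasifold_atlas (2 * DIM('a)) (regular_piece X lam Q) A" using A by (simp add: quasifold_def)
      show "topspace (regular_piece X lam Q) = pr X Q ` regular_level X lam" by (rule topspace_pieces)
      fix z assume z: "z \<in> regular_level X lam"
      then have "pr X Q z \<in> topspace (regular_piece X lam Q)" using topspace_pieces(1) by blast
      then have "pr X Q z \<in> (\<Union>c\<in>regular_charts X lam Q. patch c)"
        using regular_atlas by (simp add: quasifold_atlas_def)
      then obtain c where c: "c \<in> regular_charts X lam Q" "pr X Q z \<in> patch c" by blast
      obtain \<mu> I q where I: "I \<in> basis_sets X lam \<mu>" "frame.frame_chart X lam Q \<mu> I {} {} (2 * DIM('a)) c q" "vertex X lam \<mu>"
        using c(1)[unfolded regular_charts_iff] by (elim exE conjE) (rule that)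
      interpret g: good_frame X lam Q \<mu> I "{}" "{}" by (rule good_frame_regular[OF I(1)]) simp
      have "pr X Q z \<in> pr X Q ` g.Z" using c(2) I(2) by (simp add: g.frame_chart_def)
      \<comment> \<open>Only the class of \<open>z\<close> is known to lie in the patch; as the
        level set of the chart is saturated under \<open>N\<close>, the point \<open>z\<close>
        itself belongs to it.\<close>
      then have zZ: "z \<in> g.Z" using g.pr_Z_saturated by blast
      have "level_on I \<subseteq> regular_level X lam" unfolding regular_level_eq using I(1,3) by blast
      then have "g.Z = regular_level X lam \<inter> (\<Inter>j\<in>-I. {z. z $ j \<noteq> 0})"
        by (auto simp: g.Z_def level_on_def regular_level_def face_level_def)
      moreover have "open (\<Inter>j\<in>-I. {z :: complex ^ 'd. z $ j \<noteq> 0})"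
        by (intro open_INT ballI open_Collect_neq continuous_intros) auto
      ultimately have "openin (top_of_set (regular_level X lam)) g.Z" by (simp add: openin_open_Int)
      then show "\<exists>c\<in>A. \<exists>\<mu> I K B q. good_frame X lam Q \<mu> I K B \<and> frame.frame_chart X lam Q \<mu> I K B (2 * DIM('a)) c q \<and>
         z \<in> frame.Z X lam I K B \<and> openin (top_of_set (regular_level X lam)) (frame.Z X lam I K B) \<and> 2 * DIM('a) = 2 * card (I - K)"
        using c(1) sub zZ g.good_frame_axioms card_basis[OF I(1)] I(2)
        by (intro bexI[of _ c] exI[of _ \<mu>] exI[of _ I] exI[of _ "{}"] exI[of _ q] conjI) auto
    qed
    then show ?thesis by (rule form_setup.forms_exist)
  qed
  show ?thesis
    using sing reg regular_atlas singular_atlas unfolding singular_face_def by blast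
qed

end
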